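(* Let $0<d<n$ and let $\Sigma$ be a $k$-split of the hypersimplex $\Delta(d,n)$. Then $\Sigma$ is the image of a $k$-split of a product of simplices $\Delta_{d-1}\times\Delta_{n-d-1}$ under the Stiefel map. In particular, for a $d$-subset $I\subseteq[n]$, the $k$-split $\Sigma$ is an extension (via the Stiefel map at $e_I$) of a $k$-split of $\Delta(d-1,I)\times\Delta(1,[n]-I)$ if and only if $e_I\in H^\Sigma$, where $H^\Sigma$ is the common cell of $\Sigma$.
   Context: For $I\subseteq[n]$ and $0\le d\le \#I$ let $\Delta(d,I)=\{x\in[0,1]^n : \sum_{i\in I}x_i=d,\ \sum_{i\notin I}x_i=0\}$; $\Delta(d,n)=\Delta(d,[n])$ is the hypersimplex and $\Delta_{n-1}=\Delta(1,n)$. Write $e_I=\sum_{i\in I}e_i$. A subdivision $\Sigma$ of a finite point set $\mathcal P$ is a collection of subsets of $\mathcal P$ (cells, identified with their convex hulls) closed under taking faces, whose convex hulls cover $\operatorname{conv}\mathcal P$ and intersect pairwise in common faces. It is coarsest if it is non-trivial and the only strictly coarser subdivision is the trivial one. It is regular if it is the projection of the lower convex hull of $\mathcal P$ lifted by a height (lifting) function. A $k$-split of $\mathcal P$ is a coarsest subdivision with exactly $k$ maximal cells, all of which share a common cell of codimension $k-1$ in $\operatorname{conv}\mathcal P$; this common cell is denoted $H^\Sigma$. A $k$-split of a polytope is a $k$-split of its vertex set. Every $k$-split is a regular subdivision. Vertex figure: for $\#I=d$, the vertex figure of $e_I$ in $\Delta(d,n)$ is $\{x\in\Delta(d,n):\sum_{i\in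 I}x_i=d-1\}=\Delta(d-1,I)\times\Delta(1,[n]-I)$, which is isomorphic to $\Delta_{d-1}\times\Delta_{n-d-1}$; its vertex $e_I-e_i+e_j$ ($i\in I$, $j\in[n]-I$) corresponds to the vertex $(e_i,e_j)$ of the product. Stiefel map: let $\lambda(i,j)\in\mathbb R$ ($i\in I$, $j\in[n]-I$) be a lifting function of $\Delta_{d-1}\times\Delta_{n-d-1}\cong\Delta(d-1,I)\times\Delta(1,[n]-I)$. For $A\subseteq I$, $B\subseteq[n]-I$ with $\#A=\#B$ put $\pi(A,B)=\min_{\omega}\sum_{i\in A}\lambda(i,\omega(i))$, the minimum over all bijections $\omega:A\to B$. The (tropical) Stiefel map at $e_I$ sends $\lambda$ to the lifting function of $\Delta(d,n)$ with height $\pi(I-J,J-I)$ on the vertex $e_J$. The image (extension) of the regular subdivision induced by $\lambda$ is the regular subdivision of $\Delta(d,n)$ induced by this lifting function.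
   Formalization: In a k-split the common cell is additionally required to be interior (in no proper face of conv P). Without this the claim fails: pulling the vertex e_1+e_5 of Δ(2,5) gives a coarsest subdivision into 5 cells meeting in that vertex, which is no matroid subdivision, so no Stiefel image. *)

theory Defs
  imports "HOL-Analysis.Analysis"
begin

text \<open>A cell is the set of points of the configuration that it contains; geometrically it stands
  for its convex hull. The empty face is a face, so disjoint cells meet in the common face
  \<^term>\<open>{}\<close>.\<close>

definition config_face :: "'a::euclidean_space set \<Rightarrow> 'a set \<Rightarrow> bool" where
  "config_face F C \<longleftrightarrow> (\<exists>G. G face_of (convex hull C) \<and> F = C \<inter> G)"

definition subdivision :: "'a::euclidean_space set \<Rightarrow> 'a set set \<Rightarrow> bool" where
  "subdivision P \<S> \<longleftrightarrow>
     finite P \<and>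
     (\<forall>C\<in>\<S>. C \<subseteq> P) \<and>
     (\<forall>C\<in>\<S>. \<forall>F. config_face F C \<longrightarrow> F \<in> \<S>) \<and>
     (\<Union>C\<in>\<S>. convex hull C) = convex hull P \<and>
     (\<forall>C\<in>\<S>. \<forall>D\<in>\<S>. config_face (C \<inter> D) C \<and> config_face (C \<inter> D) D \<and>
        convex hull C \<inter> convex hull D = convex hull (C \<inter> D))"

definition trivial_subdivision :: "'a::euclidean_space set \<Rightarrow> 'a set set" where
  "trivial_subdivision P = {F. config_face F P}"

definition coarser :: "'a set set \<Rightarrow> 'a set set \<Rightarrow> bool" where
  "coarser \<T> \<S> \<longleftrightarrow> (\<forall>C\<in>\<S>. \<exists>D\<in>\<T>. C \<subseteq> D)"

definition coarsest_subdivision :: "'a::euclidean_space set \<Rightarrow> 'a set set \<Rightarrow> bool" where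
  "coarsest_subdivision P \<S> \<longleftrightarrow>
     subdivision P \<S> \<and> \<S> \<noteq> trivial_subdivision P \<and>
     (\<forall>\<T>. subdivision P \<T> \<and> coarser \<T> \<S> \<and> \<T> \<noteq> \<S> \<longrightarrow> \<T> = trivial_subdivision P)"

definition maximal_cells :: "'a set set \<Rightarrow> 'a set set" where
  "maximal_cells \<S> = {C\<in>\<S>. \<forall>D\<in>\<S>. C \<subseteq> D \<longrightarrow> D = C}"

definition common_cell :: "'a set set \<Rightarrow> 'a set" where
  "common_cell \<S> = \<Inter>(maximal_cells \<S>)"

definition interior_cell :: "'a::euclidean_space set \<Rightarrow> 'a set \<Rightarrow> bool" where
  "interior_cell P H \<longleftrightarrow> (\<forall>F. config_face F P \<and> H \<subseteq> F \<longrightarrow> F = P)"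

text \<open>The common cell of a k-split is required to be an interior cell. Without this, k-splits
  need not be regular: let S be the subdivision of a triangle T and a smaller triangle inside it
  into the inner triangle and three quadrangles. S is coarsest and in general not regular. The
  pyramid over S is coarsest, has four maximal cells, and they meet in the apex, which has
  codimension three. Likewise the hypersimplex of 2-subsets of a 5-set has a coarsest subdivision
  into five cells, some of which are not matroid polytopes, that meet in a single vertex.\<close>

definition k_split :: "nat \<Rightarrow> 'a::euclidean_space set \<Rightarrow> 'a set set \<Rightarrow> bool" where
  "k_split k P \<S> \<longleftrightarrow>
     coarsest_subdivision P \<S> \<and>
     finite (maximal_cells \<S>) \<and> card (maximal_cells \<S>) = k \<and>
     common_cell \<S> \<in> \<S> \<and> interior_cell P (common_cell \<S>) \<and>
     aff_dim P - aff_dim (common_cell \<S>) = int k - 1"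

definition lifted :: "'a set \<Rightarrow> ('a \<Rightarrow> real) \<Rightarrow> ('a \<times> real) set" where
  "lifted P h = (\<lambda>p. (p, h p)) ` P"

text \<open>Lower faces are cut out by supporting hyperplanes whose inner normal has a positive last
  coordinate. A hyperplane that misses \<^term>\<open>Q\<close> yields the empty face.\<close>

definition lower_face :: "('a::euclidean_space \<times> real) set \<Rightarrow> ('a \<times> real) set \<Rightarrow> bool" where
  "lower_face G Q \<longleftrightarrow>
     (\<exists>a t b. 0 < t \<and> (\<forall>q\<in>Q. b \<le> (a, t) \<bullet> q) \<and> G = {q\<in>Q. (a, t) \<bullet> q = b})"

definition regular_subdivision :: "'a::euclidean_space set \<Rightarrow> ('a \<Rightarrow> real) \<Rightarrow> 'a set set" where
  "regular_subdivision P h =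
     {{p\<in>P. (p, h p) \<in> G} | G. lower_face G (convex hull (lifted P h))}"

definition vertices :: "'a::euclidean_space set \<Rightarrow> 'a set" where
  "vertices Q = {v. v extreme_point_of Q}"

definition e_set :: "'n::finite set \<Rightarrow> real^'n" where
  "e_set I = (\<Sum>i\<in>I. axis i 1)"

text \<open>The ground set \<open>[n]\<close> is the index type, so \<open>n\<close> is its cardinality and \<open>[n] - I\<close> is
  \<^term>\<open>- I\<close>.\<close>

definition hypersimplex :: "nat \<Rightarrow> 'n::finite set \<Rightarrow> (real^'n) set" where
  "hypersimplex d I =
     {x. (\<forall>i. 0 \<le> x $ i \<and> x $ i \<le> 1) \<and> (\<Sum>i\<in>I. x $ i) = real d \<and> (\<Sum>i\<in>-I. x $ i) = 0}"

definition vertex_figure :: "'n::finite set \<Rightarrow> (real^'n) set" where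
  "vertex_figure I = {x \<in> hypersimplex (card I) UNIV. (\<Sum>i\<in>I. x $ i) = real (card I) - 1}"

lemma vertex_figure_eq_product:
  fixes I :: "'n::finite set"
  assumes "I \<noteq> {}"
  shows "vertex_figure I = {x + y | x y. x \<in> hypersimplex (card I - 1) I \<and> y \<in> hypersimplex 1 (-I)}"
    (is "_ = ?R")
proof
  have c: "real (card I - Suc 0) = real (card I) - 1"
    using assms by (simp add: of_nat_diff card_gt_0_iff Suc_leI)
  have split: "sum f UNIV = sum f I + sum f (-I)" for f :: "'n \<Rightarrow> real"
    using sum.subset_diff[of I UNIV f] by (simp add: Compl_eq_Diff_UNIV add.commute)
  show "vertex_figure I \<subseteq> ?R"
  proof
    fix z assume z: "z \<in> vertex_figure I"
    define x :: "real^'n" where "x = (\<chi> i. if i \<in> I then z $ i else 0)"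
    define y :: "real^'n" where "y = (\<chi> i. if i \<in> I then 0 else z $ i)"
    have s: "(\<Sum>i\<in>I. z $ i) = real (card I) - 1" "(\<Sum>i\<in>-I. z $ i) = 1"
      and b: "\<forall>i. 0 \<le> z $ i \<and> z $ i \<le> 1"
      using z by (auto simp: vertex_figure_def hypersimplex_def split)
    have "x \<in> hypersimplex (card I - 1) I" "y \<in> hypersimplex 1 (-I)"
      using s b by (auto simp: hypersimplex_def x_def y_def c)
    moreover have "z = x + y"
      by (simp add: vec_eq_iff x_def y_def)
    ultimately show "z \<in> ?R" by blast
  qed
  show "?R \<subseteq> vertex_figure I"
  proof
    fix z assume "z \<in> ?R"
    then obtain x y where z: "z = x + y"
      and x: "x \<in> hypersimplex (card I - 1) I" and y: "y \<in> hypersimplex 1 (-I)" by blast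
    have x0: "x $ i = 0" if "i \<notin> I" for i
      using x that sum_nonneg_eq_0_iff[of "-I" "\<lambda>i. x $ i"] by (auto simp: hypersimplex_def)
    have y0: "y $ i = 0" if "i \<in> I" for i
      using y that sum_nonneg_eq_0_iff[of I "\<lambda>i. y $ i"] by (auto simp: hypersimplex_def)
    have "0 \<le> z $ i \<and> z $ i \<le> 1" for i
      using x y x0[of i] y0[of i] by (cases "i \<in> I") (auto simp: hypersimplex_def z)
    then show "z \<in> vertex_figure I"
      using x y by (auto simp: vertex_figure_def hypersimplex_def z split sum.distrib c)
  qed
qed

definition stiefel_pi :: "('n \<Rightarrow> 'n \<Rightarrow> real) \<Rightarrow> 'n::finite set \<Rightarrow> 'n set \<Rightarrow> real" where
  "stiefel_pi l A B = Min {\<Sum>i\<in>A. l i (\<omega> i) | \<omega>. bij_betw \<omega> A B}"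

text \<open>A vertex of the hypersimplex is \<^term>\<open>e_set J\<close> with \<open>J = {i. x $ i = 1}\<close>. Values at other
  points are irrelevant.\<close>

definition stiefel_map :: "'n::finite set \<Rightarrow> ('n \<Rightarrow> 'n \<Rightarrow> real) \<Rightarrow> real^'n \<Rightarrow> real" where
  "stiefel_map I l x = (let J = {i. x $ i = 1} in stiefel_pi l (I - J) (J - I))"

text \<open>The product of simplices is realised as \<^term>\<open>hypersimplex 1 I \<times> hypersimplex 1 (-I)\<close>, whose
  factors have dimensions \<open>d - 1\<close> and \<open>n - d - 1\<close> if \<open>card I = d\<close>.\<close>

definition stiefel_image :: "'n::finite set \<Rightarrow> ((real^'n) \<times> (real^'n)) set set \<Rightarrow> (real^'n) set set \<Rightarrow> bool"
  where "stiefel_image I \<T> \<S> \<longleftrightarrow>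
     (\<exists>h. \<T> = regular_subdivision (vertices (hypersimplex 1 I \<times> hypersimplex 1 (-I))) h \<and>
          \<S> = regular_subdivision (vertices (hypersimplex (card I) UNIV))
                (stiefel_map I (\<lambda>i j. h (axis i 1, axis j 1))))"

definition stiefel_extension :: "'n::finite set \<Rightarrow> (real^'n) set set \<Rightarrow> (real^'n) set set \<Rightarrow> bool"
  where "stiefel_extension I \<T> \<S> \<longleftrightarrow>
     (\<exists>h. \<T> = regular_subdivision (vertices (vertex_figure I)) h \<and>
          \<S> = regular_subdivision (vertices (hypersimplex (card I) UNIV))
                (stiefel_map I (\<lambda>i j. h (e_set I - axis i 1 + axis j 1))))"

end

theory Submission
  imports Defs
begin

text \<open>Let \<open>q\<close> be the barycentre of the common cell of a \<open>k\<close>-split of the hypersimplex. The maximal cells are the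
regions where affine functions \<open>w f\<close>, one for each maximal cell \<open>f\<close> and all equal at \<open>q\<close>, are minimal. Since every
face of a cell is spanned by vertices of the hypersimplex, these functions are very rigid. Points of the
form \<open>e_X + t e_{-X}\<close> with \<open>#X = d - 1\<close> and \<open>t e_Y\<close> with \<open>#Y = d + 1\<close> show that each coordinate can
be labelled by a cell, that coordinates with the same label contribute equally, and that the cells carry a cyclic order.
Hence there is an index \<open>\<iota>\<close> on \<open>[n]\<close> with values \<open>0, ..., k - 1\<close> such that, with \<open>G_m = {y. \<iota> y \<le> m}\<close>, up to
scaling and a common summand the functions are \<open>x \<mapsto> \<Sum>y\<in>G_m. x_y - q_y\<close>. For a vertex \<open>e_I\<close> of the common cell, \<open>\<S>\<close> is
therefore induced by the height \<open>max_m (#(I \<inter> G_m) - #(J \<inter> G_m))\<close> of \<open>e_J\<close>, and a greedy matching of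
\<open>I - J\<close> with \<open>J - I\<close> identifies it with the Stiefel height of \<open>\<lambda>(i, j) = [\<iota> i < \<iota> j]\<close>. The same functions
induce a \<open>k\<close>-split of the vertex figure. Conversely, if \<open>\<S>\<close> is an extension of a \<open>k\<close>-split at \<open>e_I\<close>, the functional
supporting a maximal cell of the vertex figure extends to one supporting a cell of \<open>\<S>\<close> through \<open>e_I\<close>; counting shows
that all \<open>k\<close> maximal cells of \<open>\<S>\<close> arise in this way.\<close>

text \<open>The main obstacle is the passage from equal labels to equal contributions. Two
  coordinates with a common label \<open>c\<close> can be exchanged without leaving the cell
  \<open>c\<close>. Since \<open>k\<close> cells meet in codimension \<open>k - 1\<close>, the cone
  of \<open>c\<close> at \<open>q\<close> is simplicial modulo its lineality space. The exchange is
  a reflection preserving this cone, so it either fixes every facet, which means equal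
  contributions, or interchanges exactly two. The second case is excluded globally: a labelling with
  as few labels as possible restricts the two cells involved, and a count of unknowns and equations
  for weights on the labels does the rest. A similar count shows that every cell is a label. The
  cyclic order rests on integrality: each ray of the fan modulo lineality contains a point with
  class sums 0, 1 or -1, and it turns out to be a single exchange between two neighbouring classes.
  Around the cycle these exchanges telescope to zero, which makes all step lengths equal.
  Interiority of the common cell enters through \<open>0 < q $ y\<close> and
  \<open>q $ y < 1\<close>: for a vertex \<open>e_set I\<close> of the common cell, every class then
  has an element in \<open>I\<close> and one outside.\<close>

section \<open>Indicator vectors and linear systems\<close>

lemma e_set_nth [simp]: "e_set J $ y = (if y \<in> J then 1 else 0)"
  by (simp add: e_set_def axis_def)

lemma inj_e_set: "e_set I = e_set J \<Longrightarrow> I = J"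
  by (auto simp: vec_eq_iff) (metis zero_neq_one)+

lemma mem_hypersimplex:
  "x \<in> hypersimplex d UNIV \<longleftrightarrow> (\<forall>i. 0 \<le> x $ i \<and> x $ i \<le> 1) \<and> sum (($) x) UNIV = real d"
  by (simp add: hypersimplex_def)

lemma e_set_hypersimplex [simp]: "e_set J \<in> hypersimplex d UNIV \<longleftrightarrow> card J = d"
  by (simp add: mem_hypersimplex sum.If_cases)

text \<open>The values 0 and 1 are extreme among the coordinates of the points
  \<open>e_set J\<close>, so every point used with positive weight must share them with
  \<open>x\<close>. This is how membership in a hull becomes information about sets.\<close>

lemma convex_hull_agree_strong:
  fixes x :: "real^'n::finite"
  assumes x: "x \<in> convex hull (e_set ` \<J>)"
  shows "x \<in> convex hull (e_set ` {J\<in>\<J>. (\<forall>y. x $ y = 1 \<longrightarrow> y \<in> J) \<and> (\<forall>y. x $ y = 0 \<longrightarrow> y \<notin> J)})"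
    (is "_ \<in> convex hull (e_set ` ?\<K>)")
proof -
  have fin: "finite (e_set ` \<J>)" by simp
  from x obtain u where u: "\<forall>p\<in>e_set ` \<J>. 0 \<le> u p" "sum u (e_set ` \<J>) = 1"
    "(\<Sum>p\<in>e_set ` \<J>. u p *\<^sub>R p) = x"
    unfolding convex_hull_finite[OF fin] by blast
  have co: "x $ y = (\<Sum>p\<in>e_set ` \<J>. u p * p $ y)" for y
    using u(3) by (auto simp: sum_component)
  have co1: "1 - x $ y = (\<Sum>p\<in>e_set ` \<J>. u p * (1 - p $ y))" for y
    by (simp add: co right_diff_distrib sum_subtractf u(2))
  have zero: "u p = 0" if "p \<in> e_set ` \<J> - e_set ` ?\<K>" for p
  proof -
    from that obtain J where J: "J \<in> \<J>" "p = e_set J" "J \<notin> ?\<K>" by blast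
    then consider y where "x $ y = 1" "y \<notin> J" | y where "x $ y = 0" "y \<in> J" by blast
    then show ?thesis
    proof cases
      case 1
      then have "\<forall>p\<in>e_set ` \<J>. u p * (1 - p $ y) = 0"
        using co1[of y] by (subst sum_nonneg_eq_0_iff[symmetric]) (auto simp: u(1))
      then have "u p * (1 - p $ y) = 0" using J by blast
      then show ?thesis using 1 J by simp
    next
      case 2
      then have "\<forall>p\<in>e_set ` \<J>. u p * p $ y = 0"
        using co[of y] by (subst sum_nonneg_eq_0_iff[symmetric]) (auto simp: u(1))
      then have "u p * p $ y = 0" using J by blast
      then show ?thesis using 2 J by simp
    qed
  qed
  have sub: "e_set ` ?\<K> \<subseteq> e_set ` \<J>" by blast
  have "sum u (e_set ` ?\<K>) = sum u (e_set ` \<J>)"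
    using zero by (intro sum.mono_neutral_left[OF fin sub]) blast
  moreover have "(\<Sum>p\<in>e_set ` ?\<K>. u p *\<^sub>R p) = (\<Sum>p\<in>e_set ` \<J>. u p *\<^sub>R p)"
    using zero by (intro sum.mono_neutral_left[OF fin sub]) simp
  ultimately have "sum u (e_set ` ?\<K>) = 1" "(\<Sum>p\<in>e_set ` ?\<K>. u p *\<^sub>R p) = x"
    using u by simp_all
  moreover have "\<forall>p\<in>e_set ` ?\<K>. 0 \<le> u p" using u(1) sub by blast
  moreover have "finite (e_set ` ?\<K>)" by simp
  ultimately show ?thesis unfolding convex_hull_finite[OF \<open>finite (e_set ` ?\<K>)\<close>] by blast
qed

text \<open>If every admissible set decided \<open>b\<close> the other way, the smaller hull would
  lie in a hyperplane that fixes coordinate \<open>b\<close> at 0 or 1, against the strict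
  inequality for \<open>x\<close>.\<close>

lemma convex_hull_agree:
  fixes x :: "real^'n::finite"
  assumes x: "x \<in> convex hull (e_set ` \<J>)" and b: "0 < x $ b \<and> Q = True \<or> x $ b < 1 \<and> Q = False"
  shows "\<exists>J\<in>\<J>. (b \<in> J \<longleftrightarrow> Q) \<and> (\<forall>y. x $ y = 1 \<longrightarrow> y \<in> J) \<and> (\<forall>y. x $ y = 0 \<longrightarrow> y \<notin> J)"
proof (rule ccontr)
  let ?\<K> = "{J\<in>\<J>. (\<forall>y. x $ y = 1 \<longrightarrow> y \<in> J) \<and> (\<forall>y. x $ y = 0 \<longrightarrow> y \<notin> J)}"
  define c where "c = (if Q then 0 else 1 :: real)"
  assume "\<not> ?thesis"
  then have no: "\<not> (b \<in> J \<longleftrightarrow> Q)" if "J \<in> ?\<K>" for J using that by blast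
  have "e_set J $ b = c" if "J \<in> ?\<K>" for J using no[OF that] by (simp add: c_def)
  then have "e_set ` ?\<K> \<subseteq> {x. axis b 1 \<bullet> x = c}" unfolding inner_axis' by auto
  then have "convex hull (e_set ` ?\<K>) \<subseteq> {x. axis b 1 \<bullet> x = c}"
    by (rule hull_minimal) (rule convex_hyperplane)
  then have "x $ b = c" using convex_hull_agree_strong[OF x] by (auto simp: inner_axis')
  then show False using b by (auto simp: c_def split: if_splits)
qed

text \<open>Gaussian elimination: the unknown \<open>p\<close> is solved from the equation
  \<open>e\<close> and substituted into the others. The counting arguments for labels use this
  form.\<close>

lemma underdetermined_system:
  fixes A :: "'e \<Rightarrow> 'x \<Rightarrow> real"
  assumes "finite E" "finite X" "card E < card X"
  shows "\<exists>g. (\<exists>x\<in>X. g x \<noteq> 0) \<and> (\<forall>e\<in>E. (\<Sum>x\<in>X. A e x * g x) = 0)"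
  using assms
proof (induction E arbitrary: X A rule: finite_induct)
  case empty
  then obtain x where "x \<in> X" by (metis card_gt_0_iff card.empty ex_in_conv)
  then show ?case by (intro exI[of _ "\<lambda>_. 1"]) auto
next
  case (insert e E)
  show ?case
  proof (cases "\<forall>x\<in>X. A e x = 0")
    case True
    have "card E < card X" using insert by simp
    from insert.IH[OF insert.prems(1) this] obtain g where "\<exists>x\<in>X. g x \<noteq> 0" "\<forall>e\<in>E. (\<Sum>x\<in>X. A e x * g x) = 0"
      by blast
    with True show ?thesis by (intro exI[of _ g]) auto
  next
    case False
    then obtain p where p: "p \<in> X" "A e p \<noteq> 0" by blast
    define X' where "X' = X - {p}"
    define B where "B = (\<lambda>e' x. A e' x - A e' p * A e x / A e p)"
    have X': "finite X'" "X = insert p X'" "p \<notin> X'" using p insert.prems by (auto simp: X'_def)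
    have "card E < card X'" using insert X' by (simp add: X'(2))
    from insert.IH[OF X'(1) this] obtain g where g: "\<exists>x\<in>X'. g x \<noteq> 0" "\<forall>e'\<in>E. (\<Sum>x\<in>X'. B e' x * g x) = 0"
      by blast
    define gp where "gp = - (\<Sum>x\<in>X'. A e x * g x) / A e p"
    define h where "h = g(p := gp)"
    have hs: "(\<Sum>x\<in>X. A e' x * h x) = A e' p * gp + (\<Sum>x\<in>X'. A e' x * g x)" for e'
      using X' by (auto simp: h_def intro!: sum.cong)
    have "(\<Sum>x\<in>X. A e x * h x) = 0" unfolding hs by (simp add: gp_def p)
    moreover have "(\<Sum>x\<in>X. A e' x * h x) = 0" if "e' \<in> E" for e'
    proof -
      have "0 = (\<Sum>x\<in>X'. A e' x * g x) - A e' p / A e p * (\<Sum>x\<in>X'. A e x * g x)"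
        using g(2) that by (simp add: B_def algebra_simps sum_subtractf sum_distrib_left)
      then show ?thesis unfolding hs gp_def by (simp add: field_simps)
    qed
    moreover have "\<exists>x\<in>X. h x \<noteq> 0" using g(1) X' by (auto simp: h_def)
    ultimately show ?thesis by (intro exI[of _ h]) auto
  qed
qed

text \<open>\<open>F\<close> indexes the maximal cells, and a cell consists of the points where its function is minimal. The assumption
  \<open>lat\<close> says that each point is a convex combination of vertices that lie in all cells containing it.\<close>

locale split_fan =
  fixes d :: nat and F :: "'f set" and w :: "'f \<Rightarrow> real^'n::finite" and q :: "real^'n"
  assumes d_pos: "0 < d" and d_less: "d < CARD('n)"
    and fin_F: "finite F" and card_F: "2 \<le> card F"
    and w_sum: "\<And>f. f \<in> F \<Longrightarrow> (\<Sum>y\<in>UNIV. w f $ y) = 0"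
    and q_pos: "\<And>y. 0 < q $ y" and q_less: "\<And>y. q $ y < 1"
    and q_sum: "(\<Sum>y\<in>UNIV. q $ y) = real d"
    and ind: "\<And>\<gamma> c f. (\<Sum>f\<in>F. \<gamma> f) = 0 \<Longrightarrow> (\<And>y. (\<Sum>f\<in>F. \<gamma> f * w f $ y) = c) \<Longrightarrow> f \<in> F \<Longrightarrow> \<gamma> f = 0"
    and lat: "\<And>x. x \<in> hypersimplex d UNIV \<Longrightarrow>
       x \<in> convex hull (e_set ` {J. card J = d \<and>
          {f\<in>F. \<forall>g\<in>F. w f \<bullet> (x - q) \<le> w g \<bullet> (x - q)} \<subseteq>
          {f\<in>F. \<forall>g\<in>F. w f \<bullet> (e_set J - q) \<le> w g \<bullet> (e_set J - q)}})"
begin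

section \<open>Cells through a point, row and column barycentres\<close>

definition am :: "real^'n \<Rightarrow> 'f set" where
  "am x = {f\<in>F. \<forall>g\<in>F. w f \<bullet> (x - q) \<le> w g \<bullet> (x - q)}"

lemma am_lat: "x \<in> hypersimplex d UNIV \<Longrightarrow> x \<in> convex hull (e_set ` {J. card J = d \<and> am x \<subseteq> am (e_set J)})"
  using lat by (simp add: am_def)

lemma am_convex:
  assumes "x \<in> convex hull S" "\<And>p. p \<in> S \<Longrightarrow> f \<in> am p"
  shows "f \<in> am x"
proof -
  have "S \<noteq> {}" using assms(1) by auto
  then have f: "f \<in> F" using assms(2) by (auto simp: am_def)
  have "am_set = (\<Inter>g\<in>F. {x. (w f - w g) \<bullet> x \<le> (w f - w g) \<bullet> q})" if "am_set = {x. f \<in> am x}" for am_set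
    using f that by (auto simp: am_def algebra_simps inner_diff_right)
  then have "convex {x. f \<in> am x}" by (auto intro!: convex_Inter simp: convex_halfspace_le)
  then have "convex hull S \<subseteq> {x. f \<in> am x}" using assms(2) by (intro hull_minimal) auto
  then show ?thesis using assms(1) by auto
qed

lemma am_nonempty: "am x \<noteq> {}"
proof -
  have "F \<noteq> {}" using card_F by auto
  obtain f where "f \<in> F" "\<forall>g\<in>F. w f \<bullet> (x - q) \<le> w g \<bullet> (x - q)"
    using arg_min_if_finite[OF fin_F \<open>F \<noteq> {}\<close>, of "\<lambda>f. w f \<bullet> (x - q)"]
    by (metis not_less)
  then show ?thesis by (auto simp: am_def)
qed

lemma am_q [simp]: "am q = F"
  by (auto simp: am_def)

lemma q_hyp: "q \<in> hypersimplex d UNIV"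
  using q_pos q_less q_sum by (auto simp: mem_hypersimplex intro: less_imp_le)

lemma q_lat: "q \<in> convex hull (e_set ` {J. card J = d \<and> F = am (e_set J)})"
proof -
  have "{J. card J = d \<and> am q \<subseteq> am (e_set J)} = {J. card J = d \<and> F = am (e_set J)}"
    by (auto simp: am_def)
  then show ?thesis using am_lat[OF q_hyp] by simp
qed

text \<open>For \<open>#X = d - 1\<close> this is the barycentre of the vertices that arise from
  \<open>X\<close> by adding one of the \<open>n - d + 1\<close> remaining elements.\<close>

definition rowpt :: "'n set \<Rightarrow> real^'n" where
  "rowpt X = e_set X + (1 / (real CARD('n) - real d + 1)) *\<^sub>R e_set (-X)"

text \<open>For \<open>#Y = d + 1\<close> this is the barycentre of the \<open>d\<close>-subsets of
  \<open>Y\<close>; an element of \<open>Y\<close> lies in \<open>d\<close> of these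
  \<open>d + 1\<close> sets.\<close>

definition colpt :: "'n set \<Rightarrow> real^'n" where
  "colpt Y = (real d / (real d + 1)) *\<^sub>R e_set Y"

text \<open>The vertices that span the point inside its cells must contain \<open>X\<close>, where
  the coordinates are 1, and one of them must contain \<open>b\<close>, where the coordinate is
  positive. The cardinality leaves only \<open>insert b X\<close>.\<close>

lemma row:
  assumes X: "card X = d - 1" and f: "f \<in> am (rowpt X)" and b: "b \<notin> X"
  shows "f \<in> am (e_set (insert b X))"
proof -
  let ?m = "real CARD('n) - real d + 1"
  have m: "?m \<ge> 2" using d_less by linarith
  have nth: "rowpt X $ y = (if y \<in> X then 1 else 1 / ?m)" for y by (simp add: rowpt_def)
  have cX: "card (-X) = CARD('n) - (d - 1)" using X by (simp add: Compl_eq_Diff_UNIV card_Diff_subset)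
  have "(\<Sum>y\<in>UNIV. rowpt X $ y) = real (card X) + real (card (-X)) / ?m"
    by (simp add: nth sum.If_cases Compl_eq)
  also have "real (card (-X)) = ?m" unfolding cX using d_pos d_less by (simp add: of_nat_diff)
  finally have "(\<Sum>y\<in>UNIV. rowpt X $ y) = real d" using X d_pos m by (simp add: of_nat_diff)
  then have "rowpt X \<in> hypersimplex d UNIV" using m by (auto simp: mem_hypersimplex nth)
  from convex_hull_agree[OF am_lat[OF this], of b True]
  obtain J where J: "card J = d" "am (rowpt X) \<subseteq> am (e_set J)" "b \<in> J" "X \<subseteq> J"
    using m b by (auto simp: nth subset_iff)
  have "insert b X = J"
    using J b X d_pos by (intro card_subset_eq) auto
  then show ?thesis using J f by auto
qed

text \<open>As for \<open>row\<close>, with zeros in place of ones: coordinates outside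
  \<open>Y\<close> vanish and coordinate \<open>a\<close> is less than 1.\<close>

lemma col:
  assumes Y: "card Y = d + 1" and f: "f \<in> am (colpt Y)" and a: "a \<in> Y"
  shows "f \<in> am (e_set (Y - {a}))"
proof -
  have nth: "colpt Y $ y = (if y \<in> Y then real d / (real d + 1) else 0)" for y by (simp add: colpt_def)
  have "(\<Sum>y\<in>UNIV. colpt Y $ y) = real (card Y) * (real d / (real d + 1))"
    by (simp add: nth sum.If_cases)
  also have "\<dots> = real d" unfolding Y by (simp add: field_simps)
  finally have "colpt Y \<in> hypersimplex d UNIV" by (auto simp: mem_hypersimplex nth)
  from convex_hull_agree[OF am_lat[OF this], of a False]
  obtain J where J: "card J = d" "am (colpt Y) \<subseteq> am (e_set J)" "a \<notin> J" "J \<subseteq> Y"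
    using a by (auto simp: nth subset_iff split: if_splits)
  have "J = Y - {a}"
    using J a Y by (intro card_subset_eq) auto
  then show ?thesis using J f by auto
qed

text \<open>For a \<open>d\<close>-set \<open>K\<close> containing \<open>l\<close>, the values at the barycentre \<^term>\<open>rowpt (K - {l})\<close> are a
  positive combination of the values at \<open>K\<close> and of \<open>u l\<close>.\<close>

definition u :: "'n \<Rightarrow> 'f \<Rightarrow> real" where
  "u y f = - (w f \<bullet> q) - (real CARD('n) - real d) * w f $ y"

definition T :: "'n \<Rightarrow> 'f set" where
  "T y = {f\<in>F. \<forall>g\<in>F. u y f \<le> u y g}"

lemma w_e_set: "w f \<bullet> e_set J = (\<Sum>y\<in>J. w f $ y)"
  by (simp add: e_set_def inner_sum_right inner_axis)

lemma rowpt_value: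
  assumes "f \<in> F" "l \<in> K"
  shows "(real CARD('n) - real d + 1) * (w f \<bullet> (rowpt (K - {l}) - q)) =
     (real CARD('n) - real d) * (w f \<bullet> (e_set K - q)) + u l f"
proof -
  have m: "real CARD('n) - real d + 1 \<noteq> 0" using d_less by linarith
  have K: "w f \<bullet> e_set K = w f $ l + w f \<bullet> e_set (K - {l})"
    using assms by (simp add: w_e_set sum.remove)
  have C: "w f \<bullet> e_set (- (K - {l})) = - (w f \<bullet> e_set (K - {l}))"
    using w_sum[OF assms(1)] sum.subset_diff[of "K - {l}" UNIV "\<lambda>y. w f $ y"]
    by (simp add: w_e_set Compl_eq_Diff_UNIV)
  show ?thesis using m unfolding rowpt_def inner_diff_right inner_add_right inner_scaleR_right C K u_def
    by (simp add: field_simps)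
qed

text \<open>By \<open>rowpt_value\<close>, minimality of \<open>c\<close> at \<open>K\<close> and in
  \<open>u l\<close> add up to minimality at the barycentre of the row, which \<open>row\<close>
  spreads to all vertices of the row. So a label of \<open>l\<close> is a cell in which
  \<open>l\<close> may be exchanged for anything.\<close>

lemma row_T:
  assumes "card K = d" "c \<in> am (e_set K)" "l \<in> K" "c \<in> T l" "b \<notin> K"
  shows "c \<in> am (e_set (insert b (K - {l})))"
proof -
  let ?m = "real CARD('n) - real d"
  have m: "?m \<ge> 0" using d_less by linarith
  have "c \<in> am (rowpt (K - {l}))"
    unfolding am_def
  proof (clarify, intro conjI ballI)
    show c: "c \<in> F" using assms(4) by (simp add: T_def)
    fix g assume g: "g \<in> F"
    have "?m * (w c \<bullet> (e_set K - q)) \<le> ?m * (w g \<bullet> (e_set K - q))"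
      using assms(2) g m by (auto simp: am_def intro: mult_left_mono)
    moreover have "u l c \<le> u l g" using assms(4) g by (auto simp: T_def)
    ultimately have "(?m + 1) * (w c \<bullet> (rowpt (K - {l}) - q)) \<le> (?m + 1) * (w g \<bullet> (rowpt (K - {l}) - q))"
      unfolding rowpt_value[OF c assms(3)] rowpt_value[OF g assms(3)] by linarith
    then show "w c \<bullet> (rowpt (K - {l}) - q) \<le> w g \<bullet> (rowpt (K - {l}) - q)" using m by simp
  qed
  moreover have "card (K - {l}) = d - 1" using assms by simp
  ultimately show ?thesis using assms by (intro row) auto
qed

lemma T_nonempty: "T y \<noteq> {}"
proof -
  have "F \<noteq> {}" using card_F by auto
  obtain f where "f \<in> F" "\<forall>g\<in>F. u y f \<le> u y g"
    using arg_min_if_finite[OF fin_F \<open>F \<noteq> {}\<close>, of "u y"] by (metis not_less)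
  then show ?thesis by (auto simp: T_def)
qed

text \<open>By \<open>ind\<close> the vectors \<open>w f - w c\<close> together with the all-ones
  vector are linearly independent, so values on them can be prescribed. Only differences of values
  are controlled, hence the free constant.\<close>

lemma dual:
  fixes \<phi> :: "'f \<Rightarrow> real"
  obtains v c where "(\<Sum>y\<in>UNIV. v $ y) = 0" "\<And>f. f \<in> F \<Longrightarrow> w f \<bullet> v = \<phi> f + c"
proof -
  obtain c where c: "c \<in> F" using card_F by fastforce
  have inj: "f = g" if "f \<in> F" "g \<in> F" "w f = w g" for f g
  proof (rule ccontr)
    assume "f \<noteq> g"
    let ?\<gamma> = "(\<lambda>h. (if h = f then 1 else 0) - (if h = g then 1 else 0 :: real))"
    have "?\<gamma> f = 0"
      using that fin_F by (intro ind[of ?\<gamma> 0]) (auto simp: sum_subtractf left_diff_distrib if_distrib[of "\<lambda>x. x * _"] cong: if_cong)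
    with \<open>f \<noteq> g\<close> show False by simp
  qed
  define one where "one = ((\<chi> i. 1) :: real^'n)"
  define B where "B = insert one ((\<lambda>f. w f - w c) ` (F - {c}))"
  have finB: "finite B" using fin_F by (simp add: B_def)
  have injk: "inj_on (\<lambda>f. w f - w c) (F - {c})" using inj by (auto simp: inj_on_def)
  have onew: "one \<bullet> (w f - w c) = 0" if "f \<in> F" for f
    using w_sum[OF that] w_sum[OF c] by (simp add: one_def inner_vec_def sum_subtractf)
  have one_one: "one \<bullet> one = real CARD('n)" by (simp add: one_def inner_vec_def)
  have one_notin: "one \<notin> (\<lambda>f. w f - w c) ` (F - {c})"
    using onew one_one by force
  have "independent B"
    unfolding independent_explicit_finite_subsets
  proof (intro allI impI ballI)
    fix S r v assume S: "S \<subseteq> B" and "finite S" and z: "(\<Sum>v\<in>S. r v *\<^sub>R v) = 0" and v: "v \<in> S"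
    define r' where "r' v = (if v \<in> S then r v else 0)" for v
    have "(\<Sum>v\<in>B. r' v *\<^sub>R v) = (\<Sum>v\<in>S. r v *\<^sub>R v)"
      unfolding r'_def using S finB by (intro sum.mono_neutral_cong_right) auto
    then have z': "r' one *\<^sub>R one + (\<Sum>f\<in>F-{c}. r' (w f - w c) *\<^sub>R (w f - w c)) = 0"
      using z one_notin fin_F injk by (simp add: B_def sum.reindex)
    \<comment> \<open>The coefficient at \<open>c\<close> makes the total weight zero, which is the
      form of dependence that \<open>ind\<close> excludes.\<close>
    define \<gamma> where "\<gamma> f = (if f = c then - (\<Sum>f\<in>F-{c}. r' (w f - w c)) else r' (w f - w c))" for f
    have Fsplit: "sum h F = h c + sum h (F - {c})" for h :: "'f \<Rightarrow> real"
      using c fin_F by (rule sum.remove[rotated])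
    have s0: "sum \<gamma> F = 0" unfolding Fsplit by (simp add: \<gamma>_def)
    have "(\<Sum>f\<in>F. \<gamma> f * w f $ y) = - r' one" for y
    proof -
      have "(\<Sum>f\<in>F. \<gamma> f * w f $ y) = (\<Sum>f\<in>F-{c}. r' (w f - w c) * (w f $ y - w c $ y))"
        unfolding Fsplit by (simp add: \<gamma>_def right_diff_distrib sum_subtractf sum_distrib_right)
      moreover have "r' one + (\<Sum>f\<in>F-{c}. r' (w f - w c) * (w f $ y - w c $ y)) = 0"
        using arg_cong[OF z', of "\<lambda>x. x $ y"] by (simp add: one_def)
      ultimately show ?thesis by simp
    qed
    from ind[OF s0 this] have g0: "\<gamma> f = 0" if "f \<in> F" for f using that .
    then have r0: "r' (w f - w c) = 0" if "f \<in> F - {c}" for f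
      using that unfolding \<gamma>_def by (metis Diff_iff insertI1)
    then have "r' one *\<^sub>R one = 0" using z' by simp
    then have "r' one = 0" using one_one by auto
    with r0 have "r' v = 0" using S v by (auto simp: B_def)
    then show "r v = 0" using v by (simp add: r'_def)
  qed
  from linear_independent_extend[OF this, of "\<lambda>x. if x = one then 0 else \<phi> (the_inv_into (F - {c}) (\<lambda>f. w f - w c) x) - \<phi> c"]
  obtain g where g: "linear g"
    "\<forall>x\<in>B. g x = (if x = one then 0 else \<phi> (the_inv_into (F - {c}) (\<lambda>f. w f - w c) x) - \<phi> c)"
    by blast
  define v where "v = adjoint g 1"
  have gv: "g x = x \<bullet> v" for x
    using adjoint_works[OF g(1), of x 1] by (simp add: v_def)
  have "(\<Sum>y\<in>UNIV. v $ y) = one \<bullet> v" by (simp add: one_def inner_vec_def)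
  also have "\<dots> = 0" using g(2) by (simp add: B_def gv)
  finally have 1: "(\<Sum>y\<in>UNIV. v $ y) = 0" .
  have "w f \<bullet> v = \<phi> f + (w c \<bullet> v - \<phi> c)" if f: "f \<in> F" for f
  proof (cases "f = c")
    case False
    then have fB: "w f - w c \<in> (\<lambda>f. w f - w c) ` (F - {c})" using f by auto
    then have "w f - w c \<noteq> one" using one_notin by metis
    then have "g (w f - w c) = \<phi> f - \<phi> c"
      using g(2) fB f False by (simp add: B_def the_inv_into_f_f[OF injk])
    then show ?thesis by (simp add: gv inner_diff_left)
  qed simp
  with 1 show ?thesis by (intro that) auto
qed

end

subsection \<open>Coordinate swaps\<close>

lemma hypersimplex_perturb:
  fixes x v :: "real^'n::finite"
  assumes "\<And>i. 0 < x $ i" "\<And>i. x $ i < 1" "(\<Sum>i\<in>UNIV. x $ i) = real d" "(\<Sum>i\<in>UNIV. v $ i) = 0"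
  obtains e where "0 < e" "\<And>t. \<bar>t\<bar> \<le> e \<Longrightarrow> x + t *\<^sub>R v \<in> hypersimplex d UNIV"
proof -
  define M where "M = 1 + Max (range (\<lambda>i. \<bar>v $ i\<bar>))"
  define m where "m = Min (range (\<lambda>i. min (x $ i) (1 - x $ i)))"
  have vM: "\<bar>v $ i\<bar> \<le> M" for i
    unfolding M_def by (intro add_increasing Max_ge) auto
  have "0 \<le> (MAX i. \<bar>v $ i\<bar>)" by (rule order_trans[OF abs_ge_zero Max_ge]) auto
  then have M: "M > 0" by (simp add: M_def)
  have m: "m > 0" unfolding m_def using assms by (subst Min_gr_iff) auto
  have xm: "m \<le> x $ i" "m \<le> 1 - x $ i" for i
    using Min_le[of "range (\<lambda>i. min (x $ i) (1 - x $ i))" "min (x $ i) (1 - x $ i)"]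
    by (auto simp: m_def)
  show ?thesis
  proof (rule that[of "m / M"])
    show "0 < m / M" using m M by simp
    fix t :: real assume t: "\<bar>t\<bar> \<le> m / M"
    have "\<bar>t * v $ i\<bar> \<le> m" for i
    proof -
      have "\<bar>t * v $ i\<bar> \<le> (m / M) * M" unfolding abs_mult using t vM M m by (intro mult_mono) auto
      then show ?thesis using M by simp
    qed
    then have "0 \<le> (x + t *\<^sub>R v) $ i \<and> (x + t *\<^sub>R v) $ i \<le> 1" for i
      using xm[of i] by (simp add: abs_le_iff) (smt (verit))
    moreover have "(\<Sum>i\<in>UNIV. (x + t *\<^sub>R v) $ i) = real d"
      using assms by (simp add: sum.distrib flip: sum_distrib_left)
    ultimately show "x + t *\<^sub>R v \<in> hypersimplex d UNIV" by (simp add: mem_hypersimplex)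
  qed
qed

text \<open>The transposition as identity plus a map of rank one: it is visibly linear, and an inner
  product changes by a single product of differences.\<close>

definition swap_coord :: "'n \<Rightarrow> 'n \<Rightarrow> real^'n::finite \<Rightarrow> real^'n" where
  "swap_coord y z x = x + (x $ y - x $ z) *\<^sub>R (axis z 1 - axis y 1)"

lemma swap_coord_nth:
  "y \<noteq> z \<Longrightarrow> swap_coord y z x $ i = (if i = y then x $ z else if i = z then x $ y else x $ i)"
  by (auto simp: swap_coord_def axis_def)

lemma swap_coord_swap [simp]: "y \<noteq> z \<Longrightarrow> swap_coord y z (swap_coord y z x) = x"
  by (simp add: vec_eq_iff swap_coord_nth)

lemma linear_swap_coord: "linear (swap_coord y z)"
  unfolding swap_coord_def by (intro linearI) (auto simp: algebra_simps)

lemma swap_coord_affine: "swap_coord y z (x + t *\<^sub>R v) = swap_coord y z x + t *\<^sub>R swap_coord y z v"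
  by (simp add: linear_add[OF linear_swap_coord] linear_scale[OF linear_swap_coord])

lemma swap_coord_sum: "(\<Sum>i\<in>UNIV. swap_coord y z x $ i) = (\<Sum>i\<in>UNIV. x $ i)"
  by (simp add: swap_coord_def sum.distrib sum_subtractf axis_def right_diff_distrib flip: sum_distrib_left)

lemma swap_coord_e_set:
  assumes "y \<noteq> z"
  shows "swap_coord y z (e_set J) =
    e_set (if y \<in> J \<and> z \<notin> J then insert z (J - {y}) else if z \<in> J \<and> y \<notin> J then insert y (J - {z}) else J)"
  using assms by (auto simp: vec_eq_iff swap_coord_nth)

lemma inner_swap_coord: "a \<bullet> swap_coord y z x = a \<bullet> x + (x $ y - x $ z) * (a $ z - a $ y)"
  by (simp add: swap_coord_def inner_add_right inner_diff_right inner_axis)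

context split_fan
begin

text \<open>At vertices this is an exchange permitted by \<open>row_T\<close>. A general
  \<open>x\<close> is spanned by vertices lying in all its cells, and the transposition is
  linear.\<close>

lemma swap_invariant:
  assumes yz: "y \<noteq> z" and c: "c \<in> T y" "c \<in> T z" and x: "x \<in> hypersimplex d UNIV" "c \<in> am x"
  shows "c \<in> am (swap_coord y z x)"
proof -
  let ?S = "{J. card J = d \<and> am x \<subseteq> am (e_set J)}"
  have "swap_coord y z x \<in> swap_coord y z ` (convex hull (e_set ` ?S))" using am_lat[OF x(1)] by blast
  then have "swap_coord y z x \<in> convex hull (swap_coord y z ` e_set ` ?S)"
    by (simp add: convex_hull_linear_image[OF linear_swap_coord])
  then show ?thesis
  proof (rule am_convex)
    fix p assume "p \<in> swap_coord y z ` e_set ` ?S"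
    then obtain J where J: "card J = d" "am x \<subseteq> am (e_set J)" and p: "p = swap_coord y z (e_set J)" by auto
    have cJ: "c \<in> am (e_set J)" using J x by auto
    show "c \<in> am p" unfolding p swap_coord_e_set[OF yz]
      using row_T[OF J(1) cJ, of y z] row_T[OF J(1) cJ, of z y] c cJ by auto
  qed
qed

lemma mem_am_iff:
  "c \<in> F \<Longrightarrow> c \<in> am x \<longleftrightarrow> (\<forall>f\<in>F. 0 \<le> (w f - w c) \<bullet> (x - q))"
  by (auto simp: am_def inner_diff_left)

text \<open>The exceptional case: modulo lineality and scaling, transposing \<open>y\<close> and
  \<open>z\<close> interchanges the facets of \<open>c\<close> towards \<open>a\<close> and
  \<open>b\<close> and fixes the other facets. The last clause says that the two scaled facet
  functionals differ exactly by \<open>axis y 1 - axis z 1\<close>.\<close>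

definition bad_pair :: "'f \<Rightarrow> 'n \<Rightarrow> 'n \<Rightarrow> 'f \<Rightarrow> 'f \<Rightarrow> real \<Rightarrow> real \<Rightarrow> bool" where
  "bad_pair c y z a b \<alpha> \<beta> \<longleftrightarrow> a \<in> F \<and> b \<in> F \<and> c \<in> F \<and> a \<noteq> b \<and> a \<noteq> c \<and> b \<noteq> c \<and> 0 < \<alpha> \<and> 0 < \<beta> \<and> q $ y = q $ z \<and>
     (\<forall>f\<in>F. (w f $ y - w c $ y) - (w f $ z - w c $ z) = (if f = a then \<alpha> else 0) - (if f = b then \<beta> else 0)) \<and>
     (\<forall>x. (w a $ x - w c $ x) / \<alpha> - (w b $ x - w c $ x) / \<beta> =
        (if x = y then 1 else 0) - (if x = z then 1 else 0))"

text \<open>In the basis dual to the facet functionals of \<open>c\<close> the transposition is the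
  identity plus the rank one matrix with entries \<open>\<rho> g * D f\<close>. Invariance of the
  cone makes all entries of the sum nonnegative, while the rank one part has trace -2. Diagonal
  entries of that part are at least -1, so exactly two cells are involved.\<close>

lemma swap_dichotomy:
  assumes yz: "y \<noteq> z" and c: "c \<in> T y" "c \<in> T z"
  shows "(\<forall>f\<in>F. w f $ y - w c $ y = w f $ z - w c $ z) \<or> (\<exists>a b \<alpha> \<beta>. bad_pair c y z a b \<alpha> \<beta>)"
proof (cases "\<forall>f\<in>F. w f $ y - w c $ y = w f $ z - w c $ z")
  case True
  then show ?thesis by simp
next
  case notgood: False
  let ?s = "swap_coord y z"
  define \<kappa> where "\<kappa> f = w f - w c" for f
  define D where "D f = \<kappa> f $ z - \<kappa> f $ y" for f
  have cF: "c \<in> F" using c by (simp add: T_def)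
  have c0: "\<kappa> c = 0" by (simp add: \<kappa>_def)
  have ksum: "(\<Sum>i\<in>UNIV. \<kappa> f $ i) = 0" if "f \<in> F" for f
    using w_sum[OF that] w_sum[OF cF] by (simp add: \<kappa>_def sum_subtractf)
  note am_iff = mem_am_iff[OF cF, folded \<kappa>_def]
  obtain f1 where f1: "f1 \<in> F" "D f1 \<noteq> 0" using notgood by (auto simp: D_def \<kappa>_def)
  define \<delta> where "\<delta> f = \<kappa> f \<bullet> (?s q - q)" for f
  have \<delta>: "\<delta> f = (q $ y - q $ z) * D f" for f
    by (simp add: \<delta>_def D_def inner_diff_right inner_swap_coord)
  have sq: "c \<in> am (?s q)"
    using swap_invariant[OF yz c q_hyp] cF by simp
  have \<delta>_nonneg: "\<delta> f \<ge> 0" if "f \<in> F" for f using sq that by (simp add: am_iff \<delta>_def)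
  have sq_int: "0 < ?s q $ i" "?s q $ i < 1" for i
    using q_pos q_less yz by (auto simp: swap_coord_nth)
  have sq_sum: "(\<Sum>i\<in>UNIV. ?s q $ i) = real d" by (simp add: swap_coord_sum q_sum)
  \<comment> \<open>A \<open>v\<close> parallel to the facets through \<open>?s q\<close> can be
    followed both ways inside \<open>c\<close>. Transposing back gives a segment in \<open>c\<close>
    centred at \<open>q\<close>, so \<open>?s v\<close> is parallel to all facets.\<close>
  have X: "\<forall>f\<in>F. \<kappa> f \<bullet> ?s v = 0"
    if v: "(\<Sum>i\<in>UNIV. v $ i) = 0" "\<And>f. f \<in> F \<Longrightarrow> \<delta> f = 0 \<Longrightarrow> \<kappa> f \<bullet> v = 0" for v
  proof -
    obtain e1 where e1: "0 < e1" "\<And>t. \<bar>t\<bar> \<le> e1 \<Longrightarrow> ?s q + t *\<^sub>R v \<in> hypersimplex d UNIV"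
      using hypersimplex_perturb[OF sq_int sq_sum v(1)] by blast
    \<comment> \<open>The inequalities that are strict at \<open>?s q\<close> tolerate steps up to
      \<open>e2\<close>; the entry 1 keeps the set nonempty when none is strict.\<close>
    define e2 where "e2 = Min (insert 1 ((\<lambda>f. \<delta> f / (1 + \<bar>\<kappa> f \<bullet> v\<bar>)) ` {f\<in>F. \<delta> f \<noteq> 0}))"
    have e2: "e2 > 0" unfolding e2_def
      using fin_F \<delta>_nonneg by (subst Min_gr_iff) (auto intro!: divide_pos_pos simp: order_less_le)
    have e2': "e2 * \<bar>\<kappa> f \<bullet> v\<bar> \<le> \<delta> f" if "f \<in> F" for f
    proof (cases "\<delta> f = 0")
      case False
      have "e2 \<le> \<delta> f / (1 + \<bar>\<kappa> f \<bullet> v\<bar>)" unfolding e2_def using fin_F that False by (intro Min_le) auto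
      then have "e2 * (1 + \<bar>\<kappa> f \<bullet> v\<bar>) \<le> \<delta> f" by (simp add: pos_le_divide_eq)
      then show ?thesis using e2 by (simp add: algebra_simps)
    qed (use v that in auto)
    define e where "e = min e1 e2"
    have e: "e > 0" using e1 e2 by (simp add: e_def)
    have *: "0 \<le> t * (\<kappa> f \<bullet> ?s v)" if t: "t = e \<or> t = - e" and f: "f \<in> F" for t f
    proof -
      have ht: "?s q + t *\<^sub>R v \<in> hypersimplex d UNIV" using t e by (intro e1(2)) (auto simp: e_def)
      have "c \<in> am (?s q + t *\<^sub>R v)"
      proof (unfold am_iff, intro ballI)
        fix g assume g: "g \<in> F"
        have "\<bar>t * (\<kappa> g \<bullet> v)\<bar> \<le> e2 * \<bar>\<kappa> g \<bullet> v\<bar>"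
          unfolding abs_mult using t e by (intro mult_right_mono) (auto simp: e_def)
        with e2'[OF g] have "0 \<le> \<delta> g + t * (\<kappa> g \<bullet> v)" by linarith
        then show "0 \<le> \<kappa> g \<bullet> (?s q + t *\<^sub>R v - q)"
          by (simp add: \<delta>_def inner_diff_right inner_add_right algebra_simps)
      qed
      from swap_invariant[OF yz c ht this] have "c \<in> am (q + t *\<^sub>R ?s v)"
        by (simp add: swap_coord_affine yz)
      then show ?thesis using f by (simp add: am_iff)
    qed
    show ?thesis
    proof
      fix f assume "f \<in> F"
      from *[OF _ this, of e] *[OF _ this, of "-e"] show "\<kappa> f \<bullet> ?s v = 0" using e
        by (auto simp: zero_le_mult_iff mult_le_0_iff)
    qed
  qed
  \<comment> \<open>Two applications of \<open>X\<close> to the vector dual to \<open>f0\<close>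
    return the vector itself and would make its value at \<open>f0\<close> vanish.\<close>
  have \<delta>0: "\<delta> f0 = 0" if f0: "f0 \<in> F" for f0
  proof (rule ccontr)
    assume ne: "\<delta> f0 \<noteq> 0"
    obtain v k where v: "(\<Sum>y\<in>UNIV. v $ y) = 0" "\<And>f. f \<in> F \<Longrightarrow> w f \<bullet> v = (if f = f0 then 1 else 0) + k"
      using dual[of "\<lambda>f. if f = f0 then 1 else 0"] by metis
    have f0c: "c \<noteq> f0" using ne c0 by (auto simp: \<delta>_def)
    have kv: "\<kappa> f \<bullet> v = (if f = f0 then 1 else 0)" if "f \<in> F" for f
      using v(2)[OF that] v(2)[OF cF] f0c by (auto simp: \<kappa>_def inner_diff_left)
    have "\<forall>f\<in>F. \<kappa> f \<bullet> ?s v = 0" using kv ne v(1) by (intro X) auto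
    then have "\<forall>f\<in>F. \<kappa> f \<bullet> ?s (?s v) = 0" using v(1) by (intro X) (auto simp: swap_coord_sum)
    then show False using kv[OF f0] f0 yz by auto
  qed
  have qyz: "q $ y = q $ z" using \<delta>0[OF f1(1)] f1(2) by (auto simp: \<delta>)
  then have sqq: "?s q = q" by (simp add: swap_coord_def)
  have L: "l $ y = l $ z" if "(\<Sum>i\<in>UNIV. l $ i) = 0" "\<And>f. f \<in> F \<Longrightarrow> \<kappa> f \<bullet> l = 0" for l
    using X[OF that(1)] that(2) f1 by (auto simp: inner_swap_coord D_def)
  have "\<exists>v. (\<Sum>i\<in>UNIV. v $ i) = 0 \<and> (\<forall>f\<in>F. \<kappa> f \<bullet> v = (if f = g then 1 else 0))" if g: "g \<in> F - {c}" for g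
  proof -
    obtain v k where v: "(\<Sum>y\<in>UNIV. v $ y) = 0" "\<And>f. f \<in> F \<Longrightarrow> w f \<bullet> v = (if f = g then 1 else 0) + k"
      using dual[of "\<lambda>f. if f = g then 1 else 0"] by metis
    have "\<kappa> f \<bullet> v = (if f = g then 1 else 0)" if "f \<in> F" for f
      using v(2)[OF that] v(2)[OF cF] g by (auto simp: \<kappa>_def inner_diff_left)
    with v(1) show ?thesis by blast
  qed
  then obtain v where v: "\<And>g. g \<in> F - {c} \<Longrightarrow> (\<Sum>i\<in>UNIV. v g $ i) = 0"
    "\<And>f g. g \<in> F - {c} \<Longrightarrow> f \<in> F \<Longrightarrow> \<kappa> f \<bullet> v g = (if f = g then 1 else 0)" by metis
  define \<rho> where "\<rho> g = v g $ y - v g $ z" for g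
  \<comment> \<open>The transposed generator \<open>?s (v g)\<close> stays in the cone of
    \<open>c\<close>; its value at \<open>f\<close> is an entry of the matrix of the
    transposition.\<close>
  have nonneg: "0 \<le> (if f = g then 1 else 0) + \<rho> g * D f" if g: "g \<in> F - {c}" and f: "f \<in> F" for f g
  proof -
    obtain e where e: "0 < e" "\<And>t. \<bar>t\<bar> \<le> e \<Longrightarrow> q + t *\<^sub>R v g \<in> hypersimplex d UNIV"
      using hypersimplex_perturb[OF q_pos q_less q_sum v(1)[OF g]] by blast
    have "c \<in> am (q + e *\<^sub>R v g)" using v(2)[OF g] e by (simp add: am_iff)
    from swap_invariant[OF yz c e(2) this] have "c \<in> am (q + e *\<^sub>R ?s (v g))"
      using e by (simp add: swap_coord_affine sqq)
    then have "0 \<le> \<kappa> f \<bullet> ?s (v g)" using f e by (auto simp: am_iff zero_le_mult_iff)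
    then show ?thesis using v(2)[OF g f] by (simp add: inner_swap_coord \<rho>_def D_def)
  qed
  have expand: "x $ y - x $ z = (\<Sum>g\<in>F-{c}. \<rho> g * (\<kappa> g \<bullet> x))" if x: "(\<Sum>i\<in>UNIV. x $ i) = 0" for x
  proof -
    define l where "l = x - (\<Sum>g\<in>F-{c}. (\<kappa> g \<bullet> x) *\<^sub>R v g)"
    have "(\<Sum>i\<in>UNIV. l $ i) = 0 - (\<Sum>i\<in>UNIV. \<Sum>g\<in>F-{c}. (\<kappa> g \<bullet> x) * v g $ i)"
      using x by (simp add: l_def sum_subtractf)
    also have "(\<Sum>i\<in>UNIV. \<Sum>g\<in>F-{c}. (\<kappa> g \<bullet> x) * v g $ i) = 0"
      by (subst sum.swap) (auto simp: v(1) simp flip: sum_distrib_left intro!: sum.neutral)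
    finally have 1: "(\<Sum>i\<in>UNIV. l $ i) = 0" by simp
    have 2: "\<kappa> f \<bullet> l = 0" if f: "f \<in> F" for f
    proof (cases "f = c")
      case False
      have "\<kappa> f \<bullet> l = \<kappa> f \<bullet> x - (\<Sum>g\<in>F-{c}. (\<kappa> g \<bullet> x) * (if f = g then 1 else 0))"
        using v(2) f by (simp add: l_def inner_diff_right inner_sum_right)
      also have "\<dots> = 0" using f fin_F False by (simp add: if_distrib cong: if_cong)
      finally show ?thesis .
    qed (simp add: c0)
    have "l $ y = l $ z" by (rule L[OF 1 2])
    then show ?thesis by (simp add: l_def \<rho>_def algebra_simps sum_subtractf)
  qed
  \<comment> \<open>Inserting the root of the reflection into \<open>expand\<close> computes the
    trace of the rank one part.\<close>
  have "(\<Sum>i\<in>UNIV. (axis z 1 - axis y 1 :: real^'n) $ i) = 0"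
    by (simp add: sum_subtractf axis_def)
  note ex = expand[OF this]
  have "\<kappa> g \<bullet> (axis z 1 - axis y 1) = D g" for g
    by (simp add: inner_diff_right inner_axis D_def)
  moreover have "(axis z 1 - axis y 1 :: real^'n) $ y - (axis z 1 - axis y 1 :: real^'n) $ z = -2"
    using yz by (simp add: axis_def)
  ultimately have m2: "(\<Sum>g\<in>F-{c}. \<rho> g * D g) = -2" using ex by simp
  have "\<exists>a\<in>F-{c}. \<rho> a * D a < 0"
  proof (rule ccontr)
    assume "\<not> ?thesis"
    then have "0 \<le> (\<Sum>g\<in>F-{c}. \<rho> g * D g)" by (intro sum_nonneg) (meson not_less)
    then show False using m2 by simp
  qed
  then obtain a0 where a0: "a0 \<in> F - {c}" "\<rho> a0 * D a0 < 0" by blast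
  \<comment> \<open>A single diagonal term is at least -1 and cannot account for the trace -2
    alone.\<close>
  have "\<exists>b\<in>F-{c}-{a0}. \<rho> b * D b < 0"
  proof (rule ccontr)
    assume "\<not> ?thesis"
    then have "0 \<le> (\<Sum>g\<in>F-{c}-{a0}. \<rho> g * D g)" by (intro sum_nonneg) (meson not_less)
    then have "\<rho> a0 * D a0 \<le> -2" using m2 a0 fin_F by (subst (asm) sum.remove[of _ a0]) auto
    then show False using nonneg[OF a0(1), of a0] a0 by auto
  qed
  then obtain b0 where b0: "b0 \<in> F - {c}" "b0 \<noteq> a0" "\<rho> b0 * D b0 < 0" by blast
  have ab: "0 \<le> \<rho> a0 * D b0" "0 \<le> \<rho> b0 * D a0"
    using nonneg[OF a0(1), of b0] nonneg[OF b0(1), of a0] a0 b0 by auto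
  obtain a b where a: "a \<in> F - {c}" "\<rho> a * D a < 0" "D a < 0" and b: "b \<in> F - {c}" "b \<noteq> a" "\<rho> b * D b < 0" "D b > 0"
  proof (cases "D a0 < 0")
    case True
    then have "D b0 > 0" using a0(2) b0(3) ab
      by (smt (verit, best) mult_less_0_iff mult_nonneg_nonpos2 zero_le_mult_iff)
    with True a0 b0 that show ?thesis by blast
  next
    case False
    then have "D a0 > 0" "D b0 < 0" using a0(2) b0(3) ab
      by (smt (verit, best) mult_less_0_iff mult_nonneg_nonpos2 zero_le_mult_iff)+
    with a0 b0 that[of b0 a0] show ?thesis by blast
  qed
  have ra: "\<rho> a > 0" and rb: "\<rho> b < 0" using a b by (auto simp: mult_less_0_iff)
  have other: "D f = 0 \<and> \<rho> f = 0" if f: "f \<in> F - {c}" "f \<noteq> a" "f \<noteq> b" for f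
  proof -
    have "0 \<le> \<rho> a * D f" "0 \<le> \<rho> b * D f" "0 \<le> \<rho> f * D a" "0 \<le> \<rho> f * D b"
      using nonneg[OF a(1), of f] nonneg[OF b(1), of f] nonneg[OF f(1), of a] nonneg[OF f(1), of b] f a b by auto
    then show ?thesis using ra rb a(3) b(4)
      by (auto simp: zero_le_mult_iff)
  qed
  have two: "(\<Sum>g\<in>F-{c}. \<rho> g * h g) = \<rho> a * h a + \<rho> b * h b" for h
  proof -
    have "(\<Sum>g\<in>F-{c}. \<rho> g * h g) = (\<Sum>g\<in>{a,b}. \<rho> g * h g)"
      using a b other fin_F by (intro sum.mono_neutral_right) auto
    then show ?thesis using b by simp
  qed
  have "\<rho> a * D a \<ge> -1" "\<rho> b * D b \<ge> -1"
    using nonneg[OF a(1), of a] nonneg[OF b(1), of b] a b by auto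
  then have one: "\<rho> a * D a = -1" "\<rho> b * D b = -1"
    using m2 unfolding two by auto
  define \<alpha> where "\<alpha> = - D a"
  define \<beta> where "\<beta> = D b"
  have r: "\<rho> a = 1 / \<alpha>" "\<rho> b = - 1 / \<beta>"
    using one a b by (auto simp: \<alpha>_def \<beta>_def field_simps)
  \<comment> \<open>The vector \<open>r\<close> has coordinate sum zero, and \<open>expand\<close>
    applied to \<open>r\<close> itself says that \<open>r \<bullet> r = 0\<close>.\<close>
  define r where "r = \<rho> a *\<^sub>R \<kappa> a + \<rho> b *\<^sub>R \<kappa> b - axis y 1 + axis z 1"
  have "(\<Sum>i\<in>UNIV. r $ i) = 0"
    using ksum[of a] ksum[of b] a b
    by (simp add: r_def sum.distrib sum_subtractf axis_def flip: sum_distrib_left sum_divide_distrib)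
  from expand[OF this, unfolded two] have "r \<bullet> r = 0"
    by (subst r_def) (simp add: inner_diff_left inner_add_left inner_axis' algebra_simps)
  then have r0: "r $ x = 0" for x by simp
  have "bad_pair c y z a b \<alpha> \<beta>"
    unfolding bad_pair_def
  proof (intro conjI ballI allI)
    show "0 < \<alpha>" "0 < \<beta>" using a b by (auto simp: \<alpha>_def \<beta>_def)
    fix f assume f: "f \<in> F"
    have "\<kappa> f $ y - \<kappa> f $ z = (if f = a then \<alpha> else 0) - (if f = b then \<beta> else 0)"
      using other[of f] f b c0 a by (cases "f = c") (auto simp: \<alpha>_def \<beta>_def D_def)
    then show "w f $ y - w c $ y - (w f $ z - w c $ z) = (if f = a then \<alpha> else 0) - (if f = b then \<beta> else 0)"
      by (simp add: \<kappa>_def)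
  next
    fix x
    show "(w a $ x - w c $ x) / \<alpha> - (w b $ x - w c $ x) / \<beta> = (if x = y then 1 else 0) - (if x = z then 1 else 0)"
      using r0[of x] by (simp add: r_def r axis_def \<kappa>_def split: if_splits)
  qed (use a b cF qyz in auto)
  then show ?thesis by blast
qed

end

subsection \<open>Labelling the coordinates by maximal cells\<close>

context split_fan
begin

text \<open>A coordinate may have several admissible labels. Using as few as possible makes each
  label strictly optimal in total on its own class, compared with the other labels; this is
  \<open>ub_less\<close>.\<close>

lemma exists_minimal_labelling:
  obtains lab :: "'n \<Rightarrow> 'f" where "\<And>y. lab y \<in> T y"
    "\<And>lab'. (\<And>y. lab' y \<in> T y) \<Longrightarrow> card (range lab) \<le> card (range lab')"
proof -
  have "\<forall>y. \<exists>f. f \<in> T y" using T_nonempty by blast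
  then obtain lab0 where "\<forall>y. lab0 y \<in> T y" by metis
  from ex_has_least_nat[of "\<lambda>l. \<forall>y. l y \<in> T y", OF this, of "\<lambda>l. card (range l)"] that
  show ?thesis by blast
qed

end

locale labelled_fan = split_fan d F w q
  for d :: nat and F :: "'f set" and w :: "'f \<Rightarrow> real^'n::finite" and q :: "real^'n" +
  fixes lab :: "'n \<Rightarrow> 'f"
  assumes lab_T: "\<And>y. lab y \<in> T y"
    and lab_min: "\<And>lab'. (\<And>y. lab' y \<in> T y) \<Longrightarrow> card (range lab) \<le> card (range lab')"
begin

abbreviation "U \<equiv> range lab"

definition good :: "'n \<Rightarrow> 'n \<Rightarrow> bool" where
  "good y z \<longleftrightarrow> (\<forall>f\<in>F. \<forall>g\<in>F. w f $ y - w g $ y = w f $ z - w g $ z)"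

lemma lab_F: "lab y \<in> F"
  using lab_T[of y] by (simp add: T_def)

lemma U_F: "U \<subseteq> F"
  using lab_F by auto

lemma good_or_bad:
  assumes "lab y = lab z" "y \<noteq> z"
  shows "good y z \<or> (\<exists>a b \<alpha> \<beta>. bad_pair (lab y) y z a b \<alpha> \<beta>)"
proof -
  have "good y z" if "\<forall>f\<in>F. w f $ y - w (lab y) $ y = w f $ z - w (lab y) $ z"
    unfolding good_def
  proof (intro ballI)
    fix f g assume "f \<in> F" "g \<in> F"
    with that show "w f $ y - w g $ y = w f $ z - w g $ z" by (smt (verit))
  qed
  moreover have "lab y \<in> T z" using lab_T[of z] assms by simp
  ultimately show ?thesis using swap_dichotomy[OF assms(2) lab_T[of y]] by blast
qed

lemma bad_sym: "bad_pair c y z a b \<alpha> \<beta> \<Longrightarrow> bad_pair c z y b a \<beta> \<alpha>"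
  unfolding bad_pair_def by (auto simp: algebra_simps)

lemma bad_diff:
  assumes "bad_pair c y z a b \<alpha> \<beta>" "f \<in> F"
  shows "w f $ y - w f $ z = (w c $ y - w c $ z) + (if f = a then \<alpha> else 0) - (if f = b then \<beta> else 0)"
  using assms unfolding bad_pair_def by (smt (verit))

lemma bad_unique:
  assumes "bad_pair c y z a b \<alpha> \<beta>" "bad_pair c y z a' b' \<alpha>' \<beta>'"
  shows "a = a' \<and> b = b' \<and> \<alpha> = \<alpha>' \<and> \<beta> = \<beta>'"
proof -
  have F: "a \<in> F" "b \<in> F" "a \<noteq> b" "\<alpha> > 0" "\<beta> > 0" "\<alpha>' > 0" "\<beta>' > 0" "a' \<noteq> b'"
    using assms by (auto simp: bad_pair_def)
  then show ?thesis
    using bad_diff[OF assms(1) F(1)] bad_diff[OF assms(2) F(1)]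
      bad_diff[OF assms(1) F(2)] bad_diff[OF assms(2) F(2)]
    by (auto split: if_splits)
qed

text \<open>The scaled difference attached to a bad pair takes equal values at coordinates that are
  good to each other, but it is \<open>axis y 1 - axis z 1\<close> and so singles out
  \<open>y\<close>.\<close>

lemma good_bad_disjoint:
  assumes "good x y" "bad_pair c y z a b \<alpha> \<beta>" "x \<noteq> y"
  shows "x = z"
proof (rule ccontr)
  assume "x \<noteq> z"
  have F: "a \<in> F" "b \<in> F" "c \<in> F" "y \<noteq> z" using assms(2) by (auto simp: bad_pair_def)
  have e: "(w a $ x - w c $ x) / \<alpha> - (w b $ x - w c $ x) / \<beta> = (if x = y then 1 else 0) - (if x = z then 1 else 0)" for x
    using assms(2) by (auto simp: bad_pair_def)
  have "w a $ x - w c $ x = w a $ y - w c $ y" "w b $ x - w c $ x = w b $ y - w c $ y"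
    using assms(1) F by (auto simp: good_def)
  then show False using e[of x] e[of y] assms(3) \<open>x \<noteq> z\<close> F by simp
qed

lemma good_sym: "good x y \<longleftrightarrow> good y x"
  by (auto simp: good_def)

lemma not_good_bad:
  assumes "good y z" shows "\<not> bad_pair c y z a b \<alpha> \<beta>"
proof
  assume b: "bad_pair c y z a b \<alpha> \<beta>"
  then have F: "a \<in> F" "c \<in> F" "\<alpha> > 0" "a \<noteq> b" by (auto simp: bad_pair_def)
  then show False using bad_diff[OF b F(1)] assms by (auto simp: good_def) (smt (verit))
qed

text \<open>A class cannot mix both kinds: nothing in it is good to \<open>y\<close>, so a good pair
  \<open>x\<close>, \<open>x'\<close> would have \<open>x\<close> in a bad pair with
  \<open>y\<close>, which \<open>good_bad_disjoint\<close> forbids.\<close>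

lemma all_bad:
  assumes b: "bad_pair (lab y) y z a b \<alpha> \<beta>" and yz: "lab y = lab z"
    and x: "lab x = lab y" "lab x' = lab y" "x \<noteq> x'"
  shows "\<exists>a b \<alpha> \<beta>. bad_pair (lab y) x x' a b \<alpha> \<beta>"
proof (rule ccontr)
  assume "\<not> ?thesis"
  then have g: "good x x'" using good_or_bad[of x x'] x by auto
  have *: "\<not> good v y" if "lab v = lab y" "v \<noteq> y" for v
  proof
    assume gv: "good v y"
    with good_bad_disjoint[OF gv b] that have "v = z" by simp
    with gv b show False using not_good_bad[of z y] bad_sym[OF b] by blast
  qed
  have xy: "x \<noteq> y" "x' \<noteq> y" using *[of x'] *[of x] g x good_sym by metis+
  obtain a b \<alpha> \<beta> where "bad_pair (lab x) x y a b \<alpha> \<beta>" using good_or_bad[of x y] *[of x] xy x by auto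
  with g xy good_bad_disjoint[of x' x] x good_sym show False by metis
qed

section \<open>Totals over classes and the signs of bad pairs\<close>

definition cls :: "'f \<Rightarrow> 'n set" where "cls c = {y. lab y = c}"

definition ub :: "'f \<Rightarrow> 'f \<Rightarrow> real" where "ub c f = (\<Sum>y\<in>cls c. u y f)"

lemma ub_le: "f \<in> F \<Longrightarrow> ub c c \<le> ub c f"
  unfolding ub_def using lab_T by (intro sum_mono) (auto simp: cls_def T_def)

text \<open>Equality would make \<open>f\<close> admissible at every coordinate of the class of
  \<open>c\<close>; relabelling this class by \<open>f\<close> would save a label.\<close>

lemma ub_less:
  assumes c: "c \<in> U" and f: "f \<in> U" "f \<noteq> c"
  shows "ub c c < ub c f"
proof (rule ccontr)
  have fF: "f \<in> F" using f U_F by auto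
  assume "\<not> ?thesis"
  then have eq: "ub c c = ub c f" using ub_le[OF fF, of c] by simp
  have le: "u y c \<le> u y f" if "y \<in> cls c" for y using lab_T[of y] that fF by (auto simp: cls_def T_def)
  have "\<forall>y\<in>cls c. u y f - u y c = 0"
    using eq le by (subst sum_nonneg_eq_0_iff[symmetric]) (auto simp: ub_def sum_subtractf)
  then have fT: "f \<in> T y" if "y \<in> cls c" for y using lab_T[of y] that fF by (auto simp: cls_def T_def)
  define lab' where "lab' y = (if lab y = c then f else lab y)" for y
  have "card U \<le> card (range lab')"
    using fT lab_T by (intro lab_min) (auto simp: lab'_def cls_def)
  also have "range lab' \<subseteq> U - {c}" using f by (auto simp: lab'_def)
  then have "card (range lab') \<le> card (U - {c})" by (intro card_mono) auto
  also have "\<dots> < card U" using c by (intro psubset_card_mono) auto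
  finally show False by simp
qed

lemma bad_vec:
  assumes "bad_pair c y z a b \<alpha> \<beta>"
  shows "(1 / \<alpha>) *\<^sub>R (w a - w c) - (1 / \<beta>) *\<^sub>R (w b - w c) = axis y 1 - axis z 1"
  using assms by (auto simp: bad_pair_def vec_eq_iff axis_def)

text \<open>The scaled differences of \<open>u\<close> agree at every coordinate except
  \<open>y\<close> and \<open>z\<close>, where they deviate by opposite amounts. Both have the same
  label, so the deviations cancel in each class sum.\<close>

lemma ub_bad:
  assumes b: "bad_pair c y z a b \<alpha> \<beta>" and yz: "lab y = lab z"
  shows "(ub e a - ub e c) / \<alpha> = (ub e b - ub e c) / \<beta>"
proof -
  let ?m = "real CARD('n) - real d"
  have q: "(w a \<bullet> q - w c \<bullet> q) / \<alpha> - (w b \<bullet> q - w c \<bullet> q) / \<beta> = 0"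
    using arg_cong[OF bad_vec[OF b], of "\<lambda>x. x \<bullet> q"] b
    by (simp add: inner_diff_left inner_axis' bad_pair_def)
  have "(u x a - u x c) / \<alpha> - (u x b - u x c) / \<beta> = - ?m * ((if x = y then 1 else 0) - (if x = z then 1 else 0))" for x
  proof -
    have e: "(w a $ x - w c $ x) / \<alpha> - (w b $ x - w c $ x) / \<beta> = (if x = y then 1 else 0) - (if x = z then 1 else 0)"
      using b by (auto simp: bad_pair_def)
    have E: "(u x f - u x c) / s = - ((w f \<bullet> q - w c \<bullet> q) / s) - ?m * ((w f $ x - w c $ x) / s)" for f s
      by (simp add: u_def algebra_simps diff_divide_distrib add_divide_distrib)
    have "(u x a - u x c) / \<alpha> - (u x b - u x c) / \<beta> =
      - ((w a \<bullet> q - w c \<bullet> q) / \<alpha> - (w b \<bullet> q - w c \<bullet> q) / \<beta>)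
      - ?m * ((w a $ x - w c $ x) / \<alpha> - (w b $ x - w c $ x) / \<beta>)"
      unfolding E right_diff_distrib by linarith
    then show ?thesis unfolding q e by simp
  qed
  then have "(\<Sum>x\<in>cls e. (u x a - u x c) / \<alpha> - (u x b - u x c) / \<beta>) =
     - ?m * ((if y \<in> cls e then 1 else 0) - (if z \<in> cls e then 1 else 0))"
    by (simp add: sum_subtractf flip: sum_distrib_left sum_negf)
  also have "\<dots> = 0" using yz by (simp add: cls_def)
  finally show ?thesis by (simp add: ub_def sum_subtractf flip: sum_divide_distrib)
qed

text \<open>On the class of \<open>a\<close> the cell \<open>a\<close> is optimal, and
  \<open>ub_bad\<close> turns this into \<open>\<beta> \<le> \<alpha>\<close>. If \<open>b\<close>
  were a label too, its own class would give the opposite strict inequality.\<close>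

lemma bad_U:
  assumes b: "bad_pair c y z a b \<alpha> \<beta>" and yz: "lab y = lab z" "lab y = c" and a: "a \<in> U"
  shows "b \<notin> U" "\<beta> \<le> \<alpha>"
proof -
  have pos: "\<alpha> > 0" "\<beta> > 0" "b \<in> F" "a \<in> F" "a \<noteq> c" "b \<noteq> c" "a \<noteq> b" using b by (auto simp: bad_pair_def)
  have cU: "c \<in> U" using yz by auto
  have A: "(ub a a - ub a c) / \<alpha> = (ub a b - ub a c) / \<beta>" using ub_bad[OF b yz(1)] .
  have X: "ub a a - ub a c < 0" using ub_less[OF a cU] pos by simp
  have Y: "ub a b - ub a c = \<beta> / \<alpha> * (ub a a - ub a c)" using A pos by (simp add: field_simps)
  have "\<beta> / \<alpha> * (ub a a - ub a c) \<ge> ub a a - ub a c" using ub_le[OF pos(3), of a] Y by linarith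
  then have "(1 - \<beta> / \<alpha>) * (ub a a - ub a c) \<le> 0" by (simp add: algebra_simps)
  then have "1 - \<beta> / \<alpha> \<ge> 0" using X by (auto simp: mult_le_0_iff)
  then show ba: "\<beta> \<le> \<alpha>" using pos by simp
  show "b \<notin> U"
  proof
    assume bU: "b \<in> U"
    have "(ub b a - ub b c) / \<alpha> = (ub b b - ub b c) / \<beta>" using ub_bad[OF b yz(1)] .
    then have Y: "ub b a - ub b c = \<alpha> / \<beta> * (ub b b - ub b c)" using pos by (simp add: field_simps)
    have X: "ub b b - ub b c < 0" using ub_less[OF bU cU] pos by simp
    have "\<alpha> / \<beta> * (ub b b - ub b c) > ub b b - ub b c" using ub_less[OF bU a] pos Y by linarith
    then have "(1 - \<alpha> / \<beta>) * (ub b b - ub b c) < 0" by (simp add: algebra_simps)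
    then have "1 - \<alpha> / \<beta> > 0" using X by (auto simp: mult_less_0_iff)
    then show False using pos ba by simp
  qed
qed

text \<open>Weights on the cells that combine the functionals to \<open>axis y 1 - axis z 1\<close>;
  the coefficient at \<open>c\<close> brings the total weight to zero.\<close>

definition zt :: "'f \<Rightarrow> 'f \<Rightarrow> 'f \<Rightarrow> real \<Rightarrow> real \<Rightarrow> 'f \<Rightarrow> real" where
  "zt c a b \<alpha> \<beta> f = (if f = a then 1 / \<alpha> else 0) - (if f = b then 1 / \<beta> else 0) + (if f = c then 1 / \<beta> - 1 / \<alpha> else 0)"

lemma zt_sum:
  assumes "a \<in> F" "b \<in> F" "c \<in> F"
  shows "(\<Sum>f\<in>F. zt c a b \<alpha> \<beta> f * h f) = (h a - h c) / \<alpha> - (h b - h c) / \<beta>"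
  using assms fin_F
  by (simp add: zt_def distrib_right left_diff_distrib sum.distrib sum_subtractf if_distrib[of "\<lambda>x. x * _"] cong: if_cong)
     (simp add: field_simps diff_divide_distrib)

lemma zt_total: "bad_pair c y z a b \<alpha> \<beta> \<Longrightarrow> (\<Sum>f\<in>F. zt c a b \<alpha> \<beta> f) = 0"
  using zt_sum[of a b c \<alpha> \<beta> "\<lambda>_. 1"] by (simp add: bad_pair_def)

lemma zt_w:
  "bad_pair c y z a b \<alpha> \<beta> \<Longrightarrow> (\<Sum>f\<in>F. zt c a b \<alpha> \<beta> f * w f $ x) = (if x = y then 1 else 0) - (if x = z then 1 else 0)"
  using zt_sum[of a b c \<alpha> \<beta> "\<lambda>f. w f $ x"] by (auto simp: bad_pair_def)

text \<open>The root of the first pair is evaluated on the difference of \<open>y'\<close> and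
  \<open>z'\<close> twice: directly in coordinates, and through its weights together with
  \<open>bad_diff\<close> for the second pair.\<close>

lemma pairing:
  assumes b: "bad_pair c y z a b \<alpha> \<beta>" and b': "bad_pair c' y' z' a' b' \<alpha>' \<beta>'"
  shows "\<alpha>' * zt c a b \<alpha> \<beta> a' - \<beta>' * zt c a b \<alpha> \<beta> b' =
    (if y' = y then 1 else 0) - (if y' = z then 1 else 0) - ((if z' = y then 1 else 0) - (if z' = z then 1 else 0))"
proof -
  have F: "a' \<in> F" "b' \<in> F" using b' by (auto simp: bad_pair_def)
  have "(\<Sum>f\<in>F. zt c a b \<alpha> \<beta> f * (w f $ y' - w f $ z')) =
     (\<Sum>f\<in>F. zt c a b \<alpha> \<beta> f * (w c' $ y' - w c' $ z') + ((if f = a' then \<alpha>' * zt c a b \<alpha> \<beta> f else 0) - (if f = b' then \<beta>' * zt c a b \<alpha> \<beta> f else 0)))"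
  proof (intro sum.cong refl)
    fix f assume f: "f \<in> F"
    show "zt c a b \<alpha> \<beta> f * (w f $ y' - w f $ z') = zt c a b \<alpha> \<beta> f * (w c' $ y' - w c' $ z') +
      ((if f = a' then \<alpha>' * zt c a b \<alpha> \<beta> f else 0) - (if f = b' then \<beta>' * zt c a b \<alpha> \<beta> f else 0))"
      unfolding bad_diff[OF b' f] by (simp add: algebra_simps)
  qed
  also have "\<dots> = \<alpha>' * zt c a b \<alpha> \<beta> a' - \<beta>' * zt c a b \<alpha> \<beta> b'"
    using zt_total[OF b] F fin_F by (simp add: sum.distrib sum_subtractf flip: sum_distrib_right)
  finally show ?thesis using zt_w[OF b, of y'] zt_w[OF b, of z']
    by (simp add: right_diff_distrib sum_subtractf)
qed

text \<open>For disjoint pairs both pairings vanish. The inequalities on the scales leave only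
  \<open>b\<close> with negative weight in the first family and only \<open>b'\<close> in the
  second, and the vanishing pairings transport signs between the two cells of a pair.\<close>

lemma other_class_aux:
  assumes b: "bad_pair c y z a b \<alpha> \<beta>" "\<beta> \<le> \<alpha>" "b \<notin> U"
    and b': "bad_pair c' y' z' a' b' \<alpha>' \<beta>'" "c' \<in> U" "\<beta>' \<le> \<alpha>'" and ne: "{y, z} \<inter> {y', z'} = {}"
  shows "zt c' a' b' \<alpha>' \<beta>' b = 0"
proof (rule ccontr)
  assume nz: "\<not> ?thesis"
  note D = b(1)[unfolded bad_pair_def] b'(1)[unfolded bad_pair_def]
  have p1: "\<alpha> * zt c' a' b' \<alpha>' \<beta>' a = \<beta> * zt c' a' b' \<alpha>' \<beta>' b"
    using pairing[OF b'(1) b(1)] ne by auto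
  have p2: "\<alpha>' * zt c a b \<alpha> \<beta> a' = \<beta>' * zt c a b \<alpha> \<beta> b'"
    using pairing[OF b(1) b'(1)] ne by auto
  have neg': "f = b'" if "zt c' a' b' \<alpha>' \<beta>' f < 0" for f
    using that D b'(3) by (auto simp: zt_def field_simps split: if_splits)
  have neg: "f = b" if "zt c a b \<alpha> \<beta> f < 0" for f
    using that D b(2) by (auto simp: zt_def field_simps split: if_splits)
  have pos': "f = a' \<or> f = c'" if "zt c' a' b' \<alpha>' \<beta>' f > 0" for f
    using that D by (auto simp: zt_def field_simps split: if_splits)
  have z: "zt c a b \<alpha> \<beta> b < 0" using D by (auto simp: zt_def)
  have "zt c' a' b' \<alpha>' \<beta>' b > 0"
  proof (rule ccontr)
    assume "\<not> ?thesis"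
    then have n: "zt c' a' b' \<alpha>' \<beta>' b < 0" using nz by simp
    then have "\<alpha> * zt c' a' b' \<alpha>' \<beta>' a < 0" using p1 D by (simp add: mult_pos_neg)
    then have "zt c' a' b' \<alpha>' \<beta>' a < 0" using D by (auto simp: mult_less_0_iff)
    with n have "a = b" using neg' by blast
    with D show False by simp
  qed
  \<comment> \<open>A positive weight sits at \<open>a'\<close> or at \<open>c'\<close>, and
    \<open>c'\<close> is a label whereas \<open>b\<close> is not.\<close>
  then have ba: "b = a'" using pos' b(3) b'(2) by blast
  then have "\<beta>' * zt c a b \<alpha> \<beta> b' < 0" using p2 z D by (metis mult_pos_neg)
  then have "zt c a b \<alpha> \<beta> b' < 0" using D by (auto simp: mult_less_0_iff)
  then have "b' = b" by (rule neg)
  with ba D show False by simp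
qed

lemma zt_sym: "zt c b a \<beta> \<alpha> f = - zt c a b \<alpha> \<beta> f"
  by (simp add: zt_def)

lemma other_class:
  assumes b: "bad_pair c y z a b \<alpha> \<beta>" "\<beta> \<le> \<alpha>" "b \<notin> U"
    and b': "bad_pair c' y' z' a' b' \<alpha>' \<beta>'" "c' \<in> U" and ne: "{y, z} \<inter> {y', z'} = {}"
  shows "zt c' a' b' \<alpha>' \<beta>' b = 0"
proof (cases "\<beta>' \<le> \<alpha>'")
  case True
  then show ?thesis using other_class_aux[OF b b' _ ne] by simp
next
  case False
  have "zt c' b' a' \<beta>' \<alpha>' b = 0"
    using False ne by (intro other_class_aux[OF b bad_sym[OF b'(1)] b'(2)]) auto
  then show ?thesis by (simp add: zt_sym[of c' b' a'])
qed

text \<open>The three transpositions act on the facets like those of a symmetric group on three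
  letters, so the interchanged pairs overlap in exactly one cell. \<open>pairing\<close> forces the
  overlap, and additivity of the differences, fact \<open>h\<close>, identifies the third
  pair.\<close>

lemma third:
  assumes yz: "bad_pair c y z a b \<alpha> \<beta>" and zw: "bad_pair c z x a2 b2 \<alpha>2 \<beta>2"
    and yw: "bad_pair c y x a3 b3 \<alpha>3 \<beta>3" and ne: "y \<noteq> z" "x \<noteq> y" "x \<noteq> z"
  shows "(a2 = b \<and> a3 = a \<and> b3 = b2 \<and> b2 \<noteq> b \<and> b2 \<noteq> a) \<or>
     (b2 = a \<and> a3 = a2 \<and> b3 = b \<and> a2 \<noteq> a \<and> a2 \<noteq> b)"
proof -
  note D = yz[unfolded bad_pair_def] zw[unfolded bad_pair_def] yw[unfolded bad_pair_def]
  have F: "a \<in> F" "b \<in> F" "a2 \<in> F" "b2 \<in> F" "a3 \<in> F" "b3 \<in> F" "a \<noteq> b" "a2 \<noteq> b2" "a3 \<noteq> b3"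
    and P: "\<alpha> > 0" "\<beta> > 0" "\<alpha>2 > 0" "\<beta>2 > 0" "\<alpha>3 > 0" "\<beta>3 > 0"
    and C: "a \<noteq> c" "b \<noteq> c" "a2 \<noteq> c" "b2 \<noteq> c" using D by simp_all
  have p1: "\<alpha>2 * ((if a2 = a then 1 / \<alpha> else 0) - (if a2 = b then 1 / \<beta> else 0))
     - \<beta>2 * ((if b2 = a then 1 / \<alpha> else 0) - (if b2 = b then 1 / \<beta> else 0)) = -1"
    using pairing[OF yz zw] C ne by (simp add: zt_def)
  have p2: "\<alpha> * ((if a = a2 then 1 / \<alpha>2 else 0) - (if a = b2 then 1 / \<beta>2 else 0))
     - \<beta> * ((if b = a2 then 1 / \<alpha>2 else 0) - (if b = b2 then 1 / \<beta>2 else 0)) = -1"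
    using pairing[OF zw yz] C ne by (simp add: zt_def)
  have h: "(if f = a3 then \<alpha>3 else 0) - (if f = b3 then \<beta>3 else 0) =
    (if f = a then \<alpha> else 0) - (if f = b then \<beta> else 0) + ((if f = a2 then \<alpha>2 else 0) - (if f = b2 then \<beta>2 else 0))"
    if "f \<in> F" for f
    using bad_diff[OF yz that] bad_diff[OF zw that] bad_diff[OF yw that] by (simp split: if_splits)
  have "a2 = b \<or> b2 = a"
  proof (rule ccontr)
    assume n: "\<not> ?thesis"
    have "\<alpha>2 / \<alpha> > 0" "\<beta>2 / \<beta> > 0" using P by auto
    then show False using p1 n F by (auto split: if_splits)
  qed
  moreover have "\<not> (a2 = b \<and> b2 = a)"
  proof
    assume n: "a2 = b \<and> b2 = a"
    have e1: "\<alpha>2 / \<beta> + \<beta>2 / \<alpha> = 1" and e2: "\<alpha> / \<beta>2 + \<beta> / \<alpha>2 = 1"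
      using p1 p2 n F by auto
    have "\<alpha>2 / \<beta> > 0" "\<alpha> / \<beta>2 > 0" "\<beta>2 / \<alpha> > 0" "\<beta> / \<alpha>2 > 0" using P by auto
    then have "\<alpha>2 / \<beta> < 1" "\<beta> / \<alpha>2 < 1" using e1 e2 by linarith+
    then show False using P by simp
  qed
  ultimately consider "a2 = b" "b2 \<noteq> a" | "b2 = a" "a2 \<noteq> b" by blast
  then show ?thesis
  proof cases
    case 1
    then have "b2 \<noteq> b" using F by auto
    moreover have "\<alpha>2 = \<beta>" using p1 1 F P by (auto simp: field_simps split: if_splits)
    moreover have "a3 = a" using h[OF F(1)] 1 F P by (auto split: if_splits)
    moreover have "b3 = b2" using h[OF F(4)] 1 F P \<open>b2 \<noteq> b\<close> by (auto split: if_splits)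
    ultimately show ?thesis using 1 by blast
  next
    case 2
    then have "a2 \<noteq> a" using F by auto
    moreover have "\<beta>2 = \<alpha>" using p1 2 F P by (auto simp: field_simps split: if_splits)
    moreover have "b3 = b" using h[OF F(2)] 2 F P by (auto split: if_splits)
    moreover have "a3 = a2" using h[OF F(3)] 2 F P \<open>a2 \<noteq> a\<close> by (auto split: if_splits)
    ultimately show ?thesis using 2 by blast
  qed
qed

end

context labelled_fan
begin

section \<open>Exclusion of bad pairs by counting\<close>

lemma good_sum:
  assumes "sum \<zeta> F = 0" "good y z"
  shows "(\<Sum>f\<in>F. \<zeta> f * w f $ y) = (\<Sum>f\<in>F. \<zeta> f * w f $ z)"
proof -
  obtain f0 where f0: "f0 \<in> F" using card_F by fastforce
  have d: "w f $ y = w f $ z + (w f0 $ y - w f0 $ z)" if "f \<in> F" for f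
    using assms(2) f0 that unfolding good_def by (smt (verit))
  have "(\<Sum>f\<in>F. \<zeta> f * w f $ y) = (\<Sum>f\<in>F. \<zeta> f * w f $ z + \<zeta> f * (w f0 $ y - w f0 $ z))"
    using d by (intro sum.cong) (auto simp: distrib_left)
  also have "\<dots> = (\<Sum>f\<in>F. \<zeta> f * w f $ z)"
    using assms(1) by (simp add: sum.distrib flip: sum_distrib_right)
  finally show ?thesis .
qed

text \<open>A representative of each class that is prescribed on the class of \<open>r\<close>. The
  choice of \<open>r\<close> later decides which bad pairs enter the representation of the
  weights.\<close>

definition ref :: "'n \<Rightarrow> 'n \<Rightarrow> 'n" where
  "ref r x = (if lab x = lab r then r else (SOME y. lab y = lab x))"

lemma lab_ref [simp]: "lab (ref r x) = lab x"
proof -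
  have "lab (SOME y. lab y = lab x) = lab x" by (rule someI[of "\<lambda>v. lab v = lab x" x]) simp
  then show ?thesis by (simp add: ref_def)
qed

lemma ref_eq: "ref r x = y \<longleftrightarrow> lab x = lab y \<and> ref r y = y"
proof
  assume "ref r x = y"
  then show "lab x = lab y \<and> ref r y = y" using lab_ref[of r x] by (auto simp: ref_def)
next
  assume a: "lab x = lab y \<and> ref r y = y"
  then have "lab x = lab y" by simp
  then have "ref r x = ref r y" unfolding ref_def by (rule ssubst) (rule refl)
  then show "ref r x = y" using a by simp
qed

text \<open>If \<open>\<eta>\<close> has average \<open>\<kappa>\<close> on a class, its deviation
  from \<open>\<kappa>\<close> there is a combination of the roots
  \<open>axis (ref r x) 1 - axis x 1\<close>. In a bad class these roots are realised by the weights
  \<open>zt\<close>; by \<open>ind\<close> the resulting weights must be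
  \<open>\<zeta>\<close>.\<close>

lemma class_representation:
  assumes \<zeta>: "sum \<zeta> F = 0" and avg: "\<And>c. c \<in> U \<Longrightarrow> (\<Sum>x\<in>cls c. \<kappa> - (\<Sum>f\<in>F. \<zeta> f * w f $ x)) = 0"
  obtains Z where
    "\<And>f. f \<in> F \<Longrightarrow> \<zeta> f = (\<Sum>x\<in>UNIV. (\<kappa> - (\<Sum>f\<in>F. \<zeta> f * w f $ x)) * Z x f)"
    "\<And>x a b \<alpha> \<beta>. bad_pair (lab x) (ref r x) x a b \<alpha> \<beta> \<Longrightarrow> Z x = zt (lab x) a b \<alpha> \<beta>"
    "\<And>x. \<forall>a b \<alpha> \<beta>. \<not> bad_pair (lab x) (ref r x) x a b \<alpha> \<beta> \<Longrightarrow> Z x = (\<lambda>_. 0)"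
proof -
  define \<eta> where "\<eta> x = (\<Sum>f\<in>F. \<zeta> f * w f $ x)" for x
  define bad where "bad x \<longleftrightarrow> (\<exists>a b \<alpha> \<beta>. bad_pair (lab x) (ref r x) x a b \<alpha> \<beta>)" for x
  have "\<exists>z. (bad x \<longrightarrow> (\<exists>a b \<alpha> \<beta>. bad_pair (lab x) (ref r x) x a b \<alpha> \<beta> \<and> z = zt (lab x) a b \<alpha> \<beta>)) \<and>
      (\<not> bad x \<longrightarrow> z = (\<lambda>_. 0))" for x
    unfolding bad_def by (cases "\<exists>a b \<alpha> \<beta>. bad_pair (lab x) (ref r x) x a b \<alpha> \<beta>") blast+
  then obtain Z where Z: "\<And>x. bad x \<Longrightarrow> \<exists>a b \<alpha> \<beta>. bad_pair (lab x) (ref r x) x a b \<alpha> \<beta> \<and> Z x = zt (lab x) a b \<alpha> \<beta>"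
    "\<And>x. \<not> bad x \<Longrightarrow> Z x = (\<lambda>_. 0)" by metis
  have Z0: "sum (Z x) F = 0" for x
  proof (cases "bad x")
    case True
    then obtain a b \<alpha> \<beta> where "bad_pair (lab x) (ref r x) x a b \<alpha> \<beta>" "Z x = zt (lab x) a b \<alpha> \<beta>" using Z(1) by blast
    then show ?thesis using zt_total by simp
  qed (simp add: Z)
  have Zw: "(\<kappa> - \<eta> x) * (\<Sum>f\<in>F. Z x f * w f $ y) =
      (\<kappa> - \<eta> x) * ((if y = ref r x then 1 else 0) - (if y = x then 1 else 0))" if nb: "bad x \<or> ref r x = x \<or> \<eta> x = \<kappa>" for x y
  proof (cases "bad x")
    case True
    then obtain a b \<alpha> \<beta> where "bad_pair (lab x) (ref r x) x a b \<alpha> \<beta>" "Z x = zt (lab x) a b \<alpha> \<beta>" using Z(1) by blast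
    then show ?thesis using zt_w by simp
  next
    case False
    then show ?thesis using nb by (auto simp: Z)
  qed
  \<comment> \<open>In a class without bad pairs \<open>\<eta>\<close> is constant and hence equal
    to its average \<open>\<kappa>\<close>, so no root has to be realised.\<close>
  have nb: "bad x \<or> ref r x = x \<or> \<eta> x = \<kappa>" for x
  proof (rule ccontr)
    assume n: "\<not> ?thesis"
    have const: "\<eta> v = \<eta> x" if v: "lab v = lab x" for v
    proof (cases "v = x")
      case False
      have "good v x"
      proof (rule ccontr)
        assume "\<not> good v x"
        then obtain a b \<alpha> \<beta> where b: "bad_pair (lab v) v x a b \<alpha> \<beta>" using good_or_bad[of v x] v False by blast
        have "\<exists>a b \<alpha> \<beta>. bad_pair (lab v) (ref r x) x a b \<alpha> \<beta>"
        proof (rule all_bad[OF b v])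
          show "lab (ref r x) = lab v" "lab x = lab v" using v by simp_all
          show "ref r x \<noteq> x" using n by blast
        qed
        then have "bad x" unfolding bad_def v .
        with n show False by simp
      qed
      then show ?thesis using good_sum[OF \<zeta>] by (simp add: \<eta>_def)
    qed simp
    have "0 = (\<Sum>v\<in>cls (lab x). \<kappa> - \<eta> v)" using avg[of "lab x"] by (simp add: \<eta>_def)
    also have "\<dots> = (\<Sum>v\<in>cls (lab x). \<kappa> - \<eta> x)" 
    proof (intro sum.cong refl)
      fix v assume "v \<in> cls (lab x)"
      then have "lab v = lab x" by (simp add: cls_def)
      from const[OF this] show "\<kappa> - \<eta> v = \<kappa> - \<eta> x" by simp
    qed
    also have "\<dots> = real (card (cls (lab x))) * (\<kappa> - \<eta> x)" by simp
    finally have "card (cls (lab x)) = 0" using n by simp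
    then show False by (auto simp: cls_def)
  qed
  define \<zeta>' where "\<zeta>' f = (\<Sum>x\<in>UNIV. (\<kappa> - \<eta> x) * Z x f)" for f
  have s': "sum \<zeta>' F = 0"
    unfolding \<zeta>'_def by (subst sum.swap) (simp add: Z0 flip: sum_distrib_left)
  have "(\<Sum>f\<in>F. \<zeta>' f * w f $ y) = \<eta> y - \<kappa>" for y
  proof -
    have "(\<Sum>f\<in>F. \<zeta>' f * w f $ y) = (\<Sum>x\<in>UNIV. (\<kappa> - \<eta> x) * (\<Sum>f\<in>F. Z x f * w f $ y))"
      unfolding \<zeta>'_def sum_distrib_right sum_distrib_left by (subst sum.swap) (simp add: mult.assoc)
    also have "\<dots> = (\<Sum>x\<in>UNIV. (\<kappa> - \<eta> x) * ((if y = ref r x then 1 else 0) - (if y = x then 1 else 0)))"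
      using Zw nb by (intro sum.cong) auto
    also have "\<dots> = (\<Sum>x\<in>UNIV. if y = ref r x then \<kappa> - \<eta> x else 0) - (\<Sum>x\<in>UNIV. if y = x then \<kappa> - \<eta> x else 0)"
      by (subst sum_subtractf[symmetric]) (intro sum.cong, auto)
    also have "(\<Sum>x\<in>UNIV. if y = x then \<kappa> - \<eta> x else 0) = \<kappa> - \<eta> y" by simp
    also have "(\<Sum>x\<in>UNIV. if y = ref r x then \<kappa> - \<eta> x else 0) = 0"
    proof (cases "ref r y = y")
      case True
      then have "(y = ref r x) = (lab x = lab y)" for x using ref_eq[of r x y] True by auto
      then have "(\<Sum>x\<in>UNIV. if y = ref r x then \<kappa> - \<eta> x else 0) = (\<Sum>x\<in>cls (lab y). \<kappa> - \<eta> x)"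
        by (simp add: cls_def sum.If_cases)
      then show ?thesis using avg[of "lab y"] by (simp add: \<eta>_def)
    next
      case False
      then have "y \<noteq> ref r x" for x using ref_eq[of r x y] by auto
      then show ?thesis by simp
    qed
    finally show ?thesis by simp
  qed
  then have "(\<Sum>f\<in>F. (\<zeta> f - \<zeta>' f) * w f $ y) = \<kappa>" for y
    by (simp add: left_diff_distrib sum_subtractf \<eta>_def)
  then have "\<zeta> f - \<zeta>' f = 0" if "f \<in> F" for f
    using ind[of "\<lambda>f. \<zeta> f - \<zeta>' f" \<kappa> f] that \<zeta> s' by (simp add: sum_subtractf)
  then have r1: "\<zeta> f = \<zeta>' f" if "f \<in> F" for f using that by simp
  show ?thesis
  proof (rule that[of Z])
    show "\<zeta> f = (\<Sum>x\<in>UNIV. (\<kappa> - (\<Sum>f\<in>F. \<zeta> f * w f $ x)) * Z x f)" if "f \<in> F" for f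
      using r1[OF that] by (simp add: \<zeta>'_def \<eta>_def)
    fix x
    show "Z x = zt (lab x) a b \<alpha> \<beta>" if b: "bad_pair (lab x) (ref r x) x a b \<alpha> \<beta>" for a b \<alpha> \<beta>
    proof -
      have "bad x" using b by (auto simp: bad_def)
      then obtain a' b' \<alpha>' \<beta>' where "bad_pair (lab x) (ref r x) x a' b' \<alpha>' \<beta>'" "Z x = zt (lab x) a' b' \<alpha>' \<beta>'"
        using Z(1) by blast
      with bad_unique[OF b] show ?thesis by metis
    qed
    show "Z x = (\<lambda>_. 0)" if "\<forall>a b \<alpha> \<beta>. \<not> bad_pair (lab x) (ref r x) x a b \<alpha> \<beta>"
      using that Z(2) by (auto simp: bad_def)
  qed
qed

lemma bad_pair_L:
  assumes b: "bad_pair c y z a b \<alpha> \<beta>" and l: "\<And>f. f \<in> F \<Longrightarrow> w f \<bullet> l = k"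
  shows "l $ y = l $ z"
proof -
  have "a \<in> F" "b \<in> F" "c \<in> F" using b by (auto simp: bad_pair_def)
  with arg_cong[OF bad_vec[OF b], of "\<lambda>x. x \<bullet> l"] show ?thesis
    by (simp add: inner_diff_left inner_axis' l)
qed

text \<open>A vertex of the common cell yields a vector \<open>v\<close> on which all functionals
  agree, so weights of total zero annihilate it. In each class \<open>\<eta>\<close> or
  \<open>v\<close> is constant, so only averages of \<open>\<eta>\<close> count. On a bad class
  \<open>v\<close> is constant and nonzero, because \<open>q\<close> is strictly between 0 and 1,
  and so the last average is determined.\<close>

lemma class_average:
  assumes b: "bad_pair (lab y0) y0 z0 a0 b0 \<alpha>0 \<beta>0" "lab y0 = lab z0" and \<zeta>: "sum \<zeta> F = 0"
    and avg: "\<And>c. c \<in> U - {lab y0} \<Longrightarrow> (\<Sum>x\<in>cls c. (\<Sum>f\<in>F. \<zeta> f * w f $ x)) = \<kappa> * real (card (cls c))"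
  shows "(\<Sum>x\<in>cls (lab y0). (\<Sum>f\<in>F. \<zeta> f * w f $ x)) = \<kappa> * real (card (cls (lab y0)))"
proof -
  define \<eta> where "\<eta> x = (\<Sum>f\<in>F. \<zeta> f * w f $ x)" for x
  obtain J where J: "card J = d" "F = am (e_set J)"
    using q_lat by (metis (mono_tags, lifting) convex_hull_empty empty_iff ex_in_conv image_is_empty mem_Collect_eq)
  obtain f0 where f0: "f0 \<in> F" using card_F by fastforce
  define v where "v = e_set J - q"
  have wv: "w f \<bullet> v = w f0 \<bullet> v" if "f \<in> F" for f
    using that f0 J(2) unfolding v_def am_def by (metis (mono_tags, lifting) antisym mem_Collect_eq)
  have bad_v: "v $ y = v $ z" if "bad_pair c y z a b \<alpha> \<beta>" for c y z a b \<alpha> \<beta>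
    using bad_pair_L[OF that wv] .
  have "(\<Sum>x\<in>UNIV. v $ x * \<eta> x) = (\<Sum>f\<in>F. \<zeta> f * (w f \<bullet> v))"
    unfolding \<eta>_def inner_vec_def sum_distrib_left by (subst sum.swap) (simp add: mult_ac)
  also have "\<dots> = 0" using \<zeta> wv by (simp flip: sum_distrib_right)
  finally have tot: "(\<Sum>x\<in>UNIV. v $ x * \<eta> x) = 0" .
  have v0: "(\<Sum>x\<in>UNIV. v $ x) = 0"
    using J q_sum by (simp add: v_def sum_subtractf sum.If_cases)
  have split: "(\<Sum>x\<in>UNIV. g x) = (\<Sum>c\<in>U. \<Sum>x\<in>cls c. g x)" for g :: "'n \<Rightarrow> real"
    by (simp add: cls_def sum.image_gen[of UNIV g lab])
  have prod: "real (card (cls c)) * (\<Sum>x\<in>cls c. v $ x * \<eta> x) = (\<Sum>x\<in>cls c. v $ x) * (\<Sum>x\<in>cls c. \<eta> x)" for c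
  proof (cases "\<forall>x\<in>cls c. \<forall>x'\<in>cls c. good x x'")
    case True
    then have "\<eta> x = \<eta> x'" if "x \<in> cls c" "x' \<in> cls c" for x x'
      using that good_sum[OF \<zeta>] by (simp add: \<eta>_def)
    then obtain k where "\<And>x. x \<in> cls c \<Longrightarrow> \<eta> x = k" by metis
    then show ?thesis by (simp flip: sum_distrib_right)
  next
    case False
    then obtain x x' where x: "x \<in> cls c" "x' \<in> cls c" "\<not> good x x'" by blast
    then have xx: "x \<noteq> x'" by (auto simp: good_def)
    obtain a b \<alpha> \<beta> where bb: "bad_pair (lab x) x x' a b \<alpha> \<beta>"
      using good_or_bad[of x x'] x xx by (auto simp: cls_def)
    have "v $ p = v $ p'" if p: "p \<in> cls c" "p' \<in> cls c" for p p'
    proof (cases "p = p'")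
      case False
      then obtain a b \<alpha> \<beta> where "bad_pair (lab x) p p' a b \<alpha> \<beta>"
        using all_bad[OF bb, of p p'] x p by (auto simp: cls_def)
      then show ?thesis by (rule bad_v)
    qed simp
    then obtain k where "\<And>x. x \<in> cls c \<Longrightarrow> v $ x = k" by metis
    then show ?thesis by (simp flip: sum_distrib_left)
  qed
  have cpos: "real (card (cls c)) > 0" if "c \<in> U" for c
    using that by (auto simp: cls_def card_gt_0_iff)
  let ?c = "lab y0"
  define V where "V c = (\<Sum>x\<in>cls c. v $ x)" for c
  define m where "m = (\<Sum>x\<in>cls ?c. \<eta> x) / real (card (cls ?c))"
  have e: "(\<Sum>x\<in>cls c. v $ x * \<eta> x) = V c * (if c = ?c then m else \<kappa>)" if "c \<in> U" for c
  proof -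
    have "real (card (cls c)) \<noteq> 0" using cpos[OF that] by linarith
    moreover have "(\<Sum>x\<in>cls c. \<eta> x) = real (card (cls c)) * (if c = ?c then m else \<kappa>)"
      using avg[of c] that calculation by (simp add: m_def \<eta>_def mult.commute)
    ultimately show ?thesis using prod[of c] by (simp add: V_def)
  qed
  have "0 = (\<Sum>c\<in>U. V c * (if c = ?c then m else \<kappa>))"
    using tot unfolding split by (simp add: e)
  also have "\<dots> = V ?c * m + (\<Sum>c\<in>U - {?c}. V c * (if c = ?c then m else \<kappa>))"
    by (subst sum.remove[of U ?c]) auto
  also have "(\<Sum>c\<in>U - {?c}. V c * (if c = ?c then m else \<kappa>)) = (\<Sum>c\<in>U - {?c}. V c) * \<kappa>"
    unfolding sum_distrib_right by (intro sum.cong) auto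
  also have "(\<Sum>c\<in>U - {?c}. V c) = - V ?c"
  proof -
    have "0 = sum V U" using v0 unfolding split V_def by simp
    also have "\<dots> = V ?c + (\<Sum>c\<in>U - {?c}. V c)" by (subst sum.remove[of U ?c]) auto
    finally show ?thesis by simp
  qed
  finally have "V ?c * (m - \<kappa>) = 0" by (auto simp: algebra_simps)
  moreover have "V ?c \<noteq> 0"
  proof -
    have c: "v $ p = v $ y0" if p: "p \<in> cls ?c" for p
    proof (cases "p = y0")
      case False
      then obtain a b \<alpha> \<beta> where "bad_pair ?c p y0 a b \<alpha> \<beta>"
        using all_bad[OF b, of p y0] p by (auto simp: cls_def)
      then show ?thesis by (rule bad_v)
    qed simp
    then have "V ?c = real (card (cls ?c)) * v $ y0" by (simp add: V_def)
    moreover have "v $ y0 \<noteq> 0" using q_pos[of y0] q_less[of y0] by (simp add: v_def)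
    ultimately show ?thesis using cpos[of ?c] by (metis less_irrefl mult_eq_0_iff rangeI)
  qed
  ultimately have "m = \<kappa>" by (metis eq_iff_diff_eq_0 mult_eq_0_iff)
  moreover have "real (card (cls ?c)) \<noteq> 0" using cpos[of ?c] by (metis less_irrefl rangeI)
  ultimately show ?thesis by (simp add: m_def \<eta>_def divide_eq_eq)
qed

text \<open>The unknowns are the weights of the labels and the common average
  \<open>\<kappa>\<close>, one more than the equations, because \<open>class_average\<close>
  supplies the omitted class. A nonzero solution varies on some class, necessarily a bad one. The
  cell \<open>b\<close> of a suitable bad pair there is not a label, so its weight is 0, and reading
  \<open>class_representation\<close> at \<open>b\<close> forces the solution to be constant on this
  class after all.\<close>

lemma no_bad_pair:
  assumes "lab y0 = lab z0" shows "\<not> bad_pair (lab y0) y0 z0 a0 b0 \<alpha>0 \<beta>0"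
proof
  assume b0: "bad_pair (lab y0) y0 z0 a0 b0 \<alpha>0 \<beta>0"
  \<comment> \<open>Equation \<open>None\<close> says that the weights have total zero, equation
    \<open>Some c\<close> concerns the average on the class of \<open>c\<close>. Unknown
    \<open>None\<close> stands for \<open>\<kappa>\<close>, unknown \<open>Some f\<close> for the
    weight of \<open>f\<close>.\<close>
  define A where "A e x = (case e of None \<Rightarrow> (case x of None \<Rightarrow> 0 | Some f \<Rightarrow> 1)
     | Some c \<Rightarrow> (case x of None \<Rightarrow> - real (card (cls c)) | Some f \<Rightarrow> (\<Sum>x\<in>cls c. w f $ x)))" for e x :: "'f option"
  define E where "E = insert None (Some ` (U - {lab y0}))"
  define X where "X = insert None (Some ` U)"
  have finE: "finite E" "finite X" by (auto simp: E_def X_def)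
  have U1: "card U \<ge> 1" using card_gt_0_iff[of U] by auto
  have "card E = card U" using U1 by (simp add: E_def card_image card_Diff_singleton)
  moreover have "card X = Suc (card U)" by (simp add: X_def card_image)
  ultimately have "card E < card X" by simp
  from underdetermined_system[OF finE this, of A] obtain g where
    g: "\<exists>x\<in>X. g x \<noteq> 0" "\<And>e. e \<in> E \<Longrightarrow> (\<Sum>x\<in>X. A e x * g x) = 0" by blast
  define \<zeta> where "\<zeta> f = (if f \<in> U then g (Some f) else 0)" for f
  define \<kappa> where "\<kappa> = g None"
  define \<eta> where "\<eta> x = (\<Sum>f\<in>F. \<zeta> f * w f $ x)" for x
  have FU: "(\<Sum>f\<in>F. \<zeta> f * h f) = (\<Sum>f\<in>U. g (Some f) * h f)" for h
    using U_F fin_F by (intro sum.mono_neutral_cong_right) (auto simp: \<zeta>_def)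
  have sumX: "(\<Sum>x\<in>X. h x) = h None + (\<Sum>f\<in>U. h (Some f))" for h :: "'f option \<Rightarrow> real"
    by (simp add: X_def sum.reindex)
  have \<zeta>0: "sum \<zeta> F = 0"
    using g(2)[of None] FU[of "\<lambda>_. 1"] by (simp add: E_def sumX A_def)
  have avg1: "(\<Sum>x\<in>cls c. \<eta> x) = \<kappa> * real (card (cls c))" if "c \<in> U - {lab y0}" for c
  proof -
    have "(\<Sum>x\<in>cls c. \<eta> x) = (\<Sum>f\<in>U. g (Some f) * (\<Sum>x\<in>cls c. w f $ x))"
      unfolding \<eta>_def FU sum_distrib_left by (rule sum.swap)
    moreover have "(\<Sum>x\<in>X. A (Some c) x * g x) = 0" using that by (intro g(2)) (auto simp: E_def)
    ultimately show ?thesis by (simp add: sumX A_def \<kappa>_def mult.commute)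
  qed
  have avg: "(\<Sum>x\<in>cls c. \<eta> x) = \<kappa> * real (card (cls c))" if "c \<in> U" for c
  proof (cases "c = lab y0")
    case True
    then show ?thesis using class_average[OF b0 assms \<zeta>0, of \<kappa>] avg1 unfolding \<eta>_def by simp
  qed (use avg1 that in auto)
  have nz: "\<exists>f\<in>U. \<zeta> f \<noteq> 0"
  proof (rule ccontr)
    assume n: "\<not> ?thesis"
    then have "\<zeta> f = 0" for f by (auto simp: \<zeta>_def)
    then have "\<eta> x = 0" for x by (simp add: \<eta>_def)
    then have "\<kappa> * real (card (cls (lab y0))) = 0" using avg[of "lab y0"] by simp
    then have "\<kappa> = 0" by (auto simp: cls_def)
    with n g(1) show False by (auto simp: X_def \<zeta>_def \<kappa>_def)
  qed
  \<comment> \<open>Were \<open>\<eta>\<close> constant on every class, it would be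
    \<open>\<kappa>\<close> everywhere, and \<open>ind\<close> would make all weights
    vanish.\<close>
  have "\<exists>y z. lab y = lab z \<and> \<eta> y \<noteq> \<eta> z"
  proof (rule ccontr)
    assume n: "\<not> ?thesis"
    have "\<eta> y = \<kappa>" for y
    proof -
      have "\<eta> x = \<eta> y" if "x \<in> cls (lab y)" for x
        using n that unfolding cls_def by blast
      then have "\<eta> y * real (card (cls (lab y))) = \<kappa> * real (card (cls (lab y)))"
        using avg[of "lab y"] by simp
      moreover have "cls (lab y) \<noteq> {}" by (auto simp: cls_def)
      ultimately show ?thesis by simp
    qed
    then have e: "(\<Sum>f\<in>F. \<zeta> f * w f $ y) = \<kappa>" for y by (simp only: \<eta>_def)
    from nz obtain f where f: "f \<in> U" "\<zeta> f \<noteq> 0" by blast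
    have "f \<in> F" using f U_F by blast
    from ind[OF \<zeta>0 e this] f show False by simp
  qed
  then obtain y1 z1 where yz1: "lab y1 = lab z1" "\<eta> y1 \<noteq> \<eta> z1" by blast
  have \<eta>_bad: "\<eta> y - \<eta> z = \<alpha> * \<zeta> a - \<beta> * \<zeta> b" if b: "bad_pair c y z a b \<alpha> \<beta>" for c y z a b \<alpha> \<beta>
  proof -
    have ab: "a \<in> F" "b \<in> F" using b by (auto simp: bad_pair_def)
    have "\<eta> y - \<eta> z = (\<Sum>f\<in>F. \<zeta> f * (w f $ y - w f $ z))"
      by (simp add: \<eta>_def algebra_simps sum_subtractf)
    also have "\<dots> = (\<Sum>f\<in>F. \<zeta> f * (w c $ y - w c $ z) + ((if f = a then \<alpha> * \<zeta> f else 0) - (if f = b then \<beta> * \<zeta> f else 0)))"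
    proof (intro sum.cong refl)
      fix f assume "f \<in> F"
      then show "\<zeta> f * (w f $ y - w f $ z) = \<zeta> f * (w c $ y - w c $ z) + ((if f = a then \<alpha> * \<zeta> f else 0) - (if f = b then \<beta> * \<zeta> f else 0))"
        unfolding bad_diff[OF b \<open>f \<in> F\<close>] by (simp add: algebra_simps)
    qed
    also have "\<dots> = \<alpha> * \<zeta> a - \<beta> * \<zeta> b"
      using \<zeta>0 ab fin_F by (simp add: sum.distrib sum_subtractf flip: sum_distrib_right)
    finally show ?thesis .
  qed
  have \<eta>_good: "\<eta> y = \<eta> z" if "good y z" for y z
    using good_sum[OF \<zeta>0 that] by (simp add: \<eta>_def)
  have "\<not> good y1 z1" "y1 \<noteq> z1" using yz1 \<eta>_good by auto
  then obtain a1 b1 \<alpha>1 \<beta>1 where bp1: "bad_pair (lab y1) y1 z1 a1 b1 \<alpha>1 \<beta>1"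
    using good_or_bad[OF yz1(1)] by blast
  \<comment> \<open>The values at the two coordinates differ, so one cell of the pair carries a
    nonzero weight and is a label; exchanging the coordinates if necessary makes it
    \<open>a\<close>.\<close>
  obtain y z a b \<alpha> \<beta> where yz: "lab y = lab z" "\<eta> y \<noteq> \<eta> z" and bp: "bad_pair (lab y) y z a b \<alpha> \<beta>" and aU: "a \<in> U"
  proof (cases "\<zeta> a1 = 0")
    case False
    then have "a1 \<in> U" by (auto simp: \<zeta>_def split: if_splits)
    then show ?thesis using that yz1 bp1 by blast
  next
    case True
    then have "\<zeta> b1 \<noteq> 0" using \<eta>_bad[OF bp1] yz1 by auto
    then have "b1 \<in> U" by (auto simp: \<zeta>_def split: if_splits)
    then show ?thesis using that[of z1 y1] yz1 bad_sym[OF bp1] by auto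
  qed
  define c where "c = lab y"
  have labz: "lab z = c" and laby: "lab y = c" using yz by (auto simp: c_def)
  note bp = bp[folded c_def]
  have yzne: "y \<noteq> z" using yz by auto
  note bU = bad_U[OF bp yz(1) laby aU]
  have \<zeta>b: "\<zeta> b = 0" using bU by (simp add: \<zeta>_def)
  have pos: "\<alpha> > 0" "\<beta> > 0" "a \<noteq> b" "a \<in> F" "b \<in> F" "a \<noteq> c" "b \<noteq> c" using bp by (auto simp: bad_pair_def)
  have avg': "(\<Sum>x\<in>cls e. \<kappa> - (\<Sum>f\<in>F. \<zeta> f * w f $ x)) = 0" if "e \<in> U" for e
    using avg[OF that] by (simp add: sum_subtractf \<eta>_def)
  have badc: "\<exists>a b \<alpha> \<beta>. bad_pair c x x' a b \<alpha> \<beta>" if "lab x = c" "lab x' = c" "x \<noteq> x'" for x x'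
    using all_bad[of y z a b \<alpha> \<beta> x x'] bp that labz laby by auto
  have dich: "(\<exists>a2 \<alpha>2 b2 \<beta>2 \<alpha>3 \<beta>3. a2 = b \<and> bad_pair c z x a2 b2 \<alpha>2 \<beta>2 \<and> bad_pair c y x a b2 \<alpha>3 \<beta>3 \<and> b2 \<noteq> b \<and> b2 \<noteq> a) \<or>
      (\<exists>a2 \<alpha>2 b2 \<beta>2 \<alpha>3 \<beta>3. b2 = a \<and> bad_pair c z x a2 b2 \<alpha>2 \<beta>2 \<and> bad_pair c y x a2 b \<alpha>3 \<beta>3 \<and> a2 \<noteq> a \<and> a2 \<noteq> b)"
    if x: "lab x = c" "x \<noteq> y" "x \<noteq> z" for x
  proof -
    obtain a2 b2 \<alpha>2 \<beta>2 where 2: "bad_pair c z x a2 b2 \<alpha>2 \<beta>2" using badc[of z x] x labz by auto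
    obtain a3 b3 \<alpha>3 \<beta>3 where 3: "bad_pair c y x a3 b3 \<alpha>3 \<beta>3" using badc[of y x] x laby by auto
    from third[OF bp 2 3 yzne x(2,3)] 2 3 show ?thesis by blast
  qed
  have rep: "\<exists>Z. (\<forall>f\<in>F. \<zeta> f = (\<Sum>x\<in>UNIV. (\<kappa> - \<eta> x) * Z x f)) \<and>
      (\<forall>x a b \<alpha> \<beta>. bad_pair (lab x) (ref r x) x a b \<alpha> \<beta> \<longrightarrow> Z x = zt (lab x) a b \<alpha> \<beta>) \<and>
      (\<forall>x. (\<forall>a b \<alpha> \<beta>. \<not> bad_pair (lab x) (ref r x) x a b \<alpha> \<beta>) \<longrightarrow> Z x = (\<lambda>_. 0))" for r
  proof (rule class_representation[OF \<zeta>0, of \<kappa> r])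
    show "(\<Sum>x\<in>cls e. \<kappa> - (\<Sum>f\<in>F. \<zeta> f * w f $ x)) = 0" if "e \<in> U" for e using avg'[OF that] .
  qed (unfold \<eta>_def, blast)
  \<comment> \<open>The two outcomes of \<open>third\<close> for a further coordinate
    \<open>x\<close> of the class: the pair of \<open>y\<close> and \<open>x\<close> keeps either
    \<open>a\<close> or \<open>b\<close>.\<close>
  define I where "I x \<longleftrightarrow> (\<exists>\<alpha>2 b2 \<beta>2 \<alpha>3 \<beta>3. bad_pair c z x b b2 \<alpha>2 \<beta>2 \<and> bad_pair c y x a b2 \<alpha>3 \<beta>3 \<and> b2 \<noteq> b \<and> b2 \<noteq> a)" for x
  define II where "II x \<longleftrightarrow> (\<exists>a2 \<alpha>2 \<beta>2 \<alpha>3 \<beta>3. bad_pair c z x a2 a \<alpha>2 \<beta>2 \<and> bad_pair c y x a2 b \<alpha>3 \<beta>3 \<and> a2 \<noteq> a \<and> a2 \<noteq> b)" for x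
  have I_or_II: "I x \<or> II x" if "lab x = c" "x \<noteq> y" "x \<noteq> z" for x
    using dich[OF that] unfolding I_def II_def by blast
  have not_both: False if x: "I x" "lab x = c" and x': "II x'" "lab x' = c" for x x'
  proof -
    obtain \<alpha>2 b2 \<beta>2 where B1: "bad_pair c z x b b2 \<alpha>2 \<beta>2" "b2 \<noteq> b" "b2 \<noteq> a" using x(1) by (auto simp: I_def)
    obtain a2 \<alpha>2' \<beta>2' where B2: "bad_pair c z x' a2 a \<alpha>2' \<beta>2'" "a2 \<noteq> a" "a2 \<noteq> b" using x'(1) by (auto simp: II_def)
    have ps: "\<alpha>2 > 0" "\<beta>2' > 0" using B1 B2 by (auto simp: bad_pair_def)
    have "x \<noteq> x'"
      using bad_unique[OF B1(1)] B2 by blast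
    then obtain p r \<mu> \<nu> where B3: "bad_pair c x x' p r \<mu> \<nu>" using badc[of x x'] x x' by blast
    have p: "p \<noteq> r" "\<mu> > 0" "\<nu> > 0" "c \<noteq> p" "c \<noteq> r" using B3 by (auto simp: bad_pair_def)
    have "b = r"
      using bad_diff[OF B1(1) pos(5)] bad_diff[OF B2(1) pos(5)] bad_diff[OF B3 pos(5)] B1 B2 ps p pos
      by (auto split: if_splits)
    moreover have "a = r"
      using bad_diff[OF B1(1) pos(4)] bad_diff[OF B2(1) pos(4)] bad_diff[OF B3 pos(4)] B1 B2 ps p pos
      by (auto split: if_splits)
    ultimately show False using pos by simp
  qed
  have other: "Z x b = 0" if x: "lab x \<noteq> c" and
    Z: "\<And>x a b \<alpha> \<beta>. bad_pair (lab x) (ref r x) x a b \<alpha> \<beta> \<Longrightarrow> Z x = zt (lab x) a b \<alpha> \<beta>"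
    "\<And>x. \<forall>a b \<alpha> \<beta>. \<not> bad_pair (lab x) (ref r x) x a b \<alpha> \<beta> \<Longrightarrow> Z x = (\<lambda>_. 0)" for Z r x
  proof (cases "\<exists>a b \<alpha> \<beta>. bad_pair (lab x) (ref r x) x a b \<alpha> \<beta>")
    case True
    then obtain a' b' \<alpha>' \<beta>' where B: "bad_pair (lab x) (ref r x) x a' b' \<alpha>' \<beta>'" by blast
    have "{y, z} \<inter> {ref r x, x} = {}" using x labz laby lab_ref[of r x] by auto
    from other_class[OF bp bU(2,1) B _ this] Z(1)[OF B] show ?thesis by simp
  qed (simp add: Z(2))
  have conclude: "\<eta> y = \<eta> z" if "s \<in> {y, z}" "\<And>x. lab x = c \<Longrightarrow> x \<noteq> s \<Longrightarrow> \<eta> x = \<kappa>" for s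
  proof -
    have sc: "s \<in> cls c" using that(1) laby labz by (auto simp: cls_def)
    have "0 = (\<Sum>x\<in>cls c. \<kappa> - \<eta> x)" using avg'[of c] laby by (auto simp: \<eta>_def)
    also have "\<dots> = \<kappa> - \<eta> s"
      using sc that(2) by (subst sum.remove[of _ s]) (auto simp: cls_def)
    finally have "\<eta> x = \<kappa>" if "lab x = c" for x using that \<open>\<And>x. lab x = c \<Longrightarrow> x \<noteq> s \<Longrightarrow> \<eta> x = \<kappa>\<close> by (cases "x = s") auto
    then show ?thesis using laby labz by simp
  qed
  show False
  proof (cases "\<exists>x. lab x = c \<and> x \<noteq> y \<and> x \<noteq> z \<and> II x")
    case False
    then have allI: "I x" if "lab x = c" "x \<noteq> y" "x \<noteq> z" for x using I_or_II that by blast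
    \<comment> \<open>With base point \<open>y\<close>, the pairs formed with the other coordinates
      of the class avoid \<open>b\<close>, so only \<open>x = z\<close> contributes to the weight at
      \<open>b\<close>.\<close>
    obtain Z where Zall: "(\<forall>f\<in>F. \<zeta> f = (\<Sum>x\<in>UNIV. (\<kappa> - \<eta> x) * Z x f)) \<and>
      (\<forall>x a b \<alpha> \<beta>. bad_pair (lab x) (ref y x) x a b \<alpha> \<beta> \<longrightarrow> Z x = zt (lab x) a b \<alpha> \<beta>) \<and>
      (\<forall>x. (\<forall>a b \<alpha> \<beta>. \<not> bad_pair (lab x) (ref y x) x a b \<alpha> \<beta>) \<longrightarrow> Z x = (\<lambda>_. 0))"
      using rep[of y] by (elim exE)
    then have Z: "\<And>f. f \<in> F \<Longrightarrow> \<zeta> f = (\<Sum>x\<in>UNIV. (\<kappa> - \<eta> x) * Z x f)"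
      "\<And>x a b \<alpha> \<beta>. bad_pair (lab x) (ref y x) x a b \<alpha> \<beta> \<Longrightarrow> Z x = zt (lab x) a b \<alpha> \<beta>"
      "\<And>x. \<forall>a b \<alpha> \<beta>. \<not> bad_pair (lab x) (ref y x) x a b \<alpha> \<beta> \<Longrightarrow> Z x = (\<lambda>_. 0)"
      by blast+
    have ry: "ref y x = y" if "lab x = c" for x using that laby by (simp add: ref_def)
    have Zb: "Z x b = 0" if "x \<noteq> z" for x
    proof (cases "lab x = c")
      case True
      show ?thesis
      proof (cases "x = y")
        case x: True
        have "Z x = (\<lambda>_. 0)" using ry[OF True] x by (intro Z(3)) (auto simp: bad_pair_def)
        then show ?thesis by simp
      next
        case x: False
        from allI[OF True x that] obtain b2 \<alpha>3 \<beta>3 where B: "bad_pair c y x a b2 \<alpha>3 \<beta>3" "b2 \<noteq> b" by (auto simp: I_def)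
        then have "Z x = zt c a b2 \<alpha>3 \<beta>3" using Z(2)[of x] ry[OF True] True by simp
        then show ?thesis using B pos by (simp add: zt_def)
      qed
    next
      case False
      then show ?thesis using other[OF _ Z(2,3)] by blast
    qed
    have "Z z = zt c a b \<alpha> \<beta>" using Z(2)[of z] ry[OF labz] labz bp by simp
    then have Zz: "Z z b = - 1 / \<beta>" using pos by (simp add: zt_def)
    have "0 = (\<Sum>x\<in>UNIV. (\<kappa> - \<eta> x) * Z x b)" using Z(1)[OF pos(5)] \<zeta>b by simp
    also have "\<dots> = (\<kappa> - \<eta> z) * Z z b" using Zb by (subst sum.remove[of _ z]) auto
    finally have \<eta>z: "\<eta> z = \<kappa>" using Zz pos by simp
    have "\<eta> y = \<eta> z"
    proof (rule conclude[of y])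
      fix x assume x: "lab x = c" "x \<noteq> y"
      show "\<eta> x = \<kappa>"
      proof (cases "x = z")
        case False
        from allI[OF x False] obtain \<alpha>2 b2 \<beta>2 \<alpha>3 \<beta>3 where B: "bad_pair c z x b b2 \<alpha>2 \<beta>2" "bad_pair c y x a b2 \<alpha>3 \<beta>3"
          by (auto simp: I_def)
        have "b2 \<notin> U" using bad_U(1)[OF B(2) _ laby aU] x laby by simp
        then have "\<eta> z - \<eta> x = 0" using \<eta>_bad[OF B(1)] \<zeta>b by (simp add: \<zeta>_def)
        then show ?thesis using \<eta>z by simp
      qed (simp add: \<eta>z)
    qed simp
    then show False using yz by simp
  next
    case True
    then obtain x0 where x0: "lab x0 = c" "II x0" by blast
    have allII: "II x" if "lab x = c" "x \<noteq> y" "x \<noteq> z" for x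
      using I_or_II[OF that] not_both[of x x0] that x0 by blast
    \<comment> \<open>In this case base point \<open>z\<close> is the right choice: only the pair of
      \<open>z\<close> and \<open>y\<close> involves \<open>b\<close>.\<close>
    obtain Z where Zall: "(\<forall>f\<in>F. \<zeta> f = (\<Sum>x\<in>UNIV. (\<kappa> - \<eta> x) * Z x f)) \<and>
      (\<forall>x a b \<alpha> \<beta>. bad_pair (lab x) (ref z x) x a b \<alpha> \<beta> \<longrightarrow> Z x = zt (lab x) a b \<alpha> \<beta>) \<and>
      (\<forall>x. (\<forall>a b \<alpha> \<beta>. \<not> bad_pair (lab x) (ref z x) x a b \<alpha> \<beta>) \<longrightarrow> Z x = (\<lambda>_. 0))"
      using rep[of z] by (elim exE)
    then have Z: "\<And>f. f \<in> F \<Longrightarrow> \<zeta> f = (\<Sum>x\<in>UNIV. (\<kappa> - \<eta> x) * Z x f)"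
      "\<And>x a b \<alpha> \<beta>. bad_pair (lab x) (ref z x) x a b \<alpha> \<beta> \<Longrightarrow> Z x = zt (lab x) a b \<alpha> \<beta>"
      "\<And>x. \<forall>a b \<alpha> \<beta>. \<not> bad_pair (lab x) (ref z x) x a b \<alpha> \<beta> \<Longrightarrow> Z x = (\<lambda>_. 0)"
      by blast+
    have ry: "ref z x = z" if "lab x = c" for x using that labz by (simp add: ref_def)
    have Zb: "Z x b = 0" if "x \<noteq> y" for x
    proof (cases "lab x = c")
      case True
      show ?thesis
      proof (cases "x = z")
        case x: True
        have "Z x = (\<lambda>_. 0)" using ry[OF True] x by (intro Z(3)) (auto simp: bad_pair_def)
        then show ?thesis by simp
      next
        case x: False
        from allII[OF True that x] obtain a2 \<alpha>2 \<beta>2 where B: "bad_pair c z x a2 a \<alpha>2 \<beta>2" "a2 \<noteq> b" by (auto simp: II_def)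
        then have "Z x = zt c a2 a \<alpha>2 \<beta>2" using Z(2)[of x] ry[OF True] True by simp
        then show ?thesis using B pos by (simp add: zt_def)
      qed
    next
      case False
      then show ?thesis using other[OF _ Z(2,3)] by blast
    qed
    have "Z y = zt c b a \<beta> \<alpha>" using Z(2)[of y] ry[OF laby] laby bad_sym[OF bp] by simp
    then have Zy: "Z y b = 1 / \<beta>" using pos by (simp add: zt_def)
    have "0 = (\<Sum>x\<in>UNIV. (\<kappa> - \<eta> x) * Z x b)" using Z(1)[OF pos(5)] \<zeta>b by simp
    also have "\<dots> = (\<kappa> - \<eta> y) * Z y b" using Zb by (subst sum.remove[of _ y]) auto
    finally have \<eta>y: "\<eta> y = \<kappa>" using Zy pos by simp
    have "\<eta> y = \<eta> z"
    proof (rule conclude[of z])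
      fix x assume x: "lab x = c" "x \<noteq> z"
      show "\<eta> x = \<kappa>"
      proof (cases "x = y")
        case False
        from allII[OF x(1) False x(2)] obtain a2 \<alpha>2 \<beta>2 \<alpha>3 \<beta>3 where B: "bad_pair c z x a2 a \<alpha>2 \<beta>2" "bad_pair c y x a2 b \<alpha>3 \<beta>3"
          by (auto simp: II_def)
        have "a2 \<notin> U" using bad_U(1)[OF bad_sym[OF B(1)] _ _ aU] x labz by simp
        then have "\<eta> y - \<eta> x = 0" using \<eta>_bad[OF B(2)] \<zeta>b by (simp add: \<zeta>_def)
        then show ?thesis using \<eta>y by simp
      qed (simp add: \<eta>y)
    qed simp
    then show False using yz by simp
  qed
qed

lemma same_label_good:
  assumes "lab y = lab z" shows "good y z"
proof (cases "y = z")
  case True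
  show ?thesis unfolding True good_def by blast
next
  case False
  then show ?thesis using good_or_bad[OF assms False] no_bad_pair[OF assms] by blast
qed

text \<open>Up to a common summand the functionals are constant on classes, so asking for a constant
  combination of total weight zero means \<open>#U + 1\<close> equations in \<open>#F + 1\<close>
  unknowns. With fewer labels than cells, a nonzero solution would contradict
  \<open>ind\<close>.\<close>

lemma U_eq: "U = F"
proof -
  have "card F \<le> card U"
  proof (rule ccontr)
    assume lt: "\<not> ?thesis"
    define r where "r c = (SOME y. lab y = c)" for c
    have r: "lab (r (lab y)) = lab y" for y unfolding r_def by (rule someI[of "\<lambda>v. lab v = lab y" y]) simp
    define A where "A e x = (case e of None \<Rightarrow> (case x of None \<Rightarrow> 0 | Some f \<Rightarrow> 1)
     | Some c \<Rightarrow> (case x of None \<Rightarrow> - 1 | Some f \<Rightarrow> w f $ r c))" for e x :: "'f option"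
    define E where "E = insert None (Some ` U)"
    define X where "X = insert None (Some ` F)"
    have finE: "finite E" "finite X" using fin_F by (auto simp: E_def X_def)
    have c: "card (insert None (Some ` S)) = Suc (card S)" if "finite S" for S :: "'f set"
      using that by (simp add: card_image)
    have "finite U" by simp
    have "card E < card X" unfolding E_def X_def c[OF fin_F] c[OF \<open>finite U\<close>] using lt by linarith
    from underdetermined_system[OF finE this, of A] obtain g where
      g: "\<exists>x\<in>X. g x \<noteq> 0" "\<And>e. e \<in> E \<Longrightarrow> (\<Sum>x\<in>X. A e x * g x) = 0" by blast
    have sumX: "(\<Sum>x\<in>X. h x) = h None + (\<Sum>f\<in>F. h (Some f))" for h :: "'f option \<Rightarrow> real"
      using fin_F by (simp add: X_def sum.reindex)
    have s0: "(\<Sum>f\<in>F. g (Some f)) = 0" using g(2)[of None] by (simp add: E_def sumX A_def)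
    obtain f0 where f0: "f0 \<in> F" using card_F by fastforce
    have e: "(\<Sum>f\<in>F. g (Some f) * w f $ y) = g None" for y
    proof -
      have gd: "good y (r (lab y))" using r by (intro same_label_good) simp
      from good_sum[OF s0 this] have "(\<Sum>f\<in>F. g (Some f) * w f $ y) = (\<Sum>f\<in>F. g (Some f) * w f $ r (lab y))" by simp
      moreover have "(\<Sum>x\<in>X. A (Some (lab y)) x * g x) = 0" by (intro g(2)) (auto simp: E_def)
      ultimately show ?thesis by (simp add: sumX A_def mult.commute)
    qed
    have "g (Some f) = 0" if "f \<in> F" for f using ind[OF s0 e that] .
    moreover from this have "g None = 0" using e[of undefined] by simp
    ultimately show False using g(1) by (auto simp: X_def)
  qed
  then show ?thesis using U_F fin_F by (intro card_subset_eq) (auto intro: antisym card_mono)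
qed

text \<open>One extra unknown, \<open>Inr False\<close>, lets the combination jump on the class of
  \<open>b\<close>. The count then yields weights that combine the functionals to a constant plus a
  nonzero multiple of the indicator of the class, and these annihilate \<open>l\<close>.\<close>

lemma class_sum_zero:
  assumes b: "b \<in> F" and l: "(\<Sum>y\<in>UNIV. l $ y) = 0" "\<And>f. f \<in> F \<Longrightarrow> w f \<bullet> l = k"
  shows "(\<Sum>y\<in>cls b. l $ y) = 0"
proof -
  define r where "r c = (SOME y. lab y = c)" for c
  have r: "lab (r (lab y)) = lab y" for y unfolding r_def by (rule someI[of "\<lambda>v. lab v = lab y" y]) simp
  define A where "A e x = (case e of None \<Rightarrow> (case x of Inr _ \<Rightarrow> 0 | Inl f \<Rightarrow> 1)
   | Some c \<Rightarrow> (case x of Inr True \<Rightarrow> -1 | Inr False \<Rightarrow> (if c = b then - 1 else 0) | Inl f \<Rightarrow> w f $ r c))"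
    for e :: "'f option" and x :: "'f + bool"
  define E where "E = insert None (Some ` F)"
  define X where "X = insert (Inr True) (insert (Inr False) (Inl ` F))"
  have finE: "finite E" "finite X" using fin_F by (auto simp: E_def X_def)
  have "card (insert None (Some ` F)) = Suc (card F)" using fin_F by (simp add: card_image)
  moreover have "card X = Suc (Suc (card (Inl ` F :: ('f + bool) set)))"
    unfolding X_def using fin_F by (simp add: card_insert_if image_iff)
  moreover have "card (Inl ` F :: ('f + bool) set) = card F" by (rule card_image) simp
  ultimately have "card E < card X" unfolding E_def by linarith
  from underdetermined_system[OF finE this, of A] obtain g where
    g: "\<exists>x\<in>X. g x \<noteq> 0" "\<And>e. e \<in> E \<Longrightarrow> (\<Sum>x\<in>X. A e x * g x) = 0" by blast
  have sumX: "(\<Sum>x\<in>X. h x) = h (Inr True) + h (Inr False) + (\<Sum>f\<in>F. h (Inl f))" for h :: "_ \<Rightarrow> real"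
    using fin_F by (simp add: X_def sum.reindex image_iff)
  have s0: "(\<Sum>f\<in>F. g (Inl f)) = 0" using g(2)[of None] by (simp add: E_def sumX A_def)
  obtain f0 where f0: "f0 \<in> F" using card_F by fastforce
  have e: "(\<Sum>f\<in>F. g (Inl f) * w f $ y) = g (Inr True) + (if lab y = b then g (Inr False) else 0)" for y
  proof -
    have gd: "good y (r (lab y))" using r by (intro same_label_good) simp
    from good_sum[OF s0 this] have "(\<Sum>f\<in>F. g (Inl f) * w f $ y) = (\<Sum>f\<in>F. g (Inl f) * w f $ r (lab y))" by simp
    moreover have "(\<Sum>x\<in>X. A (Some (lab y)) x * g x) = 0" by (intro g(2)) (auto simp: E_def lab_F)
    ultimately show ?thesis by (auto simp: sumX A_def mult.commute)
  qed
  have t: "g (Inr False) \<noteq> 0"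
  proof
    assume z: "g (Inr False) = 0"
    then have e': "(\<Sum>f\<in>F. g (Inl f) * w f $ y) = g (Inr True)" for y using e[of y] by simp
    have "g (Inl f) = 0" if "f \<in> F" for f using ind[OF s0 e' that] .
    moreover from this have "g (Inr True) = 0" using e'[of undefined] by simp
    ultimately show False using g(1) z by (auto simp: X_def)
  qed
  have "0 = (\<Sum>f\<in>F. g (Inl f) * (w f \<bullet> l))" using l(2) s0 by (simp flip: sum_distrib_right)
  also have "\<dots> = (\<Sum>y\<in>UNIV. l $ y * (\<Sum>f\<in>F. g (Inl f) * w f $ y))"
    unfolding inner_vec_def sum_distrib_left by (subst sum.swap) (simp add: mult_ac)
  also have "\<dots> = (\<Sum>y\<in>UNIV. l $ y * g (Inr True)) + (\<Sum>y\<in>UNIV. if lab y = b then l $ y * g (Inr False) else 0)"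
    unfolding e by (subst sum.distrib[symmetric]) (intro sum.cong, auto simp: algebra_simps)
  also have "(\<Sum>y\<in>UNIV. l $ y * g (Inr True)) = 0" using l(1) by (simp flip: sum_distrib_right)
  also have "(\<Sum>y\<in>UNIV. if lab y = b then l $ y * g (Inr False) else 0) = (\<Sum>y\<in>cls b. l $ y) * g (Inr False)"
    by (simp add: sum.If_cases cls_def sum_distrib_right)
  finally show ?thesis using t by simp
qed

end

subsection \<open>The cyclic order of the maximal cells\<close>

text \<open>The fan modulo its lineality space: \<open>z b\<close> stands for the total deviation from \<open>q\<close> over the coordinates
  labelled \<open>b\<close>, and \<open>v b f\<close> for the value of the functional of \<open>f\<close> on such a coordinate. By \<open>ztop\<close> and
  \<open>zsig\<close>, every difference \<open>v b - v a\<close> is maximal at \<open>b\<close> and minimal at \<open>\<sigma> b\<close>; in the end \<open>\<sigma>\<close> is the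
  cyclic predecessor.\<close>

locale zfan =
  fixes F :: "'f set" and v :: "'f \<Rightarrow> 'f \<Rightarrow> real" and \<sigma> \<tau> :: "'f \<Rightarrow> 'f"
  assumes fin_F: "finite F" and card_F: "2 \<le> card F"
    and sigma_F: "\<And>b. b \<in> F \<Longrightarrow> \<sigma> b \<in> F" and tau_F: "\<And>b. b \<in> F \<Longrightarrow> \<tau> b \<in> F"
    and sigma_tau [simp]: "\<And>b. b \<in> F \<Longrightarrow> \<sigma> (\<tau> b) = b" and tau_sigma [simp]: "\<And>b. b \<in> F \<Longrightarrow> \<tau> (\<sigma> b) = b"
    and ztop: "\<And>a b h. a \<in> F \<Longrightarrow> b \<in> F \<Longrightarrow> h \<in> F \<Longrightarrow> v a b - v b b \<le> v a h - v b h"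
    and zsig: "\<And>a b h. a \<in> F \<Longrightarrow> b \<in> F \<Longrightarrow> h \<in> F \<Longrightarrow> v b (\<sigma> b) - v a (\<sigma> b) \<le> v b h - v a h"
    and zind: "\<And>z k b. sum z F = 0 \<Longrightarrow> (\<And>f. f \<in> F \<Longrightarrow> (\<Sum>b\<in>F. z b * v b f) = k) \<Longrightarrow> b \<in> F \<Longrightarrow> z b = 0"
    and zspan: "\<And>\<phi>. \<exists>z c. sum z F = 0 \<and> (\<forall>f\<in>F. (\<Sum>b\<in>F. z b * v b f) = \<phi> f + c)"
    and zlat: "\<And>z g. sum z F = 0 \<Longrightarrow> (\<forall>b\<in>F. \<bar>z b\<bar> \<le> 1) \<Longrightarrow> g \<in> F \<Longrightarrow>
       (\<exists>h\<in>F. (\<Sum>b\<in>F. z b * v b h) < (\<Sum>b\<in>F. z b * v b g)) \<Longrightarrow>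
       \<exists>\<zeta>. sum \<zeta> F = 0 \<and> (\<forall>b\<in>F. \<zeta> b \<in> {-1, 0, 1} \<and> (\<zeta> b < 0 \<longrightarrow> z b < 0) \<and> (\<zeta> b > 0 \<longrightarrow> z b > 0)) \<and>
         (\<exists>h\<in>F. (\<Sum>b\<in>F. \<zeta> b * v b h) < (\<Sum>b\<in>F. \<zeta> b * v b g)) \<and>
         (\<forall>f\<in>F. (\<forall>h\<in>F. (\<Sum>b\<in>F. z b * v b f) \<le> (\<Sum>b\<in>F. z b * v b h)) \<longrightarrow>
            (\<forall>h\<in>F. (\<Sum>b\<in>F. \<zeta> b * v b f) \<le> (\<Sum>b\<in>F. \<zeta> b * v b h)))"
    and zrow: "\<And>\<zeta> l. sum \<zeta> F = 0 \<Longrightarrow> (\<forall>b\<in>F. \<zeta> b \<in> {-1, 0, 1}) \<Longrightarrow> l \<in> F \<Longrightarrow> 0 \<le> \<zeta> l \<Longrightarrow>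
       \<exists>g\<in>F. (\<forall>h\<in>F. (\<Sum>b\<in>F. \<zeta> b * v b g) \<le> (\<Sum>b\<in>F. \<zeta> b * v b h)) \<and>
         (\<forall>a\<in>F. a \<noteq> l \<longrightarrow> \<zeta> a \<le> 0 \<longrightarrow> (\<forall>h\<in>F. (\<Sum>b\<in>F. \<zeta> b * v b g) + v a g - v l g \<le> (\<Sum>b\<in>F. \<zeta> b * v b h) + v a h - v l h))"
    and zcol: "\<And>\<zeta> l. sum \<zeta> F = 0 \<Longrightarrow> (\<forall>b\<in>F. \<zeta> b \<in> {-1, 0, 1}) \<Longrightarrow> l \<in> F \<Longrightarrow> \<zeta> l \<le> 0 \<Longrightarrow>
       \<exists>g\<in>F. (\<forall>h\<in>F. (\<Sum>b\<in>F. \<zeta> b * v b g) \<le> (\<Sum>b\<in>F. \<zeta> b * v b h)) \<and>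
         (\<forall>a\<in>F. a \<noteq> l \<longrightarrow> 0 \<le> \<zeta> a \<longrightarrow> (\<forall>h\<in>F. (\<Sum>b\<in>F. \<zeta> b * v b g) + v l g - v a g \<le> (\<Sum>b\<in>F. \<zeta> b * v b h) + v l h - v a h))"
begin

section \<open>Rays of the reduced fan and single exchanges\<close>

definition rho :: "('f \<Rightarrow> real) \<Rightarrow> 'f \<Rightarrow> real" where
  "rho z f = (\<Sum>b\<in>F. z b * v b f)"

text \<open>These are the class sums reached from a vertex of the common cell by adding or removing
  at most one element in each class.\<close>

definition lattice_pt :: "('f \<Rightarrow> real) \<Rightarrow> bool" where
  "lattice_pt z \<longleftrightarrow> sum z F = 0 \<and> (\<forall>b\<in>F. z b \<in> {-1, 0, 1})"

text \<open>At \<open>z\<close> all cells except \<open>f\<close> are minimal, so \<open>z\<close>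
  spans the ray of the fan that lies opposite to \<open>f\<close>.\<close>

definition ray :: "'f \<Rightarrow> ('f \<Rightarrow> real) \<Rightarrow> bool" where
  "ray f z \<longleftrightarrow> lattice_pt z \<and> (\<exists>t c. 0 < t \<and> (\<forall>g\<in>F. rho z g = (if g = f then t else 0) + c))"

text \<open>The ray opposite to \<open>f\<close> is realised by one exchange, which removes an
  element of class \<open>\<tau> f\<close> and adds one to class \<open>f\<close>.\<close>

definition short :: "'f \<Rightarrow> bool" where
  "short f \<longleftrightarrow> (\<exists>s c. 0 < s \<and> (\<forall>g\<in>F. v f g - v (\<tau> f) g = (if g = f then s else 0) + c))"

lemma diff_not_const:
  assumes "a \<in> F" "b \<in> F" "a \<noteq> b" shows "\<not> (\<forall>f\<in>F. v a f - v b f = k)"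
proof
  assume c: "\<forall>f\<in>F. v a f - v b f = k"
  define z where "z x = (if x = a then 1 else 0) - (if x = b then 1 else 0 :: real)" for x
  have "(\<Sum>x\<in>F. z x * v x f) = k" if "f \<in> F" for f
    using c that assms fin_F
    by (simp add: z_def left_diff_distrib sum_subtractf if_distrib[of "\<lambda>x. x * _"] cong: if_cong)
  moreover have "sum z F = 0" using assms fin_F by (simp add: z_def sum_subtractf)
  ultimately have "z a = 0" using zind assms by blast
  then show False using assms by (simp add: z_def)
qed

lemma exists_other: "b \<in> F \<Longrightarrow> \<exists>a\<in>F. a \<noteq> b"
proof (rule ccontr)
  assume "b \<in> F" "\<not> ?thesis"
  then have "F \<subseteq> {b}" by blast
  then have "card F \<le> 1" using card_mono[of "{b}" F] by simp
  then show False using card_F by simp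
qed

lemma tau_ne: "f \<in> F \<Longrightarrow> \<tau> f \<noteq> f"
proof
  assume f: "f \<in> F" "\<tau> f = f"
  then have s: "\<sigma> f = f" using sigma_tau[OF f(1)] by simp
  obtain a where a: "a \<in> F" "a \<noteq> f" using exists_other f by blast
  have "\<forall>h\<in>F. v a h - v f h = v a f - v f f"
    using ztop[OF a(1) f(1)] zsig[OF a(1) f(1)] s by (smt (verit))
  then show False using diff_not_const[OF a(1) f(1) a(2)] by blast
qed

lemma rho_diff:
  assumes "sum z F = 0"
  shows "rho z f - rho z g = (\<Sum>a\<in>F. z a * ((v a f - v a g) - k))"
proof -
  have "(\<Sum>a\<in>F. z a * ((v a f - v a g) - k)) = rho z f - rho z g - sum z F * k"
    unfolding rho_def sum_distrib_right by (simp add: algebra_simps sum_subtractf sum.distrib)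
  then show ?thesis using assms by simp
qed

text \<open>After removal of an element of class \<open>f\<close>, \<open>zrow\<close> gives one
  cell \<open>g\<close> that is minimal for all replacements. In the difference of the values at
  \<open>f\<close> and \<open>g\<close> only class \<open>\<tau> f\<close> can contribute
  positively. This forces \<open>g = \<tau> f\<close>, and the minimality of \<open>g\<close> then
  makes the exchange constant away from \<open>f\<close>.\<close>

lemma row_short:
  assumes f: "f \<in> F" and r: "ray f z" and zf: "0 \<le> z f"
  shows "short f"
proof -
  obtain t c where t: "0 < t" "\<And>g. g \<in> F \<Longrightarrow> rho z g = (if g = f then t else 0) + c"
    using r by (auto simp: ray_def)
  have z0: "sum z F = 0" and zl: "\<forall>b\<in>F. z b \<in> {-1, 0, 1}" using r by (auto simp: ray_def lattice_pt_def)
  have tf: "\<tau> f \<in> F" "\<tau> f \<noteq> f" using f tau_F tau_ne by auto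
  obtain g where g: "g \<in> F" "\<And>h. h \<in> F \<Longrightarrow> rho z g \<le> rho z h"
    "\<And>a h. a \<in> F \<Longrightarrow> a \<noteq> f \<Longrightarrow> z a \<le> 0 \<Longrightarrow> h \<in> F \<Longrightarrow> rho z g + v a g - v f g \<le> rho z h + v a h - v f h"
    using zrow[OF z0 zl f zf] unfolding rho_def by blast
  have gf: "g \<noteq> f" using g(2)[OF tf(1)] t(1) tf by (auto simp: t(2) f tf)
  define K where "K a = v a f - v a g" for a
  have k1: "K a \<le> K f" if "a \<in> F" for a using ztop[OF that f g(1)] by (simp add: K_def)
  have k2: "K g \<le> K a" if "a \<in> F" for a using ztop[OF that g(1) f] by (simp add: K_def)
  \<comment> \<open>The condition \<open>a \<noteq> \<tau> f\<close> means that
    \<open>\<sigma> a\<close> is not \<open>f\<close>, so \<open>z\<close> has the same value at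
    \<open>\<sigma> a\<close> as at \<open>g\<close>.\<close>
  have k3: "K a = K f" if a: "a \<in> F" "a \<noteq> f" "z a \<le> 0" "a \<noteq> \<tau> f" for a
  proof -
    have s: "\<sigma> a \<in> F" "\<sigma> a \<noteq> f" using a sigma_F tau_sigma[OF a(1)] by auto
    have "v a g - v f g \<le> v a (\<sigma> a) - v f (\<sigma> a)"
      using g(3)[OF a(1-3) s(1)] s gf g(1) by (simp add: t(2))
    also have "\<dots> \<le> v a f - v f f" using zsig[OF f a(1) f] by simp
    finally have "K f \<le> K a" by (simp add: K_def)
    with k1[OF a(1)] show ?thesis by simp
  qed
  have tsum: "t = (\<Sum>a\<in>F. z a * (K a - K f))"
    using rho_diff[OF z0, of f g "K f"] gf by (simp add: t(2) f g(1) K_def)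
  have tm: "z a * (K a - K f) \<le> 0" if "a \<in> F" "a \<noteq> \<tau> f" for a
    using k1[OF that(1)] k3[of a] that by (cases "z a \<le> 0"; cases "a = f") (auto simp: mult_le_0_iff)
  have "t \<le> z (\<tau> f) * (K (\<tau> f) - K f)"
    unfolding tsum using fin_F tf tm by (subst sum.remove[of _ "\<tau> f"]) (auto intro!: sum_nonpos)
  then have "0 < z (\<tau> f) * (K (\<tau> f) - K f)" using t by simp
  then have "z (\<tau> f) < 0" using k1[OF tf(1)] by (auto simp: zero_less_mult_iff)
  then have ztf: "z (\<tau> f) = -1" using zl tf by auto
  have "g = \<tau> f"
  proof (rule ccontr)
    assume ne: "g \<noteq> \<tau> f"
    show False
    proof (cases "z g \<le> 0")
      case True
      then have "K g = K f" using k3 g gf ne by blast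
      then have "K a = K f" if "a \<in> F" for a using k1[OF that] k2[OF that] by simp
      then show False using tsum t(1) by simp
    next
      case False
      then have zg: "z g = 1" using zl g by auto
      have "t = z (\<tau> f) * (K (\<tau> f) - K f) + (z g * (K g - K f) + (\<Sum>a\<in>F - {\<tau> f} - {g}. z a * (K a - K f)))"
        unfolding tsum using fin_F tf g ne by (subst sum.remove[of _ "\<tau> f"]; simp add: sum.remove[of _ g])
      moreover have "(\<Sum>a\<in>F - {\<tau> f} - {g}. z a * (K a - K f)) \<le> 0" using tm by (intro sum_nonpos) auto
      ultimately show False using zg ztf k2[OF tf(1)] t(1) by simp
    qed
  qed
  define c' where "c' = v f (\<tau> f) - v (\<tau> f) (\<tau> f)"
  have off: "v f h - v (\<tau> f) h = c'" if h: "h \<in> F" "h \<noteq> f" for h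
    using g(3)[OF tf _ h(1)] ztf h ztop[OF f tf(1) h(1)] tf unfolding \<open>g = \<tau> f\<close>
    by (simp add: t(2) c'_def)
  have ge: "v f f - v (\<tau> f) f \<ge> c'" using ztop[OF f tf(1) f] by (simp add: c'_def)
  have "v f f - v (\<tau> f) f \<noteq> c'" using off diff_not_const[OF f tf(1)] tf by metis
  then have "0 < v f f - v (\<tau> f) f - c'" using ge by simp
  then show ?thesis unfolding short_def using off
    by (intro exI[of _ "v f f - v (\<tau> f) f - c'"] exI[of _ c']) auto
qed

end

text \<open>Negation turns maxima of differences into minima, and the shift by \<open>\<tau>\<close>
  puts the extreme cells back in place. Rows and columns trade roles, as they do under complements
  of sets, so the column version of \<open>row_short\<close> comes for free.\<close>

lemma (in zfan) dual_zfan: "zfan F (\<lambda>b f. - v (\<tau> b) f) \<tau> \<sigma>"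
proof -
  have bij: "bij_betw \<tau> F F"
    by (rule bij_betw_byWitness[of _ \<sigma>]) (auto simp: sigma_F tau_F)
  have bij': "bij_betw \<sigma> F F"
    by (rule bij_betw_byWitness[of _ \<tau>]) (auto simp: sigma_F tau_F)
  define n where "n z b = - z (\<sigma> b)" for z :: "'f \<Rightarrow> real" and b
  have re: "(\<Sum>b\<in>F. z b * - v (\<tau> b) f) = (\<Sum>b\<in>F. n z b * v b f)" for z :: "'f \<Rightarrow> real" and f
    by (subst sum.reindex_bij_betw[OF bij, symmetric]) (simp add: n_def)
  have sm: "sum (n z) F = - sum z F" for z :: "'f \<Rightarrow> real"
    using sum.reindex_bij_betw[OF bij', of z] by (simp add: n_def sum_negf)
  have nn: "n (\<lambda>b. - z (\<tau> b)) b = z b" if "b \<in> F" for z b using that by (simp add: n_def)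
  show ?thesis
  proof
    show "- v (\<tau> a) b - - v (\<tau> b) b \<le> - v (\<tau> a) h - - v (\<tau> b) h" if "a \<in> F" "b \<in> F" "h \<in> F" for a b h
      using zsig[of "\<tau> a" "\<tau> b" h] that by (simp add: tau_F)
    show "- v (\<tau> b) (\<tau> b) - - v (\<tau> a) (\<tau> b) \<le> - v (\<tau> b) h - - v (\<tau> a) h" if "a \<in> F" "b \<in> F" "h \<in> F" for a b h
      using ztop[of "\<tau> a" "\<tau> b" h] that by (simp add: tau_F)
    show "z b = 0" if "sum z F = 0" "\<And>f. f \<in> F \<Longrightarrow> (\<Sum>b\<in>F. z b * - v (\<tau> b) f) = k" "b \<in> F" for z k b
    proof -
      have "n z (\<tau> b) = 0" using that(1) that(2)[unfolded re] that(3) by (intro zind[of "n z" k]) (auto simp: sm tau_F)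
      then show ?thesis using that by (simp add: n_def)
    qed
    show "\<exists>z c. sum z F = 0 \<and> (\<forall>f\<in>F. (\<Sum>b\<in>F. z b * - v (\<tau> b) f) = \<phi> f + c)" for \<phi>
    proof -
      obtain z c where z: "sum z F = 0" "\<forall>f\<in>F. (\<Sum>b\<in>F. z b * v b f) = \<phi> f + c" using zspan by blast
      have "sum (\<lambda>b. - z (\<tau> b)) F = 0" using z(1) sum.reindex_bij_betw[OF bij, of z] by (simp add: sum_negf)
      moreover have "(\<Sum>b\<in>F. - z (\<tau> b) * - v (\<tau> b) f) = (\<Sum>b\<in>F. z b * v b f)" for f
        unfolding re by (intro sum.cong) (auto simp: nn)
      ultimately show ?thesis using z(2) by (intro exI[of _ "\<lambda>b. - z (\<tau> b)"] exI[of _ c]) simp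
    qed
    fix z :: "'f \<Rightarrow> real" and l :: 'f
    assume z: "sum z F = 0"
    have nz: "sum (n z) F = 0" using z by (simp add: sm)
    show "\<exists>g\<in>F. (\<forall>h\<in>F. (\<Sum>b\<in>F. z b * - v (\<tau> b) g) \<le> (\<Sum>b\<in>F. z b * - v (\<tau> b) h)) \<and>
         (\<forall>a\<in>F. a \<noteq> l \<longrightarrow> z a \<le> 0 \<longrightarrow> (\<forall>h\<in>F. (\<Sum>b\<in>F. z b * - v (\<tau> b) g) + - v (\<tau> a) g - - v (\<tau> l) g
            \<le> (\<Sum>b\<in>F. z b * - v (\<tau> b) h) + - v (\<tau> a) h - - v (\<tau> l) h))"
      if "\<forall>b\<in>F. z b \<in> {-1, 0, 1}" "l \<in> F" "0 \<le> z l"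
    proof -
      have "\<forall>b\<in>F. n z b \<in> {-1, 0, 1}" using that(1) sigma_F by (auto simp: n_def)
      from zcol[OF nz this, of "\<tau> l"] that obtain g where g: "g \<in> F"
        "\<And>h. h \<in> F \<Longrightarrow> (\<Sum>b\<in>F. n z b * v b g) \<le> (\<Sum>b\<in>F. n z b * v b h)"
        "\<And>a h. a \<in> F \<Longrightarrow> a \<noteq> \<tau> l \<Longrightarrow> 0 \<le> n z a \<Longrightarrow> h \<in> F \<Longrightarrow>
           (\<Sum>b\<in>F. n z b * v b g) + v (\<tau> l) g - v a g \<le> (\<Sum>b\<in>F. n z b * v b h) + v (\<tau> l) h - v a h"
        by (auto simp: n_def tau_F)
      show ?thesis
        unfolding re
      proof (intro bexI[OF _ g(1)] conjI ballI impI)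
        fix a h assume a: "a \<in> F" "a \<noteq> l" "z a \<le> 0" "h \<in> F"
        have "\<tau> a \<noteq> \<tau> l" using a that by (metis sigma_tau)
        with g(3)[of "\<tau> a" h] a show "(\<Sum>b\<in>F. n z b * v b g) + - v (\<tau> a) g - - v (\<tau> l) g
            \<le> (\<Sum>b\<in>F. n z b * v b h) + - v (\<tau> a) h - - v (\<tau> l) h"
          by (simp add: tau_F n_def)
      qed (use g(2) in auto)
    qed
    show "\<exists>g\<in>F. (\<forall>h\<in>F. (\<Sum>b\<in>F. z b * - v (\<tau> b) g) \<le> (\<Sum>b\<in>F. z b * - v (\<tau> b) h)) \<and>
         (\<forall>a\<in>F. a \<noteq> l \<longrightarrow> 0 \<le> z a \<longrightarrow> (\<forall>h\<in>F. (\<Sum>b\<in>F. z b * - v (\<tau> b) g) + - v (\<tau> l) g - - v (\<tau> a) g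
            \<le> (\<Sum>b\<in>F. z b * - v (\<tau> b) h) + - v (\<tau> l) h - - v (\<tau> a) h))"
      if "\<forall>b\<in>F. z b \<in> {-1, 0, 1}" "l \<in> F" "z l \<le> 0"
    proof -
      have "\<forall>b\<in>F. n z b \<in> {-1, 0, 1}" using that(1) sigma_F by (auto simp: n_def)
      from zrow[OF nz this, of "\<tau> l"] that obtain g where g: "g \<in> F"
        "\<And>h. h \<in> F \<Longrightarrow> (\<Sum>b\<in>F. n z b * v b g) \<le> (\<Sum>b\<in>F. n z b * v b h)"
        "\<And>a h. a \<in> F \<Longrightarrow> a \<noteq> \<tau> l \<Longrightarrow> n z a \<le> 0 \<Longrightarrow> h \<in> F \<Longrightarrow>
           (\<Sum>b\<in>F. n z b * v b g) + v a g - v (\<tau> l) g \<le> (\<Sum>b\<in>F. n z b * v b h) + v a h - v (\<tau> l) h"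
        by (auto simp: n_def tau_F)
      show ?thesis
        unfolding re
      proof (intro bexI[OF _ g(1)] conjI ballI impI)
        fix a h assume a: "a \<in> F" "a \<noteq> l" "0 \<le> z a" "h \<in> F"
        have "\<tau> a \<noteq> \<tau> l" using a that by (metis sigma_tau)
        with g(3)[of "\<tau> a" h] a show "(\<Sum>b\<in>F. n z b * v b g) + - v (\<tau> l) g - - v (\<tau> a) g
            \<le> (\<Sum>b\<in>F. n z b * v b h) + - v (\<tau> l) h - - v (\<tau> a) h"
          by (simp add: tau_F n_def)
      qed (use g(2) in auto)
    qed
    show "\<exists>\<zeta>. sum \<zeta> F = 0 \<and> (\<forall>b\<in>F. \<zeta> b \<in> {-1, 0, 1} \<and> (\<zeta> b < 0 \<longrightarrow> z b < 0) \<and> (\<zeta> b > 0 \<longrightarrow> z b > 0)) \<and>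
         (\<exists>h\<in>F. (\<Sum>b\<in>F. \<zeta> b * - v (\<tau> b) h) < (\<Sum>b\<in>F. \<zeta> b * - v (\<tau> b) g)) \<and>
         (\<forall>f\<in>F. (\<forall>h\<in>F. (\<Sum>b\<in>F. z b * - v (\<tau> b) f) \<le> (\<Sum>b\<in>F. z b * - v (\<tau> b) h)) \<longrightarrow>
            (\<forall>h\<in>F. (\<Sum>b\<in>F. \<zeta> b * - v (\<tau> b) f) \<le> (\<Sum>b\<in>F. \<zeta> b * - v (\<tau> b) h)))"
      if "\<forall>b\<in>F. \<bar>z b\<bar> \<le> 1" "g \<in> F" "\<exists>h\<in>F. (\<Sum>b\<in>F. z b * - v (\<tau> b) h) < (\<Sum>b\<in>F. z b * - v (\<tau> b) g)" for g
    proof -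
      have "\<forall>b\<in>F. \<bar>n z b\<bar> \<le> 1" using that(1) sigma_F by (auto simp: n_def)
      from zlat[OF nz this that(2) that(3)[unfolded re]] obtain \<zeta> where \<zeta>: "sum \<zeta> F = 0"
        "\<forall>b\<in>F. \<zeta> b \<in> {-1, 0, 1} \<and> (\<zeta> b < 0 \<longrightarrow> n z b < 0) \<and> (\<zeta> b > 0 \<longrightarrow> n z b > 0)"
        "\<exists>h\<in>F. (\<Sum>b\<in>F. \<zeta> b * v b h) < (\<Sum>b\<in>F. \<zeta> b * v b g)"
        "\<forall>f\<in>F. (\<forall>h\<in>F. (\<Sum>b\<in>F. n z b * v b f) \<le> (\<Sum>b\<in>F. n z b * v b h)) \<longrightarrow>
            (\<forall>h\<in>F. (\<Sum>b\<in>F. \<zeta> b * v b f) \<le> (\<Sum>b\<in>F. \<zeta> b * v b h))" by blast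
      define \<zeta>' where "\<zeta>' b = - \<zeta> (\<tau> b)" for b
      have e: "(\<Sum>b\<in>F. \<zeta>' b * - v (\<tau> b) f) = (\<Sum>b\<in>F. \<zeta> b * v b f)" for f
        unfolding re \<zeta>'_def by (intro sum.cong) (auto simp: nn)
      have 1: "sum \<zeta>' F = 0" using \<zeta>(1) sum.reindex_bij_betw[OF bij, of \<zeta>] by (simp add: \<zeta>'_def sum_negf)
      have 2: "\<zeta>' b \<in> {-1, 0, 1} \<and> (\<zeta>' b < 0 \<longrightarrow> z b < 0) \<and> (\<zeta>' b > 0 \<longrightarrow> z b > 0)" if "b \<in> F" for b
        using \<zeta>(2)[rule_format, OF tau_F[OF that]] that by (auto simp: \<zeta>'_def n_def)
      show ?thesis
        by (rule exI[of _ \<zeta>'], unfold e re[of z]) (use 1 2 \<zeta>(3,4) in blast)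
    qed
  qed (auto simp: fin_F card_F sigma_F tau_F)
qed

context zfan
begin

lemma col_short:
  assumes f: "f \<in> F" and r: "ray f z" and zf: "z (\<tau> f) \<le> 0"
  shows "short f"
proof -
  interpret dual: zfan F "\<lambda>b f. - v (\<tau> b) f" \<tau> \<sigma> by (rule dual_zfan)
  have bij: "bij_betw \<tau> F F"
    by (rule bij_betw_byWitness[of _ \<sigma>]) (auto simp: sigma_F tau_F)
  define z' where "z' b = - z (\<tau> b)" for b
  have e: "dual.rho z' g = rho z g" for g
    using sum.reindex_bij_betw[OF bij, of "\<lambda>b. z b * v b g"] by (simp add: dual.rho_def rho_def z'_def)
  have "sum z' F = - sum z F" using sum.reindex_bij_betw[OF bij, of z] by (simp add: z'_def sum_negf)
  then have "dual.ray f z'"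
    using r unfolding ray_def dual.ray_def lattice_pt_def dual.lattice_pt_def e
    using tau_F by (auto simp: z'_def)
  then have "dual.short f" using zf by (intro dual.row_short f) (auto simp: z'_def)
  then show ?thesis using f by (simp add: dual.short_def short_def)
qed

text \<open>A real point of the ray is scaled into the box. The lattice point from
  \<open>zlat\<close> keeps every cell other than \<open>f\<close> minimal, but not
  \<open>f\<close>, and so lies on the same ray.\<close>

lemma ray_exists:
  assumes f: "f \<in> F" obtains z where "ray f z"
proof -
  obtain z c where z: "sum z F = 0" "\<forall>g\<in>F. (\<Sum>b\<in>F. z b * v b g) = (if g = f then 1 else 0) + c"
    using zspan[of "\<lambda>g. if g = f then 1 else 0"] by blast
  define M where "M = 1 + (\<Sum>b\<in>F. \<bar>z b\<bar>)"
  have M: "M > 0" unfolding M_def by (smt (verit) sum_nonneg abs_ge_zero)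
  define y where "y b = z b / M" for b
  have yr: "(\<Sum>b\<in>F. y b * v b g) = ((if g = f then 1 else 0) + c) / M" if "g \<in> F" for g
    using z(2) that by (simp add: y_def flip: sum_divide_distrib)
  have y0: "sum y F = 0" using z(1) by (simp add: y_def flip: sum_divide_distrib)
  have y1: "\<forall>b\<in>F. \<bar>y b\<bar> \<le> 1"
  proof
    fix b assume "b \<in> F"
    then have "\<bar>z b\<bar> \<le> (\<Sum>b\<in>F. \<bar>z b\<bar>)" using fin_F by (intro member_le_sum) auto
    then show "\<bar>y b\<bar> \<le> 1" using M by (simp add: y_def M_def)
  qed
  obtain h0 where h0: "h0 \<in> F" "h0 \<noteq> f" using exists_other f by blast
  have "\<exists>h\<in>F. (\<Sum>b\<in>F. y b * v b h) < (\<Sum>b\<in>F. y b * v b f)"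
    using h0 f M by (intro bexI[of _ h0]) (auto simp: yr divide_strict_right_mono)
  from zlat[OF y0 y1 f this] obtain \<zeta> where \<zeta>: "sum \<zeta> F = 0" "\<forall>b\<in>F. \<zeta> b \<in> {-1, 0, 1}"
    "\<exists>h\<in>F. rho \<zeta> h < rho \<zeta> f"
    "\<And>g h. g \<in> F \<Longrightarrow> (\<forall>h\<in>F. (\<Sum>b\<in>F. y b * v b g) \<le> (\<Sum>b\<in>F. y b * v b h)) \<Longrightarrow> h \<in> F \<Longrightarrow> rho \<zeta> g \<le> rho \<zeta> h"
    unfolding rho_def by blast
  have le: "rho \<zeta> g \<le> rho \<zeta> h" if "g \<in> F" "g \<noteq> f" "h \<in> F" for g h
    using that M by (intro \<zeta>(4)) (auto simp: yr divide_right_mono)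
  obtain h where h: "h \<in> F" "rho \<zeta> h < rho \<zeta> f" using \<zeta>(3) by blast
  have hf: "h \<noteq> f" using h by auto
  have "rho \<zeta> g = (if g = f then rho \<zeta> f - rho \<zeta> h else 0) + rho \<zeta> h" if "g \<in> F" for g
    using le[OF that _ h(1)] le[OF h(1) hf that] by (auto intro: antisym)
  then have "ray f \<zeta>" unfolding ray_def lattice_pt_def using \<zeta>(1,2) h(2)
    by (intro conjI exI[of _ "rho \<zeta> f - rho \<zeta> h"] exI[of _ "rho \<zeta> h"]) auto
  then show ?thesis using that by blast
qed

text \<open>Shortness of \<open>g = \<tau> f\<close> makes \<open>K a - K g\<close> equal to a
  positive constant \<open>s\<close> for all \<open>a\<close> other than \<open>g\<close>. As
  \<open>z\<close> has total zero, its value at \<open>f\<close> exceeds that at \<open>g\<close> by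
  \<open>- z g * s\<close>.\<close>

lemma short_tau_neg:
  assumes f: "f \<in> F" and sh: "short (\<tau> f)" and r: "ray f z"
  shows "z (\<tau> f) < 0"
proof -
  define g where "g = \<tau> f"
  define p where "p = \<tau> g"
  have F: "g \<in> F" "p \<in> F" "g \<noteq> f" "p \<noteq> g" "\<sigma> g = f" "\<sigma> p = g"
    using f tau_F tau_ne by (auto simp: g_def p_def)
  obtain s c where s: "0 < s" "\<And>h. h \<in> F \<Longrightarrow> v g h - v p h = (if h = g then s else 0) + c"
    using sh unfolding short_def g_def p_def by blast
  obtain t c' where t: "0 < t" "\<And>g. g \<in> F \<Longrightarrow> rho z g = (if g = f then t else 0) + c'"
    using r by (auto simp: ray_def)
  have z0: "sum z F = 0" using r by (auto simp: ray_def lattice_pt_def)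
  define K where "K a = v a f - v a g" for a
  have K: "K a - K g = s" if a: "a \<in> F" "a \<noteq> g" for a
  proof (rule antisym)
    have "v a f - v p f \<le> v a g - v p g" using zsig[OF a(1) F(2) f] F by simp
    then show "K a - K g \<le> s" using s(2)[OF f] s(2)[OF F(1)] F(3) by (simp add: K_def)
    have "v a g - v p g \<le> v a a - v p a" using ztop[OF F(2) a(1) F(1)] by simp
    moreover have "v a a - v g a \<le> v a f - v g f" using zsig[OF a(1) F(1) a(1)] F by simp
    ultimately show "s \<le> K a - K g" using s(2)[OF a(1)] s(2)[OF F(1)] a(2) by (simp add: K_def)
  qed
  have "t = (\<Sum>a\<in>F. z a * (K a - K g))"
    using rho_diff[OF z0, of f g "K g"] F by (simp add: t(2) f K_def)
  also have "\<dots> = (\<Sum>a\<in>F - {g}. z a * s)"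
    using fin_F F K by (subst sum.remove[of _ g]) (auto intro!: sum.cong)
  also have "\<dots> = - z g * s"
    using fin_F F z0 sum.remove[of F g z] by (simp flip: sum_distrib_right) (simp add: add_eq_0_iff)
  finally have "- z g * s > 0" using t by simp
  then show ?thesis using s(1) unfolding g_def by (simp add: mult_less_0_iff)
qed

text \<open>A ray opposite to a cell \<open>f\<close> that is not short has -1 at \<open>f\<close>
  and 1 at \<open>\<tau> f\<close>, and then \<open>\<tau> f\<close> is not short either. In the sum
  of the two rays the entry at \<open>\<tau> f\<close> cancels. A lattice point in the face spanned
  by both is either a ray with entry 0 there, so that \<open>col_short\<close> applies, or it
  contradicts \<open>zrow\<close>.\<close>

lemma all_short:
  assumes f: "f \<in> F" shows "short f"
proof (rule ccontr)
  assume nf: "\<not> short f"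
  define g where "g = \<tau> f"
  have F: "g \<in> F" "\<tau> g \<in> F" "g \<noteq> f" "\<tau> g \<noteq> g" using f tau_F tau_ne by (auto simp: g_def)
  obtain z where z: "ray f z" using ray_exists f by blast
  have zl: "z f = -1" "z g = 1"
    using row_short[OF f z] col_short[OF f z] nf z f F unfolding g_def ray_def lattice_pt_def by fastforce+
  have ng: "\<not> short g" using short_tau_neg[OF f _ z] zl unfolding g_def by auto
  obtain z' where z': "ray g z'" using ray_exists F by blast
  have zl': "z' g = -1" "z' (\<tau> g) = 1"
    using row_short[OF F(1) z'] col_short[OF F(1) z'] ng z' F unfolding ray_def lattice_pt_def by fastforce+
  obtain t c where t: "0 < t" "\<And>g. g \<in> F \<Longrightarrow> rho z g = (if g = f then t else 0) + c"
    using z by (auto simp: ray_def)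
  obtain t' c' where t': "0 < t'" "\<And>h. h \<in> F \<Longrightarrow> rho z' h = (if h = g then t' else 0) + c'"
    using z' by (auto simp: ray_def)
  have zz: "sum z F = 0" "sum z' F = 0" "\<And>b. b \<in> F \<Longrightarrow> z b \<in> {-1,0,1}" "\<And>b. b \<in> F \<Longrightarrow> z' b \<in> {-1,0,1}"
    using z z' by (auto simp: ray_def lattice_pt_def)
  show False
  \<comment> \<open>A third cell serves as reference for the face of the two rays. With only two
    cells the signs at \<open>f\<close> and \<open>g\<close> contradict \<open>ztop\<close> at
    once.\<close>
  proof (cases "F = {f, g}")
    case True
    have "t = rho z f - rho z g" using F f by (simp add: t(2))
    also have "\<dots> = - (v f f - v f g) + (v g f - v g g)"
      unfolding rho_def using zl F(3) by (simp add: True)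
    also have "\<dots> \<le> 0" using ztop[OF F(1) f F(1)] by simp
    finally show False using t(1) by simp
  next
    case False
    then obtain h0 where h0: "h0 \<in> F" "h0 \<noteq> f" "h0 \<noteq> g" using f F by blast
    define y where "y b = (z b + z' b) / 2" for b
    have yr: "(\<Sum>b\<in>F. y b * v b h) = ((if h = f then t else 0) + (if h = g then t' else 0) + (c + c')) / 2" if "h \<in> F" for h
    proof -
      have "(\<Sum>b\<in>F. y b * v b h) = (rho z h + rho z' h) / 2"
        unfolding rho_def y_def by (simp add: algebra_simps add_divide_distrib sum.distrib sum_divide_distrib)
      then show ?thesis by (simp add: t(2) t'(2) that)
    qed
    have y0: "sum y F = 0" using zz by (simp add: y_def sum.distrib flip: sum_divide_distrib)
    have y1: "\<forall>b\<in>F. \<bar>y b\<bar> \<le> 1"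
    proof
      fix b assume "b \<in> F"
      then show "\<bar>y b\<bar> \<le> 1" using zz(3,4)[of b] by (auto simp: y_def)
    qed
    have "\<exists>h\<in>F. (\<Sum>b\<in>F. y b * v b h) < (\<Sum>b\<in>F. y b * v b f)"
      using h0 f F t(1) by (intro bexI[of _ h0]) (auto simp: yr)
    from zlat[OF y0 y1 f this] obtain \<zeta> where \<zeta>: "sum \<zeta> F = 0" "\<forall>b\<in>F. \<zeta> b \<in> {-1, 0, 1}"
      "\<And>b. b \<in> F \<Longrightarrow> \<zeta> b < 0 \<Longrightarrow> y b < 0" "\<And>b. b \<in> F \<Longrightarrow> \<zeta> b > 0 \<Longrightarrow> y b > 0"
      "\<exists>h\<in>F. rho \<zeta> h < rho \<zeta> f"
      "\<And>g h. g \<in> F \<Longrightarrow> (\<forall>h\<in>F. (\<Sum>b\<in>F. y b * v b g) \<le> (\<Sum>b\<in>F. y b * v b h)) \<Longrightarrow> h \<in> F \<Longrightarrow> rho \<zeta> g \<le> rho \<zeta> h"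
      unfolding rho_def by blast
    have le: "rho \<zeta> h \<le> rho \<zeta> h'" if "h \<in> F" "h \<noteq> f" "h \<noteq> g" "h' \<in> F" for h h'
      using that t t' by (intro \<zeta>(6)) (auto simp: yr)
    have \<zeta>g: "\<zeta> g = 0" using \<zeta>(3,4)[OF F(1)] zl zl' by (cases "\<zeta> g" "0::real" rule: linorder_cases) (auto simp: y_def)
    \<comment> \<open>The entry 1 of \<open>z'\<close> outweighs whatever \<open>z\<close> has in
      this class.\<close>
    have \<zeta>tg: "\<zeta> (\<tau> g) \<ge> 0" using \<zeta>(3)[OF F(2)] zz(3)[OF F(2)] zl' by (force simp: y_def)
    define B where "B = rho \<zeta> g - rho \<zeta> h0"
    have eq: "rho \<zeta> h = rho \<zeta> h0" if "h \<in> F" "h \<noteq> f" "h \<noteq> g" for h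
      using le[OF that h0(1)] le[OF h0 that(1)] by simp
    obtain h1 where h1: "h1 \<in> F" "rho \<zeta> h1 < rho \<zeta> f" using \<zeta>(5) by blast
    have fgt: "rho \<zeta> h0 < rho \<zeta> f" using h1 le[OF h0, of h1] by simp
    have B0: "B \<ge> 0" using le[OF h0 F(1)] by (simp add: B_def)
    show False
    proof (cases "B = 0")
      case True
      then have "rho \<zeta> h = (if h = f then rho \<zeta> f - rho \<zeta> h0 else 0) + rho \<zeta> h0" if "h \<in> F" for h
        using eq[OF that] by (auto simp: B_def)
      then have "ray f \<zeta>" unfolding ray_def lattice_pt_def using \<zeta>(1,2) fgt
        by (intro conjI exI[of _ "rho \<zeta> f - rho \<zeta> h0"] exI[of _ "rho \<zeta> h0"]) auto
      then have "short f" using \<zeta>g by (intro col_short[OF f]) (auto simp: g_def)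
      with nf show False by simp
    next
      case False
      then have Bpos: "B > 0" using B0 by simp
      obtain g' where g': "g' \<in> F" "\<And>h. h \<in> F \<Longrightarrow> rho \<zeta> g' \<le> rho \<zeta> h"
        "\<And>a h. a \<in> F \<Longrightarrow> a \<noteq> g \<Longrightarrow> \<zeta> a \<le> 0 \<Longrightarrow> h \<in> F \<Longrightarrow> rho \<zeta> g' + v a g' - v g g' \<le> rho \<zeta> h + v a h - v g h"
        using zrow[OF \<zeta>(1,2) F(1)] \<zeta>g unfolding rho_def by auto
      have ne: "g' \<noteq> f" "g' \<noteq> g" using g'(2)[OF h0(1)] fgt Bpos by (auto simp: B_def)
      have rg: "rho \<zeta> g' = rho \<zeta> h0" using eq g'(1) ne by blast
      define K where "K a = v a g - v a g'" for a
      have k1: "K a \<le> K g" if "a \<in> F" for a using ztop[OF that F(1) g'(1)] by (simp add: K_def)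
      have k3: "K a = K g" if a: "a \<in> F" "a \<noteq> g" "\<zeta> a \<le> 0" "a \<noteq> \<tau> g" for a
      proof -
        have "\<sigma> a \<in> F" using a(1) by (rule sigma_F)
        moreover have "\<sigma> a \<noteq> g" using a(4) tau_sigma[OF a(1)] by metis
        moreover have "\<sigma> a \<noteq> f" using a(2) tau_sigma[OF a(1)] unfolding g_def by metis
        ultimately have "rho \<zeta> (\<sigma> a) = rho \<zeta> g'" using eq rg by simp
        then have "v a g' - v g g' \<le> v a (\<sigma> a) - v g (\<sigma> a)"
          using g'(3)[OF a(1-3), of "\<sigma> a"] sigma_F[OF a(1)] by simp
        also have "\<dots> \<le> v a g - v g g" using zsig[OF F(1) a(1) F(1)] by simp
        finally have "K g \<le> K a" by (simp add: K_def)
        with k1[OF a(1)] show ?thesis by simp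
      qed
      have "B = (\<Sum>a\<in>F. \<zeta> a * (K a - K g))"
        using rho_diff[OF \<zeta>(1), of g g' "K g"] rg by (simp add: B_def K_def)
      also have "\<dots> \<le> 0"
      proof (rule sum_nonpos)
        fix a assume a: "a \<in> F"
        show "\<zeta> a * (K a - K g) \<le> 0"
          using k1[OF a] k3[OF a] \<zeta>g \<zeta>tg by (cases "a = g"; cases "\<zeta> a \<le> 0"; cases "a = \<tau> g") (auto simp: mult_le_0_iff)
      qed
      finally show False using Bpos by simp
    qed
  qed
qed

text \<open>The relations of shortness, summed over a set closed under \<open>\<tau>\<close>,
  telescope to zero. On a proper nonempty subset this would contradict positivity of the steps, so
  \<open>\<tau>\<close> is a single cycle; on all of \<open>F\<close> it shows that the steps are
  equal. The formula is summation by parts along the cycle.\<close>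

lemma cycle:
  obtains fl :: "nat \<Rightarrow> 'f" and s where "bij_betw fl {..<card F} F" "0 < s"
    "\<And>z. sum z F = 0 \<Longrightarrow> \<exists>c. \<forall>m<card F. rho z (fl m) = s * (\<Sum>i\<le>m. z (fl i)) + c"
proof -
  have "\<exists>s c. 0 < s \<and> (\<forall>g\<in>F. v f g - v (\<tau> f) g = (if g = f then s else 0) + c)" if "f \<in> F" for f
    using all_short[OF that] by (simp add: short_def)
  then obtain S C where S: "\<And>f. f \<in> F \<Longrightarrow> 0 < S f"
    "\<And>f g. f \<in> F \<Longrightarrow> g \<in> F \<Longrightarrow> v f g - v (\<tau> f) g = (if g = f then S f else 0) + C f" by metis
  have inj: "inj_on \<tau> F" by (metis inj_onI sigma_tau)
  have orbit_sum: "0 = (if g \<in> O' then S g else 0) + sum C O'" if O: "O' \<subseteq> F" "\<tau> ` O' \<subseteq> O'" and g: "g \<in> F" for O' g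
  proof -
    have fin: "finite O'" using O fin_F finite_subset by blast
    have injO: "inj_on \<tau> O'" using inj O inj_on_subset by blast
    have "\<tau> ` O' = O'" using endo_inj_surj[OF fin O(2) injO] .
    then have "(\<Sum>f\<in>O'. v (\<tau> f) g) = (\<Sum>f\<in>O'. v f g)" using sum.reindex[OF injO, of "\<lambda>f. v f g"] by simp
    then have "0 = (\<Sum>f\<in>O'. v f g - v (\<tau> f) g)" by (simp add: sum_subtractf)
    also have "\<dots> = (\<Sum>f\<in>O'. (if g = f then S f else 0) + C f)" using S(2) O g by (intro sum.cong) auto
    also have "\<dots> = (if g \<in> O' then S g else 0) + sum C O'" using fin by (simp add: sum.distrib)
    finally show ?thesis .
  qed
  have orbit: "O' = F" if O: "O' \<subseteq> F" "\<tau> ` O' \<subseteq> O'" "O' \<noteq> {}" for O'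
  proof (rule ccontr)
    assume "O' \<noteq> F"
    then obtain g g' where "g \<in> F - O'" "g' \<in> O'" using O by blast
    then show False using orbit_sum[OF O(1,2), of g] orbit_sum[OF O(1,2), of g'] S(1)[of g'] O by auto
  qed
  obtain f0 where f0: "f0 \<in> F" using card_F by fastforce
  define fl where "fl i = (\<tau> ^^ i) f0" for i
  have flF: "fl i \<in> F" for i by (induction i) (auto simp: fl_def f0 tau_F)
  have flS: "fl (Suc i) = \<tau> (fl i)" for i by (simp add: fl_def)
  have fl_inj: "inj_on fl {..<card F}"
  proof (rule ccontr)
    assume "\<not> ?thesis"
    then obtain i j where ij: "i < j" "j < card F" "fl i = fl j"
      unfolding inj_on_def by (metis lessThan_iff linorder_neqE_nat)
    have "fl (j - i) = f0"
    proof -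
      have "fl (i - n) = fl (j - n)" if "n \<le> i" for n
        using that
      proof (induction n)
        case (Suc n)
        then have "fl (Suc (i - Suc n)) = fl (Suc (j - Suc n))" using ij by (simp add: Suc_diff_Suc)
        then show ?case using inj flF unfolding flS inj_on_def by blast
      qed (simp add: ij)
      from this[of i] show ?thesis by (simp add: fl_def)
    qed
    then have per: "fl (Suc m) \<in> fl ` {..<j - i}" if "m < j - i" for m
    proof (cases "Suc m = j - i")
      case True
      then have "fl (Suc m) = fl 0" using \<open>fl (j - i) = f0\<close> by (simp add: fl_def)
      then show ?thesis using ij by auto
    qed (use that in auto)
    have "fl ` {..<j - i} = F"
    proof (rule orbit)
      show "fl ` {..<j - i} \<subseteq> F" using flF by blast
      show "\<tau> ` fl ` {..<j - i} \<subseteq> fl ` {..<j - i}" using per unfolding flS by blast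
      show "fl ` {..<j - i} \<noteq> {}" using ij by (metis image_is_empty lessThan_iff empty_iff zero_less_diff)
    qed
    then have "card F \<le> j - i" using card_image_le[of "{..<j-i}" fl] by simp
    then show False using ij by simp
  qed
  have bij: "bij_betw fl {..<card F} F"
    unfolding bij_betw_def using fl_inj flF fin_F card_image[OF fl_inj]
    by (intro conjI card_subset_eq) auto
  define s where "s = S f0"
  have Ss: "S g = s" if "g \<in> F" for g
  proof -
    have "\<tau> ` F \<subseteq> F" using tau_F by blast
    from orbit_sum[OF order_refl this that] orbit_sum[OF order_refl this f0] that f0
    show ?thesis by (simp add: s_def)
  qed
  show ?thesis
  proof (rule that[OF bij])
    show "0 < s" using S(1)[OF f0] by (simp add: s_def)
    fix z :: "'f \<Rightarrow> real" assume z0: "sum z F = 0"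
    define Z where "Z m = (\<Sum>i\<le>m. z (fl i))" for m
    define k where "k = card F - 1"
    have kk: "{..<card F} = {..k}" using card_F by (auto simp: k_def)
    have Zk: "Z k = 0"
      using z0 sum.reindex_bij_betw[OF bij, of z] by (simp add: Z_def kk)
    have abel: "(\<Sum>i\<le>n. z (fl i) * v (fl i) g) = (\<Sum>i<n. Z i * (v (fl i) g - v (fl (Suc i)) g)) + Z n * v (fl n) g" for n g
      by (induction n) (auto simp: Z_def algebra_simps)
    have "rho z (fl m) = s * Z m + (\<Sum>i<k. Z i * C (fl i))" if m: "m < card F" for m
    proof -
      have "rho z (fl m) = (\<Sum>i\<le>k. z (fl i) * v (fl i) (fl m))"
        unfolding rho_def kk[symmetric] by (rule sum.reindex_bij_betw[OF bij, symmetric])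
      also have "\<dots> = (\<Sum>i<k. Z i * (v (fl i) (fl m) - v (fl (Suc i)) (fl m)))"
        unfolding abel Zk by simp
      also have "\<dots> = (\<Sum>i<k. (if i = m then s * Z m else 0) + Z i * C (fl i))"
      proof (intro sum.cong refl)
        fix i assume "i \<in> {..<k}"
        then have "(fl m = fl i) = (m = i)" using fl_inj m by (auto simp: inj_on_def k_def)
        then show "Z i * (v (fl i) (fl m) - v (fl (Suc i)) (fl m)) = (if i = m then s * Z m else 0) + Z i * C (fl i)"
          unfolding flS S(2)[OF flF flF] using Ss[OF flF] by (auto simp: algebra_simps)
      qed
      also have "\<dots> = s * Z m + (\<Sum>i<k. Z i * C (fl i))"
        using Zk m by (cases "m = k") (auto simp: sum.distrib k_def)
      finally show ?thesis .
    qed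
    then show "\<exists>c. \<forall>m<card F. rho z (fl m) = s * (\<Sum>i\<le>m. z (fl i)) + c"
      unfolding Z_def by blast
  qed
qed

end

context labelled_fan
begin

section \<open>Class sums as coordinates modulo lineality\<close>

definition cs :: "real^'n \<Rightarrow> 'f \<Rightarrow> real" where
  "cs x b = (\<Sum>y\<in>cls b. x $ y - q $ y)"

definition rep :: "'f \<Rightarrow> 'n" where "rep b = (SOME y. lab y = b)"

lemma lab_rep: "b \<in> F \<Longrightarrow> lab (rep b) = b"
  unfolding rep_def using U_eq by (metis (mono_tags) imageE someI)

definition vv :: "'f \<Rightarrow> 'f \<Rightarrow> real" where "vv b f = w f $ rep b"

lemma sum_classes: "(\<Sum>y\<in>UNIV. g y) = (\<Sum>b\<in>F. \<Sum>y\<in>cls b. g y)" for g :: "'n \<Rightarrow> real"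
  using sum.image_gen[of UNIV g lab] by (simp add: cls_def U_eq)

text \<open>Moving a coordinate to the representative of its class changes all functionals by the
  same amount, so up to a common constant only the class sums count.\<close>

lemma value_classes: "\<exists>c. \<forall>f\<in>F. w f \<bullet> l = (\<Sum>b\<in>F. (\<Sum>y\<in>cls b. l $ y) * vv b f) + c"
proof -
  obtain f0 where f0: "f0 \<in> F" using card_F by fastforce
  define k where "k y = w f0 $ y - w f0 $ rep (lab y)" for y
  have "w f \<bullet> l = (\<Sum>b\<in>F. (\<Sum>y\<in>cls b. l $ y) * vv b f) + (\<Sum>y\<in>UNIV. k y * l $ y)" if f: "f \<in> F" for f
  proof -
    have "w f $ y = vv (lab y) f + k y" for y
    proof -
      have "good y (rep (lab y))" using lab_rep[OF lab_F] by (intro same_label_good) simp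
      then have "w f $ y - w f0 $ y = w f $ rep (lab y) - w f0 $ rep (lab y)"
        using f f0 unfolding good_def by blast
      then show ?thesis by (simp add: k_def vv_def)
    qed
    then have "w f \<bullet> l = (\<Sum>y\<in>UNIV. vv (lab y) f * l $ y) + (\<Sum>y\<in>UNIV. k y * l $ y)"
      by (simp add: inner_vec_def distrib_right sum.distrib)
    also have "(\<Sum>y\<in>UNIV. vv (lab y) f * l $ y) = (\<Sum>b\<in>F. (\<Sum>y\<in>cls b. l $ y) * vv b f)"
      unfolding sum_classes sum_distrib_right by (intro sum.cong refl) (auto simp: cls_def)
    finally show ?thesis .
  qed
  then show ?thesis by blast
qed

definition rh :: "('f \<Rightarrow> real) \<Rightarrow> 'f \<Rightarrow> real" where "rh z f = (\<Sum>b\<in>F. z b * vv b f)"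

lemma value_cs: "\<exists>c. \<forall>f\<in>F. w f \<bullet> (x - q) = rh (cs x) f + c"
  using value_classes[of "x - q"] by (simp add: cs_def rh_def)

lemma mem_am_rh: "f \<in> am x \<longleftrightarrow> f \<in> F \<and> (\<forall>g\<in>F. rh (cs x) f \<le> rh (cs x) g)"
  using value_cs[of x] by (auto simp: am_def)

text \<open>The prescribed sums are placed on the representatives. A constant value makes the
  resulting vector one to which \<open>class_sum_zero\<close> applies.\<close>

lemma rh_zero:
  assumes "sum z F = 0" "\<And>f. f \<in> F \<Longrightarrow> rh z f = k" "b \<in> F"
  shows "z b = 0"
proof -
  define l :: "real^'n" where "l = (\<chi> y. if y = rep (lab y) then z (lab y) else 0)"
  have cl: "(\<Sum>y\<in>cls b. l $ y) = z b" if b: "b \<in> F" for b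
  proof -
    have "(\<Sum>y\<in>cls b. l $ y) = (\<Sum>y\<in>cls b. if y = rep b then z b else 0)"
      by (intro sum.cong) (auto simp: l_def cls_def)
    then show ?thesis using lab_rep[OF b] by (simp add: cls_def)
  qed
  obtain c where c: "\<And>f. f \<in> F \<Longrightarrow> w f \<bullet> l = (\<Sum>b\<in>F. (\<Sum>y\<in>cls b. l $ y) * vv b f) + c"
    using value_classes by metis
  have "w f \<bullet> l = k + c" if "f \<in> F" for f
    using c[OF that] assms(2)[OF that] cl by (simp add: rh_def)
  moreover have "(\<Sum>y\<in>UNIV. l $ y) = 0" unfolding sum_classes using cl assms(1) by simp
  ultimately show ?thesis using class_sum_zero[OF assms(3), of l "k + c"] cl[OF assms(3)] by simp
qed

lemma rh_span: "\<exists>z c. sum z F = 0 \<and> (\<forall>f\<in>F. rh z f = \<phi> f + c)"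
proof -
  obtain x c where x: "(\<Sum>y\<in>UNIV. x $ y) = 0" "\<And>f. f \<in> F \<Longrightarrow> w f \<bullet> x = \<phi> f + c"
    using dual by blast
  obtain c' where c': "\<And>f. f \<in> F \<Longrightarrow> w f \<bullet> x = (\<Sum>b\<in>F. (\<Sum>y\<in>cls b. x $ y) * vv b f) + c'"
    using value_classes by metis
  show ?thesis
  proof (intro exI[of _ "\<lambda>b. \<Sum>y\<in>cls b. x $ y"] exI[of _ "c - c'"] conjI ballI)
    show "(\<Sum>b\<in>F. \<Sum>y\<in>cls b. x $ y) = 0" using x(1) by (simp flip: sum_classes)
    fix f assume "f \<in> F"
    then show "rh (\<lambda>b. \<Sum>y\<in>cls b. x $ y) f = \<phi> f + (c - c')"
      using x(2)[of f] c'[of f] by (simp add: rh_def)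
  qed
qed

end

section \<open>Lattice points around a vertex of the common cell\<close>

locale based_fan = labelled_fan d F w q lab
  for d F w q and lab :: "'n::finite \<Rightarrow> 'f" +
  fixes J0 :: "'n set"
  assumes J0: "card J0 = d" "am (e_set J0) = F"
begin

lemma base_cs: "b \<in> F \<Longrightarrow> (\<Sum>y\<in>cls b. e_set J0 $ y - q $ y) = 0"
proof -
  assume b: "b \<in> F"
  obtain f0 where f0: "f0 \<in> F" using card_F by fastforce
  have "w f \<bullet> (e_set J0 - q) = w f0 \<bullet> (e_set J0 - q)" if "f \<in> F" for f
  proof -
    have "f \<in> am (e_set J0)" "f0 \<in> am (e_set J0)" using that f0 J0 by auto
    then show ?thesis using that f0 unfolding am_def by (metis (mono_tags, lifting) antisym mem_Collect_eq)
  qed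
  moreover have "(\<Sum>y\<in>UNIV. (e_set J0 - q) $ y) = 0"
    using J0 q_sum by (simp add: sum_subtractf sum.If_cases)
  ultimately have "(\<Sum>y\<in>cls b. (e_set J0 - q) $ y) = 0" using class_sum_zero[OF b] by metis
  then show ?thesis by simp
qed

text \<open>On each class \<open>J0\<close> has the same sum as \<open>q\<close>, and this sum lies
  strictly between 0 and the size of the class.\<close>

lemma exists_red_blue:
  assumes "b \<in> F" shows "\<exists>y. lab y = b \<and> y \<in> J0" "\<exists>y. lab y = b \<and> y \<notin> J0"
proof -
  have ne: "cls b \<noteq> {}" using lab_rep[OF assms] by (auto simp: cls_def)
  have s: "(\<Sum>y\<in>cls b. e_set J0 $ y) = (\<Sum>y\<in>cls b. q $ y)"
    using base_cs[OF assms] by (simp add: sum_subtractf)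
  show "\<exists>y. lab y = b \<and> y \<in> J0"
  proof (rule ccontr)
    assume "\<not> ?thesis"
    then have "(\<Sum>y\<in>cls b. e_set J0 $ y) = 0" by (intro sum.neutral) (auto simp: cls_def)
    moreover have "(\<Sum>y\<in>cls b. q $ y) > 0" using ne q_pos by (intro sum_pos) auto
    ultimately show False using s by simp
  qed
  show "\<exists>y. lab y = b \<and> y \<notin> J0"
  proof (rule ccontr)
    assume "\<not> ?thesis"
    then have "(\<Sum>y\<in>cls b. e_set J0 $ y) = (\<Sum>y\<in>cls b. 1)" by (intro sum.cong) (auto simp: cls_def)
    moreover have "(\<Sum>y\<in>cls b. q $ y) < (\<Sum>y\<in>cls b. 1)" using ne q_less by (intro sum_strict_mono) auto
    ultimately show False using s by simp
  qed
qed

definition red :: "'f \<Rightarrow> 'n" where "red b = (SOME y. lab y = b \<and> y \<in> J0)"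
definition blue :: "'f \<Rightarrow> 'n" where "blue b = (SOME y. lab y = b \<and> y \<notin> J0)"

lemma red: "b \<in> F \<Longrightarrow> lab (red b) = b \<and> red b \<in> J0"
  unfolding red_def using exists_red_blue(1) by (rule someI_ex)

lemma blue: "b \<in> F \<Longrightarrow> lab (blue b) = b \<and> blue b \<notin> J0"
  unfolding blue_def using exists_red_blue(2) by (rule someI_ex)

lemma cs_change:
  assumes b: "b \<in> F" and x: "\<And>y. lab y = b \<Longrightarrow> y \<noteq> red b \<Longrightarrow> y \<noteq> blue b \<Longrightarrow> x $ y = e_set J0 $ y"
  shows "cs x b = x $ red b - 1 + x $ blue b"
proof -
  have rb: "red b \<in> cls b" "blue b \<in> cls b" "red b \<noteq> blue b" using red[OF b] blue[OF b] by (auto simp: cls_def)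
  have "cs x b = (\<Sum>y\<in>cls b. x $ y - e_set J0 $ y)"
    using base_cs[OF b] by (simp add: cs_def sum_subtractf)
  also have "\<dots> = (\<Sum>y\<in>{red b, blue b}. x $ y - e_set J0 $ y)"
    using rb x by (intro sum.mono_neutral_right) (auto simp: cls_def)
  also have "\<dots> = x $ red b - 1 + x $ blue b" using rb red[OF b] blue[OF b] by simp
  finally show ?thesis .
qed

text \<open>Realises the class sums \<open>z\<close> near \<open>J0\<close>: a negative sum lowers
  only the red element of its class, a positive one raises only the blue element. Entries -1, 0, 1
  thus give a vertex.\<close>

definition pt :: "('f \<Rightarrow> real) \<Rightarrow> real^'n" where
  "pt z = (\<chi> y. if y = red (lab y) then 1 + min (z (lab y)) 0 else if y = blue (lab y) then max (z (lab y)) 0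
     else e_set J0 $ y)"

lemma pt_red: "b \<in> F \<Longrightarrow> pt z $ red b = 1 + min (z b) 0"
  using red[of b] by (simp add: pt_def)

lemma pt_blue: "b \<in> F \<Longrightarrow> pt z $ blue b = max (z b) 0"
  using blue[of b] red[of b] by (auto simp: pt_def)

lemma pt_other: "y \<noteq> red (lab y) \<Longrightarrow> y \<noteq> blue (lab y) \<Longrightarrow> pt z $ y = e_set J0 $ y"
  by (simp add: pt_def)

lemma cs_pt: "b \<in> F \<Longrightarrow> cs (pt z) b = z b"
  by (subst cs_change) (auto simp: pt_other pt_red pt_blue min_def max_def)

lemma sum_cs: "(\<Sum>b\<in>F. cs x b) = (\<Sum>y\<in>UNIV. x $ y) - real d"
  using q_sum by (simp add: cs_def sum_subtractf flip: sum_classes)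

lemma pt_hyp:
  assumes "sum z F = 0" "\<forall>b\<in>F. \<bar>z b\<bar> \<le> 1"
  shows "pt z \<in> hypersimplex d UNIV"
  unfolding mem_hypersimplex
proof (intro conjI allI)
  fix i
  have "\<bar>z (lab i)\<bar> \<le> 1" using assms(2) lab_F by blast
  then show "0 \<le> pt z $ i" "pt z $ i \<le> 1" by (auto simp: pt_def min_def max_def)
next
  show "sum (($) (pt z)) UNIV = real d" using sum_cs[of "pt z"] cs_pt assms(1) by simp
qed

definition jset :: "('f \<Rightarrow> real) \<Rightarrow> 'n set" where "jset z = {y. pt z $ y = 1}"

lemma pt_jset:
  assumes "\<forall>b\<in>F. z b \<in> {-1, 0, 1}" shows "pt z = e_set (jset z)"
proof -
  have "pt z $ y = 0 \<or> pt z $ y = 1" for y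
  proof -
    have "z (lab y) \<in> {-1, 0, 1}" using assms lab_F[of y] by blast
    then show ?thesis by (auto simp: pt_def)
  qed
  then show ?thesis by (auto simp: vec_eq_iff jset_def)
qed

lemma card_jset:
  assumes "sum z F = 0" "\<forall>b\<in>F. z b \<in> {-1, 0, 1}" shows "card (jset z) = d"
proof -
  have "pt z \<in> hypersimplex d UNIV" using assms by (intro pt_hyp) auto
  from this[unfolded pt_jset[OF assms(2)]] show ?thesis by simp
qed

lemma mem_jset_red: "b \<in> F \<Longrightarrow> red b \<in> jset z \<longleftrightarrow> 0 \<le> z b"
  by (auto simp: jset_def pt_red min_def)

lemma mem_jset_blue: "b \<in> F \<Longrightarrow> blue b \<in> jset z \<longleftrightarrow> z b = 1"
  by (auto simp: jset_def pt_blue max_def)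

lemma cs_swap:
  assumes "a \<in> J" "lab a = la" "b \<notin> J" "lab b = lb" 
  shows "cs (e_set (insert b (J - {a}))) c = cs (e_set J) c + (if c = lb then 1 else 0) - (if c = la then 1 else 0)"
proof -
  have "e_set (insert b (J - {a})) $ y - q $ y = (e_set J $ y - q $ y) + ((if y = b then 1 else 0) - (if y = a then 1 else 0))" for y
    using assms by auto
  then have "cs (e_set (insert b (J - {a}))) c = (\<Sum>y\<in>cls c. (e_set J $ y - q $ y) + ((if y = b then 1 else 0) - (if y = a then 1 else 0)))"
    unfolding cs_def by (rule sum.cong[OF refl])
  also have "\<dots> = cs (e_set J) c + ((\<Sum>y\<in>cls c. if y = b then 1 else 0) - (\<Sum>y\<in>cls c. if y = a then 1 else 0))"
    unfolding cs_def sum.distrib by (simp add: sum_subtractf)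
  finally have "cs (e_set (insert b (J - {a}))) c = cs (e_set J) c + ((\<Sum>y\<in>cls c. if y = b then 1 else 0) - (\<Sum>y\<in>cls c. if y = a then 1 else 0))" .
  then show ?thesis using assms by (auto simp: cls_def)
qed

lemma rh_change:
  assumes "a \<in> F" "b \<in> F" "\<And>c. c \<in> F \<Longrightarrow> z' c = z c + (if c = b then 1 else 0) - (if c = a then 1 else 0)"
  shows "rh z' f = rh z f + vv b f - vv a f"
proof -
  have "rh z' f = (\<Sum>c\<in>F. z c * vv c f + (if c = b then vv c f else 0) - (if c = a then vv c f else 0))"
    unfolding rh_def
  proof (intro sum.cong refl)
    fix c assume "c \<in> F"
    show "z' c * vv c f = z c * vv c f + (if c = b then vv c f else 0) - (if c = a then vv c f else 0)"
      unfolding assms(3)[OF \<open>c \<in> F\<close>] by (auto simp: algebra_simps)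
  qed
  then show ?thesis using assms fin_F by (simp add: rh_def sum.distrib sum_subtractf)
qed

lemma rh_cong: "(\<And>c. c \<in> F \<Longrightarrow> z c = z' c) \<Longrightarrow> rh z f = rh z' f"
  by (simp add: rh_def)

text \<open>This is \<open>row\<close> for \<open>jset z\<close> without the red element of
  \<open>l\<close>. The sign conditions say that this element is present and that the blue elements
  to be inserted are absent.\<close>

lemma fan_row:
  assumes z: "sum z F = 0" "\<forall>b\<in>F. z b \<in> {-1, 0, 1}" and l: "l \<in> F" "0 \<le> z l"
  shows "\<exists>g\<in>F. (\<forall>h\<in>F. rh z g \<le> rh z h) \<and>
    (\<forall>a\<in>F. a \<noteq> l \<longrightarrow> z a \<le> 0 \<longrightarrow> (\<forall>h\<in>F. rh z g + vv a g - vv l g \<le> rh z h + vv a h - vv l h))"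
proof -
  let ?J = "jset z"
  define X where "X = ?J - {red l}"
  have rJ: "red l \<in> ?J" using l by (simp add: mem_jset_red)
  have cX: "card X = d - 1" using rJ card_jset[OF z] by (simp add: X_def)
  obtain g where g: "g \<in> am (rowpt X)" using am_nonempty by blast
  have csJ: "cs (e_set ?J) c = z c" if "c \<in> F" for c using cs_pt[OF that] pt_jset[OF z(2)] by metis
  have gJ: "g \<in> am (e_set ?J)"
    using row[OF cX g, of "red l"] rJ by (simp add: X_def insert_absorb)
  have gF: "g \<in> F" using gJ by (simp add: am_def)
  show ?thesis
  proof (intro bexI[OF _ gF] conjI ballI impI)
    fix h assume h: "h \<in> F"
    show "rh z g \<le> rh z h" using gJ h rh_cong[OF csJ] by (auto simp: mem_am_rh)
    fix a assume a: "a \<in> F" "a \<noteq> l" "z a \<le> 0"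
    have bJ: "blue a \<notin> ?J" using a by (auto simp: mem_jset_blue)
    have "g \<in> am (e_set (insert (blue a) X))" using bJ by (intro row[OF cX g]) (simp add: X_def)
    then have "rh (cs (e_set (insert (blue a) X))) g \<le> rh (cs (e_set (insert (blue a) X))) h"
      using h by (auto simp: mem_am_rh)
    moreover have "cs (e_set (insert (blue a) X)) c = z c + (if c = a then 1 else 0) - (if c = l then 1 else 0)" if "c \<in> F" for c
      unfolding X_def using cs_swap[OF rJ _ bJ, of l a c] red[OF l(1)] blue[OF a(1)] csJ[OF that] by simp
    ultimately show "rh z g + vv a g - vv l g \<le> rh z h + vv a h - vv l h"
      using rh_change[OF l(1) a(1)] by simp
  qed
qed

lemma fan_col:
  assumes z: "sum z F = 0" "\<forall>b\<in>F. z b \<in> {-1, 0, 1}" and l: "l \<in> F" "z l \<le> 0"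
  shows "\<exists>g\<in>F. (\<forall>h\<in>F. rh z g \<le> rh z h) \<and>
    (\<forall>a\<in>F. a \<noteq> l \<longrightarrow> 0 \<le> z a \<longrightarrow> (\<forall>h\<in>F. rh z g + vv l g - vv a g \<le> rh z h + vv l h - vv a h))"
proof -
  let ?J = "jset z"
  define Y where "Y = insert (blue l) ?J"
  have bJ: "blue l \<notin> ?J" using l by (simp add: mem_jset_blue)
  have cY: "card Y = d + 1" using bJ card_jset[OF z] by (simp add: Y_def)
  obtain g where g: "g \<in> am (colpt Y)" using am_nonempty by blast
  have csJ: "cs (e_set ?J) c = z c" if "c \<in> F" for c using cs_pt[OF that] pt_jset[OF z(2)] by metis
  have "Y - {blue l} = ?J" using bJ by (auto simp: Y_def)
  then have gJ: "g \<in> am (e_set ?J)"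
    using col[OF cY g, of "blue l"] by (simp add: Y_def)
  have gF: "g \<in> F" using gJ by (simp add: am_def)
  show ?thesis
  proof (intro bexI[OF _ gF] conjI ballI impI)
    fix h assume h: "h \<in> F"
    show "rh z g \<le> rh z h" using gJ h rh_cong[OF csJ] by (auto simp: mem_am_rh)
    fix a assume a: "a \<in> F" "a \<noteq> l" "0 \<le> z a"
    have rJ: "red a \<in> ?J" using a by (auto simp: mem_jset_red)
    have "blue l \<noteq> red a" using bJ rJ by auto
    then have e: "Y - {red a} = insert (blue l) (?J - {red a})" by (auto simp: Y_def)
    have "g \<in> am (e_set (Y - {red a}))" using rJ by (intro col[OF cY g]) (simp add: Y_def)
    then have "rh (cs (e_set (Y - {red a}))) g \<le> rh (cs (e_set (Y - {red a}))) h"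
      using h by (auto simp: mem_am_rh)
    moreover have "cs (e_set (Y - {red a})) c = z c + (if c = l then 1 else 0) - (if c = a then 1 else 0)" if "c \<in> F" for c
      unfolding e using cs_swap[OF rJ _ bJ, of a l c] red[OF a(1)] blue[OF l(1)] csJ[OF that] by simp
    ultimately show "rh z g + vv l g - vv a g \<le> rh z h + vv l h - vv a h"
      using rh_change[OF a(1) l(1)] by simp
  qed
qed

text \<open>The red element of \<open>b\<close> is labelled \<open>b\<close>, so by
  \<open>row_T\<close> it can be exchanged for a blue element of \<open>a\<close> inside the cell
  \<open>b\<close>.\<close>

lemma fan_top:
  assumes a: "a \<in> F" and b: "b \<in> F" and h: "h \<in> F"
  shows "vv a b - vv b b \<le> vv a h - vv b h"
proof (cases "a = b")
  case False
  have "b \<in> T (red b)" using lab_T[of "red b"] red[OF b] by simp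
  then have "b \<in> am (e_set (insert (blue a) (J0 - {red b})))"
    using J0 b red[OF b] blue[OF a] by (intro row_T) auto
  then have "rh (cs (e_set (insert (blue a) (J0 - {red b})))) b \<le> rh (cs (e_set (insert (blue a) (J0 - {red b})))) h"
    using h by (auto simp: mem_am_rh)
  moreover have "cs (e_set (insert (blue a) (J0 - {red b}))) c = 0 + (if c = a then 1 else 0) - (if c = b then 1 else 0)" if "c \<in> F" for c
  proof -
    have "cs (e_set J0) c = 0" using base_cs[OF that] by (simp add: cs_def)
    then show ?thesis using cs_swap[of "red b" J0 b "blue a" a c] red[OF b] blue[OF a] by simp
  qed
  ultimately have "rh (\<lambda>_. 0) b + vv a b - vv b b \<le> rh (\<lambda>_. 0) h + vv a h - vv b h"
    using rh_change[OF b a, of "cs (e_set (insert (blue a) (J0 - {red b})))" "\<lambda>_. 0"] by simp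
  then show ?thesis by (simp add: rh_def)
qed simp

text \<open>The column through \<open>J0\<close> with a blue element of \<open>b\<close> added lies
  in one cell, which is therefore minimal for the removal of an element of any class.\<close>

lemma fan_sig: "\<forall>b\<in>F. \<exists>g\<in>F. \<forall>a\<in>F. \<forall>h\<in>F. vv b g - vv a g \<le> vv b h - vv a h"
proof
  fix b assume b: "b \<in> F"
  obtain g where g: "g \<in> F" "\<forall>a\<in>F. a \<noteq> b \<longrightarrow> (\<forall>h\<in>F. rh (\<lambda>_. 0) g + vv b g - vv a g \<le> rh (\<lambda>_. 0) h + vv b h - vv a h)"
    using fan_col[of "\<lambda>_. 0" b] b by auto
  have "vv b g - vv a g \<le> vv b h - vv a h" if "a \<in> F" "h \<in> F" for a h
    using g that by (cases "a = b") (auto simp: rh_def)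
  then show "\<exists>g\<in>F. \<forall>a\<in>F. \<forall>h\<in>F. vv b g - vv a g \<le> vv b h - vv a h" using g(1) by blast
qed

text \<open>Since \<open>pt z\<close> is outside \<open>g\<close>, one of the vertices that span it
  inside all its cells is outside \<open>g\<close>. This vertex agrees with \<open>J0\<close> except
  at red and blue elements where \<open>pt z\<close> is moved, whence the entries and their
  signs.\<close>

lemma fan_lat:
  assumes z: "sum z F = 0" "\<forall>b\<in>F. \<bar>z b\<bar> \<le> 1" and g: "g \<in> F" "\<exists>h\<in>F. rh z h < rh z g"
  shows "\<exists>\<zeta>. sum \<zeta> F = 0 \<and> (\<forall>b\<in>F. \<zeta> b \<in> {-1, 0, 1} \<and> (\<zeta> b < 0 \<longrightarrow> z b < 0) \<and> (\<zeta> b > 0 \<longrightarrow> z b > 0)) \<and>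
    (\<exists>h\<in>F. rh \<zeta> h < rh \<zeta> g) \<and>
    (\<forall>f\<in>F. (\<forall>h\<in>F. rh z f \<le> rh z h) \<longrightarrow> (\<forall>h\<in>F. rh \<zeta> f \<le> rh \<zeta> h))"
proof -
  let ?x = "pt z"
  have rx: "rh (cs ?x) f = rh z f" for f using cs_pt by (rule rh_cong)
  have gx: "g \<notin> am ?x" using g by (auto simp: mem_am_rh rx not_le)
  let ?\<J> = "{J. card J = d \<and> am ?x \<subseteq> am (e_set J)}"
  define \<K> where "\<K> = {J\<in>?\<J>. (\<forall>y. ?x $ y = 1 \<longrightarrow> y \<in> J) \<and> (\<forall>y. ?x $ y = 0 \<longrightarrow> y \<notin> J)}"
  have "?x \<in> convex hull (e_set ` \<K>)"
    unfolding \<K>_def by (rule convex_hull_agree_strong[OF am_lat[OF pt_hyp[OF z]]])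
  then have "\<exists>p\<in>e_set ` \<K>. g \<notin> am p" using am_convex gx by metis
  then obtain J where JK: "J \<in> \<K>" and gJ: "g \<notin> am (e_set J)" by blast
  then have J: "card J = d" "am ?x \<subseteq> am (e_set J)" "\<And>y. ?x $ y = 1 \<Longrightarrow> y \<in> J" "\<And>y. ?x $ y = 0 \<Longrightarrow> y \<notin> J"
    by (simp_all add: \<K>_def)
  define \<zeta> where "\<zeta> = cs (e_set J)"
  have \<zeta>: "\<zeta> b = e_set J $ red b - 1 + e_set J $ blue b" if b: "b \<in> F" for b
    unfolding \<zeta>_def
  proof (rule cs_change[OF b])
    fix y assume y: "lab y = b" "y \<noteq> red b" "y \<noteq> blue b"
    then have "?x $ y = e_set J0 $ y" by (intro pt_other) auto
    then show "e_set J $ y = e_set J0 $ y" using J(3,4)[of y] by (auto split: if_splits)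
  qed
  have sg: "\<zeta> b \<in> {-1, 0, 1} \<and> (\<zeta> b < 0 \<longrightarrow> z b < 0) \<and> (\<zeta> b > 0 \<longrightarrow> z b > 0)" if b: "b \<in> F" for b
    using J(3)[of "red b"] J(4)[of "blue b"]
    by (cases "z b" "0::real" rule: linorder_cases) (auto simp: \<zeta>[OF b] pt_red[OF b] pt_blue[OF b] min_def max_def not_le)
  have "sum \<zeta> F = 0" using sum_cs[of "e_set J"] J(1) by (simp add: \<zeta>_def sum.If_cases)
  moreover have "\<exists>h\<in>F. rh \<zeta> h < rh \<zeta> g" using gJ g(1) by (auto simp: mem_am_rh \<zeta>_def not_le)
  moreover have "\<forall>f\<in>F. (\<forall>h\<in>F. rh z f \<le> rh z h) \<longrightarrow> (\<forall>h\<in>F. rh \<zeta> f \<le> rh \<zeta> h)"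
    using J(2) by (auto simp: mem_am_rh \<zeta>_def rx subset_iff)
  ultimately show ?thesis using sg by blast
qed

text \<open>The cell of \<open>fan_sig\<close> serves as \<open>\<sigma> b\<close>. If two classes
  shared it, their difference would be bounded below and above by the same value, hence constant,
  against \<open>rh_zero\<close>.\<close>

lemma fan_structure:
  obtains fl s where "bij_betw fl {..<card F} F" "0 < s"
    "\<And>z. sum z F = 0 \<Longrightarrow> \<exists>c. \<forall>m<card F. rh z (fl m) = s * (\<Sum>i\<le>m. z (fl i)) + c"
proof -
  obtain \<sigma> where \<sigma>: "\<And>b. b \<in> F \<Longrightarrow> \<sigma> b \<in> F"
    "\<And>a b h. b \<in> F \<Longrightarrow> a \<in> F \<Longrightarrow> h \<in> F \<Longrightarrow> vv b (\<sigma> b) - vv a (\<sigma> b) \<le> vv b h - vv a h"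
    using fan_sig by metis
  have inj: "inj_on \<sigma> F"
  proof (rule inj_onI, rule ccontr)
    fix a b assume ab: "a \<in> F" "b \<in> F" "\<sigma> a = \<sigma> b" "a \<noteq> b"
    define k where "k = vv a (\<sigma> a) - vv b (\<sigma> a)"
    have c: "vv a h - vv b h = k" if "h \<in> F" for h
      using \<sigma>(2)[OF ab(1,2) that] \<sigma>(2)[OF ab(2,1) that] ab(3) by (simp add: k_def)
    define z where "z c = 0 + (if c = a then 1 else 0) - (if c = b then 1 else 0 :: real)" for c
    have "rh z f = k" if "f \<in> F" for f
      using rh_change[OF ab(2,1), of z "\<lambda>_. 0" f] c[OF that] by (simp add: z_def) (simp add: rh_def)
    moreover have "sum z F = 0" using ab fin_F by (simp add: z_def sum_subtractf)
    ultimately have "z a = 0" using rh_zero ab(1) by blast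
    then show False using ab by (simp add: z_def)
  qed
  have im: "\<sigma> ` F = F" using \<sigma>(1) inj fin_F by (intro endo_inj_surj) auto
  define \<tau> where "\<tau> = inv_into F \<sigma>"
  interpret Z: zfan F vv \<sigma> \<tau>
  proof
    show "finite F" "2 \<le> card F" by (rule fin_F, rule card_F)
    show "\<sigma> b \<in> F" if "b \<in> F" for b using \<sigma>(1) that .
    show "\<tau> b \<in> F" if "b \<in> F" for b unfolding \<tau>_def using that im by (metis inv_into_into)
    show "\<sigma> (\<tau> b) = b" if "b \<in> F" for b unfolding \<tau>_def using that im by (metis f_inv_into_f)
    show "\<tau> (\<sigma> b) = b" if "b \<in> F" for b unfolding \<tau>_def using that inj by (rule inv_into_f_f[rotated])
    show "vv a b - vv b b \<le> vv a h - vv b h" if "a \<in> F" "b \<in> F" "h \<in> F" for a b h using fan_top that by blast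
    show "vv b (\<sigma> b) - vv a (\<sigma> b) \<le> vv b h - vv a h" if "a \<in> F" "b \<in> F" "h \<in> F" for a b h using \<sigma>(2) that by blast
    show "z b = 0" if "sum z F = 0" "\<And>f. f \<in> F \<Longrightarrow> (\<Sum>b\<in>F. z b * vv b f) = k" "b \<in> F" for z k b
      by (rule rh_zero[OF that(1) _ that(3), of k]) (simp add: rh_def that(2))
  qed (rule rh_span[unfolded rh_def] | (rule fan_lat[unfolded rh_def] fan_row[unfolded rh_def] fan_col[unfolded rh_def]; assumption))+
  have e: "Z.rho = rh" by (intro ext) (simp add: Z.rho_def rh_def)
  show ?thesis by (rule Z.cycle[unfolded e]) (rule that)
qed

text \<open>The index of a coordinate is the position of its label on the cycle, so partial sums of
  class sums become sums over initial segments of indices.\<close>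

lemma index_structure:
  obtains \<iota> :: "'n \<Rightarrow> nat" and fl s where "bij_betw fl {..<card F} F" "0 < s" "\<And>y. \<iota> y < card F"
    "\<And>i. i < card F \<Longrightarrow> \<exists>y. \<iota> y = i"
    "\<And>x. (\<Sum>y\<in>UNIV. x $ y) = real d \<Longrightarrow>
       \<exists>c. \<forall>m<card F. w (fl m) \<bullet> (x - q) = s * (\<Sum>y\<in>{y. \<iota> y \<le> m}. x $ y - q $ y) + c"
proof -
  obtain fl s where fl: "bij_betw fl {..<card F} F" "0 < s"
    "\<And>z. sum z F = 0 \<Longrightarrow> \<exists>c. \<forall>m<card F. rh z (fl m) = s * (\<Sum>i\<le>m. z (fl i)) + c"
    by (rule fan_structure) (rule that)
  define \<iota> where "\<iota> y = the_inv_into {..<card F} fl (lab y)" for y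
  have inj: "inj_on fl {..<card F}" and im: "fl ` {..<card F} = F" using fl(1) by (auto simp: bij_betw_def)
  have \<iota>: "\<iota> y < card F" "fl (\<iota> y) = lab y" for y
    using the_inv_into_into[OF inj, of "lab y" "{..<card F}"] f_the_inv_into_f[OF inj, of "lab y"] lab_F[of y] im
    by (auto simp: \<iota>_def)
  have \<iota>_eq: "\<iota> y = i \<longleftrightarrow> lab y = fl i" if "i < card F" for y i
    using \<iota>[of y] that inj by (metis inj_onD lessThan_iff)
  show ?thesis
  proof (rule that[OF fl(1,2) \<iota>(1)])
    fix i assume i: "i < card F"
    have "lab (rep (fl i)) = fl i" using i im by (intro lab_rep) auto
    then show "\<exists>y. \<iota> y = i" using \<iota>_eq[OF i] by blast
  next
    fix x :: "real^'n" assume x: "(\<Sum>y\<in>UNIV. x $ y) = real d"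
    have "sum (cs x) F = 0" using sum_cs[of x] x by simp
    then obtain c where c: "\<And>m. m < card F \<Longrightarrow> rh (cs x) (fl m) = s * (\<Sum>i\<le>m. cs x (fl i)) + c" using fl(3) by blast
    obtain c' where c': "\<And>f. f \<in> F \<Longrightarrow> w f \<bullet> (x - q) = rh (cs x) f + c'" using value_cs[of x] by blast
    have "w (fl m) \<bullet> (x - q) = s * (\<Sum>y\<in>{y. \<iota> y \<le> m}. x $ y - q $ y) + (c + c')" if m: "m < card F" for m
    proof -
      have "(\<Sum>i\<le>m. cs x (fl i)) = (\<Sum>i\<le>m. \<Sum>y\<in>{y. \<iota> y = i}. x $ y - q $ y)"
        unfolding cs_def cls_def using m by (intro sum.cong) (auto simp: \<iota>_eq)
      also have "\<dots> = (\<Sum>y\<in>(\<Union>i\<in>{..m}. {y. \<iota> y = i}). x $ y - q $ y)"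
        by (rule sum.UNION_disjoint[symmetric]) auto
      also have "(\<Union>i\<in>{..m}. {y. \<iota> y = i}) = {y. \<iota> y \<le> m}" by auto
      finally have e: "(\<Sum>i\<le>m. cs x (fl i)) = (\<Sum>y | \<iota> y \<le> m. x $ y - q $ y)" .
      have "fl m \<in> F" using m im by blast
      from c'[OF this] c[OF m] show ?thesis unfolding e by simp
    qed
    then show "\<exists>c. \<forall>m<card F. w (fl m) \<bullet> (x - q) = s * (\<Sum>y\<in>{y. \<iota> y \<le> m}. x $ y - q $ y) + c" by blast
  qed
qed

end

lemma (in split_fan) index_structure:
  obtains \<iota> :: "'n \<Rightarrow> nat" and fl s where "bij_betw fl {..<card F} F" "0 < s" "\<And>y. \<iota> y < card F"
    "\<And>i. i < card F \<Longrightarrow> \<exists>y. \<iota> y = i"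
    "\<And>x. (\<Sum>y\<in>UNIV. x $ y) = real d \<Longrightarrow>
       \<exists>c. \<forall>m<card F. w (fl m) \<bullet> (x - q) = s * (\<Sum>y\<in>{y. \<iota> y \<le> m}. x $ y - q $ y) + c"
proof -
  obtain lab where lab: "\<And>y. lab y \<in> T y" "\<And>lab'. (\<And>y. lab' y \<in> T y) \<Longrightarrow> card (range lab) \<le> card (range lab')"
    using exists_minimal_labelling by blast
  interpret L: labelled_fan d F w q lab by unfold_locales (use lab in auto)
  obtain J where J: "card J = d" "F = am (e_set J)"
    using q_lat by (metis (mono_tags, lifting) convex_hull_empty empty_iff ex_in_conv image_is_empty mem_Collect_eq)
  interpret B: based_fan d F w q lab J by unfold_locales (rule J(1), rule J(2)[symmetric])
  show ?thesis by (rule B.index_structure) (rule that)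
qed

subsection \<open>Slices of the cube and faces of subdivisions\<close>

text \<open>A common form of hypersimplices, simplices and vertex figures, so that integrality of
  vertices is proved once.\<close>

definition box_slice :: "'n::finite set \<Rightarrow> real \<Rightarrow> real \<Rightarrow> (real^'n) set" where
  "box_slice I \<alpha> \<beta> = {x. (\<forall>i. 0 \<le> x $ i \<and> x $ i \<le> 1) \<and> (\<Sum>i\<in>I. x $ i) = \<alpha> \<and> (\<Sum>i\<in>-I. x $ i) = \<beta>}"

lemma box_slice_alt:
  "box_slice I \<alpha> \<beta> = cbox 0 (\<chi> i. 1) \<inter> {x. e_set I \<bullet> x = \<alpha>} \<inter> {x. e_set (-I) \<bullet> x = \<beta>}"
  by (auto simp: box_slice_def mem_box_cart e_set_def inner_sum_left inner_axis')

lemma compact_box_slice: "compact (box_slice I \<alpha> \<beta>)"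
  unfolding box_slice_alt by (intro compact_Int_closed compact_cbox closed_hyperplane)

lemma convex_box_slice: "convex (box_slice I \<alpha> \<beta>)"
  unfolding box_slice_alt by (intro convex_Int convex_box convex_hyperplane)

text \<open>A single fractional term cannot occur in an integral sum.\<close>

lemma another_fractional:
  fixes x :: "real^'n::finite"
  assumes x: "\<And>i. 0 \<le> x $ i \<and> x $ i \<le> 1" and s: "(\<Sum>i\<in>A. x $ i) \<in> \<int>"
    and i: "i \<in> A" "x $ i \<noteq> 0" "x $ i \<noteq> 1"
  shows "\<exists>j\<in>A. j \<noteq> i \<and> x $ j \<noteq> 0 \<and> x $ j \<noteq> 1"
proof (rule ccontr)
  assume "\<not> ?thesis"
  then have "(\<Sum>j\<in>A - {i}. x $ j) \<in> \<int>" by (intro Ints_sum) force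
  moreover have "(\<Sum>j\<in>A. x $ j) = x $ i + (\<Sum>j\<in>A - {i}. x $ j)" using i(1) by (simp add: sum.remove)
  ultimately have "x $ i \<in> \<int>" using s by (metis Ints_diff add_diff_cancel_right')
  then obtain m where m: "x $ i = of_int m" by (rule Ints_cases)
  have "0 < x $ i" "x $ i < 1" using x[of i] i by auto
  then show False unfolding m by simp
qed

text \<open>Two fractional coordinates on the same side of \<open>I\<close> can be shifted against
  each other in both directions without changing either sum.\<close>

lemma extreme_box_slice:
  fixes x :: "real^'n::finite"
  assumes z: "\<alpha> \<in> \<int>" "\<beta> \<in> \<int>" and x: "x extreme_point_of box_slice I \<alpha> \<beta>"
  shows "x $ i = 0 \<or> x $ i = 1"
proof (rule ccontr)
  assume n: "\<not> ?thesis"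
  have xb: "\<And>i. 0 \<le> x $ i \<and> x $ i \<le> 1" "(\<Sum>i\<in>I. x $ i) = \<alpha>" "(\<Sum>i\<in>-I. x $ i) = \<beta>"
    using x by (auto simp: extreme_point_of_def box_slice_def)
  define A where "A = (if i \<in> I then I else -I)"
  have "\<exists>j\<in>A. j \<noteq> i \<and> x $ j \<noteq> 0 \<and> x $ j \<noteq> 1"
    using xb z n by (intro another_fractional) (auto simp: A_def)
  then obtain j where j: "j \<in> A" "j \<noteq> i" "x $ j \<noteq> 0" "x $ j \<noteq> 1" by blast
  have jI: "j \<in> I \<longleftrightarrow> i \<in> I" using j(1) by (auto simp: A_def split: if_splits)
  define e where "e = Min {x $ i, 1 - x $ i, x $ j, 1 - x $ j}"
  have pos: "0 < x $ i" "x $ i < 1" "0 < x $ j" "x $ j < 1" using xb(1)[of i] xb(1)[of j] n j by auto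
  have e: "e > 0" "e \<le> x $ i" "e \<le> 1 - x $ i" "e \<le> x $ j" "e \<le> 1 - x $ j"
    using pos by (auto simp: e_def)
  define v :: "real^'n" where "v = axis i e - axis j e"
  have vs: "(\<Sum>y\<in>B. v $ y) = (if i \<in> B then e else 0) - (if j \<in> B then e else 0)" for B
    by (simp add: v_def axis_def sum_subtractf)
  have vb: "0 \<le> x $ y + v $ y \<and> x $ y + v $ y \<le> 1" "0 \<le> x $ y - v $ y \<and> x $ y - v $ y \<le> 1" for y
    using e xb(1)[of y] j(2) by (auto simp: v_def axis_def)
  have in1: "x + v \<in> box_slice I \<alpha> \<beta>" "x - v \<in> box_slice I \<alpha> \<beta>"
    unfolding box_slice_def using vb xb jI by (auto simp: sum.distrib sum_subtractf vs)
  have "v \<noteq> 0" using e j by (auto simp: v_def vec_eq_iff axis_def intro!: exI[of _ i])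
  then have ne: "x + v \<noteq> x - v" by (metis add_uminus_conv_diff add_left_cancel eq_neg_iff_add_eq_0 scaleR_2 scaleR_eq_0_iff zero_neq_numeral)
  have "x = (1 - 1/2) *\<^sub>R (x + v) + (1/2) *\<^sub>R (x - v)" by (simp add: algebra_simps flip: scaleR_add_left)
  then have "x \<in> open_segment (x + v) (x - v)" using ne unfolding in_segment
    by (intro conjI exI[of _ "1/2::real"]) auto
  then show False using x in1 by (auto simp: extreme_point_of_def)
qed

lemma e_set_extreme:
  assumes "e_set J \<in> Q" "Q \<subseteq> {x. \<forall>i. 0 \<le> x $ i \<and> x $ i \<le> 1}"
  shows "e_set J extreme_point_of Q"
  unfolding extreme_point_of_def
proof (intro conjI ballI notI)
  fix a b assume ab: "a \<in> Q" "b \<in> Q" and s: "e_set J \<in> open_segment a b"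
  from s obtain u where u: "a \<noteq> b" "0 < u" "u < 1" "e_set J = (1 - u) *\<^sub>R a + u *\<^sub>R b"
    by (auto simp: in_segment)
  have "a $ i = b $ i" for i
  proof -
    have e: "(1 - u) * a $ i + u * b $ i = (if i \<in> J then 1 else 0)"
      using arg_cong[OF u(4), of "\<lambda>x. x $ i"] by simp
    have r: "0 \<le> a $ i" "a $ i \<le> 1" "0 \<le> b $ i" "b $ i \<le> 1" using ab assms(2) by auto
    show ?thesis
    proof (cases "i \<in> J")
      case True
      have "(1 - u) * (1 - a $ i) + u * (1 - b $ i) = 0" using e True by (simp add: algebra_simps)
      moreover have "(1 - u) * (1 - a $ i) \<ge> 0" "u * (1 - b $ i) \<ge> 0" using r u by auto
      ultimately have "(1 - u) * (1 - a $ i) = 0" "u * (1 - b $ i) = 0" by linarith+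
      then show ?thesis using u by simp
    next
      case False
      have "(1 - u) * a $ i \<ge> 0" "u * b $ i \<ge> 0" using r u by auto
      moreover have "(1 - u) * a $ i + u * b $ i = 0" using e False by simp
      ultimately have "(1 - u) * a $ i = 0" "u * b $ i = 0" by linarith+
      then show ?thesis using u by simp
    qed
  qed
  then show False using u(1) by (simp add: vec_eq_iff)
qed (rule assms(1))

lemma vertices_box_slice:
  assumes z: "\<alpha> \<in> \<int>" "\<beta> \<in> \<int>"
  shows "vertices (box_slice I \<alpha> \<beta>) = {e_set J | J. e_set J \<in> box_slice I \<alpha> \<beta>}"
    and "convex hull (vertices (box_slice I \<alpha> \<beta>)) = box_slice I \<alpha> \<beta>"
proof -
  show "vertices (box_slice I \<alpha> \<beta>) = {e_set J | J. e_set J \<in> box_slice I \<alpha> \<beta>}"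
  proof (intro equalityI subsetI)
    fix x assume "x \<in> vertices (box_slice I \<alpha> \<beta>)"
    then have x: "x extreme_point_of box_slice I \<alpha> \<beta>" by (simp add: vertices_def)
    have "x = e_set {i. x $ i = 1}" using extreme_box_slice[OF z x] by (auto simp: vec_eq_iff)
    moreover have "x \<in> box_slice I \<alpha> \<beta>" using x by (simp add: extreme_point_of_def)
    ultimately show "x \<in> {e_set J | J. e_set J \<in> box_slice I \<alpha> \<beta>}" by auto
  next
    fix x assume "x \<in> {e_set J | J. e_set J \<in> box_slice I \<alpha> \<beta>}"
    then show "x \<in> vertices (box_slice I \<alpha> \<beta>)"
      unfolding vertices_def by (auto intro!: e_set_extreme) (auto simp: box_slice_def)
  qed
  show "convex hull (vertices (box_slice I \<alpha> \<beta>)) = box_slice I \<alpha> \<beta>"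
    unfolding vertices_def by (rule Krein_Milman_Minkowski[OF compact_box_slice convex_box_slice, symmetric])
qed

lemma hypersimplex_box: "hypersimplex d I = box_slice I (real d) 0"
  by (simp add: hypersimplex_def box_slice_def)

lemma vertices_hypersimplex:
  "vertices (hypersimplex d (UNIV :: 'n::finite set)) = e_set ` {J. card J = d}"
  using vertices_box_slice(1)[of "real d" 0 "UNIV :: 'n set"]
  by (auto simp: hypersimplex_box box_slice_def sum.If_cases)

lemma hull_vertices_hypersimplex: "convex hull (vertices (hypersimplex d I)) = hypersimplex d I"
  unfolding hypersimplex_box by (intro vertices_box_slice) auto

section \<open>Barycentres, faces and cells of a subdivision\<close>

definition mean :: "'a::real_vector set \<Rightarrow> 'a" where
  "mean A = (1 / real (card A)) *\<^sub>R \<Sum>A"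

lemma mean_weights: "finite A \<Longrightarrow> A \<noteq> {} \<Longrightarrow> mean A = (\<Sum>p\<in>A. (1 / real (card A)) *\<^sub>R p)"
  by (simp add: mean_def scaleR_sum_right)

lemma mean_in_hull:
  assumes "finite A" "A \<noteq> {}" shows "mean A \<in> convex hull A"
  unfolding convex_hull_finite[OF assms(1)]
  using assms by (intro CollectI exI[of _ "\<lambda>_. 1 / real (card A)"] conjI) (auto simp: mean_weights)

text \<open>A combination with all weights positive is, for each \<open>p\<close>, an inner point of
  a segment that starts at \<open>p\<close>; a face through it contains the ends of the
  segment.\<close>

lemma face_contains_positive:
  assumes "finite A" "G face_of convex hull A" "\<And>p. p \<in> A \<Longrightarrow> 0 < \<mu> p" "sum \<mu> A = 1"
    "(\<Sum>p\<in>A. \<mu> p *\<^sub>R p) \<in> G"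
  shows "A \<subseteq> G"
proof
  fix p assume p: "p \<in> A"
  show "p \<in> G"
  proof (cases "A = {p}")
    case True
    then show ?thesis using assms(4,5) by simp
  next
    case False
    define B where "B = A - {p}"
    have B: "finite B" "B \<noteq> {}" "A = insert p B" "p \<notin> B" using False p assms(1) by (auto simp: B_def)
    define s where "s = sum \<mu> B"
    have s: "s > 0" unfolding s_def using B assms(3) by (intro sum_pos) auto
    have ps: "\<mu> p = 1 - s" using assms(4) B by (simp add: s_def)
    define y where "y = (\<Sum>x\<in>B. (\<mu> x / s) *\<^sub>R x)"
    have y: "y \<in> convex hull B" unfolding y_def using B s assms(3)
      by (intro convex_sum[OF _ convex_convex_hull]) (auto simp: s_def hull_inc less_imp_le simp flip: sum_divide_distrib)
    then have yA: "y \<in> convex hull A" using B hull_mono[of B A] by blast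
    have pA: "p \<in> convex hull A" using p by (simp add: hull_inc)
    have sum: "(\<Sum>p\<in>A. \<mu> p *\<^sub>R p) = (1 - s) *\<^sub>R p + s *\<^sub>R y"
      using B s ps by (simp add: y_def scaleR_sum_right)
    show ?thesis
    proof (cases "p = y")
      case True
      then have "(\<Sum>p\<in>A. \<mu> p *\<^sub>R p) = p" unfolding sum by (simp add: algebra_simps flip: scaleR_add_left)
      then show ?thesis using assms(5) by simp
    next
      case False
      have "s < 1" using ps assms(3)[OF p] by simp
      then have "(\<Sum>p\<in>A. \<mu> p *\<^sub>R p) \<in> open_segment p y"
        unfolding in_segment sum using False s by (intro conjI exI[of _ s]) auto
      then show ?thesis using assms(2,5) pA yA unfolding face_of_def by blast
    qed
  qed
qed

lemma face_contains_mean: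
  assumes "finite A" "A \<noteq> {}" "G face_of convex hull A" "mean A \<in> G" shows "A \<subseteq> G"
  using face_contains_positive[OF assms(1,3), of "\<lambda>_. 1 / real (card A)"] assms
  by (simp add: mean_weights card_gt_0_iff)

lemma independent_dual:
  fixes B :: "'a::euclidean_space set"
  assumes "independent B" shows "\<exists>r. \<forall>u\<in>B. u \<bullet> r = \<psi> u"
proof -
  obtain g where g: "linear g" "\<forall>x\<in>B. g x = (\<psi> x :: real)"
    using linear_independent_extend[OF assms] by blast
  have "u \<bullet> adjoint g 1 = g u" for u using adjoint_works[OF g(1), of u 1] by simp
  then show ?thesis using g(2) by (intro exI[of _ "adjoint g 1"]) simp
qed

lemma config_face_empty [simp]: "config_face {} C"
  unfolding config_face_def by (intro exI[of _ "{}"]) simp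

lemma config_face_refl [simp]: "config_face C C"
  unfolding config_face_def by (intro exI[of _ "convex hull C"]) (auto simp: hull_inc face_of_refl)

lemma config_face_halfspace:
  assumes "\<And>p. p \<in> P \<Longrightarrow> b \<le> a \<bullet> p" shows "config_face {p\<in>P. a \<bullet> p = b} P"
proof -
  have "P \<subseteq> {x. a \<bullet> x \<ge> b}" using assms by auto
  then have "convex hull P \<subseteq> {x. a \<bullet> x \<ge> b}" by (intro hull_minimal convex_halfspace_ge)
  then have "convex hull P \<inter> {x. a \<bullet> x = b} face_of convex hull P"
    by (intro face_of_Int_supporting_hyperplane_ge) auto
  then show ?thesis unfolding config_face_def
    by (intro exI[of _ "convex hull P \<inter> {x. a \<bullet> x = b}"]) (auto simp: hull_inc)
qed

context
  fixes P :: "'a::euclidean_space set" and \<S>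
  assumes sub: "subdivision P \<S>"
begin

lemma subdivision_finite: "finite P" "finite \<S>" "C \<in> \<S> \<Longrightarrow> finite C" "C \<in> \<S> \<Longrightarrow> C \<subseteq> P"
proof -
  show f: "finite P" and s: "C \<in> \<S> \<Longrightarrow> C \<subseteq> P" using sub by (auto simp: subdivision_def)
  have "\<S> \<subseteq> Pow P" using sub by (auto simp: subdivision_def)
  then show "finite \<S>" using f finite_subset by blast
  show "C \<in> \<S> \<Longrightarrow> finite C" using s f finite_subset by blast
qed

lemma cell_Int:
  assumes "C \<in> \<S>" "D \<in> \<S>"
  shows "C \<inter> D \<in> \<S>" "config_face (C \<inter> D) C" "convex hull C \<inter> convex hull D = convex hull (C \<inter> D)"
  using sub assms by (auto simp: subdivision_def)

lemma cell_in_maximal: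
  assumes "C \<in> \<S>" shows "\<exists>D\<in>maximal_cells \<S>. C \<subseteq> D"
proof -
  have "\<exists>D\<in>{D\<in>\<S>. C \<subseteq> D}. \<forall>E\<in>{D\<in>\<S>. C \<subseteq> D}. D \<subseteq> E \<longrightarrow> D = E"
    using subdivision_finite(2) assms by (intro finite_has_maximal) auto
  then show ?thesis by (force simp: maximal_cells_def)
qed

lemma maximal_cells_cover: "(\<Union>C\<in>maximal_cells \<S>. convex hull C) = convex hull P"
proof -
  have "(\<Union>C\<in>maximal_cells \<S>. convex hull C) = (\<Union>C\<in>\<S>. convex hull C)"
  proof
    show "(\<Union>C\<in>\<S>. convex hull C) \<subseteq> (\<Union>C\<in>maximal_cells \<S>. convex hull C)"
      using cell_in_maximal hull_mono by blast
  qed (auto simp: maximal_cells_def)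
  then show ?thesis using sub by (simp add: subdivision_def)
qed

lemma cells_Inter:
  assumes "finite A" "A \<noteq> {}" "A \<subseteq> \<S>"
  shows "\<Inter>A \<in> \<S> \<and> (\<Inter>C\<in>A. convex hull C) = convex hull (\<Inter>A)"
  using assms
proof (induction rule: finite_ne_induct)
  case (insert C A)
  then show ?case using cell_Int[of C "\<Inter>A"] by simp
qed simp

text \<open>The two hulls meet in the hull of a common face, and a face of \<open>a\<close> through
  the barycentre of \<open>a\<close> is everything. Inclusions between cells are often tested this
  way below.\<close>

lemma mean_in_cell:
  assumes a: "a \<in> \<S>" "a \<noteq> {}" and b: "b \<in> \<S>" and m: "mean a \<in> convex hull b"
  shows "a \<subseteq> b"
proof -
  have fin: "finite a" using a by (simp add: subdivision_finite)
  obtain G where G: "G face_of convex hull a" "a \<inter> b = a \<inter> G"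
    using cell_Int(2)[OF a(1) b] by (auto simp: config_face_def)
  have "mean a \<in> convex hull (a \<inter> b)"
    using cell_Int(3)[OF a(1) b] mean_in_hull[OF fin a(2)] m by blast
  also have "convex hull (a \<inter> b) \<subseteq> G"
    using G by (intro hull_minimal face_of_imp_convex) auto
  finally have "a \<subseteq> G" by (rule face_contains_mean[OF fin a(2) G(1)])
  then show ?thesis using G by blast
qed

lemma maximal_in_trivial:
  assumes "P \<in> \<S>" shows "\<S> = trivial_subdivision P"
proof
  show "\<S> \<subseteq> trivial_subdivision P"
  proof
    fix C assume C: "C \<in> \<S>"
    then have "config_face (P \<inter> C) P" "C \<subseteq> P" using cell_Int[OF assms C] subdivision_finite by auto
    then show "C \<in> trivial_subdivision P" by (simp add: trivial_subdivision_def Int_absorb1)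
  qed
  show "trivial_subdivision P \<subseteq> \<S>" using sub assms by (auto simp: trivial_subdivision_def subdivision_def)
qed

end

subsection \<open>The fan of a split\<close>

locale hypersimplex_split =
  fixes d k :: nat and \<S> :: "(real^'n::finite) set set"
  assumes d_pos: "0 < d" and d_less: "d < CARD('n)"
    and ksplit: "k_split k (vertices (hypersimplex d (UNIV :: 'n set))) \<S>"
begin

abbreviation \<Delta> :: "(real^'n) set" where "\<Delta> \<equiv> hypersimplex d UNIV"
abbreviation V :: "(real^'n) set" where "V \<equiv> vertices \<Delta>"
abbreviation F :: "(real^'n) set set" where "F \<equiv> maximal_cells \<S>"
abbreviation H :: "(real^'n) set" where "H \<equiv> common_cell \<S>"

definition q :: "real^'n" where "q = mean H"

lemma sub: "subdivision V \<S>"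
  using ksplit by (simp add: k_split_def coarsest_subdivision_def)

lemma hull_V: "convex hull V = \<Delta>"
  by (rule hull_vertices_hypersimplex)

lemma V_eq: "V = e_set ` {J. card J = d}"
  by (rule vertices_hypersimplex)

lemma F_S: "f \<in> F \<Longrightarrow> f \<in> \<S>"
  by (simp add: maximal_cells_def)

lemma fin_F: "finite F" and card_F_k: "card F = k"
  using ksplit by (auto simp: k_split_def)

lemma H_S: "H \<in> \<S>" and H_int: "interior_cell V H"
  using ksplit by (auto simp: k_split_def)

lemma H_sub: "f \<in> F \<Longrightarrow> H \<subseteq> f"
  by (auto simp: common_cell_def)

lemma exists_vertex: "\<exists>J. card J = d \<and> y \<in> J" "\<exists>J. card J = d \<and> y \<notin> J" for y :: 'n
proof -
  have "d - 1 \<le> card (UNIV - {y})" using d_less by simp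
  then obtain K where K: "K \<subseteq> UNIV - {y}" "card K = d - 1" by (metis obtain_subset_with_card_n)
  then have "card (insert y K) = d" using d_pos by (subst card_insert_disjoint) (auto simp: finite)
  then show "\<exists>J. card J = d \<and> y \<in> J" by blast
  have "d \<le> card (UNIV - {y})" using d_less by simp
  then show "\<exists>J. card J = d \<and> y \<notin> J" by (metis obtain_subset_with_card_n Diff_iff singletonI subsetD)
qed

lemma V_ne: "V \<noteq> {}"
  using exists_vertex(1) by (auto simp: V_eq)

lemma H_ne: "H \<noteq> {}"
  using H_int V_ne unfolding interior_cell_def by (metis config_face_empty empty_subsetI)

lemma H_V: "H \<subseteq> V"
  using subdivision_finite(4)[OF sub H_S] .

lemma fin_H: "finite H"
  using subdivision_finite(3)[OF sub H_S] .

text \<open>As \<open>0 < d < n\<close>, the conditions that coordinate \<open>y\<close> is 0 or 1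
  cut out proper faces of the hypersimplex, and an interior cell lies in no proper face.\<close>

lemma H_coord: "\<exists>p\<in>H. p $ y = 1" "\<exists>p\<in>H. p $ y = 0"
proof -
  show "\<exists>p\<in>H. p $ y = 1"
  proof (rule ccontr)
    assume n: "\<not> ?thesis"
    have "config_face {p\<in>V. axis y 1 \<bullet> p = 0} V"
      by (rule config_face_halfspace) (auto simp: V_eq inner_axis')
    moreover have "H \<subseteq> {p\<in>V. axis y 1 \<bullet> p = 0}"
      using n H_V by (fastforce simp: V_eq inner_axis')
    ultimately have "{p\<in>V. axis y 1 \<bullet> p = 0} = V" using H_int by (simp add: interior_cell_def)
    moreover obtain J where "card J = d" "y \<in> J" using exists_vertex(1) by blast
    moreover from this have "e_set J \<in> V" by (auto simp: V_eq)
    ultimately show False by (auto simp: inner_axis' set_eq_iff) (metis e_set_nth zero_neq_one)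
  qed
  show "\<exists>p\<in>H. p $ y = 0"
  proof (rule ccontr)
    assume n: "\<not> ?thesis"
    have "config_face {p\<in>V. axis y (-1) \<bullet> p = -1} V"
      by (rule config_face_halfspace) (auto simp: V_eq inner_axis')
    moreover have "H \<subseteq> {p\<in>V. axis y (-1) \<bullet> p = -1}"
    proof
      fix p assume p: "p \<in> H"
      then have "p \<in> V" using H_V by blast
      then obtain J where J: "card J = d" "p = e_set J" by (auto simp: V_eq)
      have "p $ y \<noteq> 0" using n p by blast
      then have "p $ y = 1" by (auto simp: J split: if_splits)
      then show "p \<in> {p\<in>V. axis y (-1) \<bullet> p = -1}" using \<open>p \<in> V\<close> by (simp add: inner_axis')
    qed
    ultimately have "{p\<in>V. axis y (-1) \<bullet> p = -1} = V" using H_int by (simp add: interior_cell_def)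
    moreover obtain J where "card J = d" "y \<notin> J" using exists_vertex(2) by blast
    moreover from this have "e_set J \<in> V" by (auto simp: V_eq)
    ultimately show False by (auto simp: inner_axis' set_eq_iff) (metis e_set_nth zero_neq_one)
  qed
qed

lemma mean_interior:
  assumes "H \<subseteq> A" "A \<subseteq> V"
  shows "0 < mean A $ y" "mean A $ y < 1" "(\<Sum>i\<in>UNIV. mean A $ i) = real d"
proof -
  have finA: "finite A" using assms(2) subdivision_finite(1)[OF sub] finite_subset by blast
  have A_ne: "A \<noteq> {}" using assms(1) H_ne by blast
  have mA: "mean A $ y = (\<Sum>p\<in>A. p $ y) / real (card A)" for y by (simp add: mean_def)
  have c: "real (card A) > 0" using finA A_ne by (simp add: card_gt_0_iff)
  have r: "0 \<le> p $ y \<and> p $ y \<le> 1" if "p \<in> A" for p y using assms(2) that by (auto simp: V_eq)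
  obtain p where "p \<in> A" "p $ y = 1" using H_coord(1) assms(1) by blast
  then have "0 < (\<Sum>p\<in>A. p $ y)" using finA r by (intro sum_pos2[of A p]) auto
  then show "0 < mean A $ y" using c by (simp add: mA)
  obtain p' where "p' \<in> A" "p' $ y = 0" using H_coord(2) assms(1) by blast
  then have "0 < (\<Sum>p\<in>A. 1 - p $ y)" using finA r by (intro sum_pos2[of A p']) auto
  then show "mean A $ y < 1" using c by (simp add: mA sum_subtractf)
  have "(\<Sum>i\<in>UNIV. mean A $ i) = (\<Sum>p\<in>A. \<Sum>i\<in>UNIV. p $ i) / real (card A)"
    unfolding mA sum_divide_distrib[symmetric] by (subst sum.swap) (rule refl)
  also have "(\<Sum>p\<in>A. \<Sum>i\<in>UNIV. p $ i) = (\<Sum>p\<in>A. real d)"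
    using assms(2) by (intro sum.cong) (auto simp: V_eq sum.If_cases)
  finally show "(\<Sum>i\<in>UNIV. mean A $ i) = real d" using c by simp
qed

lemma q_interior: "0 < q $ y" "q $ y < 1" "(\<Sum>i\<in>UNIV. q $ i) = real d"
  unfolding q_def using mean_interior[of H] H_V by auto

lemma cell_V: "f \<in> F \<Longrightarrow> f \<subseteq> V"
  using subdivision_finite(4)[OF sub F_S] .

lemma fin_cell: "f \<in> F \<Longrightarrow> finite f"
  using subdivision_finite(3)[OF sub F_S] .

lemma closed_cell: "f \<in> F \<Longrightarrow> closed (convex hull f)"
  by (intro compact_imp_closed compact_convex_hull finite_imp_compact fin_cell)

lemma q_hull: "f \<in> F \<Longrightarrow> q \<in> convex hull f"
  using mean_in_hull[OF fin_H H_ne] hull_mono[OF H_sub] unfolding q_def by blast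

lemma cell_hull:
  assumes "C \<subseteq> V" "p \<in> V" "p \<in> convex hull C" shows "p \<in> C"
proof -
  have "convex hull C \<subseteq> \<Delta>" using hull_mono[OF assms(1)] hull_V by metis
  moreover have "p extreme_point_of \<Delta>" using assms(2) by (simp add: vertices_def)
  ultimately have "p extreme_point_of convex hull C" using assms(3) unfolding extreme_point_of_def by blast
  then show ?thesis by (rule extreme_point_of_convex_hull)
qed

lemma cover: "x \<in> \<Delta> \<Longrightarrow> \<exists>f\<in>F. x \<in> convex hull f"
  using maximal_cells_cover[OF sub] by (auto simp: hull_V)

lemma hull_cell_sub: "f \<in> F \<Longrightarrow> convex hull f \<subseteq> \<Delta>"
  using hull_mono[OF cell_V] hull_V by metis

lemma card_F: "2 \<le> card F"
proof (rule ccontr)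
  assume "\<not> ?thesis"
  moreover have "F \<noteq> {}" using cover V_ne hull_subset[of V convex] unfolding hull_V by blast
  ultimately have "card F = 1" using fin_F by (metis One_nat_def Suc_1 card_gt_0_iff leI less_2_cases_iff not_less_eq nat_neq_iff)
  then obtain a where a: "F = {a}" using card_1_singletonE by blast
  have "V \<subseteq> a"
  proof
    fix p assume p: "p \<in> V"
    then have "p \<in> convex hull a" using cover[of p] a hull_subset[of V convex] unfolding hull_V by auto
    then show "p \<in> a" using cell_hull cell_V a p by auto
  qed
  then have "a = V" using cell_V a by auto
  then have "V \<in> \<S>" using F_S a by auto
  then show False using maximal_in_trivial[OF sub] ksplit by (simp add: k_split_def coarsest_subdivision_def)
qed

text \<open>The other cells are finitely many, closed and miss \<open>x\<close>, so near
  \<open>x\<close> the covering leaves only \<open>a\<close>.\<close>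

lemma interior_direction:
  assumes a: "a \<in> F" and x: "\<And>y. 0 < x $ y" "\<And>y. x $ y < 1" "(\<Sum>i\<in>UNIV. x $ i) = real d"
    and xb: "\<And>b. b \<in> F \<Longrightarrow> b \<noteq> a \<Longrightarrow> x \<notin> convex hull b" and v: "(\<Sum>i\<in>UNIV. v $ i) = 0"
  obtains e where "0 < e" "\<And>t. \<bar>t\<bar> \<le> e \<Longrightarrow> x + t *\<^sub>R v \<in> convex hull a"
proof -
  define B where "B = (\<Union>b\<in>F - {a}. convex hull b)"
  have "closed B" unfolding B_def using fin_F closed_cell by (intro closed_UN) auto
  then have "open (- B)" by (rule open_Compl)
  moreover have "x \<in> - B" using xb by (auto simp: B_def)
  ultimately obtain r where r: "r > 0" "ball x r \<subseteq> - B" by (meson openE)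
  obtain e where e: "0 < e" "\<And>t. \<bar>t\<bar> \<le> e \<Longrightarrow> x + t *\<^sub>R v \<in> \<Delta>"
    by (rule hypersimplex_perturb[OF x v]) (rule that)
  define e' where "e' = min e (r / (2 * (1 + norm v)))"
  show ?thesis
  proof (rule that[of e'])
    show "0 < e'" using e r by (simp add: e'_def add_pos_nonneg)
    fix t assume t: "\<bar>t\<bar> \<le> e'"
    have "\<bar>t\<bar> * norm v \<le> r / (2 * (1 + norm v)) * (1 + norm v)"
      using t by (intro mult_mono) (auto simp: e'_def)
    also have "\<dots> = r / 2"
    proof -
      have "1 + norm v \<noteq> 0" by (smt (verit) norm_ge_zero)
      then show ?thesis by (simp add: field_simps)
    qed
    also have "\<dots> < r" using r by simp
    finally have "dist x (x + t *\<^sub>R v) < r" by (simp add: dist_norm)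
    then have "x + t *\<^sub>R v \<notin> B" using r(2) by auto
    moreover have "x + t *\<^sub>R v \<in> \<Delta>" using t e(2) by (simp add: e'_def)
    ultimately show "x + t *\<^sub>R v \<in> convex hull a" using cover unfolding B_def by blast
  qed
qed

lemma cell_mean:
  assumes a: "a \<in> F"
  shows "0 < mean a $ y" "mean a $ y < 1" "(\<Sum>i\<in>UNIV. mean a $ i) = real d" "mean a \<in> convex hull a"
    "b \<in> F \<Longrightarrow> b \<noteq> a \<Longrightarrow> mean a \<notin> convex hull b"
proof -
  show "0 < mean a $ y" "mean a $ y < 1" "(\<Sum>i\<in>UNIV. mean a $ i) = real d"
    using mean_interior[OF H_sub[OF a] cell_V[OF a]] by auto
  have ne: "a \<noteq> {}" using H_sub[OF a] H_ne by blast
  show "mean a \<in> convex hull a" using mean_in_hull[OF fin_cell[OF a] ne] .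
  show "mean a \<notin> convex hull b" if "b \<in> F" "b \<noteq> a"
    using mean_in_cell[OF sub F_S[OF a] ne F_S[OF that(1)]] a that by (auto simp: maximal_cells_def)
qed

text \<open>The relative interior of \<open>a\<close> misses \<open>b\<close>. Thickening it by all
  multiples of \<open>one\<close> before separating forces the normal to have coordinate sum zero.
  The hyperplane passes through \<open>q\<close>, which lies in both cells, and the room around
  \<open>mean a\<close> makes the inequality strict there.\<close>

lemma separate:
  assumes a: "a \<in> F" and b: "b \<in> F" "b \<noteq> a"
  shows "\<exists>w. (\<Sum>i\<in>UNIV. w $ i) = 0 \<and> (\<forall>x\<in>convex hull a. w \<bullet> (x - q) \<le> 0) \<and>
    (\<forall>x\<in>convex hull b. 0 \<le> w \<bullet> (x - q)) \<and> w \<bullet> (mean a - q) < 0"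
proof -
  define one where "one = ((\<chi> i. 1) :: real^'n)"
  have one: "one \<bullet> x = (\<Sum>i\<in>UNIV. x $ i)" for x by (simp add: one_def inner_vec_def)
  define R where "R = rel_interior (convex hull a)"
  define S where "S = (\<Union>x\<in>R. \<Union>y\<in>range (\<lambda>t. t *\<^sub>R one). {x + y})"
  have cR: "convex R" unfolding R_def by (intro convex_rel_interior convex_convex_hull)
  have "convex (range (\<lambda>t. t *\<^sub>R one))"
    unfolding span_singleton[symmetric] by (intro subspace_imp_convex subspace_span)
  then have "convex S" unfolding S_def using cR by (rule convex_sums[rotated])
  have "a \<noteq> {}" using H_sub[OF a] H_ne by blast
  then have "R \<noteq> {}" unfolding R_def by (simp add: rel_interior_eq_empty)
  then have "S \<noteq> {}" by (auto simp: S_def)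
  have disj: "R \<inter> convex hull b = {}"
  proof -
    obtain G where G: "G face_of convex hull a" "a \<inter> b = a \<inter> G"
      using cell_Int(2)[OF sub F_S[OF a] F_S[OF b(1)]] by (auto simp: config_face_def)
    have "G \<noteq> convex hull a"
    proof
      assume "G = convex hull a"
      then have "a \<subseteq> b" using G(2) hull_subset[of a convex] by blast
      then show False using a b by (auto simp: maximal_cells_def)
    qed
    then have "G \<inter> R = {}" unfolding R_def by (rule face_of_disjoint_rel_interior[OF G(1)])
    moreover have "convex hull (a \<inter> b) \<subseteq> G"
      using G by (intro hull_minimal face_of_imp_convex) auto
    moreover have "R \<subseteq> convex hull a" unfolding R_def by (rule rel_interior_subset)
    ultimately show ?thesis using cell_Int(3)[OF sub F_S[OF a] F_S[OF b(1)]] by blast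
  qed
  have sumD: "one \<bullet> x = real d" if "x \<in> \<Delta>" for x using that by (simp add: one mem_hypersimplex)
  have "S \<inter> convex hull b = {}"
  proof (rule ccontr)
    assume "\<not> ?thesis"
    then obtain x t where x: "x \<in> R" "x + t *\<^sub>R one \<in> convex hull b" by (auto simp: S_def)
    have xa: "x \<in> convex hull a" using x(1) rel_interior_subset unfolding R_def by blast
    have "one \<bullet> (x + t *\<^sub>R one) = real d" "one \<bullet> x = real d"
      using sumD x(2) xa hull_cell_sub a b by blast+
    then have "t * (one \<bullet> one) = 0" by (simp add: inner_add_right)
    moreover have "one \<bullet> one \<noteq> 0" unfolding one by (simp add: one_def)
    ultimately have "t = 0" by simp
    with x disj show False by auto
  qed
  moreover have "convex hull b \<noteq> {}" using H_sub[OF b(1)] H_ne by auto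
  ultimately obtain w c where w: "w \<noteq> 0" "\<forall>x\<in>S. w \<bullet> x \<le> c" "\<forall>x\<in>convex hull b. w \<bullet> x \<ge> c"
    using separating_hyperplane_sets[OF \<open>convex S\<close> convex_convex_hull \<open>S \<noteq> {}\<close>, of b] by blast
  have S: "w \<bullet> x + t * (w \<bullet> one) \<le> c" if "x \<in> R" for x t
  proof -
    have "x + t *\<^sub>R one \<in> S" using that by (auto simp: S_def)
    then have "w \<bullet> (x + t *\<^sub>R one) \<le> c" using w(2) by blast
    then show ?thesis by (simp add: inner_add_right)
  qed
  have w1: "w \<bullet> one = 0"
  proof (rule ccontr)
    assume n: "w \<bullet> one \<noteq> 0"
    obtain x where "x \<in> R" using \<open>R \<noteq> {}\<close> by blast
    from S[OF this, of "(c - w \<bullet> x + 1) / (w \<bullet> one)"] n show False by simp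
  qed
  then have w0: "(\<Sum>i\<in>UNIV. w $ i) = 0" by (simp add: one[symmetric] inner_commute)
  have "closure R = convex hull a"
    unfolding R_def convex_closure_rel_interior[OF convex_convex_hull]
    using closed_cell[OF a] by (rule closure_closed)
  moreover have "closure R \<subseteq> {x. w \<bullet> x \<le> c}"
    using S w1 by (intro closure_minimal closed_halfspace_le) auto
  ultimately have wa: "w \<bullet> x \<le> c" if "x \<in> convex hull a" for x using that by blast
  have wq: "w \<bullet> q = c" using wa[OF q_hull[OF a]] w(3) q_hull[OF b(1)] by (simp add: antisym)
  note m = cell_mean[OF a]
  obtain e where e: "0 < e" "\<And>t. \<bar>t\<bar> \<le> e \<Longrightarrow> mean a + t *\<^sub>R w \<in> convex hull a"
    using interior_direction[OF a m(1-3) m(5) w0] by blast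
  have "w \<bullet> (mean a + e *\<^sub>R w) \<le> c" using e by (intro wa) auto
  moreover have "0 < e * (w \<bullet> w)" using e w(1) by simp
  ultimately have "w \<bullet> mean a < c" by (simp add: inner_add_right)
  then show ?thesis using w0 wa w(3) wq by (intro exI[of _ w]) (auto simp: inner_diff_right)
qed

end

section \<open>Simplicial cones of the cells\<close>

locale separated_split = hypersimplex_split d k \<S>
  for d k and \<S> :: "(real^'n::finite) set set" +
  fixes W :: "(real^'n) set \<Rightarrow> (real^'n) set \<Rightarrow> real^'n"
  assumes W: "\<And>a b. a \<in> F \<Longrightarrow> b \<in> F \<Longrightarrow> b \<noteq> a \<Longrightarrow>
    (\<Sum>i\<in>UNIV. W a b $ i) = 0 \<and> (\<forall>x\<in>convex hull a. W a b \<bullet> (x - q) \<le> 0) \<and>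
    (\<forall>x\<in>convex hull b. 0 \<le> W a b \<bullet> (x - q)) \<and> W a b \<bullet> (mean a - q) < 0"
begin

text \<open>On the segment from \<open>x\<close> to \<open>mean a\<close> all inequalities are
  strict beyond \<open>x\<close>, so no other cell contains these points; \<open>x\<close> follows
  by closedness.\<close>

lemma conv_iff:
  assumes a: "a \<in> F" and x: "x \<in> \<Delta>"
  shows "x \<in> convex hull a \<longleftrightarrow> (\<forall>b\<in>F - {a}. W a b \<bullet> (x - q) \<le> 0)"
proof
  show "x \<in> convex hull a \<Longrightarrow> \<forall>b\<in>F - {a}. W a b \<bullet> (x - q) \<le> 0" using W[OF a] by blast
  assume n: "\<forall>b\<in>F - {a}. W a b \<bullet> (x - q) \<le> 0"
  have ma: "mean a \<in> convex hull a" using cell_mean(4)[OF a] .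
  have y: "(1 - t) *\<^sub>R x + t *\<^sub>R mean a \<in> convex hull a" if t: "0 < t" "t \<le> 1" for t
  proof -
    let ?y = "(1 - t) *\<^sub>R x + t *\<^sub>R mean a"
    have "convex \<Delta>" by (metis hull_V convex_convex_hull)
    then have "?y \<in> \<Delta>" using x ma hull_cell_sub[OF a] t by (intro convexD) auto
    then obtain f where f: "f \<in> F" "?y \<in> convex hull f" using cover by blast
    have "f = a"
    proof (rule ccontr)
      assume fa: "f \<noteq> a"
      have "0 \<le> W a f \<bullet> (?y - q)" using W[OF a f(1) fa] f(2) by blast
      also have "?y - q = (1 - t) *\<^sub>R (x - q) + t *\<^sub>R (mean a - q)" by (simp add: algebra_simps)
      also have "W a f \<bullet> \<dots> = (1 - t) * (W a f \<bullet> (x - q)) + t * (W a f \<bullet> (mean a - q))"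
        by (simp add: inner_add_right)
      also have "\<dots> < 0"
      proof -
        have "(1 - t) * (W a f \<bullet> (x - q)) \<le> 0" using n f fa t by (intro mult_nonneg_nonpos) auto
        moreover have "t * (W a f \<bullet> (mean a - q)) < 0" using W[OF a f(1) fa] t by (intro mult_pos_neg) auto
        ultimately show ?thesis by linarith
      qed
      finally show False by simp
    qed
    with f show ?thesis by simp
  qed
  have lim: "((\<lambda>t. (1 - t) *\<^sub>R x + t *\<^sub>R mean a) \<longlongrightarrow> (1 - 0) *\<^sub>R x + 0 *\<^sub>R mean a) (at_right (0::real))"
    by (intro tendsto_intros)
  have "eventually (\<lambda>t. (1 - t) *\<^sub>R x + t *\<^sub>R mean a \<in> convex hull a) (at_right (0::real))"
    unfolding eventually_at_right_field using y by (intro exI[of _ 1]) auto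
  from Lim_in_closed_set[OF closed_cell[OF a] this _ lim] show "x \<in> convex hull a" by (simp add: trivial_limit_at_right_real)
qed

text \<open>The cone of directions that lead from \<open>q\<close> into the cell
  \<open>a\<close>.\<close>

definition K :: "(real^'n) set \<Rightarrow> (real^'n) set" where
  "K a = {v. (\<Sum>i\<in>UNIV. v $ i) = 0 \<and> (\<forall>b\<in>F - {a}. W a b \<bullet> v \<le> 0)}"

lemma K_small:
  assumes v: "(\<Sum>i\<in>UNIV. v $ i) = 0"
  obtains e where "0 < e" "q + e *\<^sub>R v \<in> \<Delta>" "q - e *\<^sub>R v \<in> \<Delta>"
    "\<And>a. a \<in> F \<Longrightarrow> v \<in> K a \<longleftrightarrow> q + e *\<^sub>R v \<in> convex hull a"
proof -
  obtain e where e: "0 < e" "\<And>t. \<bar>t\<bar> \<le> e \<Longrightarrow> q + t *\<^sub>R v \<in> \<Delta>"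
    by (rule hypersimplex_perturb[OF q_interior v]) (rule that)
  have d: "q + e *\<^sub>R v \<in> \<Delta>" using e by auto
  show ?thesis
  proof (rule that[OF e(1) d])
    show "q - e *\<^sub>R v \<in> \<Delta>" using e(2)[of "-e"] e(1) by simp
    show "v \<in> K a \<longleftrightarrow> q + e *\<^sub>R v \<in> convex hull a" if "a \<in> F" for a
      unfolding conv_iff[OF that d] K_def using v e(1) by (auto simp: mult_le_0_iff)
  qed
qed

lemma K_cover:
  assumes v: "(\<Sum>i\<in>UNIV. v $ i) = 0" shows "\<exists>a\<in>F. v \<in> K a"
proof -
  obtain e where "0 < e" "q + e *\<^sub>R v \<in> \<Delta>" "\<And>a. a \<in> F \<Longrightarrow> v \<in> K a \<longleftrightarrow> q + e *\<^sub>R v \<in> convex hull a"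
    using K_small[OF v] by blast
  then show ?thesis using cover by blast
qed

lemma K_opp:
  assumes "a \<in> F" "b \<in> F" "b \<noteq> a" "v \<in> K b" shows "0 \<le> W a b \<bullet> v"
proof -
  have v: "(\<Sum>i\<in>UNIV. v $ i) = 0" using assms(4) by (simp add: K_def)
  obtain e where e: "0 < e" "\<And>a. a \<in> F \<Longrightarrow> v \<in> K a \<longleftrightarrow> q + e *\<^sub>R v \<in> convex hull a"
    using K_small[OF v] by blast
  have "0 \<le> W a b \<bullet> (q + e *\<^sub>R v - q)" using W[OF assms(1-3)] e(2)[OF assms(2)] assms(4) by blast
  then show ?thesis using e(1) by (simp add: zero_le_mult_iff)
qed

definition L :: "(real^'n) set" where "L = span ((\<lambda>x. - q + x) ` H)"

lemma W_L:
  assumes "a \<in> F" "b \<in> F" "b \<noteq> a" "v \<in> L" shows "W a b \<bullet> v = 0"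
proof -
  have "orthogonal (W a b) v"
    using assms(4) unfolding L_def
  proof (rule orthogonal_to_span)
    fix y assume "y \<in> (\<lambda>x. - q + x) ` H"
    then obtain p where p: "p \<in> H" "y = p - q" by auto
    have "p \<in> convex hull a" "p \<in> convex hull b"
      by (rule hull_inc[OF subsetD[OF H_sub[OF assms(1)] p(1)]], rule hull_inc[OF subsetD[OF H_sub[OF assms(2)] p(1)]])
    then have "W a b \<bullet> (p - q) \<le> 0" "0 \<le> W a b \<bullet> (p - q)" using W[OF assms(1-3)] by blast+
    then show "orthogonal (W a b) y" by (simp add: orthogonal_def p(2))
  qed
  then show ?thesis by (simp add: orthogonal_def)
qed

text \<open>Along such a \<open>v\<close> the point \<open>q\<close> is the midpoint of a segment in
  \<open>a\<close>. The common cell is a face of \<open>a\<close> whose hull contains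
  \<open>q\<close>, so it contains the segment.\<close>

lemma lineality:
  assumes a: "a \<in> F" and v: "(\<Sum>i\<in>UNIV. v $ i) = 0" "\<And>b. b \<in> F \<Longrightarrow> b \<noteq> a \<Longrightarrow> W a b \<bullet> v = 0"
  shows "v \<in> L"
proof -
  obtain e where e: "0 < e" "q + e *\<^sub>R v \<in> \<Delta>" "q - e *\<^sub>R v \<in> \<Delta>" using K_small[OF v(1)] by blast
  have in_a: "q + e *\<^sub>R v \<in> convex hull a" "q - e *\<^sub>R v \<in> convex hull a"
    unfolding conv_iff[OF a e(2)] conv_iff[OF a e(3)] using v(2) by auto
  have "config_face (a \<inter> H) a" using cell_Int(2)[OF sub F_S[OF a] H_S] .
  then obtain G where G: "G face_of convex hull a" "H = a \<inter> G"
    using H_sub[OF a] by (auto simp: config_face_def Int_absorb1)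
  have qG: "q \<in> G"
  proof -
    have "convex hull H \<subseteq> G" using G by (intro hull_minimal face_of_imp_convex) auto
    then show ?thesis using mean_in_hull[OF fin_H H_ne] unfolding q_def by blast
  qed
  have "q + e *\<^sub>R v \<in> convex hull H"
  proof (cases "v = 0")
    case False
    have "q = (1 - 1/2) *\<^sub>R (q + e *\<^sub>R v) + (1/2) *\<^sub>R (q - e *\<^sub>R v)"
      by (simp add: algebra_simps flip: scaleR_add_left)
    moreover have "q + e *\<^sub>R v \<noteq> q - e *\<^sub>R v"
    proof
      assume "q + e *\<^sub>R v = q - e *\<^sub>R v"
      then have "(2 * e) *\<^sub>R v = 0" by (simp add: algebra_simps eq_neg_iff_add_eq_0 flip: scaleR_add_left)
      then show False using e(1) False by simp
    qed
    ultimately have "q \<in> open_segment (q + e *\<^sub>R v) (q - e *\<^sub>R v)"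
      unfolding in_segment by (intro conjI exI[of _ "1/2::real"]) auto
    then have "q + e *\<^sub>R v \<in> G" using face_ofD[OF G(1) _ in_a qG] by blast
    moreover obtain S' where S': "S' \<subseteq> a" "G = convex hull S'"
      using face_of_convex_hull_subset[OF finite_imp_compact[OF fin_cell[OF a]] G(1)] by blast
    moreover have "S' \<subseteq> H" using S' G(2) hull_subset[of S' convex] by blast
    ultimately show ?thesis using hull_mono by blast
  qed (use mean_in_hull[OF fin_H H_ne] in \<open>simp add: q_def\<close>)
  then have "q + e *\<^sub>R v \<in> affine hull H" using convex_hull_subset_affine_hull by blast
  moreover have "q \<in> affine hull H"
    using convex_hull_subset_affine_hull mean_in_hull[OF fin_H H_ne] unfolding q_def by blast
  ultimately have "q + e *\<^sub>R v \<in> (\<lambda>x. q + x) ` L" unfolding L_def by (metis affine_hull_span_gen)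
  then have "e *\<^sub>R v \<in> L" by auto
  then have "(1 / e) *\<^sub>R e *\<^sub>R v \<in> L" unfolding L_def by (rule span_scale)
  then show ?thesis using e(1) by simp
qed

definition one :: "real^'n" where "one = (\<chi> i. 1)"

lemma one_inner: "one \<bullet> x = (\<Sum>i\<in>UNIV. x $ i)"
  by (simp add: one_def inner_vec_def)

lemma dim_L: "int (dim L) \<le> int CARD('n) - int k"
proof -
  have "q \<in> affine hull H"
    using convex_hull_subset_affine_hull mean_in_hull[OF fin_H H_ne] unfolding q_def by blast
  then have "aff_dim H = int (dim L)" unfolding L_def dim_span by (rule aff_dim_eq_dim)
  moreover have "aff_dim V - aff_dim H = int k - 1" using ksplit by (simp add: k_split_def)
  moreover have "aff_dim V \<le> int CARD('n) - 1"
  proof -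
    have "V \<subseteq> {x. one \<bullet> x = real d}" by (auto simp: V_eq one_inner sum.If_cases)
    then have "aff_dim V \<le> aff_dim {x. one \<bullet> x = real d}" by (rule aff_dim_subset)
    moreover have "one \<noteq> 0" by (simp add: one_def vec_eq_iff)
    ultimately show ?thesis by (simp add: aff_dim_hyperplane)
  qed
  ultimately show ?thesis by linarith
qed

text \<open>Whatever is orthogonal to these at most \<open>k\<close> vectors lies in
  \<open>L\<close>, whose dimension is at most \<open>n - k\<close>. So they must span a space of
  dimension \<open>k\<close>. Here the codimension of the common cell makes the cones
  simplicial.\<close>

lemma W_independent:
  assumes a: "a \<in> F"
  shows "independent (insert one (W a ` (F - {a})))" (is "independent ?B")
    "inj_on (W a) (F - {a})" "one \<notin> W a ` (F - {a})"
proof -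
  have fB: "finite ?B" using fin_F by simp
  have "{y \<in> UNIV. \<forall>x \<in> span ?B. orthogonal x y} \<subseteq> L"
  proof
    fix y assume "y \<in> {y \<in> UNIV. \<forall>x \<in> span ?B. orthogonal x y}"
    then have "\<And>x. x \<in> ?B \<Longrightarrow> x \<bullet> y = 0" by (auto simp: orthogonal_def span_base)
    then show "y \<in> L" by (intro lineality[OF a]) (auto simp flip: one_inner)
  qed
  then have "dim {y \<in> UNIV. \<forall>x \<in> span ?B. orthogonal x y} \<le> dim L" by (rule dim_subset)
  moreover have "dim {y \<in> UNIV. \<forall>x \<in> span ?B. orthogonal x y} + dim (span ?B) = dim (UNIV :: (real^'n) set)"
    by (rule dim_subspace_orthogonal_to_vectors) auto
  ultimately have kB: "k \<le> dim (span ?B)" using dim_L by simp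
  have "dim (span ?B) \<le> card ?B" using dim_le_card'[OF fB] by simp
  moreover have "card ?B \<le> Suc (card (W a ` (F - {a})))" by (rule card_insert_le_m1) (auto)
  moreover have "card (W a ` (F - {a})) \<le> card (F - {a})" using fin_F by (intro card_image_le) auto
  moreover have "Suc (card (F - {a})) = k" using a fin_F card_F_k card_Suc_Diff1 by metis
  ultimately have c: "card ?B = k" "card (W a ` (F - {a})) = card (F - {a})" "card ?B = Suc (card (W a ` (F - {a})))"
    using kB by linarith+
  show "independent ?B"
    by (rule card_le_dim_spanning[of ?B "span ?B"]) (use fB c kB in \<open>auto simp: span_superset\<close>)
  show "inj_on (W a) (F - {a})" using c(2) fin_F by (intro eq_card_imp_inj_on) auto
  show "one \<notin> W a ` (F - {a})" using c(3) fin_F by (auto simp: card_insert_if split: if_splits)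
qed

lemma W_dual:
  assumes a: "a \<in> F"
  obtains r where "(\<Sum>i\<in>UNIV. r $ i) = 0" "\<And>b. b \<in> F \<Longrightarrow> b \<noteq> a \<Longrightarrow> W a b \<bullet> r = \<phi> b"
proof -
  let ?\<psi> = "\<lambda>u. if u = one then 0 else \<phi> (the_inv_into (F - {a}) (W a) u)"
  from independent_dual[OF W_independent(1)[OF a], of ?\<psi>]
  obtain r where r: "\<forall>u\<in>insert one (W a ` (F - {a})). u \<bullet> r = ?\<psi> u" by (elim exE)
  show ?thesis
  proof (rule that[of r])
    have "one \<bullet> r = 0" using bspec[OF r, of one] by simp
    then show "(\<Sum>i\<in>UNIV. r $ i) = 0" by (simp add: one_inner)
    fix b assume b: "b \<in> F" "b \<noteq> a"
    then have "W a b \<noteq> one" using W_independent(3)[OF a] by (metis DiffI imageI singletonD)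
    moreover have "W a b \<in> insert one (W a ` (F - {a}))" using b by blast
    ultimately show "W a b \<bullet> r = \<phi> b"
      using bspec[OF r] b the_inv_into_f_f[OF W_independent(2)[OF a], of b] by simp
  qed
qed

text \<open>By independence some direction \<open>y\<close> crosses the facet towards
  \<open>c\<close> and moves away from the others. The points \<open>v + t *\<^sub>R y\<close> with
  \<open>t > 0\<close> can then lie only in \<open>K c\<close>, and \<open>t\<close> may be taken
  arbitrarily small.\<close>

lemma facet:
  assumes a: "a \<in> F" and c: "c \<in> F" "c \<noteq> a" and v: "v \<in> K a" "W a c \<bullet> v = 0"
  shows "v \<in> K c"
proof -
  obtain y where y: "(\<Sum>i\<in>UNIV. y $ i) = 0" "\<And>b. b \<in> F \<Longrightarrow> b \<noteq> a \<Longrightarrow> W a b \<bullet> y = (if b = c then 1 else -1)"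
    by (rule W_dual[OF a, of "\<lambda>b. if b = c then 1 else -1"]) (rule that)
  have v0: "(\<Sum>i\<in>UNIV. v $ i) = 0" using v by (simp add: K_def)
  have vt: "v + t *\<^sub>R y \<in> K c" if t: "t > 0" for t
  proof -
    have "(\<Sum>i\<in>UNIV. (v + t *\<^sub>R y) $ i) = 0" using v0 y(1) by (simp add: sum.distrib flip: sum_distrib_left)
    then obtain f where f: "f \<in> F" "v + t *\<^sub>R y \<in> K f" using K_cover by blast
    have "f \<noteq> a"
    proof
      assume "f = a"
      then have "W a c \<bullet> (v + t *\<^sub>R y) \<le> 0" using f c by (simp add: K_def)
      then show False using v(2) y(2)[OF c] t by (simp add: inner_add_right)
    qed
    have "f = c"
    proof (rule ccontr)
      assume fc: "f \<noteq> c"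
      have "0 \<le> W a f \<bullet> (v + t *\<^sub>R y)" using K_opp[OF a f(1) \<open>f \<noteq> a\<close> f(2)] .
      moreover have "W a f \<bullet> v \<le> 0" using v(1) f(1) \<open>f \<noteq> a\<close> by (simp add: K_def)
      ultimately show False using y(2)[OF f(1) \<open>f \<noteq> a\<close>] fc t by (simp add: inner_add_right)
    qed
    with f show ?thesis by simp
  qed
  have "W c b \<bullet> v \<le> 0" if b: "b \<in> F - {c}" for b
  proof (rule ccontr)
    assume n: "\<not> ?thesis"
    define t where "t = (W c b \<bullet> v) / (2 * (1 + \<bar>W c b \<bullet> y\<bar>))"
    have t: "t > 0" using n by (simp add: t_def add_pos_nonneg)
    have "t * \<bar>W c b \<bullet> y\<bar> \<le> t * (1 + \<bar>W c b \<bullet> y\<bar>)" using t by simp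
    also have "\<dots> = (W c b \<bullet> v) / 2" unfolding t_def by (simp add: field_simps add_pos_nonneg)
    finally have "t * \<bar>W c b \<bullet> y\<bar> < W c b \<bullet> v" using n by simp
    then have "W c b \<bullet> v + t * (W c b \<bullet> y) > 0" using t by (smt (verit) abs_le_iff mult_left_mono mult_minus_right)
    moreover have "W c b \<bullet> (v + t *\<^sub>R y) \<le> 0" using vt[OF t] b by (simp add: K_def)
    ultimately show False by (simp add: inner_add_right)
  qed
  then show ?thesis using v0 by (simp add: K_def)
qed

text \<open>The edge of \<open>K c\<close> opposite to its facet towards \<open>a\<close> lies in
  every cone other than \<open>K a\<close> by \<open>facet\<close>. If it were on the wall between
  \<open>a\<close> and some \<open>b\<close>, it would be a lineality vector, against its value -1
  at \<open>W c a\<close>.\<close>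

lemma exists_ray:
  assumes a: "a \<in> F"
  obtains r where "(\<Sum>i\<in>UNIV. r $ i) = 0" "\<And>b. b \<in> F \<Longrightarrow> b \<noteq> a \<Longrightarrow> r \<in> K b \<and> 0 < W a b \<bullet> r"
proof -
  obtain c where c: "c \<in> F" "c \<noteq> a"
  proof -
    have "F \<noteq> {a}" using card_F by auto
    then show ?thesis using a that by blast
  qed
  obtain r where r: "(\<Sum>i\<in>UNIV. r $ i) = 0" "\<And>b. b \<in> F \<Longrightarrow> b \<noteq> c \<Longrightarrow> W c b \<bullet> r = (if b = a then -1 else 0)"
    by (rule W_dual[OF c(1), of "\<lambda>b. if b = a then -1 else 0"]) (rule that)
  have rc: "r \<in> K c" using r by (simp add: K_def)
  have rK: "r \<in> K b" if b: "b \<in> F" "b \<noteq> a" for b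
  proof (cases "b = c")
    case False
    then show ?thesis using facet[OF c(1) b(1) False rc] r(2)[OF b(1) False] b by simp
  qed (simp add: rc)
  have nn: "0 \<le> W a b \<bullet> r" if "b \<in> F" "b \<noteq> a" for b using K_opp[OF a that rK[OF that]] .
  have "W a b \<bullet> r \<noteq> 0" if b: "b \<in> F" "b \<noteq> a" for b
  proof
    assume z: "W a b \<bullet> r = 0"
    have "- r \<in> K a" using r(1) nn by (simp add: K_def sum_negf)
    then have mr: "- r \<in> K b" using facet[OF a b] z by simp
    have "W b g \<bullet> r = 0" if g: "g \<in> F" "g \<noteq> b" for g
    proof -
      have "W b g \<bullet> r \<le> 0" "W b g \<bullet> (- r) \<le> 0" using rK[OF b] mr g unfolding K_def by blast+
      then show ?thesis by simp
    qed
    from lineality[OF b(1) r(1) this] have "r \<in> L" .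
    then have "W c a \<bullet> r = 0" using W_L[OF c(1) a c(2)[symmetric]] by blast
    then show False using r(2)[OF a] c(2) by simp
  qed
  then show ?thesis using rK nn that[OF r(1)] by (metis order_le_less)
qed

text \<open>The separating functionals of a single cell \<open>a\<close> suffice once each is scaled
  to the value -1 on the ray opposite to \<open>a\<close>. A vector where \<open>w c\<close> is
  minimal is moved along this ray to the facet of \<open>K a\<close> towards \<open>c\<close>; both
  that facet and the ray lie in \<open>K c\<close>.\<close>

lemma fan_functionals:
  obtains w where "\<And>f. f \<in> F \<Longrightarrow> (\<Sum>i\<in>UNIV. w f $ i) = 0"
    "\<And>\<gamma> c f. (\<Sum>f\<in>F. \<gamma> f) = 0 \<Longrightarrow> \<forall>y. (\<Sum>f\<in>F. \<gamma> f * w f $ y) = c \<Longrightarrow> f \<in> F \<Longrightarrow> \<gamma> f = 0"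
    "\<And>f x. f \<in> F \<Longrightarrow> x \<in> \<Delta> \<Longrightarrow> x \<in> convex hull f \<longleftrightarrow> (\<forall>g\<in>F. w f \<bullet> (x - q) \<le> w g \<bullet> (x - q))"
proof -
  obtain a where a: "a \<in> F" using card_F by fastforce
  obtain r where r: "(\<Sum>i\<in>UNIV. r $ i) = 0" "\<And>b. b \<in> F \<Longrightarrow> b \<noteq> a \<Longrightarrow> r \<in> K b \<and> 0 < W a b \<bullet> r"
    by (rule exists_ray[OF a]) (rule that)
  define s where "s b = - 1 / (W a b \<bullet> r)" for b
  define w where "w b = (if b = a then 0 else s b *\<^sub>R W a b)" for b
  have s: "s b < 0" if "b \<in> F" "b \<noteq> a" for b using r(2)[OF that] by (simp add: s_def)
  have wr: "w b \<bullet> r = -1" if "b \<in> F" "b \<noteq> a" for b using r(2)[OF that] that by (simp add: w_def s_def)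
  have w0: "(\<Sum>i\<in>UNIV. w f $ i) = 0" if "f \<in> F" for f
    using W[OF a that] by (simp add: w_def flip: sum_distrib_left)
  have wa: "w a = 0" by (simp add: w_def)
  have w_sign: "0 \<le> w b \<bullet> v \<longleftrightarrow> W a b \<bullet> v \<le> 0" if "b \<in> F" "b \<noteq> a" for b v
    using s[OF that] that(2) by (auto simp: w_def zero_le_mult_iff)
  have Ka: "v \<in> K a \<longleftrightarrow> (\<forall>b\<in>F. 0 \<le> w b \<bullet> v)" if v0: "(\<Sum>i\<in>UNIV. v $ i) = 0" for v
  proof -
    have "(\<forall>b\<in>F. 0 \<le> w b \<bullet> v) \<longleftrightarrow> (\<forall>b\<in>F - {a}. W a b \<bullet> v \<le> 0)"
      using w_sign wa by fastforce
    then show ?thesis using v0 by (simp add: K_def)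
  qed
  have suff: "v \<in> K c" if c: "c \<in> F" and v: "(\<Sum>i\<in>UNIV. v $ i) = 0" "\<And>b. b \<in> F \<Longrightarrow> w c \<bullet> v \<le> w b \<bullet> v" for c v
  proof (cases "c = a")
    case True
    then show ?thesis using Ka v wa by simp
  next
    case False
    define t where "t = - (w c \<bullet> v)"
    have t: "t \<ge> 0" using v(2)[OF a] wa by (simp add: t_def)
    define v' where "v' = v - t *\<^sub>R r"
    have v'0: "(\<Sum>i\<in>UNIV. v' $ i) = 0" using v(1) r(1) by (simp add: v'_def sum_subtractf flip: sum_distrib_left)
    have wv': "w b \<bullet> v' = w b \<bullet> v + t" if "b \<in> F" "b \<noteq> a" for b
      using wr[OF that] by (simp add: v'_def inner_diff_right)
    have "0 \<le> w b \<bullet> v'" if "b \<in> F" for b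
      using v(2)[OF that] wv'[OF that] wa by (cases "b = a") (auto simp: t_def)
    then have v'K: "v' \<in> K a" using Ka[OF v'0] by blast
    have "w c \<bullet> v' = 0" using wv'[OF c False] by (simp add: t_def)
    then have "W a c \<bullet> v' = 0" using s[OF c False] False by (simp add: w_def)
    then have "v' \<in> K c" using facet[OF a c False v'K] by simp
    moreover have "r \<in> K c" using r(2)[OF c False] by simp
    moreover have "v = v' + t *\<^sub>R r" by (simp add: v'_def)
    ultimately show ?thesis using t v(1)
      by (auto simp: K_def inner_add_right intro!: add_nonpos_nonpos mult_nonneg_nonpos)
  qed
  \<comment> \<open>A small shift towards the barycentre of \<open>c\<close> makes the inequalities
    of \<open>K c\<close> strict, so that a minimal functional can only be that of
    \<open>c\<close>.\<close>
  have nec: "w c \<bullet> v \<le> w m \<bullet> v" if c: "c \<in> F" and v: "v \<in> K c" and m: "m \<in> F" for c v m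
  proof (rule ccontr)
    assume n: "\<not> ?thesis"
    define y where "y = mean c - q"
    have y0: "(\<Sum>i\<in>UNIV. y $ i) = 0" using cell_mean(3)[OF c] q_interior(3) by (simp add: y_def sum_subtractf)
    have Wy: "W c b \<bullet> y < 0" if "b \<in> F" "b \<noteq> c" for b using W[OF c that] by (simp add: y_def)
    define D where "D = w c \<bullet> v - w m \<bullet> v"
    have D: "D > 0" using n by (simp add: D_def)
    \<comment> \<open>Small enough for the shift to change the gap \<open>D\<close> by at most one
      half of it.\<close>
    define e where "e = D / (2 * (1 + \<bar>w c \<bullet> y - w m \<bullet> y\<bar>))"
    have e: "e > 0" using D by (simp add: e_def add_pos_nonneg)
    define u where "u = v + e *\<^sub>R y"
    have v0: "(\<Sum>i\<in>UNIV. v $ i) = 0" using v by (simp add: K_def)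
    have u0: "(\<Sum>i\<in>UNIV. u $ i) = 0" using v0 y0 by (simp add: u_def sum.distrib flip: sum_distrib_left)
    have Wu: "W c b \<bullet> u < 0" if "b \<in> F" "b \<noteq> c" for b
    proof -
      have "W c b \<bullet> v \<le> 0" using v that by (simp add: K_def)
      moreover have "e * (W c b \<bullet> y) < 0" using Wy[OF that] e by (intro mult_pos_neg)
      ultimately show ?thesis by (simp add: u_def inner_add_right)
    qed
    have Fne: "F \<noteq> {}" using c by blast
    obtain f where f: "f \<in> F" "\<forall>g\<in>F. w f \<bullet> u \<le> w g \<bullet> u"
      using arg_min_if_finite[OF fin_F Fne, of "\<lambda>f. w f \<bullet> u"] by (metis not_less)
    then have "u \<in> K f" using suff u0 by blast
    then have "f = c" using K_opp[OF c f(1), of u] Wu[OF f(1)] by fastforce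
    then have "w c \<bullet> u \<le> w m \<bullet> u" using f m by blast
    then have "D \<le> e * (w m \<bullet> y - w c \<bullet> y)" by (simp add: u_def D_def inner_add_right algebra_simps)
    also have "\<dots> \<le> e * (1 + \<bar>w c \<bullet> y - w m \<bullet> y\<bar>)" using e by (intro mult_left_mono) auto
    also have "\<dots> = D / 2"
    proof -
      have "1 + \<bar>w c \<bullet> y - w m \<bullet> y\<bar> \<noteq> 0" using abs_ge_zero[of "w c \<bullet> y - w m \<bullet> y"] by linarith
      then show ?thesis by (simp add: e_def field_simps)
    qed
    finally show False using D by simp
  qed
  show ?thesis
  proof (rule that[of w])
    show "(\<Sum>i\<in>UNIV. w f $ i) = 0" if "f \<in> F" for f using w0[OF that] .
    show "\<gamma> f = 0" if \<gamma>: "(\<Sum>f\<in>F. \<gamma> f) = 0" "\<forall>y. (\<Sum>f\<in>F. \<gamma> f * w f $ y) = c" and f: "f \<in> F" for \<gamma> c f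
    proof -
      have \<gamma>2: "(\<Sum>f\<in>F. \<gamma> f * w f $ y) = c" for y using \<gamma>(2) by blast
      have z: "\<gamma> b = 0" if b: "b \<in> F" "b \<noteq> a" for b
      proof -
        obtain x where x: "(\<Sum>i\<in>UNIV. x $ i) = 0" "\<And>g. g \<in> F \<Longrightarrow> g \<noteq> a \<Longrightarrow> W a g \<bullet> x = (if g = b then 1 else 0)"
          by (rule W_dual[OF a, of "\<lambda>g. if g = b then 1 else 0"]) (rule that)
        have wx: "w g \<bullet> x = (if g = b then s b else 0)" if "g \<in> F" for g
        proof (cases "g = a")
          case True
          then show ?thesis using b(2) by (simp add: wa)
        next
          case False
          then show ?thesis by (simp add: w_def x(2)[OF that False])
        qed
        have "(\<Sum>g\<in>F. \<gamma> g * (w g \<bullet> x)) = (\<Sum>y\<in>UNIV. (\<Sum>g\<in>F. \<gamma> g * w g $ y) * x $ y)"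
          unfolding inner_vec_def sum_distrib_left sum_distrib_right by (subst sum.swap) (simp add: mult.assoc)
        also have "\<dots> = 0" unfolding \<gamma>2 using x(1) by (simp flip: sum_distrib_left)
        also have "(\<Sum>g\<in>F. \<gamma> g * (w g \<bullet> x)) = (\<Sum>g\<in>F. if g = b then \<gamma> b * s b else 0)"
          using wx by (intro sum.cong) auto
        finally show ?thesis using b fin_F s[OF b] by simp
      qed
      have "\<gamma> a = 0" using \<gamma>(1) z a fin_F by (simp add: sum.remove[of F a])
      with z f show ?thesis by blast
    qed
    show "x \<in> convex hull f \<longleftrightarrow> (\<forall>g\<in>F. w f \<bullet> (x - q) \<le> w g \<bullet> (x - q))" if f: "f \<in> F" and x: "x \<in> \<Delta>" for f x
    proof -
      have x0: "(\<Sum>i\<in>UNIV. (x - q) $ i) = 0" using x q_interior(3) by (simp add: mem_hypersimplex sum_subtractf)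
      have "x \<in> convex hull f \<longleftrightarrow> x - q \<in> K f" unfolding conv_iff[OF f x] K_def using x0 by simp
      then show ?thesis using suff[OF f x0] nec[OF f] by blast
    qed
  qed
qed

end

context hypersimplex_split
begin

text \<open>The hypothesis \<open>lat\<close> comes from the face condition: the maximal cells
  through \<open>x\<close> intersect in a cell, and its hull is the intersection of their
  hulls.\<close>

lemma split_fan_exists:
  obtains w where "split_fan d F w q"
    "\<And>f x. f \<in> F \<Longrightarrow> x \<in> \<Delta> \<Longrightarrow> x \<in> convex hull f \<longleftrightarrow> (\<forall>g\<in>F. w f \<bullet> (x - q) \<le> w g \<bullet> (x - q))"
proof -
  obtain W where "\<And>a b. a \<in> F \<Longrightarrow> b \<in> F \<Longrightarrow> b \<noteq> a \<Longrightarrow>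
    (\<Sum>i\<in>UNIV. W a b $ i) = 0 \<and> (\<forall>x\<in>convex hull a. W a b \<bullet> (x - q) \<le> 0) \<and>
    (\<forall>x\<in>convex hull b. 0 \<le> W a b \<bullet> (x - q)) \<and> W a b \<bullet> (mean a - q) < 0"
    using separate by metis
  then interpret separated_split d k \<S> W by unfold_locales
  obtain w where w: "\<And>f. f \<in> F \<Longrightarrow> (\<Sum>i\<in>UNIV. w f $ i) = 0"
    "\<And>\<gamma> c f. (\<Sum>f\<in>F. \<gamma> f) = 0 \<Longrightarrow> \<forall>y. (\<Sum>f\<in>F. \<gamma> f * w f $ y) = c \<Longrightarrow> f \<in> F \<Longrightarrow> \<gamma> f = 0"
    "\<And>f x. f \<in> F \<Longrightarrow> x \<in> \<Delta> \<Longrightarrow> x \<in> convex hull f \<longleftrightarrow> (\<forall>g\<in>F. w f \<bullet> (x - q) \<le> w g \<bullet> (x - q))"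
    by (rule fan_functionals) (rule that)
  have "split_fan d F w q"
  proof (unfold_locales)
    show "x \<in> convex hull (e_set ` {J. card J = d \<and>
          {f\<in>F. \<forall>g\<in>F. w f \<bullet> (x - q) \<le> w g \<bullet> (x - q)} \<subseteq>
          {f\<in>F. \<forall>g\<in>F. w f \<bullet> (e_set J - q) \<le> w g \<bullet> (e_set J - q)}})" if x: "x \<in> \<Delta>" for x
    proof -
      define A where "A = {f\<in>F. \<forall>g\<in>F. w f \<bullet> (x - q) \<le> w g \<bullet> (x - q)}"
      have A: "A = {f\<in>F. x \<in> convex hull f}" using w(3) x by (auto simp: A_def)
      have "A \<noteq> {}" using cover[OF x] by (auto simp: A)
      moreover have "A \<subseteq> \<S>" "finite A" using F_S fin_F by (auto simp: A)
      ultimately have I: "(\<Inter>C\<in>A. convex hull C) = convex hull (\<Inter>A)" "\<Inter>A \<in> \<S>" using cells_Inter[OF sub] by auto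
      have "x \<in> convex hull (\<Inter>A)" unfolding I(1)[symmetric] by (auto simp: A)
      moreover have "\<Inter>A \<subseteq> e_set ` {J. card J = d \<and> A \<subseteq>
          {f\<in>F. \<forall>g\<in>F. w f \<bullet> (e_set J - q) \<le> w g \<bullet> (e_set J - q)}}"
      proof
        fix p assume p: "p \<in> \<Inter>A"
        then have "p \<in> V" using subdivision_finite(4)[OF sub I(2)] by blast
        then obtain J where J: "card J = d" "p = e_set J" by (auto simp: V_eq)
        have "f \<in> {f\<in>F. \<forall>g\<in>F. w f \<bullet> (e_set J - q) \<le> w g \<bullet> (e_set J - q)}" if "f \<in> A" for f
        proof -
          have "f \<in> F" "p \<in> convex hull f" using that p by (auto simp: A hull_inc)
          then show ?thesis using w(3)[of f p] J by simp
        qed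
        then show "p \<in> e_set ` {J. card J = d \<and> A \<subseteq>
          {f\<in>F. \<forall>g\<in>F. w f \<bullet> (e_set J - q) \<le> w g \<bullet> (e_set J - q)}}" using J by blast
      qed
      ultimately show ?thesis using hull_mono unfolding A_def[symmetric] by blast
    qed
    show "\<gamma> f = 0" if "sum \<gamma> F = 0" "\<And>y. (\<Sum>f\<in>F. \<gamma> f * w f $ y) = c" "f \<in> F" for \<gamma> c f
      using w(2)[OF that(1) _ that(3)] that(2) by blast
  qed (fact d_pos d_less fin_F card_F q_interior | erule w(1))+
  then show ?thesis using w(3) by (rule that)
qed

end

subsection \<open>Subdivisions induced by piecewise linear functions\<close>

text \<open>The last coordinate of a lower normal is positive and can be scaled to 1; a lower face
  is then the contact set of an affine function below the height.\<close>

lemma regular_subdivision_eq: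
  fixes P :: "'a::euclidean_space set"
  shows "regular_subdivision P h = {C. \<exists>a b. (\<forall>p\<in>P. b \<le> a \<bullet> p + h p) \<and> C = {p\<in>P. a \<bullet> p + h p = b}}"
    (is "_ = ?R")
proof (intro equalityI subsetI)
  let ?Q = "convex hull (lifted P h)"
  have mem: "(p, h p) \<in> ?Q" if "p \<in> P" for p using that by (auto simp: lifted_def intro: hull_inc)
  fix C
  {
    assume "C \<in> regular_subdivision P h"
    then obtain a t b where t: "0 < t" "\<forall>x\<in>?Q. b \<le> (a, t) \<bullet> x"
      and C: "C = {p\<in>P. (p, h p) \<in> {x\<in>?Q. (a, t) \<bullet> x = b}}"
      unfolding regular_subdivision_def lower_face_def by auto
    have e: "((1 / t) *\<^sub>R a) \<bullet> p + h p = (a \<bullet> p + t * h p) / t" for p using t by (simp add: field_simps)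
    have "\<forall>p\<in>P. b / t \<le> ((1 / t) *\<^sub>R a) \<bullet> p + h p"
      unfolding e using t mem by (fastforce simp: divide_right_mono)
    moreover have "C = {p\<in>P. ((1 / t) *\<^sub>R a) \<bullet> p + h p = b / t}"
      unfolding e C using t mem by auto
    ultimately show "C \<in> ?R" by blast
  next
    assume "C \<in> ?R"
    then obtain a b where ab: "\<forall>p\<in>P. b \<le> a \<bullet> p + h p" and C: "C = {p\<in>P. a \<bullet> p + h p = b}" by blast
    have "lifted P h \<subseteq> {x. (a, 1) \<bullet> x \<ge> b}" using ab by (auto simp: lifted_def)
    then have "?Q \<subseteq> {x. (a, 1) \<bullet> x \<ge> b}" by (intro hull_minimal convex_halfspace_ge)
    then have "lower_face {x\<in>?Q. (a, 1) \<bullet> x = b} ?Q"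
      unfolding lower_face_def by (intro exI[of _ a] exI[of _ "1::real"] exI[of _ b]) auto
    moreover have "C = {p\<in>P. (p, h p) \<in> {x\<in>?Q. (a, 1) \<bullet> x = b}}" using C mem by auto
    ultimately show "C \<in> regular_subdivision P h" unfolding regular_subdivision_def by blast
  }
qed

lemma regular_subdivision_cong:
  assumes "\<And>p. p \<in> P \<Longrightarrow> h p = h' p" shows "regular_subdivision P h = regular_subdivision P h'"
  using assms unfolding regular_subdivision_eq by (intro Collect_cong ex_cong1) (auto cong: conj_cong)

lemma small_eps:
  fixes A B :: "'s \<Rightarrow> real"
  assumes "finite S" "\<And>s. s \<in> S \<Longrightarrow> 0 < A s"
  obtains e where "0 < e" "\<And>t s. \<bar>t\<bar> \<le> e \<Longrightarrow> s \<in> S \<Longrightarrow> \<bar>t * B s\<bar> < A s"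
proof -
  define e where "e = Min (insert 1 ((\<lambda>s. A s / (1 + \<bar>B s\<bar>)) ` S))"
  have pos: "e > 0" unfolding e_def using assms by (subst Min_gr_iff) (auto intro!: divide_pos_pos add_pos_nonneg)
  show ?thesis
  proof (rule that[OF pos])
    fix t s assume t: "\<bar>t\<bar> \<le> e" and s: "s \<in> S"
    have "e \<le> A s / (1 + \<bar>B s\<bar>)" unfolding e_def using assms(1) s by (intro Min_le) auto
    then have "e * (1 + \<bar>B s\<bar>) \<le> A s" by (simp add: pos_le_divide_eq add_pos_nonneg)
    moreover have "\<bar>t * B s\<bar> \<le> e * \<bar>B s\<bar>" unfolding abs_mult using t by (intro mult_right_mono) auto
    ultimately show "\<bar>t * B s\<bar> < A s" using pos by (simp add: algebra_simps)
  qed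
qed

lemma convex_hull_halfspace: "x \<in> convex hull S \<Longrightarrow> (\<And>p. p \<in> S \<Longrightarrow> b \<le> a \<bullet> p) \<Longrightarrow> b \<le> a \<bullet> x"
  using hull_minimal[of S "{x. a \<bullet> x \<ge> b}" convex] convex_halfspace_ge[of b a] by auto

lemma hull_Int_hyperplane:
  fixes C :: "'a::euclidean_space set"
  assumes fin: "finite C" and ge: "\<And>p. p \<in> C \<Longrightarrow> b \<le> a \<bullet> p" and x: "x \<in> convex hull C" "a \<bullet> x = b"
  shows "x \<in> convex hull {p\<in>C. a \<bullet> p = b}"
proof -
  have "convex hull C \<inter> {x. a \<bullet> x = b} face_of convex hull C"
    using convex_hull_halfspace[OF _ ge] by (intro face_of_Int_supporting_hyperplane_ge convex_convex_hull) blast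
  from face_of_convex_hull_subset[OF finite_imp_compact[OF fin] this]
  obtain S where S: "S \<subseteq> C" "convex hull C \<inter> {x. a \<bullet> x = b} = convex hull S" by blast
  have "S \<subseteq> {p\<in>C. a \<bullet> p = b}" using S hull_subset[of S convex] by blast
  then show ?thesis using S(2) x hull_mono by blast
qed

text \<open>Heights of the form \<open>max\<^sub>f (g f \<bullet> x + c f)\<close>. The assumption \<open>tight\<close> says that the domains of
  linearity, and all their intersections, are spanned by points of \<open>P\<close>.\<close>

locale pl_data =
  fixes P :: "'a::euclidean_space set" and F :: "'f set" and g :: "'f \<Rightarrow> 'a" and c :: "'f \<Rightarrow> real"
  assumes fin_P: "finite P" and fin_F: "finite F" and F_ne: "F \<noteq> {}"
    and tight: "\<And>x. x \<in> convex hull P \<Longrightarrow> x \<in> convex hull {p\<in>P.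
      {f\<in>F. \<forall>e\<in>F. g e \<bullet> x + c e \<le> g f \<bullet> x + c f} \<subseteq> {f\<in>F. \<forall>e\<in>F. g e \<bullet> p + c e \<le> g f \<bullet> p + c f}}"
begin

definition psi :: "'f \<Rightarrow> 'a \<Rightarrow> real" where "psi f x = g f \<bullet> x + c f"

definition amx :: "'a \<Rightarrow> 'f set" where "amx x = {f\<in>F. \<forall>e\<in>F. psi e x \<le> psi f x}"

definition ht :: "'a \<Rightarrow> real" where "ht x = Max ((\<lambda>f. psi f x) ` F)"

definition cell :: "'f \<Rightarrow> 'a set" where "cell f = {p\<in>P. f \<in> amx p}"

abbreviation "RS \<equiv> regular_subdivision P ht"

lemma psi_add: "psi f (x + t *\<^sub>R u) = psi f x + t * (g f \<bullet> u)"
  by (simp add: psi_def inner_add_right)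

lemma tight_amx: "x \<in> convex hull P \<Longrightarrow> x \<in> convex hull {p\<in>P. amx x \<subseteq> amx p}"
  unfolding amx_def psi_def by (rule tight)

lemma amx_nonempty: "amx x \<noteq> {}"
proof -
  obtain f where "f \<in> F" "\<forall>e\<in>F. - psi f x \<le> - psi e x"
    using arg_min_if_finite[OF fin_F F_ne, of "\<lambda>f. - psi f x"] by (metis not_less)
  then show ?thesis by (auto simp: amx_def)
qed

lemma ht_ge: "f \<in> F \<Longrightarrow> psi f x \<le> ht x"
  unfolding ht_def using fin_F by (intro Max_ge) auto

lemma ht_eq_iff: "f \<in> F \<Longrightarrow> psi f x = ht x \<longleftrightarrow> f \<in> amx x"
proof
  assume f: "f \<in> F" "psi f x = ht x"
  then show "f \<in> amx x" using ht_ge by (auto simp: amx_def)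
next
  assume "f \<in> F" "f \<in> amx x"
  then show "psi f x = ht x" unfolding ht_def amx_def using fin_F by (intro Max_eqI[symmetric]) auto
qed

lemma cell_P: "cell f \<subseteq> P" by (auto simp: cell_def)

lemma fin_cell: "finite (cell f)" using cell_P fin_P finite_subset by blast

lemma cell_hull_iff:
  assumes x: "x \<in> convex hull P" and f: "f \<in> F"
  shows "x \<in> convex hull (cell f) \<longleftrightarrow> f \<in> amx x"
proof
  assume xf: "x \<in> convex hull (cell f)"
  have "psi e x \<le> psi f x" if e: "e \<in> F" for e
  proof -
    have "c e - c f \<le> (g f - g e) \<bullet> x"
      using e f by (intro convex_hull_halfspace[OF xf]) (auto simp: cell_def amx_def psi_def inner_diff_left algebra_simps)
    then show ?thesis by (simp add: psi_def inner_diff_left)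
  qed
  then show "f \<in> amx x" using f by (simp add: amx_def)
next
  assume "f \<in> amx x"
  then have "{p\<in>P. amx x \<subseteq> amx p} \<subseteq> cell f" by (auto simp: cell_def)
  then show "x \<in> convex hull (cell f)" using tight_amx[OF x] hull_mono by blast
qed

lemma cell_RS: "f \<in> F \<Longrightarrow> cell f \<in> RS"
  unfolding regular_subdivision_eq
proof (intro CollectI exI[of _ "- g f"] exI[of _ "c f"] conjI ballI)
  assume f: "f \<in> F"
  show "c f \<le> - g f \<bullet> p + ht p" for p using ht_ge[OF f, of p] by (simp add: psi_def)
  have "- g f \<bullet> p + ht p = c f \<longleftrightarrow> psi f p = ht p" for p by (auto simp: psi_def)
  then show "cell f = {p \<in> P. - g f \<bullet> p + ht p = c f}" by (simp add: ht_eq_iff[OF f] cell_def)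
qed

lemma cover: "x \<in> convex hull P \<Longrightarrow> \<exists>f\<in>F. x \<in> convex hull (cell f)"
  using amx_nonempty[of x] cell_hull_iff[of x] by (auto simp: amx_def)

text \<open>A face of a cell is exposed, and a slight tilt of the supporting functional of the cell
  cuts it out without violating the strict inequalities elsewhere. Two cells intersect where their
  supporting functionals agree.\<close>

lemma RS_subdivision: "subdivision P RS"
  unfolding subdivision_def
proof (intro conjI ballI allI impI)
  show "finite P" by (rule fin_P)
  show sub: "C \<subseteq> P" if "C \<in> RS" for C using that unfolding regular_subdivision_eq by blast
  show "(\<Union>C\<in>RS. convex hull C) = convex hull P"
  proof
    show "(\<Union>C\<in>RS. convex hull C) \<subseteq> convex hull P" using sub hull_mono by blast
    show "convex hull P \<subseteq> (\<Union>C\<in>RS. convex hull C)" using cover cell_RS by blast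
  qed
  show "E \<in> RS" if C: "C \<in> RS" and E: "config_face E C" for C E
  proof -
    obtain a b where ab: "\<forall>p\<in>P. b \<le> a \<bullet> p + ht p" "C = {p\<in>P. a \<bullet> p + ht p = b}"
      using C unfolding regular_subdivision_eq by blast
    obtain G where G: "G face_of convex hull C" "E = C \<inter> G" using E by (auto simp: config_face_def)
    have "polyhedron (convex hull C)" using sub[OF C] fin_P finite_subset by (intro polyhedron_convex_hull) blast
    then have "G exposed_face_of convex hull C" using G(1) exposed_face_of_polyhedron by blast
    then obtain u s where us: "convex hull C \<subseteq> {x. u \<bullet> x \<le> s}" "G = convex hull C \<inter> {x. u \<bullet> x = s}"
      by (auto simp: exposed_face_of_def)
    have CG: "E = {p\<in>C. u \<bullet> p = s}" unfolding G(2) us(2) by (auto simp: hull_inc)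
    have Cle: "u \<bullet> p \<le> s" if "p \<in> C" for p using subsetD[OF us(1) hull_inc[OF that]] by simp
    obtain e where e: "0 < e" "\<And>t p. \<bar>t\<bar> \<le> e \<Longrightarrow> p \<in> P - C \<Longrightarrow> \<bar>t * (u \<bullet> p - s)\<bar> < a \<bullet> p + ht p - b"
    proof (rule small_eps[of "P - C" "\<lambda>p. a \<bullet> p + ht p - b" "\<lambda>p. u \<bullet> p - s"])
      show "finite (P - C)" using fin_P by simp
      show "0 < a \<bullet> p + ht p - b" if "p \<in> P - C" for p using ab that by (auto simp: order_less_le)
    qed (rule that)
    have strict: "b - e * s < (a - e *\<^sub>R u) \<bullet> p + ht p" if "p \<in> P - C" for p
      using e(2)[of e p] e(1) that by (simp add: inner_diff_left right_diff_distrib abs_less_iff)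
    have inC: "(a - e *\<^sub>R u) \<bullet> p + ht p = b - e * (u \<bullet> p)" if "p \<in> C" for p
      using that ab(2) by (auto simp: inner_diff_left)
    have "b - e * s \<le> (a - e *\<^sub>R u) \<bullet> p + ht p" if "p \<in> P" for p
    proof (cases "p \<in> C")
      case True
      then show ?thesis using inC[OF True] Cle[OF True] e(1) by simp
    qed (use strict[of p] that in simp)
    moreover have "E = {p\<in>P. (a - e *\<^sub>R u) \<bullet> p + ht p = b - e * s}"
    proof (intro equalityI subsetI)
      fix p assume "p \<in> E"
      then have "p \<in> C" "u \<bullet> p = s" by (auto simp: CG)
      then show "p \<in> {p\<in>P. (a - e *\<^sub>R u) \<bullet> p + ht p = b - e * s}" using inC sub[OF C] by auto
    next
      fix p assume p: "p \<in> {p\<in>P. (a - e *\<^sub>R u) \<bullet> p + ht p = b - e * s}"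
      then have "p \<in> C" using strict[of p] by fastforce
      then show "p \<in> E" using inC[of p] p e(1) by (simp add: CG)
    qed
    ultimately show ?thesis unfolding regular_subdivision_eq
      by (intro CollectI exI[of _ "a - e *\<^sub>R u"] exI[of _ "b - e * s"] conjI ballI)
  qed
  have pair: "config_face (C \<inter> D) C \<and> convex hull C \<inter> convex hull D \<subseteq> convex hull (C \<inter> D)"
    if CD: "C \<in> RS" "D \<in> RS" for C D
  proof -
    obtain a b where ab: "\<forall>p\<in>P. b \<le> a \<bullet> p + ht p" "C = {p\<in>P. a \<bullet> p + ht p = b}"
      using CD(1) unfolding regular_subdivision_eq by blast
    obtain a' b' where ab': "\<forall>p\<in>P. b' \<le> a' \<bullet> p + ht p" "D = {p\<in>P. a' \<bullet> p + ht p = b'}"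
      using CD(2) unfolding regular_subdivision_eq by blast
    have e: "C \<inter> D = {p\<in>C. (a' - a) \<bullet> p = b' - b}"
      using ab(2) ab'(2) by (auto simp: inner_diff_left)
    have ge: "b' - b \<le> (a' - a) \<bullet> p" if "p \<in> C" for p
      using that ab(2) ab'(1) by (auto simp: inner_diff_left)
    have le: "b - b' \<le> (a - a') \<bullet> p" if "p \<in> D" for p
      using that ab'(2) ab(1) by (auto simp: inner_diff_left)
    have finC: "finite C" using sub[OF CD(1)] fin_P finite_subset by blast
    have "x \<in> convex hull (C \<inter> D)" if "x \<in> convex hull C" "x \<in> convex hull D" for x
    proof -
      have "(a' - a) \<bullet> x = b' - b"
        using convex_hull_halfspace[OF that(1) ge] convex_hull_halfspace[OF that(2) le] by (simp add: inner_diff_left)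
      then show ?thesis unfolding e using hull_Int_hyperplane[OF finC ge that(1)] by simp
    qed
    then show ?thesis unfolding e using config_face_halfspace[of C "b' - b" "a' - a"] ge e by blast
  qed
  fix C D assume CD: "C \<in> RS" "D \<in> RS"
  show "config_face (C \<inter> D) C" using pair[OF CD] by blast
  show "config_face (C \<inter> D) D" using pair[OF CD(2,1)] by (simp add: Int_commute)
  show "convex hull C \<inter> convex hull D = convex hull (C \<inter> D)"
    using pair[OF CD] hull_mono[of "C \<inter> D" C convex] hull_mono[of "C \<inter> D" D convex] by blast
qed

lemma subdivision_below_cells:
  assumes T: "subdivision P \<T>" "\<And>f. f \<in> F \<Longrightarrow> cell f \<in> \<T>" and E: "E \<in> \<T>"
  shows "\<exists>f\<in>F. E \<subseteq> cell f"
proof (cases "E = {}")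
  case True
  then show ?thesis using F_ne by blast
next
  case False
  have "mean E \<in> convex hull P"
    using mean_in_hull[OF subdivision_finite(3)[OF T(1) E] False] hull_mono[OF subdivision_finite(4)[OF T(1) E]] by blast
  then obtain f where f: "f \<in> F" "mean E \<in> convex hull (cell f)" using cover by blast
  then show ?thesis using mean_in_cell[OF T(1) E False T(2)[OF f(1)] f(2)] by blast
qed

text \<open>By \<open>subdivision_below_cells\<close> every further cell lies in one of the cells of
  linearity, hence is one of its faces.\<close>

lemma RS_unique:
  assumes T: "subdivision P \<T>" "\<And>f. f \<in> F \<Longrightarrow> cell f \<in> \<T>"
  shows "\<T> = RS"
proof -
  have le: "\<A> \<subseteq> \<B>" if A: "subdivision P \<A>" "\<And>f. f \<in> F \<Longrightarrow> cell f \<in> \<A>"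
    and B: "subdivision P \<B>" "\<And>f. f \<in> F \<Longrightarrow> cell f \<in> \<B>" for \<A> \<B>
  proof
    fix E assume E: "E \<in> \<A>"
    obtain f where f: "f \<in> F" "E \<subseteq> cell f" using subdivision_below_cells[OF A E] by blast
    have "config_face (cell f \<inter> E) (cell f)" using cell_Int(2)[OF A(1) A(2)[OF f(1)] E] .
    then have "config_face E (cell f)" using f(2) by (simp add: Int_absorb1)
    then show "E \<in> \<B>" using B f(1) by (auto simp: subdivision_def)
  qed
  show ?thesis using le[OF T RS_subdivision cell_RS] le[OF RS_subdivision cell_RS T] by blast
qed

end

section \<open>Piecewise linear heights that induce k-splits\<close>

locale pl_split = pl_data P F g c
  for P :: "'a::euclidean_space set" and F :: "'f set" and g c +
  fixes \<mu> :: "'a \<Rightarrow> real" and q :: 'a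
  assumes card_F: "2 \<le> card F"
    and mu: "\<And>p. p \<in> P \<Longrightarrow> 0 < \<mu> p" "sum \<mu> P = 1" and q_def: "q = (\<Sum>p\<in>P. \<mu> p *\<^sub>R p)"
    and q_all: "\<And>e f. e \<in> F \<Longrightarrow> f \<in> F \<Longrightarrow> g e \<bullet> q + c e = g f \<bullet> q + c f"
    and indep: "\<And>\<gamma> k f. sum \<gamma> F = 0 \<Longrightarrow> (\<And>p. p \<in> P \<Longrightarrow> (\<Sum>f\<in>F. \<gamma> f * (g f \<bullet> p + c f)) = k) \<Longrightarrow> f \<in> F \<Longrightarrow> \<gamma> f = 0"
begin

definition U :: "'a set" where "U = span ((\<lambda>p. - q + p) ` P)"

lemma q_P: "q \<in> convex hull P"
  unfolding convex_hull_finite[OF fin_P] using mu q_def by (intro CollectI exI[of _ \<mu>]) (auto simp: less_imp_le)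

lemma psi_q: "e \<in> F \<Longrightarrow> f \<in> F \<Longrightarrow> psi e q = psi f q"
  unfolding psi_def by (rule q_all)

lemma amx_q: "amx q = F"
  unfolding amx_def using eq_refl[OF psi_q] by blast

lemma diff_U: "x \<in> convex hull P \<Longrightarrow> x - q \<in> U"
proof -
  have "convex hull P \<subseteq> affine hull P" by (rule convex_hull_subset_affine_hull)
  moreover have "affine hull P = (\<lambda>x. q + x) ` U"
    unfolding U_def using q_P convex_hull_subset_affine_hull by (intro affine_hull_span_gen) blast
  ultimately show "x \<in> convex hull P \<Longrightarrow> x - q \<in> U" by auto
qed

lemma subspace_U: "subspace U" unfolding U_def by (rule subspace_span)

text \<open>Relative interior in a form suited to linear arguments: room in every direction of
  \<open>U\<close>, where the amount may depend on the direction.\<close>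

definition inn :: "'a \<Rightarrow> bool" where
  "inn x \<longleftrightarrow> x \<in> convex hull P \<and> (\<forall>u\<in>U. \<exists>e>0. \<forall>t. \<bar>t\<bar> \<le> e \<longrightarrow> x + t *\<^sub>R u \<in> convex hull P)"

lemma innE:
  assumes "inn x" "u \<in> U"
  obtains e where "e > 0" "\<And>t. \<bar>t\<bar> \<le> e \<Longrightarrow> x + t *\<^sub>R u \<in> convex hull P"
proof -
  have "\<exists>e>0. \<forall>t. \<bar>t\<bar> \<le> e \<longrightarrow> x + t *\<^sub>R u \<in> convex hull P"
    using assms unfolding inn_def by (elim conjE) (rule bspec)
  then show ?thesis using that by blast
qed

lemma inn_q: "inn q"
  unfolding inn_def
proof (intro conjI ballI q_P)
  fix u assume "u \<in> U"
  then obtain r where r: "u = (\<Sum>v\<in>(\<lambda>p. - q + p) ` P. r v *\<^sub>R v)"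
    unfolding U_def using fin_P by (auto simp: span_finite)
  define s where "s p = r (- q + p)" for p
  have u: "u = (\<Sum>p\<in>P. s p *\<^sub>R (p - q))"
    unfolding r s_def by (subst sum.reindex) (auto simp: inj_on_def)
  define R where "R = sum s P"
  obtain e where e: "0 < e" "\<And>t p. \<bar>t\<bar> \<le> e \<Longrightarrow> p \<in> P \<Longrightarrow> \<bar>t * (s p - R * \<mu> p)\<bar> < \<mu> p"
    by (rule small_eps[of P \<mu> "\<lambda>p. s p - R * \<mu> p"]) (use fin_P mu in auto)
  show "\<exists>e>0. \<forall>t. \<bar>t\<bar> \<le> e \<longrightarrow> q + t *\<^sub>R u \<in> convex hull P"
  proof (intro exI[of _ e] conjI allI impI e(1))
    fix t assume t: "\<bar>t\<bar> \<le> e"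
    \<comment> \<open>Subtracting a multiple of \<open>\<mu>\<close> keeps the total weight 1 and
      accounts for the terms in \<open>q\<close> of \<open>u\<close>.\<close>
    define \<nu> where "\<nu> p = \<mu> p + t * (s p - R * \<mu> p)" for p
    have "0 \<le> \<nu> p" if "p \<in> P" for p using e(2)[OF t that] by (simp add: \<nu>_def abs_less_iff)
    moreover have "sum \<nu> P = 1"
      using mu(2) by (simp add: \<nu>_def sum.distrib sum_subtractf R_def flip: sum_distrib_left)
    moreover have "(\<Sum>p\<in>P. \<nu> p *\<^sub>R p) = q + t *\<^sub>R u"
    proof -
      have "u = (\<Sum>p\<in>P. s p *\<^sub>R p) - R *\<^sub>R q"
        unfolding u R_def by (simp add: scaleR_diff_right sum_subtractf scaleR_sum_left)
      moreover have "(\<Sum>p\<in>P. \<nu> p *\<^sub>R p) = (\<Sum>p\<in>P. \<mu> p *\<^sub>R p) + t *\<^sub>R ((\<Sum>p\<in>P. s p *\<^sub>R p) - R *\<^sub>R (\<Sum>p\<in>P. \<mu> p *\<^sub>R p))"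
        unfolding \<nu>_def by (simp add: scaleR_add_left scaleR_diff_left sum.distrib sum_subtractf scaleR_sum_right algebra_simps)
      ultimately show ?thesis using q_def by simp
    qed
    ultimately show "q + t *\<^sub>R u \<in> convex hull P"
      unfolding convex_hull_finite[OF fin_P] by blast
  qed
qed

lemma inn_mix:
  assumes x: "inn x" and y: "y \<in> convex hull P" and s: "0 < s" "s \<le> 1"
  shows "inn (y + s *\<^sub>R (x - y))"
proof -
  have mix: "y + s *\<^sub>R (z - y) \<in> convex hull P" if "z \<in> convex hull P" for z
  proof -
    have "(1 - s) *\<^sub>R y + s *\<^sub>R z \<in> convex hull P" using that y s by (intro convexD[OF convex_convex_hull]) auto
    then show ?thesis by (simp add: algebra_simps)
  qed
  show ?thesis unfolding inn_def
  proof (intro conjI ballI)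
    show "y + s *\<^sub>R (x - y) \<in> convex hull P" using mix x by (simp add: inn_def)
    fix u assume "u \<in> U"
    obtain e where e: "e > 0" "\<And>t. \<bar>t\<bar> \<le> e \<Longrightarrow> x + t *\<^sub>R u \<in> convex hull P" by (rule innE[OF x \<open>u \<in> U\<close>]) (rule that)
    show "\<exists>e>0. \<forall>t. \<bar>t\<bar> \<le> e \<longrightarrow> y + s *\<^sub>R (x - y) + t *\<^sub>R u \<in> convex hull P"
    proof (intro exI[of _ "s * e"] conjI allI impI)
      show "0 < s * e" using s e by simp
      fix t assume "\<bar>t\<bar> \<le> s * e"
      then have "\<bar>t / s\<bar> \<le> e" using s by (simp add: abs_mult field_simps)
      from mix[OF e(2)[OF this]] show "y + s *\<^sub>R (x - y) + t *\<^sub>R u \<in> convex hull P"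
        using s by (simp add: algebra_simps)
    qed
  qed
qed

lemma interior_of_cell:
  assumes x: "inn x" "amx x = {f}" and u: "u \<in> U"
  obtains e where "0 < e" "\<And>t. \<bar>t\<bar> \<le> e \<Longrightarrow> x + t *\<^sub>R u \<in> convex hull (cell f)"
proof -
  have f: "f \<in> F" using x(2) by (auto simp: amx_def)
  have lt: "psi h x < psi f x" if "h \<in> F - {f}" for h
  proof (rule ccontr)
    assume n: "\<not> ?thesis"
    have "psi e x \<le> psi f x" if "e \<in> F" for e
    proof -
      have "f \<in> amx x" using x(2) by simp
      then show ?thesis using that unfolding amx_def by blast
    qed
    then have "psi e x \<le> psi h x" if "e \<in> F" for e using n that order_trans by (metis linorder_not_le order_less_imp_le)
    then have "h \<in> amx x" using that by (simp add: amx_def)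
    then show False using x(2) that by simp
  qed
  obtain e1 where e1: "0 < e1" "\<And>t. \<bar>t\<bar> \<le> e1 \<Longrightarrow> x + t *\<^sub>R u \<in> convex hull P"
    by (rule innE[OF x(1) u]) (rule that)
  obtain e2 where e2: "0 < e2" "\<And>t h. \<bar>t\<bar> \<le> e2 \<Longrightarrow> h \<in> F - {f} \<Longrightarrow> \<bar>t * (g h \<bullet> u - g f \<bullet> u)\<bar> < psi f x - psi h x"
    by (rule small_eps[of "F - {f}" "\<lambda>h. psi f x - psi h x" "\<lambda>h. g h \<bullet> u - g f \<bullet> u"]) (use fin_F lt in auto)
  show ?thesis
  proof (rule that[of "min e1 e2"])
    show "0 < min e1 e2" using e1 e2 by simp
    fix t assume t: "\<bar>t\<bar> \<le> min e1 e2"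
    have "psi h (x + t *\<^sub>R u) \<le> psi f (x + t *\<^sub>R u)" if "h \<in> F" for h
      using e2(2)[of t h] t that by (cases "h = f") (auto simp: psi_add right_diff_distrib abs_less_iff)
    then have "f \<in> amx (x + t *\<^sub>R u)" using f by (simp add: amx_def)
    then show "x + t *\<^sub>R u \<in> convex hull (cell f)" using e1(2) t f by (subst cell_hull_iff) auto
  qed
qed

text \<open>Orthogonal projection of the gradients to the direction space of \<^term>\<open>P\<close> turns the independence
  assumption into linear independence.\<close>

lemma projected_gradients:
  obtains y where "\<And>f. f \<in> F \<Longrightarrow> y f \<in> U" "\<And>f u. u \<in> U \<Longrightarrow> y f \<bullet> u = g f \<bullet> u"
    "\<And>f0. f0 \<in> F \<Longrightarrow> independent ((\<lambda>f. y f - y f0) ` (F - {f0})) \<and> inj_on (\<lambda>f. y f - y f0) (F - {f0})"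
proof -
  have "\<exists>y. y \<in> U \<and> (\<forall>u\<in>U. y \<bullet> u = g f \<bullet> u)" for f
  proof -
    obtain y z where yz: "y \<in> span U" "\<And>w. w \<in> span U \<Longrightarrow> orthogonal z w" "g f = y + z"
      using orthogonal_subspace_decomp_exists[of U "g f"] by metis
    have sU: "span U = U" using subspace_U by (simp add: span_eq_iff)
    have "y \<bullet> u = g f \<bullet> u" if "u \<in> U" for u
      using yz that by (simp add: sU inner_add_left orthogonal_def)
    then show ?thesis using yz(1) sU by auto
  qed
  then obtain y where y: "\<And>f. y f \<in> U" "\<And>f u. u \<in> U \<Longrightarrow> y f \<bullet> u = g f \<bullet> u" by metis
  have key: "r f = 0" if f0: "f0 \<in> F" and z: "(\<Sum>f\<in>F - {f0}. r f *\<^sub>R (y f - y f0)) = 0" and f: "f \<in> F - {f0}" for r f f0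
  proof -
    define \<gamma> where "\<gamma> f = (if f = f0 then - (\<Sum>f\<in>F - {f0}. r f) else r f)" for f
    have Fs: "(\<Sum>f\<in>F. h f) = h f0 + (\<Sum>f\<in>F - {f0}. h f)" for h :: "'f \<Rightarrow> real"
      using fin_F f0 by (rule sum.remove)
    have s0: "sum \<gamma> F = 0" unfolding Fs by (simp add: \<gamma>_def)
    have "(\<Sum>f\<in>F. \<gamma> f * (g f \<bullet> p + c f)) = 0" if p: "p \<in> P" for p
    proof -
      have pq: "p - q \<in> U" using p by (intro diff_U hull_inc)
      have "(\<Sum>f\<in>F. \<gamma> f * (g f \<bullet> p + c f)) = (\<Sum>f\<in>F. \<gamma> f * (g f \<bullet> (p - q)) + \<gamma> f * (g f0 \<bullet> q + c f0))"
      proof (intro sum.cong refl)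
        fix f assume "f \<in> F"
        then have "g f \<bullet> q + c f = g f0 \<bullet> q + c f0" using q_all f0 by blast
        then have "g f \<bullet> p + c f = g f \<bullet> (p - q) + (g f0 \<bullet> q + c f0)" by (simp add: inner_diff_right)
        then show "\<gamma> f * (g f \<bullet> p + c f) = \<gamma> f * (g f \<bullet> (p - q)) + \<gamma> f * (g f0 \<bullet> q + c f0)"
          by (simp add: distrib_left)
      qed
      also have "\<dots> = (\<Sum>f\<in>F. \<gamma> f * (y f \<bullet> (p - q)))"
        using s0 y(2)[OF pq] by (simp add: sum.distrib flip: sum_distrib_right)
      also have "\<dots> = (\<Sum>f\<in>F - {f0}. r f *\<^sub>R (y f - y f0)) \<bullet> (p - q)"
        unfolding Fs by (simp add: \<gamma>_def inner_sum_left inner_diff_left right_diff_distrib sum_subtractf sum_distrib_right)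
      finally show ?thesis using z by simp
    qed
    then have "\<gamma> f = 0" using indep[OF s0] f by blast
    then show ?thesis using f by (simp add: \<gamma>_def)
  qed
  have inj: "inj_on (\<lambda>f. y f - y f0) (F - {f0})" if f0: "f0 \<in> F" for f0
  proof (rule inj_onI, rule ccontr)
    fix e f assume ef: "e \<in> F - {f0}" "f \<in> F - {f0}" "y e - y f0 = y f - y f0" "e \<noteq> f"
    have "(\<Sum>h\<in>F - {f0}. ((if h = e then 1 else 0) - (if h = f then 1 else 0 :: real)) *\<^sub>R (y h - y f0)) = 0"
      using ef fin_F by (simp add: scaleR_diff_left sum_subtractf if_distrib[of "\<lambda>x. x *\<^sub>R _"] cong: if_cong)
    from key[OF f0 this ef(1)] ef(4) show False by simp
  qed
  have "independent ((\<lambda>f. y f - y f0) ` (F - {f0}))" if f0: "f0 \<in> F" for f0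
    unfolding independent_explicit_finite_subsets
  proof (intro allI impI ballI)
    fix S r v assume S: "S \<subseteq> (\<lambda>f. y f - y f0) ` (F - {f0})" and "finite S" and z: "(\<Sum>v\<in>S. r v *\<^sub>R v) = 0" and v: "v \<in> S"
    define r' where "r' v = (if v \<in> S then r v else 0)" for v
    have "(\<Sum>v\<in>(\<lambda>f. y f - y f0) ` (F - {f0}). r' v *\<^sub>R v) = (\<Sum>v\<in>S. r v *\<^sub>R v)"
      unfolding r'_def using S fin_F by (intro sum.mono_neutral_cong_right) auto
    then have "(\<Sum>f\<in>F - {f0}. r' (y f - y f0) *\<^sub>R (y f - y f0)) = 0"
      using z inj[OF f0] by (simp add: sum.reindex)
    from key[OF f0 this] have "r' v = 0" using S v by auto
    then show "r v = 0" using v by (simp add: r'_def)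
  qed
  then show ?thesis using that[of y] y inj by blast
qed

text \<open>Independence of the projected gradients lets their values relative to \<open>f0\<close>
  be prescribed; the component of the solution orthogonal to \<open>U\<close> does not change them.
  The later arguments choose their directions in this way.\<close>

lemma direction:
  assumes f0: "f0 \<in> F"
  obtains u where "u \<in> U" "\<And>f. f \<in> F \<Longrightarrow> f \<noteq> f0 \<Longrightarrow> g f \<bullet> u - g f0 \<bullet> u = \<phi> f"
proof -
  obtain y where y: "\<And>f. f \<in> F \<Longrightarrow> y f \<in> U" "\<And>f u. u \<in> U \<Longrightarrow> y f \<bullet> u = g f \<bullet> u"
    "\<And>f0. f0 \<in> F \<Longrightarrow> independent ((\<lambda>f. y f - y f0) ` (F - {f0})) \<and> inj_on (\<lambda>f. y f - y f0) (F - {f0})"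
    by (rule projected_gradients) (rule that)
  let ?k = "\<lambda>f. y f - y f0"
  have ind: "independent (?k ` (F - {f0}))" and inj: "inj_on ?k (F - {f0})" using y(3)[OF f0] by auto
  from independent_dual[OF ind, of "\<lambda>x. \<phi> (the_inv_into (F - {f0}) ?k x)"]
  obtain r where r: "\<forall>x\<in>?k ` (F - {f0}). x \<bullet> r = \<phi> (the_inv_into (F - {f0}) ?k x)" by (elim exE)
  obtain u z where uz: "u \<in> span U" "\<And>w. w \<in> span U \<Longrightarrow> orthogonal z w" "r = u + z"
    using orthogonal_subspace_decomp_exists[of U r] by metis
  have sU: "span U = U" using subspace_U by (simp add: span_eq_iff)
  have u: "u \<in> U" using uz(1) sU by simp
  show ?thesis
  proof (rule that[OF u])
    fix f assume f: "f \<in> F" "f \<noteq> f0"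
    have "?k f \<in> U" using y(1) f f0 subspace_U by (intro subspace_diff) auto
    then have "?k f \<bullet> z = 0" using uz(2)[of "?k f"] sU by (simp add: orthogonal_def inner_commute)
    moreover have "?k f \<bullet> r = \<phi> f" using r f the_inv_into_f_f[OF inj, of f] by simp
    ultimately have "?k f \<bullet> u = \<phi> f" by (simp add: uz(3) inner_add_right)
    then show "g f \<bullet> u - g f0 \<bullet> u = \<phi> f" using y(2)[OF u] by (simp add: inner_diff_left)
  qed
qed

lemma near_q:
  assumes f: "f \<in> F" and u: "u \<in> U" "\<And>h. h \<in> F \<Longrightarrow> h \<noteq> f \<Longrightarrow> g h \<bullet> u \<le> g f \<bullet> u"
  obtains e where "0 < e" "\<And>t. 0 \<le> t \<Longrightarrow> t \<le> e \<Longrightarrow> q + t *\<^sub>R u \<in> convex hull (cell f)"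
proof -
  obtain e where e: "e > 0" "\<And>t. \<bar>t\<bar> \<le> e \<Longrightarrow> q + t *\<^sub>R u \<in> convex hull P" by (rule innE[OF inn_q u(1)]) (rule that)
  show ?thesis
  proof (rule that[OF e(1)])
    fix t assume t: "0 \<le> t" "t \<le> e"
    have "psi h (q + t *\<^sub>R u) \<le> psi f (q + t *\<^sub>R u)" if h: "h \<in> F" for h
    proof -
      have "g h \<bullet> u \<le> g f \<bullet> u" using u(2)[OF h] by (cases "h = f") auto
      then have "t * (g h \<bullet> u) \<le> t * (g f \<bullet> u)" using t(1) by (rule mult_left_mono)
      then show ?thesis using psi_q[OF h f] by (simp add: psi_add)
    qed
    then have "f \<in> amx (q + t *\<^sub>R u)" using f by (simp add: amx_def)
    then show "q + t *\<^sub>R u \<in> convex hull (cell f)" using e(2) t f by (subst cell_hull_iff) auto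
  qed
qed

text \<open>Along a direction in which \<open>f\<close> beats all other pieces strictly, half of the
  admissible step keeps the point in the relative interior.\<close>

lemma exists_single:
  assumes f: "f \<in> F" obtains x where "inn x" "amx x = {f}"
proof -
  obtain u where u: "u \<in> U" "\<And>h. h \<in> F \<Longrightarrow> h \<noteq> f \<Longrightarrow> g h \<bullet> u - g f \<bullet> u = -1"
    by (rule direction[OF f, of "\<lambda>_. -1"]) (rule that)
  obtain e where e: "e > 0" "\<And>t. \<bar>t\<bar> \<le> e \<Longrightarrow> q + t *\<^sub>R u \<in> convex hull P" by (rule innE[OF inn_q u(1)]) (rule that)
  have "inn ((q + e *\<^sub>R u) + (1/2) *\<^sub>R (q - (q + e *\<^sub>R u)))"
    using e by (intro inn_mix inn_q) auto
  also have "(q + e *\<^sub>R u) + (1/2) *\<^sub>R (q - (q + e *\<^sub>R u)) = q + (e / 2) *\<^sub>R u"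
    by (simp add: algebra_simps flip: scaleR_add_left)
  finally have "inn (q + (e / 2) *\<^sub>R u)" .
  moreover have "amx (q + (e / 2) *\<^sub>R u) = {f}"
  proof -
    have "psi h (q + (e / 2) *\<^sub>R u) = psi f (q + (e / 2) *\<^sub>R u) - e / 2" if "h \<in> F" "h \<noteq> f" for h
    proof -
      have "g h \<bullet> u = g f \<bullet> u - 1" using u(2)[OF that] by simp
      then show ?thesis using psi_q[OF that(1) f] by (simp add: psi_add right_diff_distrib)
    qed
    then show ?thesis using f e(1) by (fastforce simp: amx_def)
  qed
  ultimately show ?thesis using that by blast
qed

lemma cell_subset_eq:
  assumes "e \<in> F" "f \<in> F" "cell e \<subseteq> cell f" shows "e = f"
proof -
  obtain x where x: "inn x" "amx x = {e}" using exists_single[OF assms(1)] .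
  have xP: "x \<in> convex hull P" using x by (simp add: inn_def)
  have "x \<in> convex hull (cell e)" using cell_hull_iff[OF xP assms(1)] x(2) by simp
  then have "x \<in> convex hull (cell f)" using hull_mono[OF assms(3)] by blast
  then show ?thesis using cell_hull_iff[OF xP assms(2)] x(2) by simp
qed

lemma maximal_RS: "maximal_cells RS = cell ` F"
proof (intro equalityI subsetI)
  fix C assume C: "C \<in> maximal_cells RS"
  then obtain f where "f \<in> F" "C \<subseteq> cell f"
    using subdivision_below_cells[OF RS_subdivision cell_RS, of C] by (auto simp: maximal_cells_def)
  then show "C \<in> cell ` F" using C cell_RS by (auto simp: maximal_cells_def)
next
  fix C assume "C \<in> cell ` F"
  then obtain f where f: "f \<in> F" "C = cell f" by blast
  have "D = cell f" if D: "D \<in> RS" "cell f \<subseteq> D" for D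
  proof -
    obtain h where h: "h \<in> F" "D \<subseteq> cell h" using subdivision_below_cells[OF RS_subdivision cell_RS D(1)] by blast
    then have "f = h" using cell_subset_eq[OF f(1) h(1)] D(2) by blast
    then show ?thesis using h(2) D(2) by blast
  qed
  then show "C \<in> maximal_cells RS" using cell_RS f by (auto simp: maximal_cells_def)
qed

lemma card_maximal_RS: "card (maximal_cells RS) = card F"
  unfolding maximal_RS by (rule card_image) (auto intro!: inj_onI cell_subset_eq)

lemma common_RS: "common_cell RS = {p\<in>P. amx p = F}"
  unfolding common_cell_def maximal_RS using F_ne by (auto simp: cell_def amx_def)

lemma common_in_RS: "common_cell RS \<in> RS"
proof -
  have "\<Inter>(cell ` F) \<in> RS \<and> (\<Inter>C\<in>cell ` F. convex hull C) = convex hull (\<Inter>(cell ` F))"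
    using fin_F F_ne cell_RS by (intro cells_Inter[OF RS_subdivision]) auto
  then show ?thesis unfolding common_cell_def maximal_RS by blast
qed

lemma q_common: "q \<in> convex hull (common_cell RS)"
proof -
  have "{p\<in>P. amx q \<subseteq> amx p} = common_cell RS" unfolding amx_q common_RS by (auto simp: amx_def)
  then show ?thesis using tight_amx[OF q_P] by simp
qed

lemma interior_common: "interior_cell P (common_cell RS)"
  unfolding interior_cell_def
proof (intro allI impI, elim conjE)
  fix E assume E: "config_face E P" "common_cell RS \<subseteq> E"
  then obtain G where G: "G face_of convex hull P" "E = P \<inter> G" by (auto simp: config_face_def)
  have "convex hull (common_cell RS) \<subseteq> G" using E G by (intro hull_minimal face_of_imp_convex) auto
  then have "q \<in> G" using q_common by blast
  then have "P \<subseteq> G" using mu unfolding q_def by (intro face_contains_positive[OF fin_P G(1), of \<mu>]) auto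
  then show "E = P" using G by blast
qed

text \<open>The direction space of the common cell is the orthogonal complement, inside
  \<open>U\<close>, of the \<open>#F - 1\<close> independent differences of projected
  gradients.\<close>

lemma dim_common: "aff_dim P - aff_dim (common_cell RS) = int (card F) - 1"
proof -
  let ?H = "common_cell RS"
  obtain f0 where f0: "f0 \<in> F" using F_ne by blast
  obtain y where y: "\<And>f. f \<in> F \<Longrightarrow> y f \<in> U" "\<And>f u. u \<in> U \<Longrightarrow> y f \<bullet> u = g f \<bullet> u"
    "\<And>f0. f0 \<in> F \<Longrightarrow> independent ((\<lambda>f. y f - y f0) ` (F - {f0})) \<and> inj_on (\<lambda>f. y f - y f0) (F - {f0})"
    by (rule projected_gradients) (rule that)
  define B where "B = (\<lambda>f. y f - y f0) ` (F - {f0})"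
  have B: "independent B" "card B = card F - 1"
    using y(3)[OF f0] f0 fin_F by (auto simp: B_def card_image card_Diff_singleton)
  have BU: "B \<subseteq> U" using y(1) f0 subspace_U by (auto simp: B_def intro!: subspace_diff)
  have qH: "q \<in> affine hull ?H" using q_common convex_hull_subset_affine_hull by blast
  have qP: "q \<in> affine hull P" using q_P convex_hull_subset_affine_hull by blast
  have aP: "aff_dim P = int (dim U)" unfolding U_def dim_span by (rule aff_dim_eq_dim[OF qP])
  define L where "L = span ((\<lambda>p. - q + p) ` ?H)"
  have aH: "aff_dim ?H = int (dim L)" unfolding L_def dim_span by (rule aff_dim_eq_dim[OF qH])
  have H_P: "?H \<subseteq> P" unfolding common_RS by blast
  have LU: "L \<subseteq> U" unfolding L_def U_def using H_P by (intro span_mono) blast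
  have "L = {u \<in> U. \<forall>x\<in>span B. orthogonal x u}"
  proof (intro equalityI subsetI)
    fix u assume u: "u \<in> L"
    have Hb: "x \<bullet> (p - q) = 0" if x: "x \<in> B" and p: "p \<in> ?H" for x p
    proof -
      obtain f where f: "f \<in> F" "x = y f - y f0" using x by (auto simp: B_def)
      have "amx p = F" using p unfolding common_RS by blast
      then have "psi f p = psi f0 p" using f f0 by (auto simp: amx_def intro: antisym)
      moreover have pq: "p - q \<in> U" using p H_P by (intro diff_U hull_inc) blast
      ultimately show ?thesis using y(2)[OF pq, of f] y(2)[OF pq, of f0] psi_q[OF f(1) f0] by (simp add: f psi_def inner_diff_left inner_diff_right)
    qed
    have "orthogonal x u" if x: "x \<in> span B" for x
    proof -
      have 1: "orthogonal b u" if "b \<in> B" for b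
        using u unfolding L_def by (rule orthogonal_to_span) (use Hb[OF that] in \<open>auto simp: orthogonal_def\<close>)
      have "orthogonal u x" using x by (rule orthogonal_to_span) (use 1 orthogonal_commute in blast)
      then show ?thesis by (simp add: orthogonal_commute)
    qed
    then show "u \<in> {u \<in> U. \<forall>x\<in>span B. orthogonal x u}" using u LU by blast
  next
    fix u assume u: "u \<in> {u \<in> U. \<forall>x\<in>span B. orthogonal x u}"
    have gu: "g f \<bullet> u = g f0 \<bullet> u" if f: "f \<in> F" for f
    proof (cases "f = f0")
      case False
      then have "y f - y f0 \<in> span B" using f by (auto simp: B_def intro: span_base)
      then have "(y f - y f0) \<bullet> u = 0" using u by (auto simp: orthogonal_def)
      then show ?thesis using y(2)[of u] u by (simp add: inner_diff_left)
    qed simp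
    obtain e where e: "e > 0" "\<And>t. \<bar>t\<bar> \<le> e \<Longrightarrow> q + t *\<^sub>R u \<in> convex hull P" by (rule innE[OF inn_q, of u]) (use u in blast, rule that)
    have eP: "q + e *\<^sub>R u \<in> convex hull P" using e by auto
    have "psi f (q + e *\<^sub>R u) = psi h (q + e *\<^sub>R u)" if "f \<in> F" "h \<in> F" for f h
      using psi_q[OF that] gu[OF that(1)] gu[OF that(2)] by (simp add: psi_add)
    from eq_refl[OF this] have aF: "amx (q + e *\<^sub>R u) = F" unfolding amx_def by blast
    have "{p\<in>P. amx (q + e *\<^sub>R u) \<subseteq> amx p} = ?H" unfolding aF common_RS by (auto simp: amx_def)
    then have "q + e *\<^sub>R u \<in> convex hull ?H" using tight_amx[OF eP] by simp
    then have "q + e *\<^sub>R u \<in> affine hull ?H" using convex_hull_subset_affine_hull by blast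
    then have "q + e *\<^sub>R u \<in> (\<lambda>x. q + x) ` L" unfolding L_def using affine_hull_span_gen[OF qH] by blast
    then have "e *\<^sub>R u \<in> L" by auto
    then have "(1 / e) *\<^sub>R e *\<^sub>R u \<in> L" unfolding L_def by (rule span_scale)
    then show "u \<in> L" using e(1) by simp
  qed
  moreover have "dim {u \<in> U. \<forall>x\<in>span B. orthogonal x u} + dim (span B) = dim U"
    using BU subspace_U by (intro dim_subspace_orthogonal_to_vectors subspace_span) (auto intro: span_minimal[THEN subsetD])
  moreover have "dim (span B) = card F - 1" using B by (simp add: dim_eq_card_independent)
  ultimately have "int (dim L) + (int (card F) - 1) = int (dim U)" using card_F by simp
  then show ?thesis using aP aH by simp
qed

text \<open>Every direction is a sum of one into \<open>cell e\<close> and one into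
  \<open>cell f\<close>, so a cell \<open>E\<close> that contains both has \<open>q\<close> in its
  relative interior. The face condition then puts \<open>E\<close> into every \<open>D h\<close>,
  and conversely every point of \<open>P\<close> into \<open>E\<close>.\<close>

lemma merged_cells_trivial:
  assumes T: "subdivision P \<T>" and D: "\<And>f. f \<in> F \<Longrightarrow> D f \<in> \<T> \<and> cell f \<subseteq> D f"
    and E: "E \<in> \<T>" "cell e \<subseteq> E" "cell f \<subseteq> E" and ef: "e \<in> F" "f \<in> F" "e \<noteq> f"
  shows "\<T> = trivial_subdivision P"
proof -
  have q_cell: "q \<in> convex hull (cell h)" if "h \<in> F" for h
    using cell_hull_iff[OF q_P that] amx_q that by simp
  have ball: "\<exists>t>0. q + t *\<^sub>R u \<in> convex hull E" if u: "u \<in> U" for u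
  proof -
    \<comment> \<open>This direction keeps \<open>e\<close> maximal and lifts all pieces other than
      \<open>f\<close> above \<open>f\<close> by exactly 1, so subtracting a large multiple of it
      makes \<open>f\<close> maximal.\<close>
    obtain v where v: "v \<in> U" "\<And>h. h \<in> F \<Longrightarrow> h \<noteq> e \<Longrightarrow> g h \<bullet> v - g e \<bullet> v = (if h = f then -1 else 0)"
      by (rule direction[OF ef(1), of "\<lambda>h. if h = f then -1 else 0"]) (rule that)
    have ve: "g h \<bullet> v \<le> g e \<bullet> v" if "h \<in> F" "h \<noteq> e" for h using v(2)[OF that] by (auto split: if_splits)
    have vf: "g h \<bullet> v = g f \<bullet> v + 1" if "h \<in> F" "h \<noteq> f" for h
      using v(2)[OF ef(2)] v(2)[OF that(1)] ef that by (cases "h = e") auto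
    define N where "N = (\<Sum>h\<in>F. \<bar>g h \<bullet> u - g f \<bullet> u\<bar>)"
    have N0: "N \<ge> 0" unfolding N_def by (intro sum_nonneg) auto
    have N: "g h \<bullet> u - g f \<bullet> u \<le> N" if "h \<in> F" for h
    proof -
      have "\<bar>g h \<bullet> u - g f \<bullet> u\<bar> \<le> N" unfolding N_def using that fin_F by (intro member_le_sum) auto
      then show ?thesis by simp
    qed
    have u1: "N *\<^sub>R v \<in> U" "u - N *\<^sub>R v \<in> U" using u v(1) subspace_U by (auto intro: subspace_scale subspace_diff)
    obtain e1 where e1: "e1 > 0" "\<And>t. 0 \<le> t \<Longrightarrow> t \<le> e1 \<Longrightarrow> q + t *\<^sub>R (N *\<^sub>R v) \<in> convex hull (cell e)"
    proof (rule near_q[OF ef(1) u1(1)])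
      show "g h \<bullet> N *\<^sub>R v \<le> g e \<bullet> N *\<^sub>R v" if "h \<in> F" "h \<noteq> e" for h
        using ve[OF that] N0 by (simp add: mult_left_mono)
    qed (rule that)
    obtain e2 where e2: "e2 > 0" "\<And>t. 0 \<le> t \<Longrightarrow> t \<le> e2 \<Longrightarrow> q + t *\<^sub>R (u - N *\<^sub>R v) \<in> convex hull (cell f)"
    proof (rule near_q[OF ef(2) u1(2)])
      show "g h \<bullet> (u - N *\<^sub>R v) \<le> g f \<bullet> (u - N *\<^sub>R v)" if "h \<in> F" "h \<noteq> f" for h
        using vf[OF that] N[OF that(1)] by (simp add: inner_diff_right algebra_simps)
    qed (rule that)
    define t where "t = min e1 e2"
    have t: "t > 0" "t \<le> e1" "t \<le> e2" using e1 e2 by (auto simp: t_def)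
    have "q + t *\<^sub>R (N *\<^sub>R v) \<in> convex hull E" "q + t *\<^sub>R (u - N *\<^sub>R v) \<in> convex hull E"
      using e1(2)[of t] e2(2)[of t] t hull_mono[OF E(2)] hull_mono[OF E(3)] by auto
    then have "(1/2) *\<^sub>R (q + t *\<^sub>R (N *\<^sub>R v)) + (1/2) *\<^sub>R (q + t *\<^sub>R (u - N *\<^sub>R v)) \<in> convex hull E"
      by (intro convexD[OF convex_convex_hull]) auto
    also have "(1/2) *\<^sub>R (q + t *\<^sub>R (N *\<^sub>R v)) + (1/2) *\<^sub>R (q + t *\<^sub>R (u - N *\<^sub>R v)) = q + (t / 2) *\<^sub>R u"
      by (simp add: algebra_simps flip: scaleR_add_left)
    finally show ?thesis using t by (intro exI[of _ "t / 2"]) simp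
  qed
  have ED: "E \<subseteq> D h" if h: "h \<in> F" for h
  proof -
    obtain G where G: "G face_of convex hull E" "E \<inter> D h = E \<inter> G"
      using cell_Int(2)[OF T E(1)] D[OF h] by (metis config_face_def)
    have "q \<in> convex hull E \<inter> convex hull (D h)"
      using q_cell[OF ef(1)] q_cell[OF h] hull_mono[OF E(2)] hull_mono[of "cell h" "D h" convex] D[OF h] by blast
    then have "q \<in> convex hull (E \<inter> D h)" using cell_Int(3)[OF T E(1)] D[OF h] by blast
    moreover have "convex hull (E \<inter> D h) \<subseteq> G" using G by (intro hull_minimal face_of_imp_convex) auto
    ultimately have qG: "q \<in> G" by blast
    have "p \<in> G" if p: "p \<in> E" for p
    proof (cases "p = q")
      case False
      have pE: "p \<in> convex hull E" using p by (rule hull_inc)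
      have "p \<in> convex hull P" using pE hull_mono[OF subdivision_finite(4)[OF T E(1)]] by blast
      then have "q - p \<in> U" using diff_U subspace_neg[OF subspace_U] by fastforce
      then obtain t where t: "t > 0" "q + t *\<^sub>R (q - p) \<in> convex hull E" using ball by blast
      define s where "s = t / (1 + t)"
      have s: "0 < s" "s < 1" using t by (auto simp: s_def)
      have "q + t *\<^sub>R (q - p) \<noteq> p"
      proof
        assume "q + t *\<^sub>R (q - p) = p"
        then have "(1 + t) *\<^sub>R (q - p) = 0" by (simp add: algebra_simps)
        then show False using t False by simp
      qed
      moreover have "q = (1 - s) *\<^sub>R (q + t *\<^sub>R (q - p)) + s *\<^sub>R p"
      proof -
        have "(1 - s) * (1 + t) = 1" "(1 - s) * t = s" using t by (auto simp: s_def field_simps)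
        moreover have "(1 - s) *\<^sub>R (q + t *\<^sub>R (q - p)) + s *\<^sub>R p = ((1 - s) * (1 + t)) *\<^sub>R q + (s - (1 - s) * t) *\<^sub>R p"
          by (simp add: algebra_simps)
        ultimately show ?thesis by simp
      qed
      ultimately have "q \<in> open_segment (q + t *\<^sub>R (q - p)) p" unfolding in_segment using s by blast
      then show ?thesis using face_ofD[OF G(1) _ t(2) pE qG] by blast
    qed (simp add: qG)
    then show ?thesis using G(2) by blast
  qed
  have "P \<subseteq> E"
  proof
    fix p assume p: "p \<in> P"
    have pP: "p \<in> convex hull P" using p by (rule hull_inc)
    obtain h where h: "h \<in> amx p" using amx_nonempty by blast
    then have hF: "h \<in> F" by (simp add: amx_def)
    have pD: "p \<in> D h" using D[OF hF] p h by (auto simp: cell_def)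
    obtain G where G: "G face_of convex hull (D h)" "D h \<inter> E = D h \<inter> G"
      using cell_Int(2)[OF T _ E(1)] D[OF hF] by (metis config_face_def)
    have EG: "convex hull E \<subseteq> G" using G ED[OF hF] by (intro hull_minimal face_of_imp_convex) auto
    show "p \<in> E"
    proof (cases "p = q")
      case True
      then have "p \<in> G" using EG q_cell[OF ef(1)] hull_mono[OF E(2)] by blast
      then show ?thesis using G(2) pD by blast
    next
      case False
      obtain t where t: "t > 0" "q + t *\<^sub>R (p - q) \<in> convex hull E" using ball diff_U[OF pP] by blast
      define s where "s = min t (1/2)"
      have s: "0 < s" "s < 1" "s \<le> t" using t by (auto simp: s_def)
      have qE: "q \<in> convex hull E" using q_cell[OF ef(1)] hull_mono[OF E(2)] by blast
      have "(1 - s / t) *\<^sub>R q + (s / t) *\<^sub>R (q + t *\<^sub>R (p - q)) \<in> convex hull E"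
        using s t qE by (intro convexD[OF convex_convex_hull]) auto
      also have "(1 - s / t) *\<^sub>R q + (s / t) *\<^sub>R (q + t *\<^sub>R (p - q)) = (1 - s) *\<^sub>R q + s *\<^sub>R p"
        using t by (simp add: algebra_simps)
      finally have "(1 - s) *\<^sub>R q + s *\<^sub>R p \<in> G" using EG by blast
      moreover have "(1 - s) *\<^sub>R q + s *\<^sub>R p \<in> open_segment q p" unfolding in_segment using s False by blast
      moreover have "q \<in> convex hull (D h)" "p \<in> convex hull (D h)"
        using q_cell[OF hF] hull_mono[of "cell h" "D h" convex] D[OF hF] hull_inc[OF pD, of convex] by blast+
      ultimately have "p \<in> G" using face_ofD[OF G(1)] by blast
      then show ?thesis using G(2) pD by blast
    qed
  qed
  then have "E = P" using subdivision_finite(4)[OF T E(1)] by blast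
  then show ?thesis using maximal_in_trivial[OF T] E(1) by blast
qed

text \<open>The new point \<open>p\<close> belongs to some \<open>cell e\<close>. Between
  \<open>p\<close> and a point of \<open>cell f\<close> where \<open>e\<close> is the second best
  piece there are points at which \<open>e\<close> alone is maximal. They lie in the hull of
  \<open>D f\<close>, so the face condition puts \<open>cell e\<close> into
  \<open>D f\<close>.\<close>

lemma enlarged_cell_merges:
  assumes T: "subdivision P \<T>" and D: "\<And>f. f \<in> F \<Longrightarrow> D f \<in> \<T> \<and> cell f \<subseteq> D f"
    and f: "f \<in> F" and p: "p \<in> D f" "p \<notin> cell f"
  shows "\<exists>e\<in>F. e \<noteq> f \<and> cell e \<subseteq> D f"
proof -
  have pP: "p \<in> P" using subdivision_finite(4)[OF T] D[OF f] p(1) by blast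
  obtain e where e: "e \<in> amx p" using amx_nonempty by blast
  then have eF: "e \<in> F" by (simp add: amx_def)
  have fp: "f \<notin> amx p" using p(2) pP by (simp add: cell_def)
  then have ef: "e \<noteq> f" using e by blast
  \<comment> \<open>The values -1 and -2 make \<open>e\<close> the runner-up behind
    \<open>f\<close>, so \<open>e\<close> wins against all pieces that tie with it at
    \<open>p\<close>.\<close>
  obtain u where u: "u \<in> U" "\<And>h. h \<in> F \<Longrightarrow> h \<noteq> f \<Longrightarrow> g h \<bullet> u - g f \<bullet> u = (if h = e then -1 else -2)"
    by (rule direction[OF f, of "\<lambda>h. if h = e then -1 else -2"]) (rule that)
  obtain e1 where e1: "e1 > 0" "\<And>t. 0 \<le> t \<Longrightarrow> t \<le> e1 \<Longrightarrow> q + t *\<^sub>R u \<in> convex hull (cell f)"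
  proof (rule near_q[OF f u(1)])
    show "g h \<bullet> u \<le> g f \<bullet> u" if "h \<in> F" "h \<noteq> f" for h using u(2)[OF that] by (auto split: if_splits)
  qed (rule that)
  define d where "d = e1 / 2"
  define x where "x = q + d *\<^sub>R u"
  have d: "d > 0" using e1 by (simp add: d_def)
  have xf: "x \<in> convex hull (cell f)" unfolding x_def using e1(2)[of d] e1(1) by (simp add: d_def)
  have "q + e1 *\<^sub>R u \<in> convex hull P" using e1(2)[of e1] e1(1) hull_mono[OF cell_P[of f], of convex] by auto
  then have "inn ((q + e1 *\<^sub>R u) + (1/2) *\<^sub>R (q - (q + e1 *\<^sub>R u)))" by (intro inn_mix inn_q) auto
  also have "(q + e1 *\<^sub>R u) + (1/2) *\<^sub>R (q - (q + e1 *\<^sub>R u)) = x"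
    by (simp add: x_def d_def algebra_simps flip: scaleR_add_left)
  finally have inn_x: "inn x" .
  have psix: "psi h x = psi e x - d" if "h \<in> F" "h \<noteq> f" "h \<noteq> e" for h
  proof -
    have "g h \<bullet> u = g e \<bullet> u - 1" using u(2)[OF that(1,2)] u(2)[OF eF ef] that by simp
    then show ?thesis using psi_q[OF that(1) eF] by (simp add: x_def psi_add right_diff_distrib)
  qed
  obtain e2 where e2: "0 < e2" "\<And>t h. \<bar>t\<bar> \<le> e2 \<Longrightarrow> h \<in> F - amx p \<Longrightarrow> \<bar>t * ((psi h x - psi h p) - (psi e x - psi e p))\<bar> < psi e p - psi h p"
  proof (rule small_eps[of "F - amx p" "\<lambda>h. psi e p - psi h p" "\<lambda>h. (psi h x - psi h p) - (psi e x - psi e p)"])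
    show "finite (F - amx p)" using fin_F by simp
    show "0 < psi e p - psi h p" if "h \<in> F - amx p" for h
      using e that unfolding amx_def by force
  qed (rule that)
  define t where "t = min e2 1"
  have t: "0 < t" "t \<le> 1" "t \<le> e2" using e2 by (auto simp: t_def)
  define y where "y = p + t *\<^sub>R (x - p)"
  have inn_y: "inn y" unfolding y_def using t pP by (intro inn_mix inn_x hull_inc)
  have psiy: "psi h y = psi h p + t * (psi h x - psi h p)" for h
    by (simp add: y_def psi_add) (simp add: psi_def inner_diff_right)
  have lt: "psi h y < psi e y" if h: "h \<in> F" "h \<noteq> e" for h
  proof (cases "h \<in> amx p")
    case True
    then have "psi h p = psi e p" using e by (auto simp: amx_def intro: antisym)
    moreover have "h \<noteq> f" using True fp by blast
    ultimately show ?thesis using psix[OF h(1) _ h(2)] t d by (simp add: psiy algebra_simps)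
  next
    case False
    then show ?thesis using e2(2)[of t h] t h by (simp add: psiy abs_less_iff algebra_simps)
  qed
  have amy: "amx y = {e}"
  proof (intro equalityI subsetI)
    fix h assume "h \<in> amx y"
    then have "h \<in> F" "psi e y \<le> psi h y" using eF by (auto simp: amx_def)
    then show "h \<in> {e}" using lt by force
  next
    fix h assume "h \<in> {e}"
    then show "h \<in> amx y" using eF lt by (force simp: amx_def intro: less_imp_le)
  qed
  have "(1 - t) *\<^sub>R p + t *\<^sub>R x \<in> convex hull (D f)"
    using xf hull_mono[of "cell f" "D f" convex] D[OF f] p(1) t hull_inc by (intro convexD[OF convex_convex_hull]) auto
  then have yD: "y \<in> convex hull (D f)" by (simp add: y_def algebra_simps)
  have yP: "y \<in> convex hull P" using inn_y by (simp add: inn_def)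
  have "y \<in> convex hull (cell e)" unfolding cell_hull_iff[OF yP eF] amy by simp
  then have yE: "y \<in> convex hull (D e)" using hull_mono[of "cell e" "D e" convex] D[OF eF] by blast
  have "config_face (D e \<inter> D f) (D e)" using cell_Int(2)[OF T, of "D e" "D f"] D[OF eF] D[OF f] by blast
  then obtain G where G: "G face_of convex hull (D e)" "D e \<inter> D f = D e \<inter> G"
    unfolding config_face_def by blast
  have "y \<in> convex hull (D e \<inter> D f)" 
    using cell_Int(3)[OF T, of "D e" "D f"] D[OF eF] D[OF f] yD yE by auto
  moreover have "convex hull (D e \<inter> D f) \<subseteq> G" using G by (intro hull_minimal face_of_imp_convex) auto
  ultimately have yG: "y \<in> G" by blast
  have "z \<in> G" if z: "z \<in> cell e" for z
  proof (cases "z = y")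
    case False
    have zP: "z \<in> convex hull P" using hull_inc[OF subsetD[OF cell_P z]] .
    have "(z - q) - (y - q) \<in> U" by (rule subspace_diff[OF subspace_U diff_U[OF zP] diff_U[OF yP]])
    then have "z - y \<in> U" by simp
    then obtain r where r: "0 < r" "\<And>t. \<bar>t\<bar> \<le> r \<Longrightarrow> y + t *\<^sub>R (z - y) \<in> convex hull (cell e)"
      by (rule interior_of_cell[OF inn_y amy]) (rule that)
    define v where "v = y + (- r) *\<^sub>R (z - y)"
    have "\<bar>- r\<bar> \<le> r" using r(1) by simp
    from r(2)[OF this] have v: "v \<in> convex hull (D e)"
      unfolding v_def using hull_mono[of "cell e" "D e" convex] D[OF eF] by blast
    define s where "s = r / (1 + r)"
    have s: "0 < s" "s < 1" using r by (auto simp: s_def)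
    have "v \<noteq> z"
    proof
      assume "v = z"
      then have "(1 + r) *\<^sub>R (z - y) = 0" by (simp add: v_def algebra_simps)
      then show False using r False by simp
    qed
    moreover have "y = (1 - s) *\<^sub>R v + s *\<^sub>R z"
    proof -
      have "(1 - s) * (1 + r) = 1" "(1 - s) * r = s" using r by (auto simp: s_def field_simps)
      moreover have "(1 - s) *\<^sub>R v + s *\<^sub>R z = ((1 - s) * (1 + r)) *\<^sub>R y + (s - (1 - s) * r) *\<^sub>R z"
        by (simp add: v_def algebra_simps)
      ultimately show ?thesis by simp
    qed
    ultimately have "y \<in> open_segment v z" unfolding in_segment using s by blast
    moreover have "z \<in> convex hull (D e)" using z D[OF eF] hull_inc[of z "D e" convex] by blast
    ultimately show ?thesis using face_ofD[OF G(1) _ v _ yG] by blast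
  qed (simp add: yG)
  then have "cell e \<subseteq> D f" using G(2) D[OF eF] by blast
  then show ?thesis using eF ef by blast
qed

text \<open>For maximal coarseness: a coarser subdivision keeps all cells of linearity, and then
  equals this one, or enlarges one of them, which merges two cells.\<close>

theorem RS_k_split: "k_split (card F) P RS"
  unfolding k_split_def coarsest_subdivision_def
proof (intro conjI allI impI)
  show "subdivision P RS" by (rule RS_subdivision)
  show "RS \<noteq> trivial_subdivision P"
  proof
    assume "RS = trivial_subdivision P"
    then have "P \<in> RS" by (simp add: trivial_subdivision_def)
    then obtain f where f: "f \<in> F" "P \<subseteq> cell f" using subdivision_below_cells[OF RS_subdivision cell_RS] by blast
    have "F \<noteq> {f}" using card_F by auto
    then obtain e where "e \<in> F" "e \<noteq> f" using f by blast
    then show False using cell_subset_eq[of e f] f cell_P by blast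
  qed
  show "finite (maximal_cells RS)" unfolding maximal_RS using fin_F by simp
  show "card (maximal_cells RS) = card F" by (rule card_maximal_RS)
  show "common_cell RS \<in> RS" by (rule common_in_RS)
  show "interior_cell P (common_cell RS)" by (rule interior_common)
  show "aff_dim P - aff_dim (common_cell RS) = int (card F) - 1" by (rule dim_common)
  fix \<T> assume T: "subdivision P \<T> \<and> coarser \<T> RS \<and> \<T> \<noteq> RS"
  then have "\<forall>f\<in>F. \<exists>D. D \<in> \<T> \<and> cell f \<subseteq> D" using cell_RS by (auto simp: coarser_def)
  then obtain D where D: "\<And>f. f \<in> F \<Longrightarrow> D f \<in> \<T> \<and> cell f \<subseteq> D f" by metis
  show "\<T> = trivial_subdivision P"
  proof (cases "\<forall>f\<in>F. D f = cell f")
    case True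
    then have "\<T> = RS" using T D by (intro RS_unique) auto
    then show ?thesis using T by blast
  next
    case False
    then obtain f p where f: "f \<in> F" "p \<in> D f" "p \<notin> cell f" using D by blast
    then obtain e where e: "e \<in> F" "e \<noteq> f" "cell e \<subseteq> D f" using enlarged_cell_merges[of \<T> D f p] T D by blast
    show ?thesis using T D f(1) e by (intro merged_cells_trivial[of \<T> D "D f" e f]) auto
  qed
qed

end

subsection \<open>Stiefel heights and vertex figures\<close>

text \<open>If some \<open>b\<close> is not larger than some \<open>a\<close>, match the smallest \<open>b\<close> with the smallest \<open>a\<close> that is not
  below it; the excess condition survives the removal of this pair.\<close>

lemma greedy_matching:
  fixes \<iota> :: "'n \<Rightarrow> nat"
  assumes "finite A" "finite B" "card A = card B"
    "\<And>m. card {a\<in>A. \<iota> a \<le> m} \<le> card {b\<in>B. \<iota> b \<le> m} + e"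
  shows "\<exists>\<omega>. bij_betw \<omega> A B \<and> card {a\<in>A. \<iota> a < \<iota> (\<omega> a)} \<le> e"
  using assms
proof (induction "card A" arbitrary: A B)
  case 0
  then have "A = {}" "B = {}" by auto
  then show ?case by (intro exI[of _ id]) (simp add: bij_betw_def)
next
  case (Suc r)
  note fin = Suc.prems(1,2) and cAB = Suc.prems(3) and ex = Suc.prems(4)
  have Bne: "B \<noteq> {}" using Suc.hyps(2) cAB by auto
  show ?case
  proof (cases "\<exists>a\<in>A. \<exists>b\<in>B. \<iota> b \<le> \<iota> a")
    case False
    obtain \<omega> where w: "bij_betw \<omega> A B" using fin cAB finite_same_card_bij by blast
    have "{a\<in>A. \<iota> a < \<iota> (\<omega> a)} = A" using False w by (force simp: bij_betw_def)
    moreover have "card A \<le> e"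
    proof -
      define m where "m = Max (\<iota> ` A)"
      have Am: "{a\<in>A. \<iota> a \<le> m} = A" using fin by (auto simp: m_def)
      have "A \<noteq> {}" using Suc.hyps(2) by auto
      then have "m \<in> \<iota> ` A" unfolding m_def using fin by (intro Max_in) auto
      then have "{b\<in>B. \<iota> b \<le> m} = {}" using False by fastforce
      with ex[of m] Am show ?thesis by simp
    qed
    ultimately show ?thesis using w by auto
  next
    case True
    obtain b0 where b0: "b0 \<in> B" "\<And>b. b \<in> B \<Longrightarrow> \<iota> b0 \<le> \<iota> b"
      using ex_has_least_nat[of "\<lambda>b. b \<in> B" _ \<iota>] Bne by blast
    obtain a1 where "a1 \<in> A" "\<iota> b0 \<le> \<iota> a1" using True b0(2) order_trans by blast
    then obtain a0 where a0: "a0 \<in> A" "\<iota> b0 \<le> \<iota> a0" "\<And>a. a \<in> A \<Longrightarrow> \<iota> b0 \<le> \<iota> a \<Longrightarrow> \<iota> a0 \<le> \<iota> a"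
      using ex_has_least_nat[of "\<lambda>a. a \<in> A \<and> \<iota> b0 \<le> \<iota> a" a1 \<iota>] by blast
    define A' where "A' = A - {a0}"
    define B' where "B' = B - {b0}"
    have cA': "{a\<in>A'. \<iota> a \<le> m} = {a\<in>A. \<iota> a \<le> m} - {a0}" for m by (auto simp: A'_def)
    have cB': "{b\<in>B'. \<iota> b \<le> m} = {b\<in>B. \<iota> b \<le> m} - {b0}" for m by (auto simp: B'_def)
    have "card {a\<in>A'. \<iota> a \<le> m} \<le> card {b\<in>B'. \<iota> b \<le> m} + e" for m
    proof (cases "\<iota> a0 \<le> m")
      case True
      then have "a0 \<in> {a\<in>A. \<iota> a \<le> m}" "b0 \<in> {b\<in>B. \<iota> b \<le> m}" using a0 b0 by auto
      moreover have "card {b\<in>B. \<iota> b \<le> m} > 0" using calculation fin by (auto simp: card_gt_0_iff)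
      ultimately show ?thesis unfolding cA' cB' using ex[of m] fin by simp
    next
      case False
      then have A1: "{a\<in>A'. \<iota> a \<le> m} = {a\<in>A. \<iota> a \<le> m}" unfolding cA' by auto
      show ?thesis
      proof (cases "\<iota> b0 \<le> m")
        case True
        have e1: "{a\<in>A. \<iota> a \<le> m} = {a\<in>A. \<iota> a < \<iota> b0}"
        proof (intro Collect_cong conj_cong refl)
          fix a assume "a \<in> A"
          then show "(\<iota> a \<le> m) = (\<iota> a < \<iota> b0)" using a0(3)[of a] False True by linarith
        qed
        have "card {a\<in>A. \<iota> a < \<iota> b0} \<le> e"
        proof (cases "\<iota> b0")
          case (Suc t)
          have "{b\<in>B. \<iota> b \<le> t} = {}" using b0(2) Suc by fastforce
          then have "card {b\<in>B. \<iota> b \<le> t} = 0" by (simp only: card.empty)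
          moreover have "{a\<in>A. \<iota> a < \<iota> b0} = {a\<in>A. \<iota> a \<le> t}" using Suc by auto
          ultimately show ?thesis using ex[of t] by (simp only: add_0)
        qed simp
        then show ?thesis unfolding A1 e1 by simp
      next
        case F: False
        then have "{b\<in>B'. \<iota> b \<le> m} = {b\<in>B. \<iota> b \<le> m}" unfolding cB' by auto
        then show ?thesis unfolding A1 using ex[of m] by simp
      qed
    qed
    moreover have "r = card A'" "finite A'" "finite B'" "card A' = card B'"
      using Suc.hyps(2) fin a0(1) b0(1) cAB by (auto simp: A'_def B'_def)
    ultimately obtain \<omega> where w: "bij_betw \<omega> A' B'" "card {a\<in>A'. \<iota> a < \<iota> (\<omega> a)} \<le> e"
      using Suc.hyps(1)[of A' B'] by blast
    define \<omega>' where "\<omega>' = (\<lambda>a. if a = a0 then b0 else \<omega> a)"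
    have im: "\<omega>' ` A' = B'" and inj: "inj_on \<omega>' A'"
      using w(1) unfolding bij_betw_def \<omega>'_def A'_def by (auto simp: inj_on_def)
    have "A = insert a0 A'" "B = insert b0 B'" "a0 \<notin> A'" "b0 \<notin> B'" using a0 b0 by (auto simp: A'_def B'_def)
    then have "bij_betw \<omega>' A B" using im inj unfolding bij_betw_def by (auto simp: \<omega>'_def)
    moreover have "{a\<in>A. \<iota> a < \<iota> (\<omega>' a)} = {a\<in>A'. \<iota> a < \<iota> (\<omega> a)}"
      using a0 by (auto simp: \<omega>'_def A'_def)
    ultimately show ?thesis using w(2) by auto
  qed
qed

lemma stiefel_pi_le: "bij_betw \<omega> A B \<Longrightarrow> stiefel_pi l A B \<le> (\<Sum>i\<in>A. l i (\<omega> i))" for A :: "'n::finite set"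
  unfolding stiefel_pi_def by (intro Min_le) auto

lemma stiefel_pi_attained:
  fixes A :: "'n::finite set"
  assumes "card A = card B" obtains \<omega> where "bij_betw \<omega> A B" "stiefel_pi l A B = (\<Sum>i\<in>A. l i (\<omega> i))"
proof -
  have "\<exists>\<omega>. bij_betw \<omega> A B" using assms finite_same_card_bij[of A B] by simp
  then have "stiefel_pi l A B \<in> {\<Sum>i\<in>A. l i (\<omega> i) | \<omega>. bij_betw \<omega> A B}"
    unfolding stiefel_pi_def by (intro Min_in) auto
  then show ?thesis using that by blast
qed

definition pair_pt :: "'n::finite set \<Rightarrow> 'n \<Rightarrow> 'n \<Rightarrow> real^'n" where
  "pair_pt I i j = e_set I - axis i 1 + axis j 1"

lemma pair_pt_e_set: "i \<in> I \<Longrightarrow> j \<notin> I \<Longrightarrow> pair_pt I i j = e_set (insert j (I - {i}))"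
  by (auto simp: pair_pt_def vec_eq_iff axis_def)

text \<open>A vertex is expressed through vertices of the vertex figure, one for each matched pair,
  so affine functions that vanish at \<open>e_set I\<close> add up along a matching.\<close>

lemma e_set_matching:
  fixes I :: "'n::finite set"
  assumes "bij_betw \<omega> (I - J) (J - I)"
  shows "e_set J = e_set I + (\<Sum>i\<in>I - J. pair_pt I i (\<omega> i) - e_set I)"
proof -
  have split: "e_set K = e_set (K \<inter> L) + e_set (K - L)" for K L :: "'n set"
    by (auto simp: vec_eq_iff)
  have "(\<Sum>i\<in>I - J. pair_pt I i (\<omega> i) - e_set I) = (\<Sum>i\<in>I - J. axis (\<omega> i) 1) - e_set (I - J)"
    unfolding e_set_def[of "I - J"] by (simp add: pair_pt_def sum_subtractf)
  also have "(\<Sum>i\<in>I - J. axis (\<omega> i) 1) = e_set (J - I)"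
    unfolding e_set_def using sum.reindex_bij_betw[OF assms, of "\<lambda>j. axis j 1"] by simp
  finally show ?thesis using split[of I J] split[of J I] by (simp add: Int_commute)
qed

section \<open>Vertices of vertex figures and products of simplices\<close>

lemma vertex_figure_box:
  fixes I :: "'n::finite set"
  shows "vertex_figure I = box_slice I (real (card I) - 1) 1"
proof -
  have split: "sum f UNIV = sum f I + sum f (-I)" for f :: "'n \<Rightarrow> real"
    using sum.subset_diff[of I UNIV f] by (simp add: Compl_eq_Diff_UNIV add.commute)
  show ?thesis unfolding vertex_figure_def box_slice_def by (auto simp: mem_hypersimplex split)
qed

lemma vertices_vertex_figure:
  fixes I :: "'n::finite set"
  shows "vertices (vertex_figure I) = (\<lambda>(i, j). pair_pt I i j) ` (I \<times> - I)"
    and "convex hull (vertices (vertex_figure I)) = vertex_figure I"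
proof -
  have Z: "real (card I) - 1 \<in> \<int>" "(1 :: real) \<in> \<int>" by auto
  show "convex hull (vertices (vertex_figure I)) = vertex_figure I"
    unfolding vertex_figure_box by (rule vertices_box_slice(2)[OF Z])
  have "vertices (vertex_figure I) = {e_set J | J. e_set J \<in> box_slice I (real (card I) - 1) 1}"
    unfolding vertex_figure_box by (rule vertices_box_slice(1)[OF Z])
  also have "\<dots> = (\<lambda>(i, j). pair_pt I i j) ` (I \<times> - I)"
  proof (intro equalityI subsetI)
    fix x assume "x \<in> {e_set J | J. e_set J \<in> box_slice I (real (card I) - 1) 1}"
    then obtain J where x: "x = e_set J" and J: "e_set J \<in> box_slice I (real (card I) - 1) 1" by blast
    have c1: "real (card (I \<inter> J)) = real (card I) - 1" and c2: "real (card (- I \<inter> J)) = 1"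
      using J by (auto simp: box_slice_def sum.If_cases)
    obtain j where j: "- I \<inter> J = {j}" using c2 card_1_singletonE by (metis of_nat_eq_1_iff)
    have "card I = card (I \<inter> J) + card (I - J)" by (metis card_Int_Diff finite)
    then have "card (I - J) = 1" using c1 by linarith
    then obtain i where i: "I - J = {i}" using card_1_singletonE by blast
    have ij: "i \<in> I" "j \<notin> I" using i j by auto
    have "J = insert j (I - {i})" using i j by blast
    then have "x = pair_pt I i j" using x pair_pt_e_set[OF ij] by simp
    then show "x \<in> (\<lambda>(i, j). pair_pt I i j) ` (I \<times> - I)" using ij by auto
  next
    fix x assume "x \<in> (\<lambda>(i, j). pair_pt I i j) ` (I \<times> - I)"
    then obtain i j where ij: "i \<in> I" "j \<notin> I" "x = pair_pt I i j" by auto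
    have e: "I \<inter> insert j (I - {i}) = I - {i}" "- I \<inter> insert j (I - {i}) = {j}" using ij by auto
    have "card I \<ge> 1" using ij(1) by (metis One_nat_def Suc_leI card_gt_0_iff empty_iff finite)
    moreover have "(\<Sum>y\<in>A. e_set K $ y) = real (card (A \<inter> K))" for A K :: "'n set"
      by (simp add: sum.If_cases)
    ultimately have "e_set (insert j (I - {i})) \<in> box_slice I (real (card I) - 1) 1"
      unfolding box_slice_def using ij(1) by (simp only: mem_Collect_eq e) (simp add: of_nat_diff)
    then show "x \<in> {e_set J | J. e_set J \<in> box_slice I (real (card I) - 1) 1}"
      using ij pair_pt_e_set[OF ij(1,2)] by auto
  qed
  finally show "vertices (vertex_figure I) = (\<lambda>(i, j). pair_pt I i j) ` (I \<times> - I)" .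
qed

lemma inj_pair_pt: "inj_on (\<lambda>(i, j). pair_pt I i j) (I \<times> - I)"
proof (rule inj_onI, clarify)
  fix i j i' j' assume ij: "i \<in> I" "j \<notin> I" "i' \<in> I" "j' \<notin> I" "pair_pt I i j = pair_pt I i' j'"
  have "insert j (I - {i}) = insert j' (I - {i'})"
    using ij by (intro inj_e_set) (simp add: pair_pt_e_set)
  then have "j \<in> insert j' (I - {i'})" "i \<notin> insert j' (I - {i'})" using ij by auto
  then show "i = i' \<and> j = j'" using ij by auto
qed

lemma vertices_simplex:
  fixes I :: "'n::finite set"
  shows "vertices (hypersimplex 1 I) = (\<lambda>i. axis i 1) ` I"
proof -
  have "vertices (hypersimplex 1 I) = {e_set J | J. e_set J \<in> box_slice I (real 1) 0}"
    unfolding hypersimplex_box by (rule vertices_box_slice(1)) auto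
  also have "\<dots> = (\<lambda>i. axis i 1) ` I"
  proof (intro equalityI subsetI)
    fix x assume "x \<in> {e_set J | J. e_set J \<in> box_slice I (real 1) 0}"
    then obtain J where x: "x = e_set J" and J: "e_set J \<in> box_slice I (real 1) 0" by blast
    have c1: "real (card (I \<inter> J)) = 1" and c2: "real (card (- I \<inter> J)) = 0"
      using J by (auto simp: box_slice_def sum.If_cases)
    obtain j where j: "I \<inter> J = {j}" using c1 card_1_singletonE by (metis of_nat_eq_1_iff)
    have "- I \<inter> J = {}" using c2 by simp
    then have "J = {j}" "j \<in> I" using j by auto
    then show "x \<in> (\<lambda>i. axis i 1) ` I" using x by (simp add: e_set_def)
  next
    fix x :: "real^'n" assume "x \<in> (\<lambda>i. axis i 1) ` I"
    then obtain i where i: "i \<in> I" "x = e_set {i}" by (auto simp: e_set_def)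
    then have "I \<inter> {i} = {i}" "- I \<inter> {i} = {}" by auto
    then have "e_set {i} \<in> box_slice I (real 1) 0" by (auto simp: box_slice_def sum.If_cases)
    then show "x \<in> {e_set J | J. e_set J \<in> box_slice I (real 1) 0}" using i by blast
  qed
  finally show ?thesis .
qed

lemma vertices_product:
  fixes I :: "'n::finite set"
  shows "vertices (hypersimplex 1 I \<times> hypersimplex 1 (-I)) = (\<lambda>(i, j). (axis i 1, axis j 1)) ` (I \<times> - I)"
    and "convex hull (vertices (hypersimplex 1 I \<times> hypersimplex 1 (-I))) = hypersimplex 1 I \<times> hypersimplex 1 (-I)"
proof -
  have ext: "(x, y) extreme_point_of A \<times> B \<longleftrightarrow> x extreme_point_of A \<and> y extreme_point_of B"
    for A B :: "(real^'n) set" and x y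
  proof -
    have "{x} \<times> {y} face_of A \<times> B \<longleftrightarrow> {x} face_of A \<and> {y} face_of B" by (subst face_of_Times_eq) simp
    moreover have "{x} \<times> {y} = {(x, y)}" by simp
    ultimately show ?thesis by (simp only: face_of_singleton)
  qed
  have v: "vertices (A \<times> B) = vertices A \<times> vertices B" for A B :: "(real^'n) set"
    by (auto simp: vertices_def ext)
  show "vertices (hypersimplex 1 I \<times> hypersimplex 1 (-I)) = (\<lambda>(i, j). (axis i 1, axis j 1)) ` (I \<times> - I)"
    unfolding v vertices_simplex by force
  show "convex hull (vertices (hypersimplex 1 I \<times> hypersimplex 1 (-I))) = hypersimplex 1 I \<times> hypersimplex 1 (-I)"
    unfolding v convex_hull_Times hull_vertices_hypersimplex by simp
qed

definition step :: "('n \<Rightarrow> nat) \<Rightarrow> nat \<Rightarrow> 'n \<Rightarrow> real" where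
  "step \<iota> m y = (if \<iota> y \<le> m then 1 else 0)"

section \<open>Splits defined by an index function\<close>

locale indexed_base =
  fixes \<iota> :: "'n::finite \<Rightarrow> nat" and k :: nat and I :: "'n set"
  assumes k2: "2 \<le> k" and iota_less: "\<And>y. \<iota> y < k"
    and in_class: "\<And>b. b < k \<Longrightarrow> \<exists>i\<in>I. \<iota> i = b" and out_class: "\<And>b. b < k \<Longrightarrow> \<exists>j\<in>-I. \<iota> j = b"
begin

text \<open>The cut at \<open>\<iota> i\<close> separates \<open>i\<close> from a later
  \<open>j\<close>; the last cut \<open>k - 1\<close> separates nothing and supplies the value
  0.\<close>

lemma pair_max:
  "Max ((\<lambda>m. step \<iota> m i - step \<iota> m j) ` {..<k}) = (if \<iota> i < \<iota> j then 1 else 0)"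
proof (rule Max_eqI)
  show "finite ((\<lambda>m. step \<iota> m i - step \<iota> m j) ` {..<k})" by simp
  show "(if \<iota> i < \<iota> j then 1 else 0) \<in> (\<lambda>m. step \<iota> m i - step \<iota> m j) ` {..<k}"
  proof (cases "\<iota> i < \<iota> j")
    case True
    then show ?thesis using iota_less[of i] by (intro image_eqI[of _ _ "\<iota> i"]) (auto simp: step_def)
  next
    case False
    then show ?thesis using iota_less[of i] iota_less[of j] k2
      by (intro image_eqI[of _ _ "k - 1"]) (auto simp: step_def)
  qed
qed (auto simp: step_def)

text \<open>Treats the vertex figure and the product of simplices at once. The interior point
  \<open>q\<close> gives each class the weight \<open>1 / k\<close> on both sides of
  \<open>I\<close>, evenly spread, so that every cut function vanishes there.\<close>

lemma pair_split:
  fixes pt :: "'n \<Rightarrow> 'n \<Rightarrow> 'a::euclidean_space"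
  assumes pl: "pl_data P {..<k} g c" and P: "P = (\<lambda>(i, j). pt i j) ` (I \<times> - I)"
    and inj: "inj_on (\<lambda>(i, j). pt i j) (I \<times> - I)"
    and val: "\<And>m i j. m < k \<Longrightarrow> i \<in> I \<Longrightarrow> j \<notin> I \<Longrightarrow> g m \<bullet> pt i j + c m = step \<iota> m i - step \<iota> m j"
  shows "k_split k P (regular_subdivision P (pl_data.ht {..<k} g c))"
    "\<And>i j. i \<in> I \<Longrightarrow> j \<notin> I \<Longrightarrow> pl_data.ht {..<k} g c (pt i j) = (if \<iota> i < \<iota> j then 1 else 0)"
proof -
  interpret pl_data P "{..<k}" g c by (rule pl)
  show "ht (pt i j) = (if \<iota> i < \<iota> j then 1 else 0)" if "i \<in> I" "j \<notin> I" for i j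
    unfolding ht_def pair_max[symmetric] psi_def using val that by simp
  define \<alpha> where "\<alpha> i = 1 / (real k * real (card {y\<in>I. \<iota> y = \<iota> i}))" for i
  define \<beta> where "\<beta> j = 1 / (real k * real (card {y\<in>-I. \<iota> y = \<iota> j}))" for j
  have pos: "\<alpha> i > 0" "\<beta> j > 0" if "i \<in> I" "j \<notin> I" for i j
  proof -
    have "0 < card {y\<in>I. \<iota> y = \<iota> i}" "0 < card {y\<in>-I. \<iota> y = \<iota> j}"
      using that by (auto simp: card_gt_0_iff)
    then show "\<alpha> i > 0" "\<beta> j > 0" using k2 by (simp_all add: \<alpha>_def \<beta>_def)
  qed
  have class_sum: "(\<Sum>y\<in>A. 1 / (real k * real (card {y'\<in>A. \<iota> y' = \<iota> y})) * h (\<iota> y)) = (\<Sum>b<k. h b / real k)"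
    if A: "\<And>b. b < k \<Longrightarrow> \<exists>y\<in>A. \<iota> y = b" for A :: "'n set" and h :: "nat \<Rightarrow> real"
  proof -
    have im: "\<iota> ` A = {..<k}" using A iota_less by force
    have "(\<Sum>y\<in>A. 1 / (real k * real (card {y'\<in>A. \<iota> y' = \<iota> y})) * h (\<iota> y)) =
      (\<Sum>b<k. \<Sum>y\<in>{y\<in>A. \<iota> y = b}. 1 / (real k * real (card {y'\<in>A. \<iota> y' = \<iota> y})) * h (\<iota> y))"
      unfolding im[symmetric] by (rule sum.image_gen) simp
    also have "\<dots> = (\<Sum>b<k. h b / real k)"
    proof (intro sum.cong refl)
      fix b assume "b \<in> {..<k}"
      then have "{y\<in>A. \<iota> y = b} \<noteq> {}" using A by auto
      then have "real (card {y\<in>A. \<iota> y = b}) \<noteq> 0" by simp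
      moreover have "(\<Sum>y\<in>{y\<in>A. \<iota> y = b}. 1 / (real k * real (card {y'\<in>A. \<iota> y' = \<iota> y})) * h (\<iota> y)) =
        (\<Sum>y\<in>{y\<in>A. \<iota> y = b}. 1 / (real k * real (card {y'\<in>A. \<iota> y' = b})) * h b)"
        by (intro sum.cong) auto
      ultimately show "(\<Sum>y\<in>{y\<in>A. \<iota> y = b}. 1 / (real k * real (card {y'\<in>A. \<iota> y' = \<iota> y})) * h (\<iota> y)) = h b / real k"
        by simp
    qed
    finally show ?thesis .
  qed
  have outc: "\<exists>y\<in>-I. \<iota> y = b" if "b < k" for b using out_class[OF that] .
  have asum: "(\<Sum>i\<in>I. \<alpha> i * h (\<iota> i)) = (\<Sum>b<k. h b / real k)" for h
    unfolding \<alpha>_def by (rule class_sum[OF in_class])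
  have bsum: "(\<Sum>j\<in>-I. \<beta> j * h (\<iota> j)) = (\<Sum>b<k. h b / real k)" for h
    unfolding \<beta>_def by (rule class_sum[OF out_class])
  have a1: "sum \<alpha> I = 1" "sum \<beta> (-I) = 1" using asum[of "\<lambda>_. 1"] bsum[of "\<lambda>_. 1"] k2 by auto
  define \<mu> where "\<mu> p = (case the_inv_into (I \<times> - I) (\<lambda>(i, j). pt i j) p of (i, j) \<Rightarrow> \<alpha> i * \<beta> j)" for p
  have mu_pt: "\<mu> (pt i j) = \<alpha> i * \<beta> j" if "i \<in> I" "j \<notin> I" for i j
    using the_inv_into_f_f[OF inj, of "(i, j)"] that by (simp add: \<mu>_def)
  have sumP: "(\<Sum>p\<in>P. h p) = (\<Sum>i\<in>I. \<Sum>j\<in>-I. h (pt i j))" for h :: "'a \<Rightarrow> real"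
    unfolding P sum.reindex[OF inj] by (simp add: sum.cartesian_product split_def)
  define q where "q = (\<Sum>p\<in>P. \<mu> p *\<^sub>R p)"
  have mu1: "sum \<mu> P = 1"
  proof -
    have "sum \<mu> P = (\<Sum>i\<in>I. \<Sum>j\<in>-I. \<alpha> i * \<beta> j)" unfolding sumP by (intro sum.cong refl) (auto simp: mu_pt)
    also have "\<dots> = 1" using a1 by (simp flip: sum_distrib_left)
    finally show ?thesis .
  qed
  have psi_q0: "g m \<bullet> q + c m = 0" if m: "m < k" for m
  proof -
    have "g m \<bullet> q + c m = (\<Sum>p\<in>P. \<mu> p * (g m \<bullet> p + c m))"
      using mu1 by (simp add: q_def inner_sum_right distrib_left sum.distrib flip: sum_distrib_right)
    also have "\<dots> = (\<Sum>i\<in>I. \<Sum>j\<in>-I. \<alpha> i * \<beta> j * (step \<iota> m i - step \<iota> m j))"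
      unfolding sumP using val[OF m] by (intro sum.cong refl) (auto simp: mu_pt)
    also have "\<dots> = (\<Sum>i\<in>I. \<Sum>j\<in>-I. \<alpha> i * step \<iota> m i * \<beta> j) - (\<Sum>i\<in>I. \<Sum>j\<in>-I. \<alpha> i * (\<beta> j * step \<iota> m j))"
      by (simp add: sum_subtractf algebra_simps)
    also have "\<dots> = (\<Sum>i\<in>I. \<alpha> i * step \<iota> m i) - (\<Sum>j\<in>-I. \<beta> j * step \<iota> m j)"
      using a1 by (simp flip: sum_distrib_left sum_distrib_right)
    also have "\<dots> = 0" using asum[of "\<lambda>b. if b \<le> m then 1 else 0"] bsum[of "\<lambda>b. if b \<le> m then 1 else 0"]
      by (simp add: step_def)
    finally show ?thesis .
  qed
  have indep: "\<gamma> m = 0" if s: "sum \<gamma> {..<k} = 0" and \<gamma>: "\<And>p. p \<in> P \<Longrightarrow> (\<Sum>m<k. \<gamma> m * (g m \<bullet> p + c m)) = k0" and m: "m < k" for \<gamma> k0 m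
  proof -
    \<comment> \<open>On a pair the combination is a difference of two values of
      \<open>\<Gamma>\<close>. Every index occurs on both sides of \<open>I\<close>, so
      \<open>\<Gamma>\<close> is constant below \<open>k\<close>, and its successive differences
      return the weights.\<close>
    define \<Gamma> where "\<Gamma> b = (\<Sum>m<k. \<gamma> m * (if b \<le> m then 1 else 0))" for b
    have dif: "\<Gamma> (\<iota> i) - \<Gamma> (\<iota> j) = k0" if ij: "i \<in> I" "j \<notin> I" for i j
    proof -
      have "pt i j \<in> P" using ij by (auto simp: P)
      from \<gamma>[OF this] have "(\<Sum>m<k. \<gamma> m * (step \<iota> m i - step \<iota> m j)) = k0" using val ij by simp
      then show ?thesis by (simp add: \<Gamma>_def step_def right_diff_distrib sum_subtractf)
    qed
    have dif2: "\<Gamma> b - \<Gamma> b' = k0" if "b < k" "b' < k" for b b'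
      using in_class[OF that(1)] out_class[OF that(2)] dif by auto
    have "\<Gamma> 0 = 0" using s by (simp add: \<Gamma>_def)
    then have G0: "\<Gamma> b = 0" if "b < k" for b using dif2[OF that that] dif2[OF that, of 0] k2 by simp
    have Gk: "\<Gamma> k = 0" by (simp add: \<Gamma>_def)
    have "\<Gamma> m - \<Gamma> (Suc m) = (\<Sum>m'<k. if m' = m then \<gamma> m else 0)"
      unfolding \<Gamma>_def sum_subtractf[symmetric] by (intro sum.cong refl) auto
    then have "\<gamma> m = \<Gamma> m - \<Gamma> (Suc m)" using m by simp
    also have "\<Gamma> (Suc m) = 0" using G0[of "Suc m"] Gk m by (cases "Suc m = k") auto
    finally show ?thesis using G0[OF m] by simp
  qed
  interpret K: pl_split P "{..<k}" g c \<mu> q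
  proof
    show "2 \<le> card {..<k}" using k2 by simp
    show "0 < \<mu> p" if "p \<in> P" for p using that pos mu_pt by (auto simp: P)
    show "sum \<mu> P = 1" by (rule mu1)
    show "q = (\<Sum>p\<in>P. \<mu> p *\<^sub>R p)" by (rule q_def)
    show "g e \<bullet> q + c e = g f \<bullet> q + c f" if "e \<in> {..<k}" "f \<in> {..<k}" for e f using psi_q0 that by simp
    show "\<gamma> f = 0" if "sum \<gamma> {..<k} = 0" "\<And>p. p \<in> P \<Longrightarrow> (\<Sum>f<k. \<gamma> f * (g f \<bullet> p + c f)) = k0" "f \<in> {..<k}" for \<gamma> k0 f
      using indep[OF that(1,2), of f] that(3) by simp
  qed
  show "k_split k P (regular_subdivision P ht)" using K.RS_k_split by simp
qed

end

locale fan_base = indexed_base \<iota> k I for \<iota> :: "'n::finite \<Rightarrow> nat" and k and I :: "'n set" +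
  fixes g :: "nat \<Rightarrow> real^'n" and c :: "nat \<Rightarrow> real"
  assumes g_def: "g = (\<lambda>m. - e_set {y. \<iota> y \<le> m})" and c_def: "c = (\<lambda>m. real (card (I \<inter> {y. \<iota> y \<le> m})))"
    and pl: "pl_data (vertices (hypersimplex (card I) (UNIV :: 'n set))) {..<k} g c"
begin

sublocale pl_data "vertices (hypersimplex (card I) (UNIV :: 'n set))" "{..<k}" g c by (rule pl)

lemma e_set_inner: "e_set A \<bullet> x = (\<Sum>y\<in>A. x $ y)" for x :: "real^'n"
  by (simp add: e_set_def inner_sum_left inner_axis')

lemma psi_base: "psi m (e_set I) = 0"
  unfolding psi_def unfolding g_def c_def by (simp add: e_set_inner sum.If_cases Int_commute)

lemma psi_pair:
  assumes "i \<in> I" "j \<notin> I" shows "psi m (pair_pt I i j) = step \<iota> m i - step \<iota> m j"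
proof -
  have "psi m (pair_pt I i j) = psi m (e_set I) + (g m \<bullet> axis j 1 - g m \<bullet> axis i 1)"
    by (simp add: psi_def pair_pt_def inner_add_right inner_diff_right)
  then show ?thesis unfolding psi_base by (simp add: g_def inner_axis step_def)
qed

lemma psi_matching:
  assumes "bij_betw \<omega> (I - J) (J - I)"
  shows "psi m (e_set J) = (\<Sum>i\<in>I - J. psi m (pair_pt I i (\<omega> i)))"
proof -
  have "psi m (e_set J) = psi m (e_set I) + (\<Sum>i\<in>I - J. psi m (pair_pt I i (\<omega> i)) - psi m (e_set I))"
    by (subst e_set_matching[OF assms]) (simp add: psi_def inner_add_right inner_sum_right inner_diff_right)
  then show ?thesis by (simp add: psi_base)
qed

lemma bij_range:
  assumes "bij_betw \<omega> (I - J) (J - I)" "i \<in> I - J" shows "i \<in> I" "\<omega> i \<notin> I"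
  using assms by (auto simp: bij_betw_def)

text \<open>Each cut function is additive along a matching and at most the indicator of
  \<open>\<iota> i < \<iota> (\<omega> i)\<close> on a pair, so no matching has fewer ascending
  pairs than the height. The height is the largest excess in an initial segment, the bound reached
  by \<open>greedy_matching\<close>.\<close>

lemma exists_good_matching:
  assumes J: "card J = card I"
  obtains \<omega> where "bij_betw \<omega> (I - J) (J - I)" "ht (e_set J) = (\<Sum>i\<in>I - J. if \<iota> i < \<iota> (\<omega> i) then 1 else 0)"
proof -
  let ?A = "I - J" and ?B = "J - I"
  have cAB: "card ?A = card ?B" using J by (metis card_Diff_subset_Int finite Int_commute finite_Int)
  have A_int: "(\<Sum>i\<in>X. step \<iota> m i) = real (card {i\<in>X. \<iota> i \<le> m})" for X m
    by (simp add: step_def sum.If_cases Int_def)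
  obtain \<omega>0 where w0: "bij_betw \<omega>0 ?A ?B" using cAB finite_same_card_bij[of ?A ?B] by auto
  have psiJ: "psi m (e_set J) = real (card {i\<in>?A. \<iota> i \<le> m}) - real (card {i\<in>?B. \<iota> i \<le> m})" for m
  proof -
    have "psi m (e_set J) = (\<Sum>i\<in>?A. step \<iota> m i - step \<iota> m (\<omega>0 i))"
      unfolding psi_matching[OF w0] using bij_range[OF w0] by (intro sum.cong refl psi_pair)
    also have "\<dots> = (\<Sum>i\<in>?A. step \<iota> m i) - (\<Sum>i\<in>?B. step \<iota> m i)"
      using sum.reindex_bij_betw[OF w0, of "step \<iota> m"] by (simp add: sum_subtractf)
    finally show ?thesis by (simp add: A_int)
  qed
  have lower: "ht (e_set J) \<le> (\<Sum>i\<in>?A. if \<iota> i < \<iota> (\<omega> i) then 1 else 0)" if w: "bij_betw \<omega> ?A ?B" for \<omega>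
  proof -
    have "psi m (e_set J) \<le> (\<Sum>i\<in>?A. if \<iota> i < \<iota> (\<omega> i) then 1 else 0)" for m
      unfolding psi_matching[OF w]
    proof (rule sum_mono)
      fix i assume "i \<in> ?A"
      then show "psi m (pair_pt I i (\<omega> i)) \<le> (if \<iota> i < \<iota> (\<omega> i) then 1 else 0)"
        using bij_range[OF w] by (simp add: psi_pair step_def)
    qed
    then show ?thesis unfolding ht_def using k2 by (subst Max_le_iff) (auto simp: lessThan_empty_iff)
  qed
  have k1: "k - 1 \<in> {..<k}" using k2 by simp
  have all_le: "\<iota> i \<le> k - 1" for i using iota_less[of i] by linarith
  have "{i\<in>X. \<iota> i \<le> k - 1} = X" for X using all_le by blast
  then have "psi (k - 1) (e_set J) = 0" unfolding psiJ by (simp only: cAB)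
  then have ht0: "0 \<le> ht (e_set J)" using ht_ge[OF k1, of "e_set J"] by simp
  \<comment> \<open>The excesses are integers, so rounding the height down loses nothing.\<close>
  define e where "e = nat \<lfloor>ht (e_set J)\<rfloor>"
  have "card {i\<in>?A. \<iota> i \<le> m} \<le> card {i\<in>?B. \<iota> i \<le> m} + e" for m
  proof (cases "m < k")
    case True
    then have "real (card {i\<in>?A. \<iota> i \<le> m}) - real (card {i\<in>?B. \<iota> i \<le> m}) \<le> ht (e_set J)"
      using ht_ge[of m "e_set J"] by (simp add: psiJ)
    then have "int (card {i\<in>?A. \<iota> i \<le> m}) - int (card {i\<in>?B. \<iota> i \<le> m}) \<le> \<lfloor>ht (e_set J)\<rfloor>"
      by (simp add: le_floor_iff)
    then show ?thesis unfolding e_def by linarith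
  next
    case False
    then have "\<iota> i \<le> m" for i using iota_less[of i] by linarith
    then have "{i\<in>X. \<iota> i \<le> m} = X" for X by blast
    then show ?thesis by (simp only: cAB)
  qed
  from greedy_matching[OF _ _ cAB this] obtain \<omega> where w: "bij_betw \<omega> ?A ?B" "card {a\<in>?A. \<iota> a < \<iota> (\<omega> a)} \<le> e" by auto
  have "(\<Sum>i\<in>?A. if \<iota> i < \<iota> (\<omega> i) then 1 else 0) = real (card {a\<in>?A. \<iota> a < \<iota> (\<omega> a)})"
    by (simp add: sum.If_cases Int_def)
  also have "\<dots> \<le> ht (e_set J)" using w(2) ht0 unfolding e_def by linarith
  finally show ?thesis using lower[OF w(1)] w(1) that by (meson order_antisym)
qed

lemma ht_pair: "i \<in> I \<Longrightarrow> j \<notin> I \<Longrightarrow> ht (pair_pt I i j) = (if \<iota> i < \<iota> j then 1 else 0)"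
  unfolding ht_def pair_max[symmetric] by (simp add: psi_pair)

lemma stiefel_heights:
  assumes l: "\<And>i j. i \<in> I \<Longrightarrow> j \<notin> I \<Longrightarrow> l i j = (if \<iota> i < \<iota> j then 1 else 0)" and J: "card J = card I"
  shows "stiefel_map I l (e_set J) = ht (e_set J)"
proof -
  let ?A = "I - J" and ?B = "J - I"
  have cAB: "card ?A = card ?B" using J by (metis card_Diff_subset_Int finite Int_commute finite_Int)
  have sl: "(\<Sum>i\<in>?A. l i (\<omega> i)) = (\<Sum>i\<in>?A. if \<iota> i < \<iota> (\<omega> i) then 1 else 0)" if "bij_betw \<omega> ?A ?B" for \<omega>
    using bij_range[OF that] by (intro sum.cong refl l)
  have J': "{i. e_set J $ i = (1 :: real)} = J" by auto
  obtain \<omega> where w: "bij_betw \<omega> ?A ?B" "ht (e_set J) = (\<Sum>i\<in>?A. if \<iota> i < \<iota> (\<omega> i) then 1 else 0)"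
    by (rule exists_good_matching[OF J]) (rule that)
  obtain \<omega>' where w': "bij_betw \<omega>' ?A ?B" "stiefel_pi l ?A ?B = (\<Sum>i\<in>?A. l i (\<omega>' i))"
    by (rule stiefel_pi_attained[OF cAB]) (rule that)
  have "stiefel_pi l ?A ?B \<le> ht (e_set J)" using stiefel_pi_le[OF w(1), of l] sl[OF w(1)] w(2) by simp
  moreover have "ht (e_set J) \<le> stiefel_pi l ?A ?B"
  proof -
    have "psi m (e_set J) \<le> stiefel_pi l ?A ?B" if m: "m < k" for m
      unfolding psi_matching[OF w'(1)] w'(2)
    proof (rule sum_mono)
      fix i assume i: "i \<in> ?A"
      have "psi m (pair_pt I i (\<omega>' i)) \<le> ht (pair_pt I i (\<omega>' i))" using m by (intro ht_ge) simp
      then show "psi m (pair_pt I i (\<omega>' i)) \<le> l i (\<omega>' i)"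
        using bij_range[OF w'(1) i] by (simp add: ht_pair l)
    qed
    then show ?thesis unfolding ht_def using k2 by (subst Max_le_iff) (auto simp: lessThan_empty_iff)
  qed
  ultimately show ?thesis unfolding stiefel_map_def Let_def J' by simp
qed

text \<open>Each vertex that spans \<open>x\<close> is replaced by the pairs of a good matching. A
  piece maximal at the vertex is maximal at every pair, since the gaps are nonnegative and sum to
  zero. The coordinates of \<open>x\<close> over \<open>I\<close> sum to \<open>#I - 1\<close>,
  which makes the total weight of the pairs 1.\<close>

lemma figure_tight:
  assumes x: "x \<in> convex hull (vertices (vertex_figure I))"
  shows "x \<in> convex hull {p\<in>vertices (vertex_figure I). amx x \<subseteq> amx p}"
proof -
  let ?V = "vertices (hypersimplex (card I) (UNIV :: 'n set))"
  let ?S = "{p\<in>vertices (vertex_figure I). amx x \<subseteq> amx p}"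
  have xf: "x \<in> vertex_figure I" using x vertices_vertex_figure(2) by blast
  have xI: "(\<Sum>y\<in>I. x $ y) = real (card I) - 1" using xf by (simp add: vertex_figure_def)
  define Q where "Q = {p\<in>?V. amx x \<subseteq> amx p}"
  have "x \<in> convex hull ?V" using xf unfolding hull_vertices_hypersimplex by (simp add: vertex_figure_def)
  then have "x \<in> convex hull Q" unfolding Q_def by (rule tight_amx)
  moreover have finQ: "finite Q" unfolding Q_def using fin_P by simp
  ultimately obtain t where lam: "\<And>p. p \<in> Q \<Longrightarrow> 0 \<le> t p" "sum t Q = 1" "(\<Sum>p\<in>Q. t p *\<^sub>R p) = x"
    unfolding convex_hull_finite[OF finQ] by blast
  define good where "good p J \<omega> \<longleftrightarrow> p = e_set J \<and> bij_betw \<omega> (I - J) (J - I) \<and> (\<forall>i\<in>I - J. pair_pt I i (\<omega> i) \<in> ?S)" for p J \<omega>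
  have "\<exists>J \<omega>. good p J \<omega>" if p: "p \<in> Q" for p
  proof -
    obtain J where J: "card J = card I" "p = e_set J" using p by (auto simp: Q_def vertices_hypersimplex)
    obtain \<omega> where w: "bij_betw \<omega> (I - J) (J - I)" "ht (e_set J) = (\<Sum>i\<in>I - J. if \<iota> i < \<iota> (\<omega> i) then 1 else 0)"
      by (rule exists_good_matching[OF J(1)]) (rule that)
    have "pair_pt I i (\<omega> i) \<in> ?S" if i: "i \<in> I - J" for i
    proof -
      have r: "i \<in> I" "\<omega> i \<notin> I" using bij_range[OF w(1) i] .
      have "m \<in> amx (pair_pt I i (\<omega> i))" if m: "m \<in> amx x" for m
      proof -
        have mk: "m \<in> {..<k}" using m by (simp add: amx_def)
        have "m \<in> amx p" using p m by (auto simp: Q_def)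
        then have "psi m (e_set J) = ht (e_set J)" unfolding J(2)[symmetric] by (rule ht_eq_iff[OF mk, THEN iffD2])
        then have "(\<Sum>i\<in>I - J. ht (pair_pt I i (\<omega> i)) - psi m (pair_pt I i (\<omega> i))) = 0"
          unfolding w(2) psi_matching[OF w(1)] using bij_range[OF w(1)] by (simp add: sum_subtractf ht_pair)
        then have "ht (pair_pt I i (\<omega> i)) - psi m (pair_pt I i (\<omega> i)) = 0"
          using ht_ge[OF mk] i by (subst (asm) sum_nonneg_eq_0_iff) auto
        then have "psi m (pair_pt I i (\<omega> i)) = ht (pair_pt I i (\<omega> i))" by simp
        then show ?thesis by (rule ht_eq_iff[OF mk, THEN iffD1])
      qed
      then show ?thesis using r by (auto simp: vertices_vertex_figure(1))
    qed
    then show ?thesis unfolding good_def using J(2) w(1) by blast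
  qed
  then obtain Jf \<Omega> where "\<And>p. p \<in> Q \<Longrightarrow> good p (Jf p) (\<Omega> p)" by metis
  then have JO: "\<And>p. p \<in> Q \<Longrightarrow> p = e_set (Jf p)" "\<And>p. p \<in> Q \<Longrightarrow> bij_betw (\<Omega> p) (I - Jf p) (Jf p - I)"
    "\<And>p i. p \<in> Q \<Longrightarrow> i \<in> I - Jf p \<Longrightarrow> pair_pt I i (\<Omega> p i) \<in> ?S"
    unfolding good_def by blast+
  define X where "X = (SIGMA p:Q. I - Jf p)"
  have finX: "finite X" using finQ by (simp add: X_def)
  have total: "(\<Sum>p\<in>Q. t p * real (card (I - Jf p))) = 1"
  proof -
    have "(\<Sum>y\<in>I. x $ y) = (\<Sum>p\<in>Q. t p * (\<Sum>y\<in>I. p $ y))"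
      unfolding lam(3)[symmetric] by (simp add: sum_distrib_left) (rule sum.swap)
    also have "\<dots> = (\<Sum>p\<in>Q. t p * real (card I) - t p * real (card (I - Jf p)))"
    proof (intro sum.cong refl)
      fix p assume p: "p \<in> Q"
      have "(\<Sum>y\<in>I. p $ y) = real (card (I \<inter> Jf p))" by (subst JO(1)[OF p]) (simp add: sum.If_cases)
      moreover have "card I = card (I \<inter> Jf p) + card (I - Jf p)" by (metis card_Int_Diff finite)
      ultimately have "(\<Sum>y\<in>I. p $ y) = real (card I) - real (card (I - Jf p))" by simp
      then show "t p * (\<Sum>y\<in>I. p $ y) = t p * real (card I) - t p * real (card (I - Jf p))"
        by (simp add: right_diff_distrib)
    qed
    also have "\<dots> = real (card I) - (\<Sum>p\<in>Q. t p * real (card (I - Jf p)))"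
      using lam(2) by (simp add: sum_subtractf flip: sum_distrib_right)
    finally show ?thesis using xI by simp
  qed
  have "(\<Sum>z\<in>X. t (fst z) *\<^sub>R pair_pt I (snd z) (\<Omega> (fst z) (snd z))) \<in> convex hull ?S"
  proof (rule convex_sum[OF finX convex_convex_hull])
    have "(\<Sum>z\<in>X. t (fst z)) = (\<Sum>p\<in>Q. \<Sum>i\<in>I - Jf p. t p)"
      unfolding X_def using finQ by (subst sum.Sigma) (auto simp: split_def)
    then show "(\<Sum>z\<in>X. t (fst z)) = 1" using total by (simp add: mult.commute)
    show "0 \<le> t (fst z)" if "z \<in> X" for z using that lam(1) by (auto simp: X_def)
    show "pair_pt I (snd z) (\<Omega> (fst z) (snd z)) \<in> convex hull ?S" if "z \<in> X" for z
    proof (rule hull_inc, rule JO(3))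
      show "fst z \<in> Q" "snd z \<in> I - Jf (fst z)" using that by (auto simp: X_def)
    qed
  qed
  also have "(\<Sum>z\<in>X. t (fst z) *\<^sub>R pair_pt I (snd z) (\<Omega> (fst z) (snd z))) =
    (\<Sum>p\<in>Q. \<Sum>i\<in>I - Jf p. t p *\<^sub>R pair_pt I i (\<Omega> p i))"
    unfolding X_def using finQ by (subst sum.Sigma) (auto simp: split_def)
  also have "\<dots> = (\<Sum>p\<in>Q. t p *\<^sub>R p - t p *\<^sub>R e_set I + (t p * real (card (I - Jf p))) *\<^sub>R e_set I)"
  proof (intro sum.cong refl)
    fix p assume p: "p \<in> Q"
    have "p = e_set I + (\<Sum>i\<in>I - Jf p. pair_pt I i (\<Omega> p i) - e_set I)"
      using e_set_matching[OF JO(2)[OF p]] JO(1)[OF p] by simp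
    then have "(\<Sum>i\<in>I - Jf p. pair_pt I i (\<Omega> p i)) = p - e_set I + real (card (I - Jf p)) *\<^sub>R e_set I"
      unfolding sum_subtractf sum_constant_scaleR by (metis add.commute add_diff_cancel_left' diff_add_cancel)
    then show "(\<Sum>i\<in>I - Jf p. t p *\<^sub>R pair_pt I i (\<Omega> p i)) =
      t p *\<^sub>R p - t p *\<^sub>R e_set I + (t p * real (card (I - Jf p))) *\<^sub>R e_set I"
      by (simp add: scaleR_diff_right scaleR_add_right flip: scaleR_sum_right)
  qed
  also have "\<dots> = x"
    unfolding sum.distrib sum_subtractf lam(3) scaleR_sum_left[symmetric] lam(2) total by simp
  finally show ?thesis .
qed

lemma figure_data: "pl_data (vertices (vertex_figure I)) {..<k} g c"
proof
  show "finite (vertices (vertex_figure I))" by (simp add: vertices_vertex_figure(1))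
qed (use figure_tight[unfolded amx_def psi_def] k2 in \<open>auto simp: lessThan_empty_iff\<close>)

lemma figure_split:
  "k_split k (vertices (vertex_figure I)) (regular_subdivision (vertices (vertex_figure I)) ht)"
  using pair_split(1)[OF figure_data vertices_vertex_figure(1) inj_pair_pt] psi_pair unfolding psi_def by blast

text \<open>The map \<open>tw\<close> identifies the product with the vertex figure, with affine
  inverse \<open>bk\<close>, and tightness is transported along it. The constants \<open>c'\<close>
  vanish because the functionals do so at \<open>e_set I\<close>.\<close>

lemma product_split:
  obtains h where "k_split k (vertices (hypersimplex 1 I \<times> hypersimplex 1 (-I)))
      (regular_subdivision (vertices (hypersimplex 1 I \<times> hypersimplex 1 (-I))) h)"
    "\<And>i j. i \<in> I \<Longrightarrow> j \<notin> I \<Longrightarrow> h (axis i 1, axis j 1) = (if \<iota> i < \<iota> j then 1 else 0)"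
proof -
  let ?P = "vertices (hypersimplex 1 I \<times> hypersimplex 1 (-I))"
  define g' :: "nat \<Rightarrow> (real^'n) \<times> (real^'n)" where "g' m = (- g m, g m)" for m
  define c' :: "nat \<Rightarrow> real" where "c' m = 0" for m
  define tw where "tw z = e_set I - fst z + snd z" for z :: "(real^'n) \<times> (real^'n)"
  define bk :: "real^'n \<Rightarrow> (real^'n) \<times> (real^'n)" where
    "bk p = ((\<chi> i. if i \<in> I then 1 - p $ i else 0), (\<chi> i. if i \<in> I then 0 else p $ i))" for p
  have val: "g' m \<bullet> z + c' m = psi m (tw z)" for m z
    using psi_base[of m] by (cases z) (simp add: g'_def c'_def tw_def psi_def inner_add_right inner_diff_right)
  have pl': "pl_data ?P {..<k} g' c'"
  proof
    show "finite ?P" unfolding vertices_product(1) by simp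
    show "{..<k} \<noteq> {}" using k2 by (simp add: lessThan_empty_iff)
    fix z assume "z \<in> convex hull ?P"
    then have z: "fst z \<in> hypersimplex 1 I" "snd z \<in> hypersimplex 1 (-I)" unfolding vertices_product(2) by auto
    have z0: "fst z $ i = 0" if "i \<notin> I" for i
      using z(1) that sum_nonneg_eq_0_iff[of "-I" "\<lambda>i. fst z $ i"] by (auto simp: hypersimplex_def)
    have z1: "snd z $ i = 0" if "i \<in> I" for i
      using z(2) that sum_nonneg_eq_0_iff[of I "\<lambda>i. snd z $ i"] by (auto simp: hypersimplex_def)
    have bt: "bk (tw z) = z"
      using z0 z1 by (auto simp: bk_def tw_def vec_eq_iff prod_eq_iff)
    have "tw z \<in> vertex_figure I"
      unfolding vertex_figure_box box_slice_def
    proof (intro CollectI conjI allI)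
      show "0 \<le> tw z $ i" "tw z $ i \<le> 1" for i
        using z z0[of i] z1[of i] by (cases "i \<in> I"; simp add: tw_def hypersimplex_def)+
      show "(\<Sum>i\<in>I. tw z $ i) = real (card I) - 1"
        using z z1 by (simp add: tw_def hypersimplex_def sum.distrib sum_subtractf)
      show "(\<Sum>i\<in>-I. tw z $ i) = 1"
        using z z0 by (simp add: tw_def hypersimplex_def sum.distrib sum_subtractf)
    qed
    then have "tw z \<in> convex hull {p\<in>vertices (vertex_figure I). amx (tw z) \<subseteq> amx p}"
      by (intro figure_tight) (simp add: vertices_vertex_figure(2))
    moreover define S where "S = {p\<in>?P. {f\<in>{..<k}. \<forall>e\<in>{..<k}. g' e \<bullet> z + c' e \<le> g' f \<bullet> z + c' f} \<subseteq>
      {f\<in>{..<k}. \<forall>e\<in>{..<k}. g' e \<bullet> p + c' e \<le> g' f \<bullet> p + c' f}}"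
    have "convex {p. bk p \<in> convex hull S}"
    proof (rule convexI)
      fix a b :: "real^'n" and u v :: real
      assume ab: "a \<in> {p. bk p \<in> convex hull S}" "b \<in> {p. bk p \<in> convex hull S}" and uv: "0 \<le> u" "0 \<le> v" "u + v = 1"
      have "bk (u *\<^sub>R a + v *\<^sub>R b) = u *\<^sub>R bk a + v *\<^sub>R bk b"
      proof -
        have "1 - (u * s + v * t) = u * (1 - s) + v * (1 - t)" for s t :: real
          using uv(3) by (simp add: algebra_simps)
        then show ?thesis by (auto simp: bk_def vec_eq_iff)
      qed
      also have "\<dots> \<in> convex hull S" using ab uv by (intro convexD[OF convex_convex_hull]) auto
      finally show "u *\<^sub>R a + v *\<^sub>R b \<in> {p. bk p \<in> convex hull S}" by simp
    qed
    moreover have "{p\<in>vertices (vertex_figure I). amx (tw z) \<subseteq> amx p} \<subseteq> {p. bk p \<in> convex hull S}"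
    proof
      fix p assume p: "p \<in> {p\<in>vertices (vertex_figure I). amx (tw z) \<subseteq> amx p}"
      then obtain i j where ij: "i \<in> I" "j \<notin> I" "p = pair_pt I i j" by (auto simp: vertices_vertex_figure(1))
      have b: "bk p = (axis i 1, axis j 1)"
        using ij by (auto simp: bk_def pair_pt_def vec_eq_iff axis_def)
      have "tw (axis i 1, axis j 1) = p" using ij(3) by (simp add: tw_def pair_pt_def)
      moreover have "(axis i 1, axis j 1) \<in> ?P" using ij unfolding vertices_product(1) by auto
      ultimately have "(axis i 1, axis j 1) \<in> S"
        using p unfolding S_def val by (simp add: amx_def)
      then show "p \<in> {p. bk p \<in> convex hull S}" using b by (simp add: hull_inc)
    qed
    ultimately have "bk (tw z) \<in> convex hull S" using hull_minimal by blast
    then show "z \<in> convex hull {p\<in>?P. {f\<in>{..<k}. \<forall>e\<in>{..<k}. g' e \<bullet> z + c' e \<le> g' f \<bullet> z + c' f} \<subseteq>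
      {f\<in>{..<k}. \<forall>e\<in>{..<k}. g' e \<bullet> p + c' e \<le> g' f \<bullet> p + c' f}}" unfolding bt S_def .
  qed simp
  have inj: "inj_on (\<lambda>(i, j). (axis i 1 :: real^'n, axis j 1 :: real^'n)) (I \<times> - I)"
    by (auto simp: inj_on_def axis_eq_axis)
  have v: "g' m \<bullet> (axis i 1, axis j 1) + c' m = step \<iota> m i - step \<iota> m j" if "i \<in> I" "j \<notin> I" for m i j
    unfolding val using psi_pair[OF that, of m] by (simp add: tw_def pair_pt_def)
  note ps = pair_split[OF pl' vertices_product(1) inj v]
  show ?thesis by (rule that[OF ps(1) ps(2)]) auto
qed

end

section \<open>Extensions have their base vertex in the common cell\<close>

text \<open>The gap between the Stiefel height and a functional touching it at
  \<open>e_set I\<close> adds up along an optimal matching, so it is nonnegative on all vertices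
  once it is so on the vertex figure.\<close>

lemma stiefel_extension_base:
  fixes I :: "'n::finite set" and d :: nat
  assumes d: "card I = d" and S: "k_split k (vertices (hypersimplex d (UNIV :: 'n set))) \<S>"
    and T: "k_split k (vertices (vertex_figure I)) \<T>" and ext: "stiefel_extension I \<T> \<S>"
  shows "e_set I \<in> common_cell \<S>"
proof -
  let ?V = "vertices (hypersimplex d (UNIV :: 'n set))" and ?W = "vertices (vertex_figure I)"
  obtain h where h: "\<T> = regular_subdivision ?W h"
    "\<S> = regular_subdivision ?V (stiefel_map I (\<lambda>i j. h (pair_pt I i j)))"
    using ext d unfolding stiefel_extension_def pair_pt_def by blast
  define \<eta> where "\<eta> = stiefel_map I (\<lambda>i j. h (pair_pt I i j))"
  have V: "?V = e_set ` {J. card J = card I}" using d by (simp add: vertices_hypersimplex)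
  have eta: "\<eta> (e_set J) = stiefel_pi (\<lambda>i j. h (pair_pt I i j)) (I - J) (J - I)" for J
  proof -
    have "{i. e_set J $ i = (1 :: real)} = J" by auto
    then show ?thesis by (simp add: \<eta>_def stiefel_map_def)
  qed
  have dec: "\<exists>\<omega>. bij_betw \<omega> (I - J) (J - I) \<and> \<eta> (e_set J) = (\<Sum>i\<in>I - J. h (pair_pt I i (\<omega> i)))" if J: "card J = card I" for J
  proof -
    have c: "card (I - J) = card (J - I)" using J by (metis card_Diff_subset_Int finite Int_commute finite_Int)
    obtain \<omega> where "bij_betw \<omega> (I - J) (J - I)"
      "stiefel_pi (\<lambda>i j. h (pair_pt I i j)) (I - J) (J - I) = (\<Sum>i\<in>I - J. h (pair_pt I i (\<omega> i)))"
      by (rule stiefel_pi_attained[OF c]) (rule that)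
    then show ?thesis unfolding eta by blast
  qed
  have eta_pair: "\<eta> (pair_pt I i j) = h (pair_pt I i j)" if ij: "i \<in> I" "j \<notin> I" for i j
  proof -
    let ?J = "insert j (I - {i})"
    have s: "I - ?J = {i}" "?J - I = {j}" using ij by auto
    have "card ?J = card I" using ij by (metis card_Suc_Diff1 card_insert_disjoint finite Diff_iff)
    then obtain \<omega> where "bij_betw \<omega> {i} {j}" "\<eta> (e_set ?J) = (\<Sum>i\<in>{i}. h (pair_pt I i (\<omega> i)))" using dec[of ?J] unfolding s by blast
    then show ?thesis unfolding pair_pt_e_set[OF ij, symmetric] by (auto simp: bij_betw_def)
  qed
  have eta_I: "\<eta> (e_set I) = 0" using dec[of I] by auto
  have W_V: "?W \<subseteq> ?V"
  proof
    fix p assume "p \<in> ?W"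
    then obtain i j where ij: "i \<in> I" "j \<notin> I" "p = pair_pt I i j" by (auto simp: vertices_vertex_figure(1))
    moreover have "card (insert j (I - {i})) = card I"
      using ij by (metis card_Suc_Diff1 card_insert_disjoint finite Diff_iff)
    ultimately show "p \<in> ?V" unfolding V by (auto simp: pair_pt_e_set)
  qed
  have subS: "subdivision ?V \<S>" and subT: "subdivision ?W \<T>"
    using S T by (auto simp: k_split_def coarsest_subdivision_def)
  have eW: "\<eta> p = h p" if "p \<in> ?W" for p
    using that eta_pair by (auto simp: vertices_vertex_figure(1))
  have "\<exists>D\<in>maximal_cells \<S>. e_set I \<in> D \<and> D \<inter> ?W = C" if C: "C \<in> maximal_cells \<T>" for C
  proof -
    have "C \<in> \<T>" using C by (simp add: maximal_cells_def)
    then obtain a b where ab: "\<forall>p\<in>?W. b \<le> a \<bullet> p + h p" "C = {p\<in>?W. a \<bullet> p + h p = b}"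
      unfolding h(1) regular_subdivision_eq by blast
    \<comment> \<open>The functional \<open>e_set (-I)\<close> is 0 at \<open>e_set I\<close> and 1
      on the vertex figure. Its coefficient moves the hyperplane through \<open>e_set I\<close>,
      where the height is 0, without changing the gaps on the vertex figure.\<close>
    define A where "A = a + (a \<bullet> e_set I - b) *\<^sub>R e_set (-I)"
    define B where "B = a \<bullet> e_set I"
    have in_J: "e_set (-I) \<bullet> e_set J = real (card (J - I))" for J :: "'n set"
    proof -
      have "- I \<inter> J = J - I" by auto
      then show ?thesis by (simp add: e_set_def[of "-I"] inner_sum_left inner_axis' sum.If_cases)
    qed
    have AI: "A \<bullet> e_set I = B" by (simp add: A_def B_def inner_add_left in_J)
    have Ap: "A \<bullet> p + \<eta> p - B = a \<bullet> p + h p - b" if p: "p \<in> ?W" for p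
    proof -
      obtain i j where ij: "i \<in> I" "j \<notin> I" "p = pair_pt I i j" using p by (auto simp: vertices_vertex_figure(1))
      have "insert j (I - {i}) - I = {j}" using ij by auto
      then have "e_set (-I) \<bullet> p = 1" using ij in_J[of "insert j (I - {i})"] by (simp add: pair_pt_e_set)
      then show ?thesis using eW[OF p] by (simp add: A_def B_def inner_add_left)
    qed
    have AJ: "B \<le> A \<bullet> p + \<eta> p" if p: "p \<in> ?V" for p
    proof -
      obtain J where J: "card J = card I" "p = e_set J" using p unfolding V by blast
      obtain \<omega> where w: "bij_betw \<omega> (I - J) (J - I)" "\<eta> (e_set J) = (\<Sum>i\<in>I - J. h (pair_pt I i (\<omega> i)))"
        using dec[OF J(1)] by blast
      have r: "pair_pt I i (\<omega> i) \<in> ?W" if "i \<in> I - J" for i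
        using w(1) that unfolding vertices_vertex_figure(1) bij_betw_def by auto
      have "A \<bullet> p = B + (\<Sum>i\<in>I - J. A \<bullet> pair_pt I i (\<omega> i) - B)"
        unfolding J(2) by (subst e_set_matching[OF w(1)]) (simp add: inner_add_right inner_sum_right inner_diff_right AI)
      then have "A \<bullet> p + \<eta> p - B = (\<Sum>i\<in>I - J. A \<bullet> pair_pt I i (\<omega> i) + h (pair_pt I i (\<omega> i)) - B)"
        unfolding J(2) w(2) by (simp add: sum.distrib sum_subtractf algebra_simps)
      also have "\<dots> \<ge> 0"
      proof (rule sum_nonneg)
        fix i assume i: "i \<in> I - J"
        show "0 \<le> A \<bullet> pair_pt I i (\<omega> i) + h (pair_pt I i (\<omega> i)) - B"
          using Ap[OF r[OF i]] eW[OF r[OF i]] ab(1) r[OF i] by force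
      qed
      finally show ?thesis by simp
    qed
    define D0 where "D0 = {p\<in>?V. A \<bullet> p + \<eta> p = B}"
    have "D0 \<in> \<S>" unfolding h(2) \<eta>_def[symmetric] regular_subdivision_eq D0_def using AJ by blast
    then obtain D where D: "D \<in> maximal_cells \<S>" "D0 \<subseteq> D" using cell_in_maximal[OF subS] by blast
    have "e_set I \<in> D0" unfolding D0_def V using AI eta_I by auto
    moreover have "C \<subseteq> D0"
    proof
      fix p assume p: "p \<in> C"
      then have "p \<in> ?W" "a \<bullet> p + h p = b" using ab(2) by auto
      then show "p \<in> D0" using Ap[of p] W_V by (auto simp: D0_def)
    qed
    \<comment> \<open>By maximality of \<open>C\<close> this restriction equals \<open>C\<close>, so
      \<open>C\<close> can be recovered from \<open>D\<close>, and distinct maximal cells of the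
      figure give distinct cells.\<close>
    moreover have "D \<inter> ?W \<in> \<T>"
    proof -
      have "D \<in> \<S>" using D by (simp add: maximal_cells_def)
      then obtain a' b' where ab': "\<forall>p\<in>?V. b' \<le> a' \<bullet> p + \<eta> p" "D = {p\<in>?V. a' \<bullet> p + \<eta> p = b'}"
        unfolding h(2) \<eta>_def[symmetric] regular_subdivision_eq by blast
      have "\<forall>p\<in>?W. b' \<le> a' \<bullet> p + h p" using ab'(1) W_V eW by (metis subsetD)
      moreover have "D \<inter> ?W = {p\<in>?W. a' \<bullet> p + h p = b'}" using ab'(2) W_V eW by auto
      ultimately show ?thesis unfolding h(1) regular_subdivision_eq by blast
    qed
    moreover have "C \<subseteq> ?W" using ab(2) by blast
    ultimately have "D \<inter> ?W = C" using C D(2) by (auto simp: maximal_cells_def)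
    then show ?thesis using D \<open>e_set I \<in> D0\<close> by blast
  qed
  then obtain \<Phi> where \<Phi>: "\<And>C. C \<in> maximal_cells \<T> \<Longrightarrow> \<Phi> C \<in> maximal_cells \<S> \<and> e_set I \<in> \<Phi> C \<and> \<Phi> C \<inter> ?W = C" by metis
  have "inj_on \<Phi> (maximal_cells \<T>)" using \<Phi> by (metis inj_onI)
  then have "card (\<Phi> ` maximal_cells \<T>) = card (maximal_cells \<S>)"
    using S T by (simp add: card_image k_split_def)
  moreover have "\<Phi> ` maximal_cells \<T> \<subseteq> maximal_cells \<S>" using \<Phi> by blast
  moreover have "finite (maximal_cells \<S>)" using S by (simp add: k_split_def)
  ultimately have "\<Phi> ` maximal_cells \<T> = maximal_cells \<S>" by (intro card_subset_eq) auto
  then show ?thesis unfolding common_cell_def using \<Phi> by blast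
qed

section \<open>From the split to the Stiefel map\<close>

context hypersimplex_split
begin

text \<open>At a vertex \<open>e_set I\<close> of the common cell all initial sums agree with the
  last one, which is 0. So \<open>q\<close> and \<open>I\<close> have equal sums over each initial
  segment, which replaces \<open>q\<close> by the counts \<open>c m\<close>; the differences show
  that each class meets \<open>I\<close> and its complement.\<close>

lemma fan_base_exists:
  assumes I: "e_set I \<in> H"
  obtains \<iota> g c where "fan_base \<iota> k I g c" "\<S> = regular_subdivision V (pl_data.ht {..<k} g c)"
proof -
  have cI: "card I = d" using I H_V by (auto simp: V_eq dest: inj_e_set)
  obtain w where w: "split_fan d F w q"
    "\<And>f x. f \<in> F \<Longrightarrow> x \<in> \<Delta> \<Longrightarrow> x \<in> convex hull f \<longleftrightarrow> (\<forall>g\<in>F. w f \<bullet> (x - q) \<le> w g \<bullet> (x - q))"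
    by (rule split_fan_exists) (rule that)
  interpret W: split_fan d F w q by (rule w(1))
  obtain \<iota> fl s where fl: "bij_betw fl {..<card F} F" "0 < s" "\<And>y. \<iota> y < card F"
    "\<And>i. i < card F \<Longrightarrow> \<exists>y. \<iota> y = i"
    "\<And>x. (\<Sum>y\<in>UNIV. x $ y) = real d \<Longrightarrow>
       \<exists>c. \<forall>m<card F. w (fl m) \<bullet> (x - q) = s * (\<Sum>y\<in>{y. \<iota> y \<le> m}. x $ y - q $ y) + c"
    by (rule W.index_structure) (rule that)
  note fl = fl[unfolded card_F_k]
  have k2: "2 \<le> k" using card_F card_F_k by simp
  define g where "g = (\<lambda>m. - e_set {y. \<iota> y \<le> m} :: real^'n)"
  define c where "c = (\<lambda>m. real (card (I \<inter> {y. \<iota> y \<le> m})))"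
  have flF: "fl m \<in> F" if "m < k" for m using fl(1) that by (auto simp: bij_betw_def)
  have F_fl: "\<exists>m<k. f = fl m" if "f \<in> F" for f using fl(1) that by (auto simp: bij_betw_def)
  define Z where "Z m x = (\<Sum>y\<in>{y. \<iota> y \<le> m}. x $ y - q $ y)" for m and x :: "real^'n"
  have am_iff: "fl m \<in> W.am x \<longleftrightarrow> (\<forall>j<k. Z m x \<le> Z j x)" if m: "m < k" and x: "x \<in> \<Delta>" for m x
  proof -
    obtain c' where c': "\<And>m. m < k \<Longrightarrow> w (fl m) \<bullet> (x - q) = s * Z m x + c'"
      using fl(5)[of x] x unfolding Z_def by (auto simp: mem_hypersimplex)
    have "fl m \<in> W.am x \<longleftrightarrow> (\<forall>j<k. w (fl m) \<bullet> (x - q) \<le> w (fl j) \<bullet> (x - q))"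
      unfolding W.am_def using flF[OF m] flF F_fl by blast
    then show ?thesis using c' m fl(2) by simp
  qed
  have IH: "e_set I \<in> f" if "f \<in> F" for f using I H_sub[OF that] by blast
  have eI: "e_set I \<in> \<Delta>" using cI by simp
  have allI: "fl m \<in> W.am (e_set I)" if "m < k" for m
    using w(2)[OF flF[OF that] eI] hull_inc[OF IH[OF flF[OF that]]] flF[OF that] by (simp add: W.am_def)
  have Zend: "Z (k - 1) x = 0" if "x \<in> \<Delta>" for x
  proof -
    have "\<iota> y \<le> k - 1" for y using fl(3)[of y] by linarith
    then have "{y. \<iota> y \<le> k - 1} = UNIV" by blast
    then show ?thesis using that q_interior(3) by (simp add: Z_def mem_hypersimplex sum_subtractf)
  qed
  have k1: "k - 1 < k" using k2 by simp
  have ZI: "Z m (e_set I) = 0" if m: "m < k" for m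
  proof -
    have "Z m (e_set I) \<le> Z (k - 1) (e_set I)" using am_iff[OF m eI] allI[OF m] k1 by blast
    moreover have "Z (k - 1) (e_set I) \<le> Z m (e_set I)" using am_iff[OF k1 eI] allI[OF k1] m by blast
    ultimately show ?thesis using Zend[OF eI] by simp
  qed
  have cq: "c m = (\<Sum>y\<in>{y. \<iota> y \<le> m}. q $ y)" if "m < k" for m
    using ZI[OF that] by (simp add: Z_def c_def sum_subtractf sum.If_cases Int_commute)
  have psiZ: "g m \<bullet> x + c m = - Z m x" if "m < k" for m x
    using cq[OF that] by (simp add: g_def Z_def sum_subtractf e_set_def inner_sum_left inner_axis')
  define mx where "mx x = {f\<in>{..<k}. \<forall>e\<in>{..<k}. g e \<bullet> x + c e \<le> g f \<bullet> x + c f}" for x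
  have mx_iff: "m \<in> mx x \<longleftrightarrow> m < k \<and> fl m \<in> W.am x" if "x \<in> \<Delta>" for m x
    using am_iff[OF _ that, of m] psiZ by (auto simp: mx_def)
  have pl: "pl_data V {..<k} g c"
  proof
    show "finite V" using subdivision_finite(1)[OF sub] .
    show "{..<k} \<noteq> {}" using k2 by (simp add: lessThan_empty_iff)
    fix x assume "x \<in> convex hull V"
    then have x: "x \<in> \<Delta>" by (simp add: hull_V)
    have "e_set ` {J. card J = d \<and> W.am x \<subseteq> W.am (e_set J)} \<subseteq> {p\<in>V. mx x \<subseteq> mx p}"
    proof
      fix p assume "p \<in> e_set ` {J. card J = d \<and> W.am x \<subseteq> W.am (e_set J)}"
      then obtain J where J: "card J = d" "W.am x \<subseteq> W.am (e_set J)" "p = e_set J" by blast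
      then have "p \<in> \<Delta>" by simp
      then have "mx x \<subseteq> mx p" using mx_iff[OF x] mx_iff J by blast
      then show "p \<in> {p\<in>V. mx x \<subseteq> mx p}" using J by (auto simp: V_eq)
    qed
    then have "x \<in> convex hull {p\<in>V. mx x \<subseteq> mx p}" using W.am_lat[OF x] hull_mono by blast
    then show "x \<in> convex hull {p\<in>V.
      {f\<in>{..<k}. \<forall>e\<in>{..<k}. g e \<bullet> x + c e \<le> g f \<bullet> x + c f} \<subseteq> {f\<in>{..<k}. \<forall>e\<in>{..<k}. g e \<bullet> p + c e \<le> g f \<bullet> p + c f}}"
      unfolding mx_def .
  qed simp
  interpret D: pl_data V "{..<k}" g c by (rule pl)
  have amx_mx: "D.amx x = mx x" for x by (simp add: D.amx_def D.psi_def mx_def)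
  have "D.cell m = fl m" if m: "m < k" for m
  proof (intro equalityI subsetI)
    fix p assume "p \<in> D.cell m"
    then have p: "p \<in> V" "m \<in> mx p" by (auto simp: D.cell_def amx_mx)
    have pD: "p \<in> \<Delta>" using hull_inc[OF p(1), of convex] by (simp add: hull_V)
    then have "p \<in> convex hull (fl m)" using w(2)[OF flF[OF m] pD] mx_iff[OF pD] p(2) by (simp add: W.am_def)
    then show "p \<in> fl m" using cell_hull[OF cell_V[OF flF[OF m]] p(1)] by simp
  next
    fix p assume p: "p \<in> fl m"
    then have pV: "p \<in> V" using cell_V[OF flF[OF m]] by blast
    have pD: "p \<in> \<Delta>" using hull_inc[OF pV, of convex] by (simp add: hull_V)
    have "p \<in> convex hull (fl m)" using p by (rule hull_inc)
    then have "fl m \<in> W.am p" using w(2)[OF flF[OF m] pD] flF[OF m] by (simp add: W.am_def)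
    then show "p \<in> D.cell m" using pV m mx_iff[OF pD] by (simp add: D.cell_def amx_mx)
  qed
  then have S: "\<S> = regular_subdivision V D.ht"
    using F_S flF by (intro D.RS_unique[OF sub]) auto
  have class_q: "(\<Sum>y\<in>{y. \<iota> y = b}. q $ y) = real (card (I \<inter> {y. \<iota> y = b}))" if b: "b < k" for b
  proof (cases b)
    case 0
    then show ?thesis using cq[OF b] by (simp add: c_def)
  next
    case (Suc m)
    have u: "{y. \<iota> y \<le> b} = {y. \<iota> y \<le> m} \<union> {y. \<iota> y = b}" "{y. \<iota> y \<le> m} \<inter> {y. \<iota> y = b} = {}"
      using Suc by auto
    have "(\<Sum>y\<in>{y. \<iota> y \<le> b}. q $ y) = (\<Sum>y\<in>{y. \<iota> y \<le> m}. q $ y) + (\<Sum>y\<in>{y. \<iota> y = b}. q $ y)"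
      unfolding u(1) using u(2) by (intro sum.union_disjoint) auto
    moreover have "card (I \<inter> {y. \<iota> y \<le> b}) = card (I \<inter> {y. \<iota> y \<le> m}) + card (I \<inter> {y. \<iota> y = b})"
      unfolding u(1) Int_Un_distrib using u(2) by (intro card_Un_disjoint) auto
    ultimately show ?thesis using cq[OF b] cq[of m] Suc b by (simp add: c_def)
  qed
  have base: "indexed_base \<iota> k I"
  proof
    show "2 \<le> k" by (rule k2)
    show "\<iota> y < k" for y by (rule fl(3))
    show "\<exists>i\<in>I. \<iota> i = b" if b: "b < k" for b
    proof -
      have "{y. \<iota> y = b} \<noteq> {}" using fl(4)[OF b] by blast
      then have "0 < (\<Sum>y\<in>{y. \<iota> y = b}. q $ y)" using q_interior(1) by (intro sum_pos) auto
      then have "I \<inter> {y. \<iota> y = b} \<noteq> {}" unfolding class_q[OF b] by (metis card.empty less_irrefl of_nat_0)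
      then show ?thesis by blast
    qed
    show "\<exists>j\<in>-I. \<iota> j = b" if b: "b < k" for b
    proof (rule ccontr)
      assume "\<not> ?thesis"
      then have "I \<inter> {y. \<iota> y = b} = {y. \<iota> y = b}" by blast
      moreover have "{y. \<iota> y = b} \<noteq> {}" using fl(4)[OF b] by blast
      then have "(\<Sum>y\<in>{y. \<iota> y = b}. q $ y) < (\<Sum>y\<in>{y. \<iota> y = b}. 1)" using q_interior(2) by (intro sum_strict_mono) auto
      ultimately show False using class_q[OF b] by simp
    qed
  qed
  have "fan_base_axioms \<iota> k I g c"
    using pl cI by (intro fan_base_axioms.intro) (simp_all add: g_def c_def)
  then have "fan_base \<iota> k I g c" using base by (intro fan_base.intro)
  then show ?thesis using S by (rule that)
qed

lemma stiefel_splits: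
  assumes I: "e_set I \<in> H"
  shows "card I = d"
    "\<exists>\<T>. k_split k (vertices (hypersimplex 1 I \<times> hypersimplex 1 (-I))) \<T> \<and> stiefel_image I \<T> \<S>"
    "\<exists>\<T>. k_split k (vertices (vertex_figure I)) \<T> \<and> stiefel_extension I \<T> \<S>"
proof -
  show cI: "card I = d" using I H_V by (auto simp: V_eq dest: inj_e_set)
  obtain \<iota> g c where fb: "fan_base \<iota> k I g c" and S: "\<S> = regular_subdivision V (pl_data.ht {..<k} g c)"
    by (rule fan_base_exists[OF I]) (rule that)
  interpret B: fan_base \<iota> k I g c by (rule fb)
  have ext: "\<S> = regular_subdivision (vertices (hypersimplex (card I) UNIV)) (stiefel_map I l)"
    if l: "\<And>i j. i \<in> I \<Longrightarrow> j \<notin> I \<Longrightarrow> l i j = (if \<iota> i < \<iota> j then 1 else 0)" for l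
    unfolding S cI
  proof (rule regular_subdivision_cong)
    fix p assume "p \<in> V"
    then obtain J where J: "card J = card I" "p = e_set J" using cI by (auto simp: V_eq)
    show "B.ht p = stiefel_map I l p" using B.stiefel_heights[OF l J(1)] J(2) by simp
  qed
  obtain h where h: "k_split k (vertices (hypersimplex 1 I \<times> hypersimplex 1 (-I)))
      (regular_subdivision (vertices (hypersimplex 1 I \<times> hypersimplex 1 (-I))) h)"
    "\<And>i j. i \<in> I \<Longrightarrow> j \<notin> I \<Longrightarrow> h (axis i 1, axis j 1) = (if \<iota> i < \<iota> j then 1 else 0)"
    by (rule B.product_split) (rule that)
  have "stiefel_image I (regular_subdivision (vertices (hypersimplex 1 I \<times> hypersimplex 1 (-I))) h) \<S>"
    unfolding stiefel_image_def using ext[of "\<lambda>i j. h (axis i 1, axis j 1)"] h(2) by blast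
  then show "\<exists>\<T>. k_split k (vertices (hypersimplex 1 I \<times> hypersimplex 1 (-I))) \<T> \<and> stiefel_image I \<T> \<S>"
    using h(1) by blast
  have "stiefel_extension I (regular_subdivision (vertices (vertex_figure I)) B.ht) \<S>"
    unfolding stiefel_extension_def pair_pt_def[symmetric]
    using ext[of "\<lambda>i j. B.ht (pair_pt I i j)"] B.ht_pair by blast
  then show "\<exists>\<T>. k_split k (vertices (vertex_figure I)) \<T> \<and> stiefel_extension I \<T> \<S>"
    using B.figure_split by blast
qed

end

theorem theorem14:
  fixes \<S> :: "(real^'n::finite) set set" and d k :: nat
  assumes "0 < d" and "d < CARD('n)"
    and "k_split k (vertices (hypersimplex d (UNIV :: 'n set))) \<S>"
  shows "(\<exists>I :: 'n set. card I = d \<and>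
            (\<exists>\<T>. k_split k (vertices (hypersimplex 1 I \<times> hypersimplex 1 (-I))) \<T> \<and>
                 stiefel_image I \<T> \<S>)) \<and>
         (\<forall>I :: 'n set. card I = d \<longrightarrow>
            ((\<exists>\<T>. k_split k (vertices (vertex_figure I)) \<T> \<and> stiefel_extension I \<T> \<S>)
               \<longleftrightarrow> e_set I \<in> common_cell \<S>))"
proof -
  interpret hypersimplex_split d k \<S> by unfold_locales (rule assms)+
  obtain p where p: "p \<in> H" using H_ne by blast
  then obtain I where I: "e_set I \<in> H" using H_V by (auto simp: V_eq)
  show ?thesis
  proof (intro conjI allI impI iffI)
    show "\<exists>I :: 'n set. card I = d \<and>
      (\<exists>\<T>. k_split k (vertices (hypersimplex 1 I \<times> hypersimplex 1 (-I))) \<T> \<and> stiefel_image I \<T> \<S>)"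
      using stiefel_splits(1,2)[OF I] by blast
  next
    fix I :: "'n set" assume "card I = d" "\<exists>\<T>. k_split k (vertices (vertex_figure I)) \<T> \<and> stiefel_extension I \<T> \<S>"
    then show "e_set I \<in> common_cell \<S>" using stiefel_extension_base[OF _ assms(3)] by blast
  next
    fix I :: "'n set" assume "e_set I \<in> common_cell \<S>"
    then show "\<exists>\<T>. k_split k (vertices (vertex_figure I)) \<T> \<and> stiefel_extension I \<T> \<S>"
      by (rule stiefel_splits(3))
  qed
qed

end
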